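(* Let $\mathcal S_1,\mathcal S_2,\mathcal S_3:\Omega\to\mathbb C$ be the limits $\mathcal S_k=\lim_{\varepsilon\to0}s_k$ (locally uniform in $\Omega$, along some sequence $\varepsilon\to0$) of the discrete Schwarzians $s_k$ of the discrete conformal maps $f^\varepsilon$ approximating the conformal map $f$. Then on $\Omega$ the Schwarzian derivative of $f$ satisfies $$\mathfrak S[f]= \frac{2 \left((L_2\omega_2+L_3\omega_3)\mathcal S_1 + (L_1\omega_1-L_3\omega_3)\mathcal S_2+(-L_1\omega_1-L_2\omega_2)\mathcal S_3\right)}{3L_1L_2L_3\,\omega_1\omega_2\omega_3}.$$
   Context: Schwarzian derivative: $\mathfrak S[f]=\left(\frac{f''}{f'}\right)'-\frac12\left(\frac{f''}{f'}\right)^2$. Lattice. Let $\alpha,\beta,\gamma\in(0,\pi/2)$ with $\alpha+\beta+\gamma=\pi$. Put $\omega_1=1=-\omega_4$, $\omega_2=e^{i\beta}=-\omega_5$, $\omega_3=e^{i(\alpha+\beta)}=-\omega_6$ and $L_1=L_4=\sin\alpha$, $L_2=L_5=\sin\gamma$, $L_3=L_6=\sin\beta$; indices are taken modulo $6$. The triangular lattice $T$ is the triangulation of $\mathbb C$ with vertex set $\{nL_1\omega_1+mL_2\omega_2: n,m\in\mathbb Z\}$, edges $[v,v+L_k\omega_k]$ and triangles with vertices $v,\ v+L_k\omega_k,\ v+L_{k+1}\omega_{k+1}$. $\varepsilon T$ is $T$ scaled by $\varepsilon>0$ and $V^\varepsilon$ is its vertex set. Write $\tau_k^\varepsilon v=v+\varepsilon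 L_k\omega_k$. Cross-ratio: $\mathrm{cr}(a,b,c,d)=\frac{(a-b)(c-d)}{(b-c)(d-a)}$. Discrete conformal map. A discrete conformal map $g$ on a subcomplex $T_S$ of a triangular lattice is the restriction to the vertices of a continuous, orientation preserving map $g_{PL}$ from (the support of) $T_S$ to $\mathbb C$ which is locally a homeomorphism near each interior point, maps every triangle affinely onto the corresponding image triangle, and satisfies $|\mathrm{cr}(v_1,v_2,v_3,v_4)|=|\mathrm{cr}(g(v_1),g(v_2),g(v_3),g(v_4))|$ for all pairs of adjacent triangles $\Delta[v_1,v_2,v_3]$, $\Delta[v_1,v_3,v_4]$ with common edge $[v_1,v_3]$. If $T_S$ is simply connected this last condition is equivalent to the existence of a real function $u$ on the vertices (the associated scale factors) with $|g(v)-g(w)|=|v-w|e^{(u(v)+u(w))/2}$ for all edges $[v,w]$. Setting. $f:D\to\mathbb C$ is conformal (holomorphic, $f'\ne0$) on a domain $D\subset\mathbb C$; $K\subset D$ is compact, the closure of its simply connected interior $\Omega=\operatorname{int}(K)$, and $0\in\Omega$. The boundary $\partial K$ is assumed to have positive reach $\ge\mathcal R>0$: for every $0<\delta<\mathcal R$ every point $p\in\mathbb C$ with distance at most $\delta$ to $\partial K$ has a unique nearest point on $\partial K$. $T^\varepsilon_K$ (vertex set $V^\varepsilon_K$) is a subcomplex of $\varepsilon T$ whose support is contained in $K$ and is homeomorphic to a closed disc, which has $0$ as an interior vertex, and which is as large as possible: adding any other triangle of $\varepsilon T$ contained in $K$ and sharing an edge with a triangle of $T^\varepsilon_K$ results in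 a subcomplex which is no longer simply connected. Let $[0,v_0]$ be an edge of $T^\varepsilon_K$. For all $\varepsilon>0$ small enough it is known that there is a unique discrete conformal map $f^\varepsilon$ on $T^\varepsilon_K$ whose associated scale factors $u^\varepsilon$ satisfy $u^\varepsilon(v)=\log|f'(v)|$ for all boundary vertices $v$ and which is normalized by $f^\varepsilon(0)=f(0)$ and $\arg(f^\varepsilon(v_0)-f^\varepsilon(0))=\arg(v_0)+\arg(f'(v_0/2)) \pmod{2\pi}$. Discrete Schwarzians. For an interior vertex $v$ of $V_K^\varepsilon$ (all six neighbours $\tau^\varepsilon_kv$ in $V_K^\varepsilon$) and $k=1,\dots,6$ put $Q_k=\mathrm{cr}(v,\tau_{k-1}^\varepsilon v,\tau_k^\varepsilon v,\tau_{k+1}^\varepsilon v)=\frac{(\omega_{k-1}L_{k-1})^2}{(\omega_{k+1}L_{k+1})^2}$, $q_k(v)=\mathrm{cr}(f^\varepsilon(v),f^\varepsilon(\tau_{k-1}^\varepsilon v),f^\varepsilon(\tau_k^\varepsilon v),f^\varepsilon(\tau_{k+1}^\varepsilon v))$ and $s_k(v)=\frac1{\varepsilon^2}\left(\frac{q_k(v)}{Q_k}-1\right)$. Locally uniform convergence $s_k\to\mathcal S_k$ in $\Omega$ (along a sequence $\varepsilon\to0$) means: for every $\sigma>0$ and $z\in\Omega$ there are $\delta_1,\delta_2>0$ such that $|\mathcal S_k(z)-s_k(v)|<\sigma$ for all $\varepsilon<\delta_1$ in the sequence and all vertices $v$ in the domain of $s_k$ with $|v-z|<\delta_2$. The convergence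 is along the same sequence for all $k$. *)

theory Defs
  imports "HOL-Complex_Analysis.Complex_Analysis"
begin

definition schwarzian :: "(complex \<Rightarrow> complex) \<Rightarrow> complex \<Rightarrow> complex" where
  "schwarzian f z =
     deriv (\<lambda>w. deriv (deriv f) w / deriv f w) z
       - (1 / 2) * (deriv (deriv f) z / deriv f z)\<^sup>2"

definition cross_ratio :: "complex \<Rightarrow> complex \<Rightarrow> complex \<Rightarrow> complex \<Rightarrow> complex" where
  "cross_ratio a b c d = ((a - b) * (c - d)) / ((b - c) * (d - a))"

text \<open>Directions \<open>\<omega>\<^sub>k\<close> and lengths \<open>L\<^sub>k\<close>; the index \<open>k\<close> is read modulo 6, so the last
  alternative of \<open>lat_dir\<close> is \<open>\<omega>\<^sub>6 = \<omega>\<^sub>0\<close>. The lengths have period 3.\<close>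

definition lat_dir :: "real \<Rightarrow> real \<Rightarrow> int \<Rightarrow> complex" where
  "lat_dir \<alpha> \<beta> k =
     (if k mod 6 = 1 then 1
      else if k mod 6 = 2 then cis \<beta>
      else if k mod 6 = 3 then cis (\<alpha> + \<beta>)
      else if k mod 6 = 4 then - 1
      else if k mod 6 = 5 then - cis \<beta>
      else - cis (\<alpha> + \<beta>))"

definition lat_len :: "real \<Rightarrow> real \<Rightarrow> real \<Rightarrow> int \<Rightarrow> real" where
  "lat_len \<alpha> \<beta> \<gamma> k =
     (if k mod 3 = 1 then sin \<alpha> else if k mod 3 = 2 then sin \<gamma> else sin \<beta>)"

definition lat_vec :: "real \<Rightarrow> real \<Rightarrow> real \<Rightarrow> int \<Rightarrow> complex" where
  "lat_vec \<alpha> \<beta> \<gamma> k = of_real (lat_len \<alpha> \<beta> \<gamma> k) * lat_dir \<alpha> \<beta> k"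

definition lat_shift :: "real \<Rightarrow> real \<Rightarrow> real \<Rightarrow> real \<Rightarrow> int \<Rightarrow> complex \<Rightarrow> complex" where
  "lat_shift \<alpha> \<beta> \<gamma> \<epsilon> k v = v + of_real \<epsilon> * lat_vec \<alpha> \<beta> \<gamma> k"

definition lat_vertices :: "real \<Rightarrow> real \<Rightarrow> real \<Rightarrow> real \<Rightarrow> complex set" where
  "lat_vertices \<alpha> \<beta> \<gamma> \<epsilon> =
     {of_real \<epsilon> * (of_int n * lat_vec \<alpha> \<beta> \<gamma> 1 + of_int m * lat_vec \<alpha> \<beta> \<gamma> 2) | n m. True}"

text \<open>A simplex is represented by its set of vertices.\<close>

definition lat_edges :: "real \<Rightarrow> real \<Rightarrow> real \<Rightarrow> real \<Rightarrow> complex set set" where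
  "lat_edges \<alpha> \<beta> \<gamma> \<epsilon> =
     {{v, lat_shift \<alpha> \<beta> \<gamma> \<epsilon> k v} | v k. v \<in> lat_vertices \<alpha> \<beta> \<gamma> \<epsilon>}"

definition lat_triangles :: "real \<Rightarrow> real \<Rightarrow> real \<Rightarrow> real \<Rightarrow> complex set set" where
  "lat_triangles \<alpha> \<beta> \<gamma> \<epsilon> =
     {{v, lat_shift \<alpha> \<beta> \<gamma> \<epsilon> k v, lat_shift \<alpha> \<beta> \<gamma> \<epsilon> (k + 1) v} | v k.
        v \<in> lat_vertices \<alpha> \<beta> \<gamma> \<epsilon>}"

definition tri_lattice :: "real \<Rightarrow> real \<Rightarrow> real \<Rightarrow> real \<Rightarrow> complex set set" where
  "tri_lattice \<alpha> \<beta> \<gamma> \<epsilon> =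
     {{v} | v. v \<in> lat_vertices \<alpha> \<beta> \<gamma> \<epsilon>} \<union> lat_edges \<alpha> \<beta> \<gamma> \<epsilon> \<union> lat_triangles \<alpha> \<beta> \<gamma> \<epsilon>"

definition subcomplex :: "complex set set \<Rightarrow> complex set set \<Rightarrow> bool" where
  "subcomplex C X \<longleftrightarrow> C \<subseteq> X \<and> (\<forall>s\<in>C. \<forall>t. t \<subseteq> s \<and> t \<noteq> {} \<longrightarrow> t \<in> C)"

definition support :: "complex set set \<Rightarrow> complex set" where
  "support C = (\<Union>s\<in>C. convex hull s)"

definition vertices :: "complex set set \<Rightarrow> complex set" where
  "vertices C = \<Union>C"

definition edges :: "complex set set \<Rightarrow> complex set set" where
  "edges C = {s \<in> C. card s = 2}"

definition triangles :: "complex set set \<Rightarrow> complex set set" where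
  "triangles C = {s \<in> C. card s = 3}"

text \<open>Interior and boundary refer to the topology of the plane. All six lattice neighbours of an
  interior vertex of a subcomplex of the lattice are vertices of that subcomplex.\<close>

definition interior_vertices :: "complex set set \<Rightarrow> complex set" where
  "interior_vertices C = vertices C \<inter> interior (support C)"

definition boundary_vertices :: "complex set set \<Rightarrow> complex set" where
  "boundary_vertices C = vertices C - interior (support C)"

definition add_triangle :: "complex set \<Rightarrow> complex set set \<Rightarrow> complex set set" where
  "add_triangle \<Delta> C = C \<union> {s. s \<subseteq> \<Delta> \<and> s \<noteq> {}}"

definition maximal_disc_subcomplex ::
    "real \<Rightarrow> real \<Rightarrow> real \<Rightarrow> real \<Rightarrow> complex set \<Rightarrow> complex set set \<Rightarrow> bool" where
  "maximal_disc_subcomplex \<alpha> \<beta> \<gamma> \<epsilon> K C \<longleftrightarrow>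
     subcomplex C (tri_lattice \<alpha> \<beta> \<gamma> \<epsilon>) \<and>
     support C \<subseteq> K \<and>
     support C homeomorphic (cball 0 1 :: complex set) \<and>
     0 \<in> interior_vertices C \<and>
     (\<forall>\<Delta> \<in> lat_triangles \<alpha> \<beta> \<gamma> \<epsilon> - C.
        convex hull \<Delta> \<subseteq> K \<and> (\<exists>\<Delta>' \<in> triangles C. card (\<Delta> \<inter> \<Delta>') = 2) \<longrightarrow>
        \<not> simply_connected (support (add_triangle \<Delta> C)))"

text \<open>The piecewise linear extension \<open>G\<close> of the vertex map \<open>g\<close>. On each triangle \<open>G\<close> agrees with
  an affine map \<open>x \<mapsto> A x + b\<close>; the number \<open>Im (cnj (A 1) * A \<i>)\<close> is the determinant of the
  real linear map \<open>A\<close>, so its positivity says that \<open>G\<close> preserves orientation (and that the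
  image triangle is nondegenerate).\<close>

definition pl_extension ::
    "complex set set \<Rightarrow> (complex \<Rightarrow> complex) \<Rightarrow> (complex \<Rightarrow> complex) \<Rightarrow> bool" where
  "pl_extension C g G \<longleftrightarrow>
     continuous_on (support C) G \<and>
     (\<forall>v \<in> vertices C. G v = g v) \<and>
     (\<forall>p \<in> interior (support C). \<exists>U h. open U \<and> p \<in> U \<and> U \<subseteq> support C \<and>
        open (G ` U) \<and> homeomorphism U (G ` U) G h) \<and>
     (\<forall>\<Delta> \<in> triangles C. G ` (convex hull \<Delta>) = convex hull (g ` \<Delta>) \<and>
        (\<exists>A b. linear A \<and> 0 < Im (cnj (A 1) * A \<i>) \<and> (\<forall>x \<in> convex hull \<Delta>. G x = A x + b)))"

definition discrete_conformal :: "complex set set \<Rightarrow> (complex \<Rightarrow> complex) \<Rightarrow> bool" where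
  "discrete_conformal C g \<longleftrightarrow>
     (\<exists>G. pl_extension C g G) \<and>
     (\<forall>v1 v2 v3 v4. {v1, v2, v3} \<in> triangles C \<and> {v1, v3, v4} \<in> triangles C \<and> v2 \<noteq> v4 \<longrightarrow>
        cmod (cross_ratio v1 v2 v3 v4) = cmod (cross_ratio (g v1) (g v2) (g v3) (g v4)))"

definition scale_factors ::
    "complex set set \<Rightarrow> (complex \<Rightarrow> complex) \<Rightarrow> (complex \<Rightarrow> real) \<Rightarrow> bool" where
  "scale_factors C g u \<longleftrightarrow>
     (\<forall>v w. {v, w} \<in> edges C \<longrightarrow>
        cmod (g v - g w) = cmod (v - w) * exp ((u v + u w) / 2))"

text \<open>Since \<open>Arg\<close> is the principal argument, the normalization of the edge \<open>[0, v\<^sub>0]\<close> is stated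
  modulo \<open>2\<pi>\<close>.\<close>

definition discrete_approximation ::
    "(complex \<Rightarrow> complex) \<Rightarrow> complex set set \<Rightarrow> complex \<Rightarrow> (complex \<Rightarrow> complex) \<Rightarrow> bool" where
  "discrete_approximation f C v0 g \<longleftrightarrow>
     discrete_conformal C g \<and>
     (\<exists>u. scale_factors C g u \<and> (\<forall>v \<in> boundary_vertices C. u v = ln (cmod (deriv f v)))) \<and>
     g 0 = f 0 \<and>
     (\<exists>m::int. Arg (g v0 - g 0) = Arg v0 + Arg (deriv f (v0 / 2)) + 2 * pi * of_int m)"

definition discrete_schwarzian ::
    "real \<Rightarrow> real \<Rightarrow> real \<Rightarrow> real \<Rightarrow> (complex \<Rightarrow> complex) \<Rightarrow> int \<Rightarrow> complex \<Rightarrow> complex" where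
  "discrete_schwarzian \<alpha> \<beta> \<gamma> \<epsilon> g k v =
     (let a = lat_shift \<alpha> \<beta> \<gamma> \<epsilon> (k - 1) v;
          b = lat_shift \<alpha> \<beta> \<gamma> \<epsilon> k v;
          c = lat_shift \<alpha> \<beta> \<gamma> \<epsilon> (k + 1) v
      in (cross_ratio (g v) (g a) (g b) (g c) / cross_ratio v a b c - 1) / of_real (\<epsilon>\<^sup>2))"

text \<open>The function \<open>s \<epsilon>\<close> is only meaningful on the discrete set \<open>V \<epsilon>\<close>; the limit is taken along
  the parameters \<open>\<epsilon> = e n\<close>.\<close>

definition locally_uniform_limit_along ::
    "(nat \<Rightarrow> real) \<Rightarrow> (real \<Rightarrow> complex set) \<Rightarrow> (real \<Rightarrow> complex \<Rightarrow> complex) \<Rightarrow>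
       complex set \<Rightarrow> (complex \<Rightarrow> complex) \<Rightarrow> bool" where
  "locally_uniform_limit_along e V s \<Omega> S \<longleftrightarrow>
     (\<forall>\<sigma>>0. \<forall>z\<in>\<Omega>. \<exists>\<delta>1>0. \<exists>\<delta>2>0. \<forall>n. e n < \<delta>1 \<longrightarrow>
        (\<forall>v \<in> V (e n). cmod (v - z) < \<delta>2 \<longrightarrow> cmod (S z - s (e n) v) < \<sigma>))"

definition positive_reach :: "complex set \<Rightarrow> bool" where
  "positive_reach A \<longleftrightarrow>
     (\<exists>R>0. \<forall>\<delta>. 0 < \<delta> \<and> \<delta> < R \<longrightarrow>
        (\<forall>p. infdist p A \<le> \<delta> \<longrightarrow> (\<exists>!q. q \<in> A \<and> dist p q = infdist p A)))"

end

theory Submission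
  imports Defs
begin

text \<open>The discrete Schwarzians are second order quantities, whereas it is not clear in advance that
  the angles of \<open>f\<^sup>\<epsilon>\<close> agree with those of \<open>f\<close> to second order at each vertex. But the limits
  \<open>S k\<close> are assumed to exist locally uniformly, so it is enough to compute them in the mean: for
  the tent function \<open>\<phi>\<close> on a small disc around a point,
  \<open>\<Sum> \<phi>(v) \<epsilon>\<^sup>2 (s\<^sub>k(v) - \<i> \<theta>\<^sub>k(v))\<close> is \<open>O(\<epsilon>)\<close> with an explicit real function \<open>\<theta>\<^sub>k\<close> (the constant
  \<open>schwarzian_limit\<close> below), and therefore \<open>S k = \<i> \<theta>\<^sub>k\<close>.

  Equality of the moduli of cross-ratios gives \<open>q\<^sub>k / Q\<^sub>k = cis x\<close>, where \<open>x\<close> is the change of the sum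
  of the two angles that face an edge (\<open>cross_ratio_deviation\<close>). Let \<open>\<xi>\<close> denote the difference of an
  angle of \<open>f\<^sup>\<epsilon>\<close> and the same angle of \<open>f\<close>, and let \<open>X\<close> be the difference \<open>u - ln \<bar>f'\<bar>\<close> of the scale
  factors. By the law of sines, \<open>ln (sin angle)\<close> is the logarithm of the opposite side up to a
  constant of the triangle, and the variational principle of discrete conformal maps applies:
  \<open>\<Sum> \<xi> X = 0\<close>, since both maps have angle sum \<open>2\<pi>\<close> at interior vertices and \<open>X\<close> vanishes on the
  boundary, whereas \<open>\<Sum> \<xi> (ln sin - ln sin)\<close> is bounded below by a multiple of \<open>\<Sum> \<xi>\<^sup>2\<close>. The side lengths of
  \<open>f\<close> obey the mean value rule for \<open>ln \<bar>f'\<bar>\<close> up to \<open>O(\<epsilon>\<^sup>2)\<close>, and the result is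
  \<open>\<Sum> \<xi>\<^sup>2 = O(\<epsilon>\<^sup>2)\<close> for a sum with about \<open>\<epsilon>\<^sup>-\<^sup>2\<close> terms (\<open>energy_estimate\<close>).

  Linearising the angles in the logarithmic side lengths expresses the \<open>\<xi>\<close>-part of \<open>x\<close> by a mixed
  second difference of \<open>X\<close>, by the mean value defects \<open>\<rho>\<close> of \<open>f\<close>, and by an error that is quadratic in the angles.
  The second difference disappears after summation by parts against \<open>\<phi>\<close>, and the error is controlled by the
  energy estimate (\<open>averaged_deviation\<close>). What remains depends on \<open>f\<close> only and is computed from the
  Taylor expansion of \<open>Ln ((f y - f x) / (y - x))\<close>, in which the Schwarzian derivative is the
  coefficient of \<open>-(y - x)\<^sup>2/12\<close> in the defect of the mean value rule (\<open>second_order_target\<close>).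
  The three real numbers \<open>\<theta>\<^sub>k\<close> determine the Schwarzian derivative by linear algebra
  (\<open>schwarzian_reconstruction\<close>).

  All this takes place at vertices whose stars belong to \<open>T\<^sub>K\<close>, and the maximality of \<open>T\<^sub>K\<close> must
  imply that these include, for small \<open>\<epsilon>\<close>, all vertices near a given point. Positive reach
  forces the complement of \<open>K\<close> to be connected. A triangle inside \<open>K\<close> that shares an edge
  with a maximal disc but cannot be added to it has to cut off a hole from the complement of the
  disc; that hole lies in \<open>K\<close>, and inside it there is another such triangle with a smaller hole, which is
  impossible since only finitely many triangles fit into the first hole
  (\<open>disc_absorbs_adjacent_triangles\<close>). So no triangle is blocked, and the disc spreads along a
  path from \<open>0\<close> to every point (\<open>maximal_disc_fills\<close>).\<close>

section \<open>Sets whose boundary has positive reach\<close>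

text \<open>If \<open>y\<close> has nearest point \<open>a\<close>, then moving from \<open>y\<close> straight away from \<open>a\<close> keeps \<open>a\<close> nearest, as long
  as nearest points are unique. The map that sends \<open>x\<close> to the point at distance \<open>s\<close> from \<open>y\<close>, in the
  direction from the nearest point of \<open>x\<close> to \<open>y\<close>, has a fixed point by Brouwer's theorem. For this \<open>x\<close> the point
  \<open>y\<close> lies between \<open>x\<close> and its nearest point, so both have the same nearest point.\<close>
lemma nearest_ball_extends_step:
  fixes A :: "'a::euclidean_space set"
  assumes A: "compact A"
    and uniq: "\<And>p. infdist p A < R \<Longrightarrow> \<exists>!q. q \<in> A \<and> dist p q = infdist p A"
    and aA: "a \<in> A" and u: "norm u = 1" and t: "infdist (a + t *\<^sub>R u) A = t"
    and s: "0 < s" "s < t" "t + s < R"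
  shows "infdist (a + (t + s) *\<^sub>R u) A = t + s"
proof -
  define y where "y = a + t *\<^sub>R u"
  have infy: "infdist y A = t" using t by (simp add: y_def)
  \<comment> \<open>nearest point projection; it is continuous because its graph is closed\<close>
  define \<pi> where "\<pi> x = (THE q. q \<in> A \<and> dist x q = infdist x A)" for x
  have near: "infdist x A \<le> t + s" if "x \<in> cball y s" for x
    using infdist_triangle[of x A y] that infy by (simp add: dist_commute)
  have \<pi>: "\<pi> x \<in> A" "dist x (\<pi> x) = infdist x A" if "x \<in> cball y s" for x
    using theI'[OF uniq[of x]] near[OF that] s unfolding \<pi>_def by auto
  have \<pi>_eq: "\<pi> x = q" if "x \<in> cball y s" "q \<in> A" "dist x q = infdist x A" for x q
    using uniq[of x] \<pi>[OF that(1)] near[OF that(1)] s that by (metis le_less_trans)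
  have cont: "continuous_on (cball y s) \<pi>"
  proof (subst continuous_closed_graph_eq)
    show "compact A" by fact
    show "\<pi> \<in> cball y s \<rightarrow> A" using \<pi> by auto
    have eq: "(\<lambda>x. (x, \<pi> x)) ` cball y s
        = {z. dist (fst z) (snd z) = infdist (fst z) A} \<inter> (cball y s \<times> A)"
      using \<pi> \<pi>_eq by (auto simp: image_iff)
    have "closed {z :: 'a \<times> 'a. dist (fst z) (snd z) = infdist (fst z) A}"
    proof (rule closed_Collect_eq)
      show "continuous_on UNIV (\<lambda>z :: 'a \<times> 'a. dist (fst z) (snd z))"
        by (rule continuous_on_dist[OF continuous_on_fst[OF continuous_on_id] continuous_on_snd[OF continuous_on_id]])
      show "continuous_on UNIV (\<lambda>z :: 'a \<times> 'a. infdist (fst z) A)"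
        by (rule continuous_on_infdist[OF continuous_on_fst[OF continuous_on_id]])
    qed
    from closedin_closed_Int[OF this, of "cball y s \<times> A"]
    show "closedin (top_of_set (cball y s \<times> A)) ((\<lambda>x. (x, \<pi> x)) ` cball y s)"
      unfolding eq by (simp only: inf_commute)
  qed
  have ynotA: "y \<notin> A"
    using infy s by (metis infdist_zero less_irrefl less_trans)
  have ne: "y \<noteq> \<pi> x" if "x \<in> cball y s" for x
    using \<pi>(1)[OF that] ynotA by metis
  define \<Phi> where "\<Phi> x = y + (s / norm (y - \<pi> x)) *\<^sub>R (y - \<pi> x)" for x
  have "continuous_on (cball y s) \<Phi>"
    unfolding \<Phi>_def using ne by (intro continuous_intros cont) auto
  moreover have "\<Phi> \<in> cball y s \<rightarrow> cball y s"
    unfolding \<Phi>_def using ne s by (auto simp: dist_norm)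
  ultimately obtain x where x: "x \<in> cball y s" and fx: "\<Phi> x = x"
    using brouwer[of "cball y s" \<Phi>] s by (metis compact_cball convex_cball cball_eq_empty not_less less_imp_le)
  have "x - \<pi> x = (1 + s / norm (y - \<pi> x)) *\<^sub>R (y - \<pi> x)"
    by (subst (1) fx[symmetric]) (simp add: \<Phi>_def algebra_simps)
  then have "norm (x - \<pi> x) = \<bar>1 + s / norm (y - \<pi> x)\<bar> * norm (y - \<pi> x)"
    by simp
  also have "\<dots> = norm (y - \<pi> x) + s"
    using ne[OF x] s by (simp add: field_simps)
  finally have 1: "infdist x A = norm (y - \<pi> x) + s"
    using \<pi>(2)[OF x] by (simp add: dist_norm)
  then have "norm (y - \<pi> x) \<le> t" using near[OF x] by simp
  moreover have "infdist y A \<le> dist y (\<pi> x)" using \<pi>[OF x] by (simp add: infdist_le)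
  ultimately have nt: "norm (y - \<pi> x) = t" using infy by (simp add: dist_norm)
  have "\<pi> y = \<pi> x" using s \<pi>(1)[OF x] nt infy by (intro \<pi>_eq) (auto simp: dist_norm)
  moreover have "\<pi> y = a" using s aA infy u by (intro \<pi>_eq) (auto simp: dist_norm y_def)
  ultimately have "x = y + (s / t) *\<^sub>R (t *\<^sub>R u)"
    using fx nt unfolding \<Phi>_def by (simp add: y_def)
  then have "x = a + (t + s) *\<^sub>R u" using s by (simp add: y_def algebra_simps)
  then show ?thesis using 1 nt by simp
qed

lemma nearest_ball_extends:
  fixes A :: "'a::euclidean_space set"
  assumes A: "compact A"
    and uniq: "\<And>p. infdist p A < R \<Longrightarrow> \<exists>!q. q \<in> A \<and> dist p q = infdist p A"
    and aA: "a \<in> A" and u: "norm u = 1" and d: "infdist (a + d *\<^sub>R u) A = d"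
    and dt: "0 < d" "d \<le> t" "t < R"
  shows "infdist (a + t *\<^sub>R u) A = t"
proof -
  define S where "S = {\<tau>. infdist (a + \<tau> *\<^sub>R u) A = \<tau>} \<inter> {d..t}"
  have "closed {\<tau>. infdist (a + \<tau> *\<^sub>R u) A = \<tau>}"
    by (rule closed_Collect_eq)
      (rule continuous_on_infdist continuous_on_add continuous_on_scaleR continuous_on_const continuous_on_id)+
  then have "compact S" unfolding S_def by (intro closed_Int_compact) auto
  moreover have "d \<in> S" using d dt by (simp add: S_def)
  ultimately obtain \<tau> where \<tau>: "\<tau> \<in> S" "\<And>x. x \<in> S \<Longrightarrow> x \<le> \<tau>"
    using compact_attains_sup[of S] by blast
  show ?thesis
  proof (cases "\<tau> = t")
    case True then show ?thesis using \<tau> by (simp add: S_def)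
  next
    case False
    define s where "s = min (\<tau>/2) (t - \<tau>)"
    have s: "0 < s" "s < \<tau>" "\<tau> + s \<le> t" using False \<tau>(1) dt by (auto simp: S_def s_def min_def)
    have "infdist (a + (\<tau> + s) *\<^sub>R u) A = \<tau> + s"
      using s dt \<tau>(1) by (intro nearest_ball_extends_step[OF A uniq aA u]) (auto simp: S_def)
    then have "\<tau> + s \<in> S" using s \<tau>(1) dt by (auto simp: S_def)
    then show ?thesis using \<tau>(2) s by force
  qed
qed

text \<open>Points of \<open>W\<close> close to \<open>p\<close> lie in balls of radius \<open>r\<close> inside \<open>W\<close> that touch \<open>A\<close> near \<open>p\<close>; a limit of
  these balls touches at \<open>p\<close> itself.\<close>
lemma tangent_ball_at_boundary_point:
  fixes A :: "'a::euclidean_space set"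
  assumes A: "compact A"
    and uniq: "\<And>p. infdist p A < R \<Longrightarrow> \<exists>!q. q \<in> A \<and> dist p q = infdist p A"
    and r: "0 < r" "r < R"
    and W: "W \<inter> A = {}" "frontier W \<subseteq> A"
    and p: "p \<in> A" "p \<in> closure W"
  obtains c where "dist c p = r" "ball c r \<subseteq> W"
proof -
  have ex: "\<exists>c. \<exists>a. dist c a = r \<and> ball c r \<subseteq> W \<and> dist a p < e" if e: "0 < e" "e < r" for e
  proof -
    obtain w where w: "w \<in> W" "dist w p < e / 2"
      using p(2) e closure_approachable[of p W] by (meson half_gt_zero)
    have wA: "w \<notin> A" using w W by auto
    define d where "d = infdist w A"
    have dle: "d \<le> dist w p" unfolding d_def using p(1) by (rule infdist_le)
    have d0: "0 < d" unfolding d_def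
      using wA p(1) A by (metis compact_imp_closed emptyE in_closed_iff_infdist_zero infdist_pos_not_in_closed)
    obtain a where a: "a \<in> A" "dist w a = d"
    proof -
      have "infdist w A < R" using dle w(2) e r unfolding d_def by linarith
      then show ?thesis using uniq[of w] that unfolding d_def by blast
    qed
    define u where "u = (1/d) *\<^sub>R (w - a)"
    have u: "norm u = 1" using a d0 by (simp add: u_def dist_norm)
    have wu: "w = a + d *\<^sub>R u" using d0 by (simp add: u_def)
    define c where "c = a + r *\<^sub>R u"
    have "d < r" using dle w(2) e by linarith
    have infd: "infdist (a + d *\<^sub>R u) A = d" using wu d_def by metis
    have infc: "infdist c A = r" unfolding c_def
      using \<open>d < r\<close> by (intro nearest_ball_extends[OF A uniq a(1) u infd d0 _ r(2)]) auto
    have disj: "ball c r \<inter> A = {}"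
      using infc infdist_le[of _ A c] by (force simp: dist_commute)
    have "w - c = (d - r) *\<^sub>R u" unfolding wu c_def by (simp add: algebra_simps)
    then have "dist w c = r - d" using u \<open>d < r\<close> by (simp add: dist_norm)
    then have "w \<in> ball c r" using d0 by (simp add: dist_commute)
    then have "ball c r \<inter> W \<noteq> {}" using w(1) by blast
    moreover have "ball c r \<inter> frontier W = {}" using W(2) disj by blast
    ultimately have "ball c r \<subseteq> W"
      using connected_Int_frontier[OF connected_ball, of c r W] by blast
    moreover have "dist c a = r" using u r by (simp add: c_def dist_norm)
    moreover have "dist a p < e"
      using dist_triangle[of a p w] a w dle by (simp add: dist_commute)
    ultimately show ?thesis by blast
  qed
  have "\<forall>n. \<exists>c. \<exists>a. dist c a = r \<and> ball c r \<subseteq> W \<and> dist a p < r / real (n + 2)"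
    using r by (intro allI ex) (auto simp: field_simps intro: add_pos_nonneg)
  then obtain c a where ca: "\<And>n. dist (c n) (a n) = r" "\<And>n. ball (c n) r \<subseteq> W"
      "\<And>n. dist (a n) p < r / real (n + 2)" by metis
  have "a \<longlonglongrightarrow> p"
  proof (rule tendsto_dist_iff[THEN iffD2], rule tendsto_sandwich[OF _ _ tendsto_const])
    show "\<forall>\<^sub>F n in sequentially. dist (a n) p \<le> r / real (n + 2)"
      using ca(3) by (intro always_eventually allI) (rule less_imp_le)
    have "(\<lambda>n. r / real n) \<longlonglongrightarrow> 0" by (rule lim_const_over_n)
    from LIMSEQ_ignore_initial_segment[OF this, of 2]
    show "(\<lambda>n. r / real (n + 2)) \<longlonglongrightarrow> 0" .
  qed auto
  have "c n \<in> cball p (2 * r)" for n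
  proof -
    have "r / real (n + 2) \<le> r" using r by (simp add: field_simps)
    then show ?thesis using dist_triangle[of "c n" p "a n"] ca(1)[of n] ca(3)[of n]
      by (simp add: dist_commute)
  qed
  then obtain c0 \<rho> where \<rho>: "strict_mono \<rho>" "(c \<circ> \<rho>) \<longlonglongrightarrow> c0"
    using compact_cball[of p "2 * r"] unfolding compact_def by metis
  have "(\<lambda>n. dist ((c \<circ> \<rho>) n) ((a \<circ> \<rho>) n)) \<longlonglongrightarrow> dist c0 p"
    by (intro tendsto_dist \<rho> LIMSEQ_subseq_LIMSEQ[OF \<open>a \<longlonglongrightarrow> p\<close>])
  then have "dist c0 p = r" using ca(1) by (simp add: LIMSEQ_const_iff)
  moreover have "ball c0 r \<subseteq> W"
  proof
    fix y assume "y \<in> ball c0 r"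
    moreover have "(\<lambda>n. dist ((c \<circ> \<rho>) n) y) \<longlonglongrightarrow> dist c0 y"
      by (intro tendsto_intros \<rho>)
    ultimately have "\<forall>\<^sub>F n in sequentially. dist ((c \<circ> \<rho>) n) y < r"
      by (simp add: order_tendsto_iff)
    then obtain n where "dist ((c \<circ> \<rho>) n) y < r"
      by (meson eventually_sequentially order_refl)
    then show "y \<in> W" using ca(2)[of "\<rho> n"] by auto
  qed
  ultimately show ?thesis using that by blast
qed

text \<open>Two disjoint balls of equal radius through a common boundary point have centres opposite to
  each other, and three points cannot be pairwise opposite.\<close>
lemma not_three_disjoint_tangent_balls:
  fixes p :: "'a::euclidean_space"
  assumes r: "0 < r" and d: "dist c1 p = r" "dist c2 p = r" "dist c3 p = r"
    and dis: "ball c1 r \<inter> ball c2 r = {}" "ball c1 r \<inter> ball c3 r = {}" "ball c2 r \<inter> ball c3 r = {}"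
  shows False
proof -
  have op: "c - p = - (c' - p)" if "dist c p = r" "dist c' p = r" "ball c r \<inter> ball c' r = {}" for c c'
  proof -
    define m where "m = (1/2) *\<^sub>R (c + c')"
    have "dist c m = norm (c - c') / 2" "dist c' m = norm (c - c') / 2"
    proof -
      have "c - m = (1/2) *\<^sub>R (c - c')" "c' - m = (1/2) *\<^sub>R (c' - c)"
        by (simp_all add: m_def algebra_simps flip: scaleR_add_left)
      then show "dist c m = norm (c - c') / 2" "dist c' m = norm (c - c') / 2"
        by (simp_all add: dist_norm norm_minus_commute)
    qed
    then have "norm (c - c') \<ge> 2 * r" using that(3) r
      by (smt (verit) IntI empty_iff field_sum_of_halves mem_ball)
    then have "(norm ((c - p) - (c' - p)))\<^sup>2 \<ge> (2 * r)\<^sup>2" using r by (intro power_mono) auto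
    moreover have "(norm ((c - p) - (c' - p)))\<^sup>2 + (norm ((c - p) + (c' - p)))\<^sup>2
        = 2 * (norm (c - p))\<^sup>2 + 2 * (norm (c' - p))\<^sup>2"
      by (simp add: power2_norm_eq_inner algebra_simps inner_commute)
    moreover have "(norm (c - p))\<^sup>2 = r\<^sup>2" "(norm (c' - p))\<^sup>2 = r\<^sup>2" "(2 * r)\<^sup>2 = 4 * r\<^sup>2"
      using that by (simp_all add: dist_norm power_mult_distrib)
    ultimately have "(norm ((c - p) + (c' - p)))\<^sup>2 \<le> 0" by linarith
    then have "(c - p) + (c' - p) = 0" by simp
    then show ?thesis by (simp only: eq_neg_iff_add_eq_0)
  qed
  have "c1 - p = - (c2 - p)" "c1 - p = - (c3 - p)" "c2 - p = - (c3 - p)"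
    using op assms by blast+
  then have "c1 - p = - (c1 - p)" by metis
  then have "2 *\<^sub>R (c1 - p) = 0" unfolding scaleR_2 by (metis add.right_inverse)
  then have "c1 = p" by simp
  then show False using d r by simp
qed

text \<open>If the complement of \<open>K\<close> fell apart into open sets \<open>W\<close> and \<open>W'\<close>, their closures would be disjoint: a
  common point would carry tangent balls inside \<open>W\<close>, \<open>W'\<close> and \<open>interior K\<close>. Then the complement of \<open>interior K\<close>
  would be disconnected too, which contradicts simple connectedness.\<close>
lemma connected_complement_of_positive_reach:
  fixes K :: "complex set"
  assumes K: "compact K" "K = closure (interior K)" "simply_connected (interior K)"
    and reach: "positive_reach (frontier K)"
  shows "connected (- K)"
proof (rule ccontr)
  assume nc: "\<not> connected (- K)"
  define A where "A = frontier K"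
  have cA: "compact A" unfolding A_def using K(1) by (rule compact_frontier)
  obtain R where R0: "R > 0 \<and> (\<forall>\<delta>. 0 < \<delta> \<and> \<delta> < R \<longrightarrow>
      (\<forall>p. infdist p A \<le> \<delta> \<longrightarrow> (\<exists>!q. q \<in> A \<and> dist p q = infdist p A)))"
    using reach unfolding positive_reach_def A_def by (rule exE)
  then have R: "R > 0" by (rule conjunct1)
  have reach': "\<exists>!q. q \<in> A \<and> dist p q = infdist p A"
    if "0 < \<delta>" "\<delta> < R" "infdist p A \<le> \<delta>" for \<delta> p
    using R0[THEN conjunct2, rule_format, OF conjI[OF that(1,2)] that(3)] .
  have uniq: "\<exists>!q. q \<in> A \<and> dist p q = infdist p A" if "infdist p A < R" for p
  proof -
    have "0 \<le> infdist p A" by (rule infdist_nonneg)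
    moreover define \<delta> where "\<delta> = (infdist p A + R) / 2"
    ultimately have "0 < \<delta>" "\<delta> < R" "infdist p A \<le> \<delta>" using that R by (simp_all add: \<delta>_def)
    then show ?thesis by (rule reach')
  qed
  have clK: "closed K" using K(1) by (rule compact_imp_closed)
  then obtain W W' where WW: "open W" "open W'" "W \<inter> W' = {}" "W \<union> W' = - K" "W \<noteq> {}" "W' \<noteq> {}"
  proof -
    obtain e1 e2 where e: "open e1" "open e2" "- K \<subseteq> e1 \<union> e2" "e1 \<inter> e2 \<inter> - K = {}"
       "e1 \<inter> - K \<noteq> {}" "e2 \<inter> - K \<noteq> {}"
      using nc unfolding connected_def by blast
    have "open (- K)" using clK by blast
    then show ?thesis using e by (intro that[of "e1 \<inter> - K" "e2 \<inter> - K"]) (auto intro: open_Int)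
  qed
  have side: "V \<inter> A = {} \<and> frontier V \<subseteq> A"
    if "open V" "open V'" "V \<inter> V' = {}" "V \<union> V' = - K" for V V'
  proof -
    have "frontier V \<subseteq> A"
    proof
      fix p assume p: "p \<in> frontier V"
      then have "p \<in> closure V" "p \<notin> V" using that(1) by (auto simp: frontier_def interior_open)
      moreover have "p \<notin> V'"
        using that open_Int_closure_eq_empty[of V' V] \<open>p \<in> closure V\<close> by blast
      moreover have "closure V \<subseteq> closure (- K)" using that(4) by (intro closure_mono) auto
      ultimately show "p \<in> A" using that(4) clK closure_closed[of K] unfolding A_def frontier_closures by blast
    qed
    moreover have "V \<inter> A = {}" using that clK unfolding A_def by (auto simp: frontier_def)
    ultimately show ?thesis by blast
  qed
  have I: "interior K \<inter> A = {}" "frontier (interior K) \<subseteq> A"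
    unfolding A_def by (auto simp: frontier_def) (metis K(2) closure_closed clK)
  have "closure W \<inter> closure W' = {}"
  proof (rule ccontr)
    assume "closure W \<inter> closure W' \<noteq> {}"
    then obtain p where p: "p \<in> closure W" "p \<in> closure W'" by blast
    have "p \<notin> W" "p \<notin> W'"
      using WW p open_Int_closure_eq_empty[of W W'] open_Int_closure_eq_empty[of W' W] by blast+
    then have pA: "p \<in> A" using side[OF WW(1-4)] p WW(1) by (auto simp: frontier_def interior_open)
    have pK: "p \<in> closure (interior K)" using pA K(2) clK unfolding A_def by (metis frontier_subset_closed subsetD)
    define r where "r = R / 2"
    have r: "0 < r" "r < R" using R by (auto simp: r_def)
    note tb = tangent_ball_at_boundary_point[OF cA uniq r]
    obtain c1 where c1: "dist c1 p = r" "ball c1 r \<subseteq> W" using tb[of W p] side[OF WW(1-4)] pA p by metis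
    obtain c2 where c2: "dist c2 p = r" "ball c2 r \<subseteq> W'"
      using tb[of W' p] side[of W' W] WW pA p by (metis Int_commute Un_commute)
    obtain c3 where c3: "dist c3 p = r" "ball c3 r \<subseteq> interior K" using tb[of "interior K" p] I pA pK by metis
    have "interior K \<inter> W = {}" "interior K \<inter> W' = {}" using WW(4) interior_subset by blast+
    then show False
      using not_three_disjoint_tangent_balls[OF r(1) c1(1) c2(1) c3(1)] c1 c2 c3 WW(3) by blast
  qed
  moreover have "closure W \<union> closure W' = - interior K"
    using WW(4) by (metis closure_Un closure_complement)
  moreover have "connected (- interior K)"
    using K(1,3) by (metis bounded_interior compact_imp_bounded open_interior simply_connected_iff_simple)
  ultimately show False
    using WW(5,6) closure_subset[of W] closure_subset[of W'] unfolding connected_closed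
    by (metis (no_types, lifting) Int_absorb2 Int_commute closed_closure inf_bot_left inf_sup_absorb order_refl
        subset_empty sup.cobounded1 sup_commute)
qed

section \<open>Triangular lattices\<close>
text \<open>The edge vectors around a vertex are indexed by all integers, so that statements about the
  six directions need no case distinction. The recursion says that consecutive vectors span a lattice triangle; it implies
  \<open>E (k + 3) = - E k\<close> and period 6.\<close>
locale triangular_lattice =
  fixes E :: "int \<Rightarrow> complex"
  assumes E_rec: "E (k - 1) + E (k + 1) = E k"
    and E_pos: "Im (cnj (E 0) * E 1) > 0"
begin

lemma E_plus_1: "E (k + 1) = E k - E (k - 1)"
  using E_rec[of k] by (simp add: algebra_simps)

lemma E_plus_2: "E (k + 2) = E (k + 1) - E k"
  using E_rec[of "k + 1"] by (simp add: algebra_simps)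

lemma E_plus_3: "E (k + 3) = - E k"
  using E_plus_2[of k] E_plus_2[of "k + 1"] by (simp add: add.commute)

lemma E_plus_6: "E (k + 6) = E k"
  using E_plus_3[of k] E_plus_3[of "k + 3"] by (simp add: algebra_simps)

lemma E_mod_6: "E (k mod 6) = E k"
proof -
  have nat_mult: "E (k + 6 * int n) = E k" for k n
  proof (induction n)
    case (Suc n)
    then show ?case using E_plus_6[of "k + 6 * int n"] by (simp add: algebra_simps)
  qed simp
  show ?thesis
  proof (cases "k div 6 \<ge> 0")
    case True
    then have "k = k mod 6 + 6 * int (nat (k div 6))" by simp
    then show ?thesis using nat_mult[of "k mod 6" "nat (k div 6)"] by simp
  next
    case False
    then have "k mod 6 = k + 6 * int (nat (- (k div 6)))" by (simp add: minus_mult_div_eq_mod[symmetric])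
    then show ?thesis using nat_mult[of k "nat (- (k div 6))"] by simp
  qed
qed

text \<open>Twice the area of a lattice triangle, for every \<open>k\<close> (see \<open>Im_cnj_E\<close>).\<close>
definition area2 :: real where "area2 = Im (cnj (E 1) * E 2)"

lemma Im_cnj_E: "Im (cnj (E k) * E (k + 1)) = area2"
proof -
  have step: "Im (cnj (E (k + 1)) * E (k + 2)) = Im (cnj (E k) * E (k + 1))" for k
    unfolding E_plus_2 by (simp add: algebra_simps)
  have nat: "Im (cnj (E (k + int n)) * E (k + int n + 1)) = Im (cnj (E k) * E (k + 1))" for k n
  proof (induction n)
    case (Suc n)
    then show ?case using step[of "k + int n"] by (simp add: algebra_simps)
  qed simp
  show ?thesis
  proof (cases "k \<ge> 1")
    case True
    then show ?thesis using nat[of 1 "nat (k - 1)"] by (simp add: area2_def)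
  next
    case False
    then show ?thesis using nat[of k "nat (1 - k)"] by (simp add: area2_def)
  qed
qed

lemma area2_pos: "area2 > 0"
  using E_pos Im_cnj_E[of 0] by simp

lemma E_explicit: "E 0 = E 1 - E 2" "E 3 = E 2 - E 1" "E 4 = - E 1" "E 5 = - E 2" "E 6 = E 1 - E 2" "E 7 = E 1"
  using E_plus_2[of 0] E_plus_2[of 1] E_plus_3[of 1] E_plus_3[of 2] E_plus_6[of 0] E_plus_6[of 1] by auto

text \<open>Coordinates with respect to the basis \<open>E 1\<close>, \<open>E 2\<close>.\<close>
definition cx :: "complex \<Rightarrow> real" where "cx p = Im (cnj p * E 2) / area2"
definition cy :: "complex \<Rightarrow> real" where "cy p = Im (cnj (E 1) * p) / area2"

lemma cx_linear [simp]: "cx (p + q) = cx p + cx q" "cx (p - q) = cx p - cx q" "cx (- p) = - cx p"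
    "cx (of_real r * p) = r * cx p" "cx (of_int n * p) = of_int n * cx p" "cx (r *\<^sub>R p) = r * cx p" "cx 0 = 0"
  using area2_pos by (simp_all add: cx_def field_simps)

lemma cy_linear [simp]: "cy (p + q) = cy p + cy q" "cy (p - q) = cy p - cy q" "cy (- p) = - cy p"
    "cy (of_real r * p) = r * cy p" "cy (of_int n * p) = of_int n * cy p" "cy (r *\<^sub>R p) = r * cy p" "cy 0 = 0"
  using area2_pos by (simp_all add: cy_def field_simps)

lemma cxy_E [simp]: "cx (E 1) = 1" "cx (E 2) = 0" "cy (E 1) = 0" "cy (E 2) = 1"
  using area2_pos by (simp_all add: cx_def cy_def area2_def)

lemma cx_cy_decomp: "p = of_real (cx p) * E 1 + of_real (cy p) * E 2"
proof -
  have A: "Re (E 1) * Im (E 2) - Im (E 1) * Re (E 2) = area2"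
    by (simp add: area2_def algebra_simps)
  have "area2 *\<^sub>R p = of_real (area2 * cx p) * E 1 + of_real (area2 * cy p) * E 2"
    using area2_pos unfolding cx_def cy_def A[symmetric]
    by (simp add: complex_eq_iff) (simp add: algebra_simps)
  also have "\<dots> = area2 *\<^sub>R (of_real (cx p) * E 1 + of_real (cy p) * E 2)"
    by (simp add: algebra_simps scaleR_conv_of_real)
  finally show ?thesis using area2_pos by simp
qed

lemma cxy_eqI: "cx p = cx q \<Longrightarrow> cy p = cy q \<Longrightarrow> p = q"
  using cx_cy_decomp[of p] cx_cy_decomp[of q] by simp

definition V :: "complex set" where "V = {of_int n * E 1 + of_int m * E 2 | n m. True}"

lemma V_iff: "p \<in> V \<longleftrightarrow> cx p \<in> \<int> \<and> cy p \<in> \<int>"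
proof
  assume "p \<in> V" then show "cx p \<in> \<int> \<and> cy p \<in> \<int>" unfolding V_def by auto
next
  assume "cx p \<in> \<int> \<and> cy p \<in> \<int>"
  then obtain n m where "cx p = of_int n" "cy p = of_int m" by (auto elim!: Ints_cases)
  then show "p \<in> V" using cx_cy_decomp[of p] unfolding V_def by auto
qed

lemma E_cases: "E k \<in> {E 0, E 1, E 2, E 3, E 4, E 5}"
proof -
  have "k mod 6 \<in> {0..5}" by simp
  then have "k mod 6 \<in> {0,1,2,3,4,5}" by (simp add: atLeastAtMost_iff) presburger
  then show ?thesis using E_mod_6[of k] by auto
qed

lemma V_add_E: "v \<in> V \<Longrightarrow> v + E k \<in> V"
  using E_cases[of k] by (auto simp: V_iff E_explicit)

lemma zero_in_V: "0 \<in> V" by (simp add: V_iff)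

lemma E_eq_iff: "E k = E j \<longleftrightarrow> k mod 6 = j mod 6"
proof
  assume "E k = E j"
  then have eq: "E (k mod 6) = E (j mod 6)" by (simp add: E_mod_6)
  have "cx (E (k mod 6)) = cx (E (j mod 6))" "cy (E (k mod 6)) = cy (E (j mod 6))" using eq by simp_all
  moreover have "k mod 6 \<in> {0,1,2,3,4,5}" "j mod 6 \<in> {0,1,2,3,4,5}" by (simp; presburger)+
  ultimately show "k mod 6 = j mod 6" by (auto simp: E_explicit)
next
  assume "k mod 6 = j mod 6" then show "E k = E j" by (metis E_mod_6)
qed

lemma E_nonzero: "E k \<noteq> 0"
  using Im_cnj_E[of k] area2_pos by auto

definition tri :: "complex \<Rightarrow> int \<Rightarrow> complex set" where "tri v k = {v, v + E k, v + E (k + 1)}"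

definition TRI :: "complex set set" where "TRI = {tri v k | v k. v \<in> V}"

lemma tri_in_TRI: "v \<in> V \<Longrightarrow> tri v k \<in> TRI" by (auto simp: TRI_def)

lemma tri_mod: "k mod 6 = j mod 6 \<Longrightarrow> tri v k = tri v j"
proof -
  assume "k mod 6 = j mod 6"
  then have "E k = E j" "E (k + 1) = E (j + 1)" using E_eq_iff by (auto intro: mod_add_cong)
  then show ?thesis by (simp add: tri_def)
qed

lemma tri_rotate: "tri (v + E k) (k + 2) = tri v k"
  using E_plus_2[of k] E_plus_3[of k] by (auto simp: tri_def algebra_simps)

lemma tri_rotate2: "tri (v + E (k + 1)) (k + 4) = tri v k"
  using tri_rotate[of "v + E k" "k + 2"] tri_rotate[of v k] E_plus_2[of k] by (simp add: algebra_simps)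

lemma TRI_at_vertex:
  assumes "t \<in> TRI" "p \<in> t"
  obtains k where "t = tri p k" "p \<in> V"
proof -
  obtain v k where t: "t = tri v k" "v \<in> V" using assms by (auto simp: TRI_def)
  then have "p = v \<or> p = v + E k \<or> p = v + E (k + 1)" using assms by (auto simp: tri_def)
  then show ?thesis using that[of k] that[of "k + 2"] that[of "k + 4"] t tri_rotate[of v k] tri_rotate2[of v k] V_add_E by auto
qed

text \<open>Up to renaming of the base vertex there are only two kinds of triangles, the two halves of a
  unit cell; this reduces statements on triangles to two computations.\<close>
lemma TRI_up_down:
  assumes "t \<in> TRI"
  obtains v where "v \<in> V" "t = tri v 1 \<or> t = tri v 2"
proof -
  obtain v k where t: "t = tri v k" "v \<in> V" using assms by (auto simp: TRI_def)
  have vk: "v + E j \<in> V" for j using t V_add_E by blast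
  have "k mod 6 \<in> {0,1,2,3,4,5}" by simp presburger
  then have "k mod 6 = 1 \<or> k mod 6 = 2 \<or> (k + 2) mod 6 = 1 \<or> (k + 2) mod 6 = 2
      \<or> (k + 4) mod 6 = 1 \<or> (k + 4) mod 6 = 2"
    by simp presburger
  then consider "k mod 6 = 1" | "k mod 6 = 2" | "(k + 2) mod 6 = 1" | "(k + 2) mod 6 = 2"
      | "(k + 4) mod 6 = 1" | "(k + 4) mod 6 = 2"
    by blast
  then show ?thesis
  proof cases
    case 1 then show ?thesis using that[of v] t tri_mod[of k 1 v] by simp
  next
    case 2 then show ?thesis using that[of v] t tri_mod[of k 2 v] by simp
  next
    case 3 then show ?thesis using that[of "v + E k"] t vk tri_rotate[of v k] tri_mod[of "k + 2" 1 "v + E k"] by simp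
  next
    case 4 then show ?thesis using that[of "v + E k"] t vk tri_rotate[of v k] tri_mod[of "k + 2" 2 "v + E k"] by simp
  next
    case 5 then show ?thesis using that[of "v + E (k + 1)"] t vk tri_rotate2[of v k] tri_mod[of "k + 4" 1 "v + E (k + 1)"] by simp
  next
    case 6 then show ?thesis using that[of "v + E (k + 1)"] t vk tri_rotate2[of v k] tri_mod[of "k + 4" 2 "v + E (k + 1)"] by simp
  qed
qed

lemma tri_distinct: "v \<noteq> v + E k" "v \<noteq> v + E (k + 1)" "v + E k \<noteq> v + E (k + 1)"
  using E_nonzero[of k] E_nonzero[of "k + 1"] E_eq_iff[of k "k + 1"] by (auto; presburger)+

lemma card_tri: "card (tri v k) = 3"
  using tri_distinct[of v k] by (simp add: tri_def)

lemma TRI_card: "t \<in> TRI \<Longrightarrow> card t = 3" "t \<in> TRI \<Longrightarrow> finite t"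
  using card_tri by (auto simp: TRI_def) (simp add: tri_def)

lemma TRI_subset_V: "t \<in> TRI \<Longrightarrow> t \<subseteq> V"
  using V_add_E by (auto simp: TRI_def tri_def)

lemma TRI_subset_eq: "t \<in> TRI \<Longrightarrow> t' \<in> TRI \<Longrightarrow> t \<subseteq> t' \<Longrightarrow> t = t'"
  using TRI_card by (metis card_subset_eq)

text \<open>The third vertex is determined by the edge and the side on which the triangle lies.\<close>
lemma edge_in_two_triangles:
  assumes t: "t \<in> TRI" "t' \<in> TRI" "s \<in> TRI" "t \<noteq> t'"
    and pq: "p \<noteq> q" "{p, q} \<subseteq> t" "{p, q} \<subseteq> t'" "{p, q} \<subseteq> s"
  shows "s = t \<or> s = t'"
proof -
  have *: "\<exists>k. q = p + E k \<and> (t = tri p k \<or> t = tri p (k - 1))" if tt: "t \<in> TRI" "{p, q} \<subseteq> t" for t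
  proof -
    have "p \<in> t" using tt by blast
    then obtain k where k: "t = tri p k" using TRI_at_vertex[OF tt(1)] by metis
    then have "q = p + E k \<or> q = p + E (k + 1)" using tt pq(1) by (auto simp: tri_def)
    then show ?thesis
    proof
      assume "q = p + E (k + 1)"
      then show ?thesis using k by (intro exI[of _ "k + 1"]) simp
    qed (use k in blast)
  qed
  obtain k where k: "q = p + E k" using *[OF t(1) pq(2)] by blast
  have "t = tri p k \<or> t = tri p (k - 1)" if tt: "t \<in> TRI" "{p, q} \<subseteq> t" for t
  proof -
    obtain j where j: "q = p + E j" "t = tri p j \<or> t = tri p (j - 1)" using *[OF tt] by blast
    then have "j mod 6 = k mod 6" using k E_eq_iff by simp
    then have "(j - 1) mod 6 = (k - 1) mod 6" by (rule mod_diff_cong) simp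
    then show ?thesis using j(2) tri_mod \<open>j mod 6 = k mod 6\<close> by metis
  qed
  then show ?thesis using t pq by metis
qed

section \<open>Barycentric coordinates\<close>
text \<open>The piecewise linear function that is 1 at the origin and 0 at all other vertices. The number
  \<open>hat (y - w)\<close> is the barycentric coordinate of \<open>y\<close> at the vertex \<open>w\<close>, for any lattice triangle that
  contains \<open>y\<close>. All incidence questions below are settled by this one formula.\<close>
definition hat :: "complex \<Rightarrow> real" where
  "hat p = max 0 (1 - max \<bar>cx p\<bar> (max \<bar>cy p\<bar> \<bar>cx p + cy p\<bar>))"

text \<open>The vertices of the smallest simplex that contains \<open>y\<close>.\<close>
definition carrier :: "complex \<Rightarrow> complex set" where
  "carrier y = {w \<in> V. hat (y - w) > 0}"

lemma hat_arith:
  fixes a b :: int and x y :: real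
  assumes "0 \<le> x" "0 \<le> y" "x + y \<le> 1"
  shows "max 0 (1 - max \<bar>a + x\<bar> (max \<bar>b + y\<bar> \<bar>a + x + (b + y)\<bar>)) =
    (if a = 0 \<and> b = 0 then 1 - x - y else if a = -1 \<and> b = 0 then x else if a = 0 \<and> b = -1 then y else 0)"
proof -
  consider "a \<le> -2" | "a \<ge> 1" | "b \<le> -2" | "b \<ge> 1" | "a = 0 \<and> b = 0" | "a = -1 \<and> b = 0" | "a = 0 \<and> b = -1"
    | "a = -1 \<and> b = -1" by linarith
  then show ?thesis
  proof cases
    case 1 then have "real_of_int a \<le> -2" by simp
    then show ?thesis using assms 1 by (simp add: max_def abs_if)
  next
    case 2 then have "real_of_int a \<ge> 1" by simp
    then show ?thesis using assms 2 by (simp add: max_def abs_if)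
  next
    case 3 then have "real_of_int b \<le> -2" by simp
    then show ?thesis using assms 3 by (simp add: max_def abs_if)
  next
    case 4 then have "real_of_int b \<ge> 1" by simp
    then show ?thesis using assms 4 by (simp add: max_def abs_if)
  qed (use assms in \<open>auto simp: max_def abs_if\<close>)
qed

lemma hat_bary_up:
  assumes v: "v \<in> V" "w \<in> V" and u: "0 \<le> a" "0 \<le> b" "0 \<le> c" "a + b + c = 1"
    and y: "y = a *\<^sub>R v + b *\<^sub>R (v + E 1) + c *\<^sub>R (v + E 2)"
  shows "hat (y - w) = (if w = v then a else if w = v + E 1 then b else if w = v + E 2 then c else 0)"
proof -
  obtain n m i j where nm: "cx v = of_int n" "cy v = of_int m" "cx w = of_int i" "cy w = of_int j"
    using v V_iff by (auto elim!: Ints_cases)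
  have yv: "y = v + of_real b * E 1 + of_real c * E 2"
  proof -
    have "a = 1 - b - c" using u(4) by simp
    then show ?thesis unfolding y by (simp only:) (simp add: algebra_simps scaleR_conv_of_real)
  qed
  have cc: "cx (y - w) = of_int (n - i) + b" "cy (y - w) = of_int (m - j) + c"
    using nm by (simp_all add: yv)
  have eqs: "w = v \<longleftrightarrow> n - i = 0 \<and> m - j = 0" "w = v + E 1 \<longleftrightarrow> n - i = -1 \<and> m - j = 0"
     "w = v + E 2 \<longleftrightarrow> n - i = 0 \<and> m - j = -1"
  proof -
    have "w = p \<longleftrightarrow> cx w = cx p \<and> cy w = cy p" for p using cxy_eqI by blast
    then show "w = v \<longleftrightarrow> n - i = 0 \<and> m - j = 0" "w = v + E 1 \<longleftrightarrow> n - i = -1 \<and> m - j = 0"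
     "w = v + E 2 \<longleftrightarrow> n - i = 0 \<and> m - j = -1"
      using nm by (simp_all only: cx_linear cy_linear cxy_E) linarith+
  qed
  have "hat (y - w) = (if n - i = 0 \<and> m - j = 0 then 1 - b - c else if n - i = -1 \<and> m - j = 0 then b
      else if n - i = 0 \<and> m - j = -1 then c else 0)"
    unfolding hat_def cc by (rule hat_arith) (use u in linarith)+
  moreover have "1 - b - c = a" using u(4) by linarith
  ultimately show ?thesis unfolding eqs by simp
qed

lemma hat_bary_down:
  assumes v: "v \<in> V" "w \<in> V" and u: "0 \<le> a" "0 \<le> b" "0 \<le> c" "a + b + c = 1"
    and y: "y = a *\<^sub>R v + b *\<^sub>R (v + E 2) + c *\<^sub>R (v + E 3)"
  shows "hat (y - w) = (if w = v then a else if w = v + E 2 then b else if w = v + E 3 then c else 0)"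
proof -
  \<comment> \<open>reflection in the midpoint of the edge shared with the upward triangle\<close>
  have ev: "hat p = hat (- p)" for p
  proof -
    have "\<bar>- cx p - cy p\<bar> = \<bar>cx p + cy p\<bar>" by linarith
    then show ?thesis by (simp add: hat_def)
  qed
  have v': "v + E 2 \<in> V" using v V_add_E by blast
  define v1 where "v1 = - (v + E 2)"
  have "v1 \<in> V" "- w \<in> V" using v' v by (auto simp: V_iff v1_def)
  moreover have "- y = b *\<^sub>R v1 + c *\<^sub>R (v1 + E 1) + a *\<^sub>R (v1 + E 2)"
    unfolding y v1_def by (simp add: E_explicit algebra_simps)
  ultimately have "hat (- y - - w) = (if - w = v1 then b else if - w = v1 + E 1 then c else if - w = v1 + E 2 then a else 0)"
    using u by (intro hat_bary_up) auto
  moreover have "- w = v1 \<longleftrightarrow> w = v + E 2" "- w = v1 + E 1 \<longleftrightarrow> w = v + E 3" "- w = v1 + E 2 \<longleftrightarrow> w = v"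
    unfolding v1_def E_explicit by (auto simp: algebra_simps) 
  moreover have "hat (y - w) = hat (- y - - w)" using ev[of "y - w"] by simp
  moreover have "v \<noteq> v + E 2" "v \<noteq> v + E 3" "v + E 2 \<noteq> v + E 3" using tri_distinct[of v 2] by simp_all
  ultimately show ?thesis by presburger
qed

text \<open>The value at \<open>w\<close> does not refer to the triangle \<open>t\<close>. That is why two triangles assign the same
  coordinates to a common point, and why simplices meet in common faces.\<close>
lemma hat_bary:
  assumes t: "t \<in> TRI" and u: "\<And>a. a \<in> t \<Longrightarrow> 0 \<le> u a" "sum u t = 1" and w: "w \<in> V"
  shows "hat ((\<Sum>a\<in>t. u a *\<^sub>R a) - w) = (if w \<in> t then u w else 0)"
proof -
  obtain v where v: "v \<in> V" "t = tri v 1 \<or> t = tri v 2" using TRI_up_down[OF t] by blast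
  from v(2) show ?thesis
  proof
    assume t1: "t = tri v 1"
    have d: "v \<noteq> v + E 1" "v \<noteq> v + E 2" "v + E 1 \<noteq> v + E 2" using tri_distinct[of v 1] by simp_all
    have te: "t = {v, v + E 1, v + E 2}" using t1 by (simp add: tri_def)
    have "(\<Sum>a\<in>t. u a *\<^sub>R a) = u v *\<^sub>R v + u (v + E 1) *\<^sub>R (v + E 1) + u (v + E 2) *\<^sub>R (v + E 2)"
      "u v + u (v + E 1) + u (v + E 2) = 1"
      using u(2) d unfolding te by (simp_all add: add.assoc)
    then show ?thesis using hat_bary_up[OF v(1) w, of "u v" "u (v + E 1)" "u (v + E 2)"] u(1) te by simp
  next
    assume t1: "t = tri v 2"
    have d: "v \<noteq> v + E 2" "v \<noteq> v + E 3" "v + E 2 \<noteq> v + E 3" using tri_distinct[of v 2] by simp_all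
    have te: "t = {v, v + E 2, v + E 3}" using t1 by (simp add: tri_def)
    have "(\<Sum>a\<in>t. u a *\<^sub>R a) = u v *\<^sub>R v + u (v + E 2) *\<^sub>R (v + E 2) + u (v + E 3) *\<^sub>R (v + E 3)"
      "u v + u (v + E 2) + u (v + E 3) = 1"
      using u(2) d unfolding te by (simp_all add: add.assoc)
    then show ?thesis using hat_bary_down[OF v(1) w, of "u v" "u (v + E 2)" "u (v + E 3)"] u(1) te by simp
  qed
qed

definition simplices :: "complex set set" where "simplices = {s. s \<noteq> {} \<and> (\<exists>t\<in>TRI. s \<subseteq> t)}"

lemma TRI_SX: "t \<in> TRI \<Longrightarrow> t \<in> simplices" using TRI_card(1)[of t] by (auto simp: simplices_def)
lemma SX_finite: "s \<in> simplices \<Longrightarrow> finite s" unfolding simplices_def using TRI_card(2) finite_subset by blast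
lemma SX_V: "s \<in> simplices \<Longrightarrow> s \<subseteq> V" using TRI_subset_V by (fastforce simp: simplices_def)

lemma hat_bary_SX:
  assumes s: "s \<in> simplices" and u: "\<And>a. a \<in> s \<Longrightarrow> 0 \<le> u a" "sum u s = 1" and w: "w \<in> V"
  shows "hat ((\<Sum>a\<in>s. u a *\<^sub>R a) - w) = (if w \<in> s then u w else 0)"
proof -
  obtain t where t: "t \<in> TRI" "s \<subseteq> t" using s by (auto simp: simplices_def)
  define u' where "u' a = (if a \<in> s then u a else 0)" for a
  have "sum u' t = sum u s" unfolding u'_def using t TRI_card(2)[OF t(1)]
    by (simp add: sum.If_cases Int_absorb1)
  moreover have "(\<Sum>a\<in>t. u' a *\<^sub>R a) = (\<Sum>a\<in>s. u a *\<^sub>R a)"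
    using t TRI_card(2)[OF t(1)] by (intro sum.mono_neutral_cong_right) (auto simp: u'_def)
  ultimately show ?thesis using hat_bary[OF t(1), of u' w] u w t(2) by (auto simp: u'_def)
qed

lemma carrier_eq:
  assumes s: "s \<in> simplices" and u: "\<And>a. a \<in> s \<Longrightarrow> 0 \<le> u a" "sum u s = 1"
  shows "carrier (\<Sum>a\<in>s. u a *\<^sub>R a) = {a \<in> s. 0 < u a}"
  unfolding carrier_def using hat_bary_SX[OF s u] SX_V[OF s] by (auto split: if_splits)

lemma carrier_subset:
  assumes s: "s \<in> simplices" and y: "y \<in> convex hull s"
  shows "carrier y \<subseteq> s" "y \<in> convex hull (carrier y)" "carrier y \<noteq> {}"
proof -
  have fs: "finite s" using s by (rule SX_finite)
  obtain u where u: "\<And>a. a \<in> s \<Longrightarrow> 0 \<le> u a" "sum u s = 1" "y = (\<Sum>a\<in>s. u a *\<^sub>R a)"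
    using y unfolding convex_hull_finite[OF fs] by auto
  have c: "carrier y = {a \<in> s. 0 < u a}" using carrier_eq[OF s u(1,2)] u(3) by simp
  show "carrier y \<subseteq> s" using c by auto
  have eqs: "sum u (carrier y) = 1" "(\<Sum>a\<in>carrier y. u a *\<^sub>R a) = y"
    unfolding u(3) u(2)[symmetric] using fs u(1) c[unfolded u(3)]
    by (auto intro!: sum.mono_neutral_left simp: less_le)
  show "y \<in> convex hull (carrier y)"
    unfolding convex_hull_finite[OF finite_subset[OF \<open>carrier y \<subseteq> s\<close> fs]] mem_Collect_eq
    using eqs u(1) \<open>carrier y \<subseteq> s\<close> by (intro exI[of _ u]) blast
  show "carrier y \<noteq> {}" using eqs(1) by auto
qed

lemma midpoint_carrier:
  assumes "t \<in> TRI" "p \<in> t" "q \<in> t" "p \<noteq> q"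
  shows "carrier (midpoint p q) = {p, q}"
proof -
  have "{p, q} \<in> simplices" using assms by (auto simp: simplices_def)
  from carrier_eq[OF this, of "\<lambda>_. 1/2"] show ?thesis
    using assms by (auto simp: midpoint_def scaleR_add_right)
qed

lemma carrier_vertex: "v \<in> V \<Longrightarrow> carrier v = {v}"
proof -
  assume v: "v \<in> V"
  then have "{v} \<in> simplices" using tri_in_TRI[OF v, of 0] by (auto simp: simplices_def tri_def)
  from carrier_eq[OF this, of "\<lambda>_. 1"] show ?thesis by simp
qed

lemma hull_Int:
  assumes "s \<in> simplices" "t \<in> simplices" "y \<in> convex hull s" "y \<in> convex hull t"
  shows "y \<in> convex hull (s \<inter> t)"
  using carrier_subset[OF assms(1,3)] carrier_subset[OF assms(2,4)] hull_mono[of "carrier y" "s \<inter> t"] by blast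

lemma plane_covered: "\<exists>t\<in>TRI. y \<in> convex hull t"
proof -
  define n m where "n = \<lfloor>cx y\<rfloor>" and "m = \<lfloor>cy y\<rfloor>"
  define a b where "a = cx y - n" and "b = cy y - m"
  have ab: "0 \<le> a" "a < 1" "0 \<le> b" "b < 1" unfolding a_def b_def n_def m_def by linarith+
  define v where "v = of_int n * E 1 + of_int m * E 2"
  have vV: "v \<in> V" by (auto simp: v_def V_def)
  show ?thesis
  proof (cases "a + b \<le> 1")
    case True
    have "y = (1 - a - b) *\<^sub>R v + a *\<^sub>R (v + E 1) + b *\<^sub>R (v + E 2)"
      unfolding v_def a_def b_def by (rule cxy_eqI; simp only: cx_linear cy_linear cxy_E; simp add: algebra_simps)
    then have "y \<in> convex hull {v, v + E 1, v + E 2}" unfolding convex_hull_3 mem_Collect_eq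
      using True ab by (intro exI[of _ "1 - a - b"] exI[of _ a] exI[of _ b]) simp
    then have "y \<in> convex hull (tri v 1)" by (simp add: tri_def)
    then show ?thesis using tri_in_TRI[OF vV] by blast
  next
    case False
    define w where "w = v + E 1"
    have "y = (1 - b) *\<^sub>R w + (a + b - 1) *\<^sub>R (w + E 2) + (1 - a) *\<^sub>R (w + E 3)"
      unfolding w_def v_def a_def b_def
      by (rule cxy_eqI; simp only: cx_linear cy_linear cxy_E E_explicit; simp add: algebra_simps)
    then have "y \<in> convex hull {w, w + E 2, w + E 3}" unfolding convex_hull_3 mem_Collect_eq
      using False ab by (intro exI[of _ "1 - b"] exI[of _ "a + b - 1"] exI[of _ "1 - a"]) simp
    then have "y \<in> convex hull (tri w 2)" by (simp add: tri_def)
    moreover have "w \<in> V" using vV V_add_E by (auto simp: w_def)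
    ultimately show ?thesis using tri_in_TRI by blast
  qed
qed

lemma not_collinear_tri: "\<not> collinear (tri v k)"
proof
  assume "collinear (tri v k)"
  moreover have "tri v k = {v + E k, v, v + E (k + 1)}" by (auto simp: tri_def)
  ultimately have "collinear {0, E k, E (k + 1)}"
    using collinear_3[of "v + E k" v "v + E (k + 1)"] by simp
  then obtain c where "E (k + 1) = c *\<^sub>R E k" using E_nonzero by (auto simp: collinear_lemma)
  then have "Im (cnj (E k) * E (k + 1)) = 0" by (simp add: algebra_simps)
  then show False using Im_cnj_E[of k] area2_pos by linarith
qed

lemma interior_tri:
  "interior (convex hull (tri v k)) =
    {y. \<exists>a b c. 0 < a \<and> 0 < b \<and> 0 < c \<and> a + b + c = 1 \<and>
        a *\<^sub>R v + b *\<^sub>R (v + E k) + c *\<^sub>R (v + E (k + 1)) = y}"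
  unfolding tri_def
  by (rule interior_convex_hull_3_minimal) (use not_collinear_tri in \<open>auto simp: tri_def\<close>)

lemma interior_iff_carrier:
  assumes "t \<in> TRI"
  shows "y \<in> interior (convex hull t) \<longleftrightarrow> carrier y = t"
proof -
  obtain v k where t: "t = tri v k" "v \<in> V" using assms by (auto simp: TRI_def)
  have te: "t = {v, v + E k, v + E (k + 1)}" using t by (simp add: tri_def)
  show ?thesis
  proof
    assume "y \<in> interior (convex hull t)"
    then obtain a b c where abc: "0 < a" "0 < b" "0 < c" "a + b + c = 1"
      "a *\<^sub>R v + b *\<^sub>R (v + E k) + c *\<^sub>R (v + E (k + 1)) = y" unfolding t(1) interior_tri by blast
    define u where "u x = (if x = v then a else if x = v + E k then b else c)" for x
    have su: "sum u t = 1" "(\<Sum>x\<in>t. u x *\<^sub>R x) = y"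
      using abc(4,5) tri_distinct[of v k] unfolding te u_def by (auto simp: add.assoc)
    have up: "0 < u x" for x using abc by (simp add: u_def)
    have "carrier y = {x \<in> t. 0 < u x}"
      using carrier_eq[OF TRI_SX[OF assms] less_imp_le[OF up] su(1)] su(2) by simp
    then show "carrier y = t" using up by simp
  next
    assume c: "carrier y = t"
    obtain t' where t': "t' \<in> TRI" "y \<in> convex hull t'" using plane_covered by blast
    have "carrier y \<subseteq> t'" "y \<in> convex hull (carrier y)" using carrier_subset[OF TRI_SX] t' by auto
    then have yt: "y \<in> convex hull t" using c by simp
    obtain u where u: "\<And>a. a \<in> t \<Longrightarrow> 0 \<le> u a" "sum u t = 1" "y = (\<Sum>a\<in>t. u a *\<^sub>R a)"
      using yt unfolding convex_hull_finite[OF TRI_card(2)[OF assms]] by auto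
    have "{a \<in> t. 0 < u a} = t" using carrier_eq[OF TRI_SX[OF assms] u(1,2)] u(3) c by simp
    then have "0 < u v" "0 < u (v + E k)" "0 < u (v + E (k + 1))" using te by auto
    moreover have "u v + u (v + E k) + u (v + E (k + 1)) = 1"
       "u v *\<^sub>R v + u (v + E k) *\<^sub>R (v + E k) + u (v + E (k + 1)) *\<^sub>R (v + E (k + 1)) = y"
      using u(2,3) tri_distinct[of v k] unfolding te by (simp_all add: add.assoc)
    ultimately show "y \<in> interior (convex hull t)" unfolding t(1) interior_tri by blast
  qed
qed

lemma interior_tri_nonempty: "t \<in> TRI \<Longrightarrow> interior (convex hull t) \<noteq> {}"
proof -
  assume "t \<in> TRI"
  then obtain v k where t: "t = tri v k" by (auto simp: TRI_def)
  have "(1/3) *\<^sub>R v + (1/3) *\<^sub>R (v + E k) + (1/3) *\<^sub>R (v + E (k + 1)) \<in> interior (convex hull t)"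
    unfolding t interior_tri by (auto intro!: exI[of _ "1/3"])
  then show ?thesis by blast
qed

lemma closure_interior_tri: "t \<in> TRI \<Longrightarrow> closure (interior (convex hull t)) = convex hull t"
  using interior_tri_nonempty[of t] convex_closure_interior[of "convex hull t"] TRI_card(2)[of t]
  by (metis closure_closed compact_imp_closed convex_convex_hull finite_imp_compact_convex_hull)

lemma interior_meets_hull:
  assumes "t \<in> TRI" "s \<in> simplices" "y \<in> interior (convex hull t)" "y \<in> convex hull s"
  shows "t \<subseteq> s"
  using assms carrier_subset(1)[OF assms(2,4)] interior_iff_carrier[OF assms(1)] by simp

lemma connected_interior_tri: "connected (interior (convex hull (t :: complex set)))"
  by (intro convex_connected convex_interior convex_convex_hull)

section \<open>Local finiteness\<close>
definition mesh :: real where "mesh = (\<Sum>k\<in>{0..5}. norm (E k))"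

lemma norm_E_le_mesh: "norm (E k) \<le> mesh"
proof -
  have "norm (E (k mod 6)) \<le> mesh" unfolding mesh_def by (rule member_le_sum) auto
  then show ?thesis by (simp add: E_mod_6)
qed

lemma mesh_pos: "mesh > 0"
  using norm_E_le_mesh[of 0] E_nonzero[of 0] by (meson less_le_trans zero_less_norm_iff)

lemma hull_subset_cball:
  assumes "t \<in> TRI" "p \<in> t"
  shows "convex hull t \<subseteq> cball p mesh"
proof -
  obtain k where "t = tri p k" using TRI_at_vertex assms by blast
  then have "t \<subseteq> cball p mesh" using norm_E_le_mesh mesh_pos by (auto simp: tri_def dist_norm)
  then show ?thesis by (intro hull_minimal) auto
qed

lemma hull_subset_cball2:
  assumes "t \<in> TRI" "y \<in> convex hull t"
  shows "convex hull t \<subseteq> cball y (2 * mesh)"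
proof -
  obtain p where p: "p \<in> t" using carrier_subset[OF TRI_SX[OF assms(1)] assms(2)] by blast
  have sub: "convex hull t \<subseteq> cball p mesh" by (rule hull_subset_cball[OF assms(1) p])
  show ?thesis
  proof
    fix x assume "x \<in> convex hull t"
    then have "dist p x \<le> mesh" "dist p y \<le> mesh" using sub assms(2) by auto
    then show "x \<in> cball y (2 * mesh)" using dist_triangle2[of y x p] by (simp add: dist_commute)
  qed
qed

text \<open>Cramer's rule bounds the integer coordinates of a vertex by its norm.\<close>
lemma V_Int_cball_subset:
  defines "N \<equiv> \<lambda>M. \<lceil>M * (norm (E 1) + norm (E 2)) / area2\<rceil>"
  shows "V \<inter> cball 0 M \<subseteq> (\<lambda>(n, m). of_int n * E 1 + of_int m * E 2) ` ({- N M..N M} \<times> {- N M..N M})"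
proof
  define x where "x = M * (norm (E 1) + norm (E 2)) / area2"
  have le: "\<bar>Im (cnj p * q)\<bar> \<le> norm p * norm q" for p q :: complex
    by (metis abs_Im_le_cmod complex_mod_cnj norm_mult)
  fix p assume p: "p \<in> V \<inter> cball 0 M"
  then obtain n m where nm: "p = of_int n * E 1 + of_int m * E 2" by (auto simp: V_def)
  have "\<bar>cx p\<bar> \<le> norm p * norm (E 2) / area2" "\<bar>cy p\<bar> \<le> norm (E 1) * norm p / area2"
    unfolding cx_def cy_def using le[of p "E 2"] le[of "E 1" p] area2_pos by (simp_all add: divide_right_mono)
  moreover have "norm p * norm (E 2) / area2 \<le> x" "norm (E 1) * norm p / area2 \<le> x"
  proof -
    have M': "norm p \<le> M" using p by simp
    then have M0: "0 \<le> M" using norm_ge_zero[of p] by linarith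
    have "norm p * norm (E 2) \<le> M * (norm (E 1) + norm (E 2))"
      using M' M0 by (intro mult_mono) auto
    moreover have "norm (E 1) * norm p \<le> M * (norm (E 1) + norm (E 2))"
      using M' M0 by (subst mult.commute) (intro mult_mono; auto)
    ultimately show "norm p * norm (E 2) / area2 \<le> x" "norm (E 1) * norm p / area2 \<le> x"
      unfolding x_def using area2_pos by (simp_all add: divide_right_mono)
  qed
  moreover have "cx p = n" "cy p = m" by (simp_all add: nm)
  ultimately have "\<bar>real_of_int n\<bar> \<le> x" "\<bar>real_of_int m\<bar> \<le> x" by linarith+
  then have "n \<in> {- N M..N M}" "m \<in> {- N M..N M}" unfolding N_def x_def[symmetric] by (auto; linarith)+
  then show "p \<in> (\<lambda>(n, m). of_int n * E 1 + of_int m * E 2) ` ({- N M..N M} \<times> {- N M..N M})"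
    using nm by auto
qed

lemma finite_V_bounded:
  assumes "bounded B" shows "finite (V \<inter> B)"
proof -
  obtain M where "\<And>x. x \<in> B \<Longrightarrow> norm x \<le> M" using assms by (auto simp: bounded_iff)
  then have "V \<inter> B \<subseteq> V \<inter> cball 0 M" by auto
  then show ?thesis using V_Int_cball_subset[of M] by (rule finite_subset[OF order_trans]) simp
qed

lemma finite_TRI_meeting:
  assumes "bounded B"
  shows "finite {t \<in> TRI. convex hull t \<inter> B \<noteq> {}}"
proof -
  obtain M where M: "\<And>x. x \<in> B \<Longrightarrow> norm x \<le> M" using assms by (auto simp: bounded_iff)
  have "t \<subseteq> V \<inter> cball 0 (M + 2 * mesh)" if t: "t \<in> TRI" "convex hull t \<inter> B \<noteq> {}" for t
  proof
    fix p assume p: "p \<in> t"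
    obtain y where y: "y \<in> convex hull t" "y \<in> B" using t by blast
    have "p \<in> convex hull t" using p by (rule hull_inc)
    then have "dist y p \<le> 2 * mesh" using hull_subset_cball2[OF t(1) y(1)] by auto
    then have "norm p \<le> M + 2 * mesh" using M[OF y(2)] norm_triangle_sub[of p y] by (simp add: dist_norm norm_minus_commute)
    then show "p \<in> V \<inter> cball 0 (M + 2 * mesh)" using TRI_subset_V[OF t(1)] p by auto
  qed
  then have "{t \<in> TRI. convex hull t \<inter> B \<noteq> {}} \<subseteq> Pow (V \<inter> cball 0 (M + 2 * mesh))" by blast
  then show ?thesis using finite_V_bounded[OF bounded_cball] by (meson finite_Pow_iff finite_subset)
qed

text \<open>Only finitely many triangles are near \<open>y\<close>; removing those that do not contain \<open>y\<close> leaves a neighbourhood.\<close>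
lemma star_neighbourhood:
  obtains B where "open B" "y \<in> B" "\<And>t. t \<in> TRI \<Longrightarrow> convex hull t \<inter> B \<noteq> {} \<Longrightarrow> y \<in> convex hull t"
proof -
  define F where "F = {t \<in> TRI. convex hull t \<inter> ball y 1 \<noteq> {} \<and> y \<notin> convex hull t}"
  have "finite F" using finite_TRI_meeting[of "ball y 1"] by (rule finite_subset[rotated]) (auto simp: F_def)
  then have "closed (\<Union>t\<in>F. convex hull t)"
    using TRI_card(2) by (intro closed_UN) (auto simp: F_def finite_imp_compact_convex_hull compact_imp_closed)
  then have "open (ball y 1 - (\<Union>t\<in>F. convex hull t))" by (intro open_Diff) auto
  then show ?thesis by (rule that) (auto simp: F_def)
qed

section \<open>Rows of triangles\<close>
definition simp_complex :: "complex set set \<Rightarrow> bool" where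
  "simp_complex C \<longleftrightarrow> C \<subseteq> simplices \<and> (\<forall>s\<in>C. \<forall>r. r \<subseteq> s \<and> r \<noteq> {} \<longrightarrow> r \<in> C)"

lemma carrier_in_complex:
  assumes "simp_complex C" "y \<in> support C"
  shows "carrier y \<in> C"
proof -
  obtain s where s: "s \<in> C" "y \<in> convex hull s" using assms(2) by (auto simp: support_def)
  then have "s \<in> simplices" using assms(1) by (auto simp: simp_complex_def)
  then show ?thesis using carrier_subset[of s y] s assms(1) by (auto simp: simp_complex_def)
qed

lemma interior_disjoint_support:
  assumes "simp_complex C" "t \<in> TRI" "t \<notin> C"
  shows "interior (convex hull t) \<inter> support C = {}"
  using carrier_in_complex[OF assms(1)] interior_iff_carrier[OF assms(2)] assms(3) by force

lemma interior_disjoint_tri: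
  assumes "t \<in> TRI" "t' \<in> TRI" "t \<noteq> t'"
  shows "interior (convex hull t) \<inter> convex hull t' = {}"
  using interior_meets_hull[OF assms(1) TRI_SX[OF assms(2)]] TRI_subset_eq[OF assms(1,2)] assms(3) by blast

definition adj :: "complex set \<Rightarrow> complex set \<Rightarrow> bool" where
  "adj t t' \<longleftrightarrow> t \<in> TRI \<and> t' \<in> TRI \<and> t \<noteq> t' \<and> (\<exists>p q. p \<noteq> q \<and> {p, q} \<subseteq> t \<inter> t')"

lemma adj_sym: "adj t t' \<Longrightarrow> adj t' t" by (auto simp: adj_def)

lemma adj_card: "adj t t' \<Longrightarrow> card (t \<inter> t') = 2"
proof -
  assume a: "adj t t'"
  then obtain p q where pq: "p \<noteq> q" "{p, q} \<subseteq> t \<inter> t'" by (auto simp: adj_def)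
  have t: "t \<in> TRI" "t' \<in> TRI" "t \<noteq> t'" using a by (auto simp: adj_def)
  have f: "finite (t \<inter> t')" using TRI_card(2)[OF t(1)] by simp
  have "2 \<le> card (t \<inter> t')" using card_mono[OF f pq(2)] pq(1) by simp
  moreover have "card (t \<inter> t') \<noteq> 3"
    using t TRI_card by (metis Int_lower1 Int_lower2 card_subset_eq)
  moreover have "card (t \<inter> t') \<le> 3"
    using card_mono[OF TRI_card(2)[OF t(1)], of "t \<inter> t'"] TRI_card(1)[OF t(1)] by simp
  ultimately show ?thesis by linarith
qed

text \<open>The triangles of the strip between the lines \<open>v + \<real> E 1\<close> and \<open>v + E 2 + \<real> E 1\<close>, numbered from left to right.\<close>
definition row :: "complex \<Rightarrow> int \<Rightarrow> complex set" where
  "row v j = (if even j then tri (v + of_int (j div 2) * E 1) 1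
              else tri (v + of_int (j div 2 + 1) * E 1) 2)"

lemma V_add_mult: "v \<in> V \<Longrightarrow> v + of_int n * E 1 \<in> V"
  by (simp add: V_iff)

lemma row_TRI: "v \<in> V \<Longrightarrow> row v j \<in> TRI"
  unfolding row_def using tri_in_TRI V_add_mult by (simp del: of_int_add)

lemma sum_cx_tri: "sum cx (tri v k) = 3 * cx v + cx (E k) + cx (E (k + 1))"
  using tri_distinct[of v k] by (simp add: tri_def)

lemma sum_cx_row: "sum cx (row v j) = 3 * cx v + (if even j then 3 * (j div 2) + 1 else 3 * (j div 2) + 2)"
proof -
  have "real_of_int (j div 2 + 1) = real_of_int (j div 2) + 1" by simp
  then show ?thesis by (cases "even j"; simp add: row_def sum_cx_tri E_explicit del: of_int_add) simp
qed

text \<open>The sum of the first coordinates of the three vertices increases strictly along the row.\<close>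
lemma row_inj: "row v i = row v j \<Longrightarrow> i = j"
proof -
  assume "row v i = row v j"
  then have "sum cx (row v i) = sum cx (row v j)" by simp
  then have "real_of_int (if even i then 3 * (i div 2) + 1 else 3 * (i div 2) + 2)
      = real_of_int (if even j then 3 * (j div 2) + 1 else 3 * (j div 2) + 2)"
    unfolding sum_cx_row by (auto split: if_splits)
  then have "(if even i then 3 * (i div 2) + 1 else 3 * (i div 2) + 2)
      = (if even j then 3 * (j div 2) + 1 else 3 * (j div 2) + 2)" by (simp only: of_int_eq_iff)
  then show ?thesis by (cases "even i"; cases "even j") (auto elim!: evenE oddE; presburger)+
qed

lemma row_adj: "v \<in> V \<Longrightarrow> adj (row v j) (row v (j + 1))"
proof -
  assume v: "v \<in> V"
  have "\<exists>p q. p \<noteq> q \<and> {p, q} \<subseteq> row v j \<inter> row v (j + 1)"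
  proof (cases "even j")
    case True
    define w where "w = v + of_int (j div 2) * E 1"
    have "row v j = tri w 1" using True by (simp add: row_def w_def)
    moreover have "row v (j + 1) = tri (w + E 1) 2" using True by (simp add: row_def w_def algebra_simps)
    ultimately have "{w + E 1, w + E 2} \<subseteq> row v j \<inter> row v (j + 1)"
      by (auto simp: tri_def E_explicit)
    then show ?thesis using tri_distinct(3)[of w 1] by (intro exI[of _ "w + E 1"] exI[of _ "w + E 2"]) simp
  next
    case False
    define w where "w = v + of_int (j div 2 + 1) * E 1"
    have "(j + 1) div 2 = j div 2 + 1" using False by (elim oddE) simp
    then have "row v (j + 1) = tri w 1" using False by (simp add: row_def w_def)
    moreover have "row v j = tri w 2" using False by (simp add: row_def w_def)
    ultimately have "{w, w + E 2} \<subseteq> row v j \<inter> row v (j + 1)"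
      by (auto simp: tri_def)
    then show ?thesis using tri_distinct(1)[of w 2] by (intro exI[of _ w] exI[of _ "w + E 2"]) simp
  qed
  moreover have "row v j \<noteq> row v (j + 1)" using row_inj[of v j "j + 1"] by auto
  ultimately show ?thesis using row_TRI[OF v] by (auto simp: adj_def)
qed

lemma TRI_in_row:
  assumes "t \<in> TRI" obtains v i where "v \<in> V" "t = row v i"
proof -
  obtain v where v: "v \<in> V" "t = tri v 1 \<or> t = tri v 2" using TRI_up_down[OF assms] by blast
  have "tri v 1 = row v 0" by (simp add: row_def)
  moreover have "tri v 2 = row v (-1)" by (simp add: row_def)
  ultimately show ?thesis using v that by metis
qed

text \<open>From any triangle one can walk along its row in two directions. The single obstacle \<open>d\<close> blocks at
  most one of them, and the other one leads through infinitely many triangles.\<close>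
lemma finite_adj_closed_empty:
  assumes fin: "finite N" and N: "N \<subseteq> TRI" and d: "d \<notin> N"
    and step: "\<And>t t'. t \<in> N \<Longrightarrow> adj t t' \<Longrightarrow> t' \<noteq> d \<Longrightarrow> t' \<in> N"
  shows "N = {}"
proof (rule ccontr)
  assume "N \<noteq> {}"
  then obtain t where t: "t \<in> N" by blast
  then obtain v i where v: "v \<in> V" "t = row v i" using N TRI_in_row by blast
  have inf: False if "\<And>n. row v (i + \<sigma> * int n) \<noteq> d" and \<sigma>: "\<sigma> = 1 \<or> \<sigma> = -1" for \<sigma>
  proof -
    have "row v (i + \<sigma> * int n) \<in> N" for n
    proof (induction n)
      case 0 then show ?case using t v by simp
    next
      case (Suc n)
      have "adj (row v (i + \<sigma> * int n)) (row v (i + \<sigma> * int (Suc n)))"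
        using \<sigma>
      proof
        assume "\<sigma> = 1" then show ?thesis using row_adj[OF v(1), of "i + int n"] by (simp add: algebra_simps)
      next
        assume "\<sigma> = -1" then show ?thesis
          using row_adj[OF v(1), of "i - int n - 1"] adj_sym by (simp add: algebra_simps)
      qed
      then show ?case using step Suc that(1) by blast
    qed
    then have "(\<lambda>n. row v (i + \<sigma> * int n)) ` UNIV \<subseteq> N" by blast
    moreover have "inj (\<lambda>n. row v (i + \<sigma> * int n))"
    proof (rule injI)
      fix m n assume "row v (i + \<sigma> * int m) = row v (i + \<sigma> * int n)"
      then have "i + \<sigma> * int m = i + \<sigma> * int n" by (rule row_inj)
      then show "m = n" using \<sigma> by auto
    qed
    ultimately show False using fin by (meson finite_subset infinite_UNIV_nat finite_imageD)
  qed
  show False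
  proof (cases "\<exists>n. row v (i + 1 * int n) = d")
    case False then show ?thesis using inf[of 1] by blast
  next
    case True
    then obtain n where n: "row v (i + 1 * int n) = d" by blast
    have "row v (i + (-1) * int m) \<noteq> d" for m
    proof
      assume m: "row v (i + (-1) * int m) = d"
      then have "i + (-1) * int m = i + 1 * int n" using n row_inj by metis
      then have "m = 0" by simp
      then show False using m t v d by simp
    qed
    then show ?thesis using inf[of "-1"] by blast
  qed
qed

section \<open>Holes behind blocked triangles\<close>
lemma support_Int_tri:
  assumes "simp_complex C" "t \<in> TRI"
  shows "support C \<inter> convex hull t = (\<Union>s\<in>{s \<in> C. s \<subseteq> t}. convex hull s)"
proof
  show "support C \<inter> convex hull t \<subseteq> (\<Union>s\<in>{s \<in> C. s \<subseteq> t}. convex hull s)"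
    using carrier_in_complex[OF assms(1)] carrier_subset[OF TRI_SX[OF assms(2)]] by blast
  show "(\<Union>s\<in>{s \<in> C. s \<subseteq> t}. convex hull s) \<subseteq> support C \<inter> convex hull t"
    unfolding support_def using hull_mono[of _ t convex] by blast
qed

text \<open>If the triangle \<open>d\<close> met the disc in an absolute retract, the union would be an absolute retract and hence simply
  connected. Therefore the intersection is not the common edge alone nor a pair of edges, and it is less than the whole
  boundary of \<open>d\<close>, because the complement of the disc is connected. What is left is the edge
  together with the opposite vertex. This set is disconnected, and by Janiszewski's
  theorem the union then separates the plane.\<close>
lemma blocked_triangle:
  assumes C: "simp_complex C" and cX: "compact (support C)" and AR: "AR (support C)"
    and con: "connected (- support C)" "connected (support C)"
    and d: "adj t d" "t \<in> C" "d \<notin> C"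
    and max: "\<not> simply_connected (support C \<union> convex hull d)"
  shows "\<forall>p\<in>d. {p} \<in> C" "\<not> connected (- (support C \<union> convex hull d))"
proof -
  have dT: "d \<in> TRI" using d(1) by (simp add: adj_def)
  obtain q1 q2 where q: "q1 \<noteq> q2" "{q1, q2} \<subseteq> t \<inter> d" using d(1) by (auto simp: adj_def)
  have sub: "r \<in> C" if "s \<in> C" "r \<subseteq> s" "r \<noteq> {}" for r s using C that by (auto simp: simp_complex_def)
  have qC: "{q1, q2} \<in> C" using sub[OF d(2), of "{q1, q2}"] q by auto
  then have qC1: "{q1} \<in> C" "{q2} \<in> C" using sub[of "{q1, q2}"] by auto
  obtain k where k: "d = tri q1 k" using TRI_at_vertex[OF dT, of q1] q by auto
  obtain p where p: "d = {q1, q2, p}" "p \<noteq> q1" "p \<noteq> q2"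
  proof -
    have "q2 = q1 + E k \<or> q2 = q1 + E (k + 1)" using k q by (auto simp: tri_def)
    then show ?thesis
    proof
      assume e: "q2 = q1 + E k"
      show ?thesis using that[of "q1 + E (k + 1)"] tri_distinct[of q1 k] k by (simp add: tri_def e)
    next
      assume e: "q2 = q1 + E (k + 1)"
      have "d = {q1, q2, q1 + E k}" unfolding k tri_def e by blast
      then show ?thesis using that[of "q1 + E k"] tri_distinct[of q1 k] by (simp add: e)
    qed
  qed
  define I where "I = support C \<inter> convex hull d"
  have I: "I = (\<Union>s\<in>{s \<in> C. s \<subseteq> d}. convex hull s)" unfolding I_def by (rule support_Int_tri[OF C dT])
  have cd: "compact (convex hull d)" using TRI_card(2)[OF dT] by (rule finite_imp_compact_convex_hull)
  have nAR: "\<not> AR I"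
  proof
    assume "AR I"
    moreover have "convex hull d \<noteq> {}" using p(1) by simp
    then have "AR (convex hull d)" by (intro convex_imp_AR) simp
    ultimately have "AR (support C \<union> convex hull d)"
      using AR cX cd unfolding I_def by (intro AR_closed_Un compact_imp_closed)
    then show False using max AR_imp_contractible contractible_imp_simply_connected by blast
  qed
  have face: "s \<in> simplices" if "s \<subseteq> d" "s \<noteq> {}" for s using that dT by (auto simp: simplices_def)
  have pC: "{p} \<in> C"
  proof (rule ccontr)
    assume "{p} \<notin> C"
    then have "p \<notin> s" if "s \<in> C" for s using sub[OF that, of "{p}"] by auto
    then have "s \<subseteq> {q1, q2}" if "s \<in> C" "s \<subseteq> d" for s using that p by blast
    then have "I \<subseteq> convex hull {q1, q2}" unfolding I using hull_mono[of _ "{q1, q2}" convex] by blast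
    moreover have "convex hull {q1, q2} \<subseteq> I" unfolding I using qC p by blast
    ultimately have "I = convex hull {q1, q2}" by blast
    then have "AR I" using convex_imp_AR[of "convex hull {q1, q2}"] by simp
    then show False using nAR by blast
  qed
  have both: False if e: "{p, a} \<in> C" "{p, b} \<notin> C" and ab: "{a, b} = {q1, q2}" for a b
  proof -
    have "a = q1 \<and> b = q2 \<or> a = q2 \<and> b = q1" using ab by (simp add: doubleton_eq_iff)
    then have "b \<noteq> p" "a \<noteq> p" "a \<noteq> b" "d = {a, b, p}" using p q(1) by auto
    have sub_cases: "s \<subseteq> {q1, q2} \<or> s \<subseteq> {p, a}" if s: "s \<in> C" "s \<subseteq> d" for s
    proof (rule ccontr)
      assume "\<not> (s \<subseteq> {q1, q2} \<or> s \<subseteq> {p, a})"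
      then have "{p, b} \<subseteq> s" using s(2) \<open>d = {a, b, p}\<close> ab[symmetric] by blast
      then show False using sub[OF s(1), of "{p, b}"] e(2) by auto
    qed
    have "I \<subseteq> convex hull {q1, q2} \<union> convex hull {p, a}" unfolding I
    proof (rule UN_least)
      fix s assume "s \<in> {s \<in> C. s \<subseteq> d}"
      then have "s \<subseteq> {q1, q2} \<or> s \<subseteq> {p, a}" using sub_cases by blast
      then show "convex hull s \<subseteq> convex hull {q1, q2} \<union> convex hull {p, a}"
        using hull_mono[of s "{q1, q2}" convex] hull_mono[of s "{p, a}" convex] by blast
    qed
    moreover have "convex hull {q1, q2} \<union> convex hull {p, a} \<subseteq> I"
    proof -
      have "{q1, q2} \<subseteq> d" "{p, a} \<subseteq> d" using p(1) \<open>d = {a, b, p}\<close> by auto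
      then show ?thesis unfolding I using qC e(1) by blast
    qed
    ultimately have Ie: "I = convex hull {q1, q2} \<union> convex hull {p, a}" by blast
    have "convex hull {q1, q2} \<inter> convex hull {p, a} = convex hull {a}"
    proof
      have "{q1, q2} \<inter> {p, a} = {a}" using ab \<open>a \<noteq> p\<close> p by blast
      then show "convex hull {q1, q2} \<inter> convex hull {p, a} \<subseteq> convex hull {a}"
        using hull_Int[of "{q1, q2}" "{p, a}"] face[of "{q1, q2}"] face[of "{p, a}"] p(1) \<open>d = {a, b, p}\<close> by auto
      show "convex hull {a} \<subseteq> convex hull {q1, q2} \<inter> convex hull {p, a}"
        using hull_mono[of "{a}" "{q1, q2}" convex] hull_mono[of "{a}" "{p, a}" convex] ab by blast
    qed
    then have "AR I" unfolding Ie
      by (intro AR_closed_Un convex_imp_AR) (auto intro!: compact_imp_closed finite_imp_compact_convex_hull)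
    then show False using nAR by blast
  qed
  have all: "\<not> ({p, q1} \<in> C \<and> {p, q2} \<in> C)"
  proof
    assume pq: "{p, q1} \<in> C \<and> {p, q2} \<in> C"
    have int: "interior (convex hull d) \<inter> support C = {}" by (rule interior_disjoint_support[OF C dT d(3)])
    have "bounded (support C \<union> convex hull d)" using cX cd by (simp add: compact_imp_bounded)
    then obtain z where z: "z \<notin> support C" "z \<notin> convex hull d"
      by (metis UNIV_I Un_iff bounded_subset not_bounded_UNIV subsetI)
    have "- support C \<inter> frontier (convex hull d) \<noteq> {}"
      using connected_Int_frontier[OF con(1), of "convex hull d"] z int interior_tri_nonempty[OF dT]
        interior_subset[of "convex hull d"] by blast
    then obtain y where y: "y \<notin> support C" "y \<in> convex hull d" "y \<notin> interior (convex hull d)"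
      using cd by (auto simp: frontier_def compact_imp_closed)
    have c: "carrier y \<subseteq> d" "y \<in> convex hull (carrier y)" "carrier y \<noteq> {}" "carrier y \<noteq> d"
      using carrier_subset[OF TRI_SX[OF dT] y(2)] y(3) interior_iff_carrier[OF dT] by auto
    then have "carrier y \<subseteq> {q1, q2} \<or> carrier y \<subseteq> {p, q1} \<or> carrier y \<subseteq> {p, q2}" using p(1) by blast
    then have "carrier y \<in> C" using sub[OF qC] sub[of "{p, q1}"] sub[of "{p, q2}"] pq c(3) by blast
    then show False using y(1) c(2) by (auto simp: support_def)
  qed
  have "{p, q1} \<notin> C" using all both[of q1 q2] by auto
  have "{p, q2} \<notin> C" using all both[of q2 q1] by auto
  show "\<forall>p\<in>d. {p} \<in> C" using p pC qC1 by auto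
  have "I \<subseteq> convex hull {q1, q2} \<union> {p}" unfolding I
  proof (rule UN_least)
    fix s assume s: "s \<in> {s \<in> C. s \<subseteq> d}"
    have "s \<subseteq> {q1, q2} \<or> s \<subseteq> {p}"
    proof (rule ccontr)
      assume "\<not> (s \<subseteq> {q1, q2} \<or> s \<subseteq> {p})"
      then have "{p, q1} \<subseteq> s \<or> {p, q2} \<subseteq> s" using s p(1) by blast
      then show False using sub[of s "{p, q1}"] sub[of s "{p, q2}"] s \<open>{p, q1} \<notin> C\<close> \<open>{p, q2} \<notin> C\<close> by blast
    qed
    then show "convex hull s \<subseteq> convex hull {q1, q2} \<union> {p}"
      using hull_mono[of s "{q1, q2}" convex] hull_mono[of s "{p}" convex] by auto
  qed
  moreover have "convex hull {q1, q2} \<union> {p} \<subseteq> I"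
  proof -
    have "{q1, q2} \<subseteq> d" "{p} \<subseteq> d" using p(1) by auto
    moreover have "p \<in> convex hull {p}" by simp
    ultimately show ?thesis unfolding I using qC pC by blast
  qed
  ultimately have Ie: "I = convex hull {q1, q2} \<union> {p}" by blast
  have pn: "p \<notin> convex hull {q1, q2}"
  proof
    assume "p \<in> convex hull {q1, q2}"
    then have "carrier p \<subseteq> {q1, q2}" using carrier_subset(1)[OF face[of "{q1, q2}"]] p(1) by auto
    moreover have "carrier p = {p}" using carrier_vertex TRI_subset_V[OF dT] p(1) by auto
    ultimately show False using p by auto
  qed
  have "\<not> connected I"
  proof -
    have "closed (convex hull {q1, q2})" by (intro compact_imp_closed finite_imp_compact_convex_hull) simp
    moreover have "q1 \<in> convex hull {q1, q2}" by (simp add: hull_inc)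
    ultimately show ?thesis unfolding connected_closed Ie using pn
      by (simp only: not_not) (rule exI[of _ "convex hull {q1, q2}"], rule exI[of _ "{p}"], auto)
  qed
  then show "\<not> connected (- (support C \<union> convex hull d))"
    using Janiszewski_dual[OF cX cd con(2) convex_connected[OF convex_convex_hull]] unfolding I_def by blast
qed

lemma connected_insert_closure: "connected S \<Longrightarrow> x \<in> closure S \<Longrightarrow> connected (insert x S)"
  using connected_intermediate_closure[of S "insert x S"] closure_subset[of S] by blast

text \<open>A bounded component that met \<open>- K\<close> would contain all of the unbounded set \<open>- K\<close>.\<close>
lemma bounded_component_in_filled:
  fixes S K :: "complex set"
  assumes "S \<subseteq> K" "bounded K" "connected (- K)" "H = connected_component_set (- S) x" "bounded H"
  shows "H \<subseteq> K"
proof (rule ccontr)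
  assume "\<not> H \<subseteq> K"
  then obtain y where y: "y \<in> H" "y \<in> - K" by blast
  have "H = connected_component_set (- S) y" using y assms(4) connected_component_eq by fastforce
  moreover have "- K \<subseteq> connected_component_set (- S) y"
    using y assms(1,3) by (intro connected_component_maximal) auto
  ultimately have "bounded (- K)" using assms(5) bounded_subset by blast
  then have "bounded (K \<union> - K)" using assms(2) by (simp only: bounded_Un)
  then show False using not_bounded_UNIV[where 'a = complex] by (simp only: Compl_partition)
qed

text \<open>Let \<open>N\<close> be the set of the triangles that lie in the hole \<open>H\<close>. Since \<open>N\<close> is finite, some \<open>t\<close> in \<open>N\<close> has
  a neighbour \<open>t'\<close> outside \<open>N\<close> with \<open>t' \<noteq> d\<close>. This neighbour belongs to the disc, as otherwise one could pass from
  \<open>t\<close> to \<open>t'\<close> through the common edge without leaving \<open>H\<close>. Thus \<open>t\<close> is a triangle in \<open>K\<close> next to the disc, and it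
  is blocked as well. A hole \<open>H2\<close> which it cuts off avoids \<open>d\<close>, because \<open>d\<close> has contact with the
  unbounded component, and it lies in \<open>H\<close> without \<open>t\<close>.\<close>
lemma blocked_triangle_hole_shrinks:
  fixes C :: "complex set set" and K :: "complex set"
  assumes C: "simp_complex C" and cX: "compact (support C)" and AR: "AR (support C)"
    and con: "connected (- support C)" "connected (support C)"
    and pure: "\<And>p q. p \<noteq> q \<Longrightarrow> {p, q} \<in> C \<Longrightarrow> \<exists>t\<in>C \<inter> TRI. {p, q} \<subseteq> t"
    and K: "compact K" "connected (- K)" "support C \<subseteq> K"
    and max: "\<And>t d. adj t d \<Longrightarrow> t \<in> C \<Longrightarrow> d \<notin> C \<Longrightarrow> convex hull d \<subseteq> K \<Longrightarrow>
        \<not> simply_connected (support C \<union> convex hull d)"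
    and d: "adj t0 d" "t0 \<in> C" "d \<notin> C" "convex hull d \<subseteq> K"
    and H: "H = connected_component_set (- (support C \<union> convex hull d)) x" "x \<in> H" "bounded H"
  shows "\<exists>t1 d' x'. adj t1 d' \<and> t1 \<in> C \<and> d' \<notin> C \<and> convex hull d' \<subseteq> K \<and>
     interior (convex hull d') \<subseteq> H \<and>
     x' \<in> connected_component_set (- (support C \<union> convex hull d')) x' \<and>
     bounded (connected_component_set (- (support C \<union> convex hull d')) x') \<and>
     connected_component_set (- (support C \<union> convex hull d')) x' \<subseteq> H - convex hull d'"
proof -
  define X where "X = support C"
  define S where "S = X \<union> convex hull d"
  have dT: "d \<in> TRI" using d(1) by (simp add: adj_def)
  have cd: "compact (convex hull t)" "closed (convex hull t)" if "t \<in> TRI" for t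
    using TRI_card(2)[OF that] by (auto intro: finite_imp_compact_convex_hull compact_imp_closed)
  have cS: "compact S" unfolding S_def X_def using cX cd(1)[OF dT] by blast
  then have oS: "open (- S)" by (simp add: compact_imp_closed open_Compl)
  have H': "H = connected_component_set (- S) x" using H(1) by (simp add: S_def X_def)
  have oH: "open H" unfolding H' using oS by (rule open_connected_component)
  have HS: "H \<inter> S = {}" unfolding H' using connected_component_subset[of "- S" x] by blast
  have HK: "H \<subseteq> K"
    using bounded_component_in_filled[OF _ compact_imp_bounded[OF K(1)] K(2) H' H(3)] K(3) d(4)
    by (simp add: S_def X_def)
  have Hmax: "A \<subseteq> H" if A: "connected A" "A \<subseteq> - S" "A \<inter> H \<noteq> {}" for A
  proof -
    obtain y where y: "y \<in> A" "y \<in> H" using A(3) by blast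
    then have "H = connected_component_set (- S) y" using connected_component_eq unfolding H' by fastforce
    then show ?thesis using connected_component_maximal[OF y(1) A(1,2)] by simp
  qed
  have vX: "{p} \<in> C" if "p \<in> d" for p
    using blocked_triangle(1)[OF C cX AR con d(1,2,3) max[OF d]] that by blast
  define N where "N = {t \<in> TRI. t \<notin> C \<and> t \<noteq> d \<and> interior (convex hull t) \<subseteq> H}"
  have intS: "interior (convex hull t) \<subseteq> - S" if "t \<in> TRI" "t \<notin> C" "t \<noteq> d" for t
    using interior_disjoint_support[OF C that(1,2)] interior_disjoint_tri[OF that(1) dT that(3)]
    unfolding S_def X_def by blast
  have "finite N"
  proof (rule finite_subset[OF _ finite_TRI_meeting[OF H(3)]])
    show "N \<subseteq> {t \<in> TRI. convex hull t \<inter> H \<noteq> {}}"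
      using interior_tri_nonempty interior_subset unfolding N_def by blast
  qed
  moreover have "N \<noteq> {}"
  proof -
    obtain t where t: "t \<in> TRI" "x \<in> convex hull t" using plane_covered by blast
    have "x \<in> closure (interior (convex hull t))" using closure_interior_tri[OF t(1)] t(2) by simp
    then have ne: "interior (convex hull t) \<inter> H \<noteq> {}"
      using oH H(2) by (metis closure_iff_nhds_not_empty disjoint_iff inf_commute open_Int_closure_eq_empty)
    have "t \<noteq> d" using ne HS interior_subset[of "convex hull d"] unfolding S_def by blast
    moreover have "t \<notin> C"
    proof
      assume "t \<in> C" then have "convex hull t \<subseteq> X" by (auto simp: X_def support_def)
      then show False using ne HS interior_subset[of "convex hull t"] unfolding S_def by blast
    qed
    ultimately have "interior (convex hull t) \<subseteq> H"
      using Hmax[OF connected_interior_tri intS[OF t(1)] ne] by blast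
    then show ?thesis using t(1) \<open>t \<noteq> d\<close> \<open>t \<notin> C\<close> by (auto simp: N_def)
  qed
  moreover have "N \<subseteq> TRI" "d \<notin> N" by (auto simp: N_def)
  ultimately obtain t t' where tt: "t \<in> N" "adj t t'" "t' \<noteq> d" "t' \<notin> N"
    using finite_adj_closed_empty[of N d] by blast
  have tN: "t \<in> TRI" "t \<notin> C" "t \<noteq> d" "interior (convex hull t) \<subseteq> H" using tt(1) by (auto simp: N_def)
  have t'T: "t' \<in> TRI" "t \<noteq> t'" using tt(2) by (auto simp: adj_def)
  obtain p q where pq: "p \<noteq> q" "{p, q} \<subseteq> t" "{p, q} \<subseteq> t'" using tt(2) by (auto simp: adj_def)
  have mid: "carrier (midpoint p q) = {p, q}" using midpoint_carrier[OF tN(1)] pq by auto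
  have mhull: "midpoint p q \<in> convex hull s" if "{p, q} \<subseteq> s" for s
  proof -
    have "midpoint p q \<in> closed_segment p q" by (rule midpoint_in_closed_segment)
    then show ?thesis using hull_mono[OF that, of convex] by (auto simp: segment_convex_hull)
  qed
  \<comment> \<open>the midpoint of the common edge would connect the interiors of the two triangles inside the hole\<close>
  have t'C: "t' \<in> C"
  proof (rule ccontr)
    assume nC: "t' \<notin> C"
    have "midpoint p q \<notin> S"
    proof
      assume "midpoint p q \<in> S"
      then consider "midpoint p q \<in> X" | "midpoint p q \<in> convex hull d" by (auto simp: S_def)
      then show False
      proof cases
        case 1
        then have "{p, q} \<in> C" using carrier_in_complex[OF C] mid unfolding X_def by metis
        then obtain t'' where "t'' \<in> C" "t'' \<in> TRI" "{p, q} \<subseteq> t''" using pure[OF pq(1)] by blast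
        then show False using edge_in_two_triangles[OF tN(1) t'T(1) _ t'T(2) pq(1,2,3)] tN(2) nC by blast
      next
        case 2
        then have "{p, q} \<subseteq> d" using carrier_subset(1)[OF TRI_SX[OF dT]] mid by metis
        then show False using edge_in_two_triangles[OF tN(1) t'T(1) dT t'T(2) pq(1,2,3)] tN(3) tt(3) by blast
      qed
    qed
    moreover have "midpoint p q \<in> closure (interior (convex hull t))" "midpoint p q \<in> closure (interior (convex hull t'))"
      using mhull[OF pq(2)] mhull[OF pq(3)] closure_interior_tri[OF tN(1)] closure_interior_tri[OF t'T(1)]
      by simp_all
    then have "connected (insert (midpoint p q) (interior (convex hull t)))"
        "connected (insert (midpoint p q) (interior (convex hull t')))"
      using connected_insert_closure connected_interior_tri by blast+
    then have "connected (insert (midpoint p q) (interior (convex hull t)) \<union> insert (midpoint p q) (interior (convex hull t')))"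
      by (intro connected_Un) auto
    moreover have "interior (convex hull t) \<subseteq> - S" "interior (convex hull t') \<subseteq> - S"
      using intS[OF tN(1-3)] intS[OF t'T(1) nC tt(3)] by blast+
    ultimately have "insert (midpoint p q) (interior (convex hull t)) \<union> insert (midpoint p q) (interior (convex hull t')) \<subseteq> H"
      using tN(4) interior_tri_nonempty[OF tN(1)] by (intro Hmax) auto
    then have "t' \<in> N" using nC tt(3) t'T(1) unfolding N_def by blast
    then show False using tt(4) by blast
  qed
  have tK: "convex hull t \<subseteq> K"
  proof -
    have "closure (interior (convex hull t)) \<subseteq> K"
      using tN(4) HK K(1) by (intro closure_minimal) (auto simp: compact_imp_closed)
    then show ?thesis using closure_interior_tri[OF tN(1)] by simp
  qed
  define S' where "S' = X \<union> convex hull t"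
  have cS': "compact S'" unfolding S'_def X_def using cX cd(1)[OF tN(1)] by blast
  then have oS': "open (- S')" by (simp add: compact_imp_closed open_Compl)
  have nc: "\<not> connected (- S')"
    using blocked_triangle(2)[OF C cX AR con adj_sym[OF tt(2)] t'C tN(2) max[OF adj_sym[OF tt(2)] t'C tN(2) tK]]
    by (simp add: S'_def X_def)
  have "inside S' \<noteq> {}"
  proof
    assume "inside S' = {}"
    then have "- S' = outside S'" using inside_Un_outside[of S'] by blast
    moreover have "connected (outside S')"
      by (rule connected_outside) (use cS' in \<open>simp_all add: compact_imp_bounded\<close>)
    ultimately show False using nc by simp
  qed
  then obtain x' where x': "x' \<in> inside S'" by blast
  define H2 where "H2 = connected_component_set (- S') x'"
  have x'n: "x' \<notin> S'" and bH2: "bounded H2" using x' unfolding inside_def H2_def by auto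
  have x'H2: "x' \<in> H2" unfolding H2_def using x'n by simp
  have oH2: "open H2" unfolding H2_def using oS' by (rule open_connected_component)
  have H2S': "H2 \<subseteq> - S'" unfolding H2_def by (rule connected_component_subset)
  have cH2: "connected H2" unfolding H2_def by (rule connected_connected_component)
  have H2max: "A \<subseteq> H2" if A: "connected A" "A \<subseteq> - S'" "A \<inter> H2 \<noteq> {}" for A
  proof -
    obtain y where y: "y \<in> A" "y \<in> H2" using A(3) by blast
    then have "H2 = connected_component_set (- S') y" using connected_component_eq unfolding H2_def by fastforce
    then show ?thesis using connected_component_maximal[OF y(1) A(1,2)] by simp
  qed
  \<comment> \<open>all vertices of d belong to the disc, so a common point of d and t off the disc is interior to an edge, which bounds only d and t\<close>
  have nb: "\<exists>B. open B \<and> y \<in> B \<and> B \<subseteq> convex hull d \<union> convex hull t"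
    if y: "y \<in> convex hull d" "y \<in> convex hull t" "y \<notin> X" for y
  proof -
    have c: "carrier y \<subseteq> d" "carrier y \<subseteq> t" "y \<in> convex hull (carrier y)" "carrier y \<noteq> {}"
      using carrier_subset[OF TRI_SX[OF dT] y(1)] carrier_subset[OF TRI_SX[OF tN(1)] y(2)] by auto
    have "\<exists>a b. a \<noteq> b \<and> {a, b} \<subseteq> carrier y"
    proof (rule ccontr)
      assume "\<not> ?thesis"
      then obtain a where a: "carrier y = {a}" using c(4) by blast
      then have "{a} \<in> C" using vX c(1) by blast
      then show False using y(3) c(3) a unfolding X_def support_def by auto
    qed
    then obtain a b where ab: "a \<noteq> b" "{a, b} \<subseteq> carrier y" by blast
    obtain B where B: "open B" "y \<in> B" "\<And>s. s \<in> TRI \<Longrightarrow> convex hull s \<inter> B \<noteq> {} \<Longrightarrow> y \<in> convex hull s"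
      using star_neighbourhood by blast
    have "B \<subseteq> convex hull d \<union> convex hull t"
    proof
      fix z assume z: "z \<in> B"
      obtain s where s: "s \<in> TRI" "z \<in> convex hull s" using plane_covered by blast
      have "y \<in> convex hull s" using B(3)[OF s(1)] s(2) z by blast
      then have "{a, b} \<subseteq> s" using carrier_subset(1)[OF TRI_SX[OF s(1)]] ab by blast
      then have "s = d \<or> s = t"
        using edge_in_two_triangles[OF dT tN(1) s(1) _ ab(1)] tN(3) ab(2) c(1,2) by blast
      then show "z \<in> convex hull d \<union> convex hull t" using s by blast
    qed
    then show ?thesis using B by blast
  qed
  define O' where "O' = outside S"
  have bS: "bounded S" using cS by (rule compact_imp_bounded)
  have oO: "open O'" unfolding O'_def using cS by (simp add: compact_imp_closed open_outside)
  have cO: "connected O'" unfolding O'_def by (rule connected_outside) (use bS in simp_all)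
  have OS: "O' \<inter> S = {}" unfolding O'_def outside_def by blast
  have OH: "O' \<inter> H = {}"
  proof (rule ccontr)
    assume "O' \<inter> H \<noteq> {}"
    then have "O' \<subseteq> H" using OS by (intro Hmax cO) auto
    then show False using H(3) bounded_subset unbounded_outside[OF bS] unfolding O'_def by blast
  qed
  have Ot: "O' \<inter> convex hull t = {}"
  proof -
    have "O' \<inter> interior (convex hull t) = {}" using OH tN(4) by blast
    then have "O' \<inter> closure (interior (convex hull t)) = {}" using open_Int_closure_eq_empty[OF oO] by blast
    then show ?thesis using closure_interior_tri[OF tN(1)] by simp
  qed
  have idS': "interior (convex hull d) \<subseteq> - S'" "interior (convex hull d) \<inter> X = {}"
    using interior_disjoint_support[OF C dT d(3)] interior_disjoint_tri[OF dT tN(1)] tN(3)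
    unfolding S'_def X_def by blast+
  \<comment> \<open>d touches the unbounded component O' at a point off the disc and off t; through this point H2 would be connected to O'\<close>
  have "H2 \<inter> convex hull d = {}"
  proof (rule ccontr)
    assume "H2 \<inter> convex hull d \<noteq> {}"
    then have "H2 \<inter> interior (convex hull d) \<noteq> {}"
      using open_Int_closure_eq_empty[OF oH2, of "interior (convex hull d)"] closure_interior_tri[OF dT] by simp
    moreover have "- X \<inter> frontier O' \<noteq> {}"
    proof (rule connected_Int_frontier)
      show "connected (- X)" using con(1) by (simp add: X_def)
      have "O' \<noteq> {}" using unbounded_outside[OF bS] unfolding O'_def by auto
      then show "- X \<inter> O' \<noteq> {}" using OS unfolding S_def by blast
      show "- X - O' \<noteq> {}"
        using interior_tri_nonempty[OF dT] idS'(2) OS interior_subset[of "convex hull d"] unfolding S_def by blast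
    qed
    then obtain y where y: "y \<in> frontier O'" "y \<notin> X" by blast
    have "frontier O' \<subseteq> S" unfolding O'_def by (rule frontier_outside_subset) (use cS in \<open>rule compact_imp_closed\<close>)
    then have yd: "y \<in> convex hull d" using y unfolding S_def by blast
    have yO: "y \<in> closure O'" using y(1) by (simp add: frontier_def)
    have yt: "y \<notin> convex hull t"
    proof
      assume "y \<in> convex hull t"
      then obtain B where B: "open B" "y \<in> B" "B \<subseteq> convex hull d \<union> convex hull t" using nb[OF yd _ y(2)] by blast
      then have "B \<inter> O' = {}" using OS Ot unfolding S_def by blast
      then show False using open_Int_closure_eq_empty[OF B(1), of O'] yO B(2) by blast
    qed
    have "connected (insert y O')" using cO yO connected_insert_closure by blast
    moreover have "connected (insert y (interior (convex hull d)))"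
      using connected_interior_tri yd closure_interior_tri[OF dT] connected_insert_closure by blast
    ultimately have "connected (insert y O' \<union> insert y (interior (convex hull d)))"
      by (intro connected_Un) auto
    moreover have "insert y O' \<union> insert y (interior (convex hull d)) \<subseteq> - S'"
      using y(2) yt OS Ot idS'(1) unfolding S'_def S_def by blast
    ultimately have "insert y O' \<union> insert y (interior (convex hull d)) \<subseteq> H2"
      using \<open>H2 \<inter> interior (convex hull d) \<noteq> {}\<close> by (intro H2max) auto
    then show False using bH2 bounded_subset unbounded_outside[OF bS] unfolding O'_def by blast
  qed
  note H2d = this
  \<comment> \<open>the hole H2 touches t at a point off the disc, and there it also touches H\<close>
  have "H2 \<inter> H \<noteq> {}"
  proof
    assume dis: "H2 \<inter> H = {}"
    have itX: "interior (convex hull t) \<inter> X = {}" using interior_disjoint_support[OF C tN(1,2)] by (simp add: X_def)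
    have "- X \<inter> frontier H2 \<noteq> {}"
    proof (rule connected_Int_frontier)
      show "connected (- X)" using con(1) by (simp add: X_def)
      show "- X \<inter> H2 \<noteq> {}" using x'H2 x'n unfolding S'_def by blast
      show "- X - H2 \<noteq> {}" using itX interior_tri_nonempty[OF tN(1)] tN(4) dis by blast
    qed
    then obtain y where y: "y \<in> frontier H2" "y \<notin> X" by blast
    have "frontier H2 \<subseteq> frontier (- S')" unfolding H2_def by (rule frontier_of_connected_component_subset)
    also have "\<dots> \<subseteq> S'" using cS' by (simp add: compact_imp_closed frontier_complement frontier_subset_closed)
    finally have yt: "y \<in> convex hull t" using y unfolding S'_def by blast
    have ycl: "y \<in> closure H2" using y(1) by (simp add: frontier_def)
    show False
    proof (cases "y \<in> convex hull d")
      case True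
      then obtain B where B: "open B" "y \<in> B" "B \<subseteq> convex hull d \<union> convex hull t" using nb[OF _ yt y(2)] by blast
      then have "B \<inter> H2 = {}" using H2d H2S' unfolding S'_def by blast
      then show False using open_Int_closure_eq_empty[OF B(1), of H2] ycl B(2) by blast
    next
      case False
      have "connected (insert y H)"
      proof (rule connected_insert_closure)
        show "connected H" unfolding H' by (rule connected_connected_component)
        show "y \<in> closure H"
          using yt closure_interior_tri[OF tN(1)] closure_mono[OF tN(4)] by blast
      qed
      moreover have "insert y H \<subseteq> - S" using False y(2) HS unfolding S_def by blast
      ultimately have "y \<in> H" using Hmax[of "insert y H"] H(2) by blast
      then show False using open_Int_closure_eq_empty[OF oH, of H2] dis ycl by blast
    qed
  qed
  moreover have "H2 \<subseteq> - S" using H2d H2S' unfolding S_def S'_def by blast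
  ultimately have "H2 \<subseteq> H" using cH2 by (intro Hmax)
  then have "H2 \<subseteq> H - convex hull t" using H2S' unfolding S'_def by blast
  then show ?thesis
    using adj_sym[OF tt(2)] t'C tN tK x'H2 bH2 unfolding H2_def S'_def X_def by blast
qed

text \<open>Infinite descent on the number of triangles inside the hole.\<close>
lemma disc_absorbs_adjacent_triangles:
  fixes C :: "complex set set" and K :: "complex set"
  assumes C: "simp_complex C" and cX: "compact (support C)" and AR: "AR (support C)"
    and con: "connected (- support C)" "connected (support C)"
    and pure: "\<And>p q. p \<noteq> q \<Longrightarrow> {p, q} \<in> C \<Longrightarrow> \<exists>t\<in>C \<inter> TRI. {p, q} \<subseteq> t"
    and K: "compact K" "connected (- K)" "support C \<subseteq> K"
    and max: "\<And>t d. adj t d \<Longrightarrow> t \<in> C \<Longrightarrow> d \<notin> C \<Longrightarrow> convex hull d \<subseteq> K \<Longrightarrow>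
        \<not> simply_connected (support C \<union> convex hull d)"
    and d: "adj t d" "t \<in> C" "convex hull d \<subseteq> K"
  shows "d \<in> C"
proof (rule ccontr)
  assume dC: "d \<notin> C"
  define hole where "hole d x = connected_component_set (- (support C \<union> convex hull d)) x" for d x
  define size where "size H = card {t \<in> TRI. interior (convex hull t) \<subseteq> H}" for H
  have no: False if "adj t d" "t \<in> C" "d \<notin> C" "convex hull d \<subseteq> K" "x \<in> hole d x" "bounded (hole d x)" for t d x
    using that
  proof (induction "size (hole d x)" arbitrary: t d x rule: less_induct)
    case less
    have "\<exists>t1 d' x'. adj t1 d' \<and> t1 \<in> C \<and> d' \<notin> C \<and> convex hull d' \<subseteq> K \<and>
       interior (convex hull d') \<subseteq> hole d x \<and> x' \<in> hole d' x' \<and> bounded (hole d' x') \<and>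
       hole d' x' \<subseteq> hole d x - convex hull d'"
      unfolding hole_def
    proof (rule blocked_triangle_hole_shrinks[OF C cX AR con _ K _ less.prems(1-4) refl])
      show "\<exists>t\<in>C \<inter> TRI. {p, q} \<subseteq> t" if "p \<noteq> q" "{p, q} \<in> C" for p q by (rule pure[OF that])
      show "\<not> simply_connected (support C \<union> convex hull d)"
        if "adj t d" "t \<in> C" "d \<notin> C" "convex hull d \<subseteq> K" for t d by (rule max[OF that])
      show "x \<in> connected_component_set (- (support C \<union> convex hull d)) x" "bounded (connected_component_set (- (support C \<union> convex hull d)) x)"
        using less.prems(5,6) unfolding hole_def by blast+
    qed
    then obtain t1 d' x' where n: "adj t1 d'" "t1 \<in> C" "d' \<notin> C" "convex hull d' \<subseteq> K"
       "interior (convex hull d') \<subseteq> hole d x" "x' \<in> hole d' x'" "bounded (hole d' x')" 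
       "hole d' x' \<subseteq> hole d x - convex hull d'"
      by blast
    have d'T: "d' \<in> TRI" using n(1) by (simp add: adj_def)
    have "{t \<in> TRI. interior (convex hull t) \<subseteq> hole d' x'} \<subset> {t \<in> TRI. interior (convex hull t) \<subseteq> hole d x}"
      using n(5,8) d'T interior_tri_nonempty[OF d'T] interior_subset[of "convex hull d'"] by blast
    moreover have "finite {t \<in> TRI. interior (convex hull t) \<subseteq> hole d x}"
    proof (rule finite_subset[OF _ finite_TRI_meeting[OF less.prems(6)]])
      show "{t \<in> TRI. interior (convex hull t) \<subseteq> hole d x} \<subseteq> {t \<in> TRI. convex hull t \<inter> hole d x \<noteq> {}}"
        using interior_tri_nonempty interior_subset by blast
    qed
    ultimately have "size (hole d' x') < size (hole d x)" unfolding size_def by (intro psubset_card_mono)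
    then show False using less.hyps n by blast
  qed
  define S where "S = support C \<union> convex hull d"
  have "d \<in> TRI" using d(1) by (simp add: adj_def)
  then have cS: "compact S" unfolding S_def using cX TRI_card(2) finite_imp_compact_convex_hull by blast
  have nc: "\<not> connected (- S)"
    using blocked_triangle(2)[OF C cX AR con d(1,2) dC max[OF d(1,2) dC d(3)]] by (simp add: S_def)
  have "inside S \<noteq> {}"
  proof
    assume "inside S = {}"
    then have "- S = outside S" using inside_Un_outside[of S] by blast
    moreover have "connected (outside S)"
      by (rule connected_outside) (use cS in \<open>simp_all add: compact_imp_bounded\<close>)
    ultimately show False using nc by simp
  qed
  then obtain x where "x \<notin> S" "bounded (connected_component_set (- S) x)" unfolding inside_def by blast
  then show False using no[OF d(1,2) dC d(3), of x] unfolding hole_def S_def by simp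
qed

section \<open>Maximal discs exhaust the domain\<close>
text \<open>Near its midpoint, an edge that bounds no triangle of the complex is all there is of the support.
  A disc has no such points: its open subsets are not contained in a segment, by invariance of domain.\<close>
lemma disc_is_pure:
  assumes C: "simp_complex C" and hom: "support C homeomorphic (cball 0 1 :: complex set)"
    and pq: "p \<noteq> q" "{p, q} \<in> C"
  shows "\<exists>t\<in>C \<inter> TRI. {p, q} \<subseteq> t"
proof (rule ccontr)
  assume no: "\<not> ?thesis"
  define y where "y = midpoint p q"
  obtain t where t: "t \<in> TRI" "{p, q} \<subseteq> t" using C pq(2) unfolding simp_complex_def simplices_def by blast
  have cy: "carrier y = {p, q}" unfolding y_def using midpoint_carrier[OF t(1)] t(2) pq(1) by auto
  define B where "B = {z. 0 < hat (z - p)} \<inter> {z. 0 < hat (z - q)}"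
  have cont: "continuous_on UNIV (\<lambda>z. hat (z - w))" for w
    unfolding hat_def cx_def cy_def using area2_pos by (intro continuous_intros) auto
  have oB: "open B" unfolding B_def by (intro open_Int open_Collect_less cont continuous_on_const)
  have yB: "y \<in> B" using cy unfolding B_def carrier_def by auto
  have XB: "support C \<inter> B \<subseteq> closed_segment p q"
  proof
    fix z assume z: "z \<in> support C \<inter> B"
    then have cz: "carrier z \<in> C" using carrier_in_complex[OF C] by blast
    obtain s where s: "s \<in> TRI" "carrier z \<subseteq> s" using cz C unfolding simp_complex_def simplices_def by blast
    have "p \<in> V" "q \<in> V" using t TRI_subset_V by blast+
    then have sub: "{p, q} \<subseteq> carrier z" using z by (auto simp: B_def carrier_def)
    have "carrier z = {p, q}"
    proof (rule ccontr)
      assume ne: "carrier z \<noteq> {p, q}"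
      have f: "finite (carrier z)" using s TRI_card(2) finite_subset by blast
      have "card {p, q} < card (carrier z)" using psubset_card_mono[OF f, of "{p, q}"] sub ne by blast
      then have "card s \<le> card (carrier z)" using pq(1) TRI_card(1)[OF s(1)] by simp
      then have "carrier z = s" using card_seteq[OF TRI_card(2)[OF s(1)] s(2)] by blast
      then show False using no cz s(1) sub by blast
    qed
    moreover obtain r where "r \<in> C" "z \<in> convex hull r" using z by (auto simp: support_def)
    then have "z \<in> convex hull (carrier z)" using carrier_subset(2)[of r z] C by (auto simp: simp_complex_def)
    ultimately show "z \<in> closed_segment p q" by (simp add: segment_convex_hull)
  qed
  have yX: "y \<in> support C" unfolding support_def using pq(2) midpoint_in_closed_segment[of p q]
    by (auto simp: segment_convex_hull y_def)
  obtain h k where hk: "homeomorphism (support C) (cball 0 1 :: complex set) h k"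
    using hom unfolding homeomorphic_def by blast
  have k: "continuous_on (cball 0 1) k" "k ` cball 0 1 = support C" "inj_on k (cball 0 1)"
    "h ` support C = cball 0 1" "\<And>x. x \<in> support C \<Longrightarrow> k (h x) = x"
    using hk unfolding homeomorphism_def by (auto intro: inj_on_inverseI)
  obtain Q where Q: "open Q" "Q \<inter> cball 0 1 = k -` B \<inter> cball 0 1"
    using k(1) oB unfolding continuous_on_open_invariant by blast
  have "h y \<in> cball 0 1" using yX k(4) by blast
  moreover have "k (h y) = y" using yX k(5) by blast
  ultimately have "h y \<in> Q" using Q(2) yB by blast
  moreover have "h y \<in> closure (ball 0 1)" using \<open>h y \<in> cball 0 1\<close> by simp
  ultimately have W: "Q \<inter> ball 0 1 \<noteq> {}" using open_Int_closure_eq_empty[OF Q(1), of "ball 0 1"] by blast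
  have sub: "Q \<inter> ball 0 1 \<subseteq> cball 0 1" by auto
  have "open (k ` (Q \<inter> ball 0 1))"
    using invariance_of_domain[OF continuous_on_subset[OF k(1) sub] _ inj_on_subset[OF k(3) sub]] Q(1) by blast
  moreover have "k ` (Q \<inter> ball 0 1) \<subseteq> closed_segment p q"
  proof -
    have "k ` (Q \<inter> ball 0 1) \<subseteq> B" using Q(2) by fastforce
    moreover have "k ` (Q \<inter> ball 0 1) \<subseteq> support C" using k(2) sub by blast
    ultimately show ?thesis using XB by blast
  qed
  ultimately have "k ` (Q \<inter> ball 0 1) \<subseteq> interior (closed_segment p q)" by (simp add: interior_maximal)
  then show False using W by (simp add: interior_closed_segment_ge2)
qed

text \<open>Close to \<open>v\<close> there are points whose carrier is the full triangle.\<close>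
lemma star_of_interior_vertex:
  assumes C: "simp_complex C" and v: "v \<in> V" "v \<in> interior (support C)"
  shows "tri v k \<in> C"
proof -
  obtain e where e: "e > 0" "ball v e \<subseteq> support C" using v(2) by (meson mem_interior)
  define \<delta> where "\<delta> = min (1/3) (e / (4 * mesh))"
  have d: "0 < \<delta>" "\<delta> \<le> 1/3" "\<delta> \<le> e / (4 * mesh)" using e mesh_pos by (auto simp: \<delta>_def)
  define y where "y = (1 - 2 * \<delta>) *\<^sub>R v + \<delta> *\<^sub>R (v + E k) + \<delta> *\<^sub>R (v + E (k + 1))"
  have "y \<in> interior (convex hull (tri v k))" unfolding interior_tri mem_Collect_eq
    using d by (intro exI[of _ "1 - 2 * \<delta>"] exI[of _ \<delta>]) (simp add: y_def)
  then have c: "carrier y = tri v k" using interior_iff_carrier[OF tri_in_TRI[OF v(1)]] by blast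
  have "y - v = \<delta> *\<^sub>R (E k + E (k + 1))" by (simp add: y_def algebra_simps scaleR_conv_of_real)
  then have "norm (y - v) \<le> \<delta> * (mesh + mesh)"
    using norm_triangle_le[of "E k" "E (k + 1)" "mesh + mesh"] norm_E_le_mesh[of k] norm_E_le_mesh[of "k + 1"] d
    by (simp add: mult_left_mono)
  also have "\<dots> \<le> (e / (4 * mesh)) * (mesh + mesh)" using d(3) mesh_pos by (intro mult_right_mono) auto
  also have "\<dots> < e" using mesh_pos e by (simp add: field_simps)
  finally have "y \<in> support C" using e(2) by (auto simp: dist_norm norm_minus_commute)
  then show ?thesis using carrier_in_complex[OF C] c by metis
qed

lemma interior_vertex_of_star:
  assumes v: "v \<in> V" and st: "\<And>k. tri v k \<in> C"
  shows "v \<in> interior_vertices C"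
proof -
  obtain B where B: "open B" "v \<in> B" "\<And>t. t \<in> TRI \<Longrightarrow> convex hull t \<inter> B \<noteq> {} \<Longrightarrow> v \<in> convex hull t"
    using star_neighbourhood by blast
  have "B \<subseteq> support C"
  proof
    fix z assume z: "z \<in> B"
    obtain s where s: "s \<in> TRI" "z \<in> convex hull s" using plane_covered by blast
    have "v \<in> convex hull s" using B(3)[OF s(1)] s z by blast
    then have "v \<in> s" using carrier_subset(1)[OF TRI_SX[OF s(1)]] carrier_vertex[OF v] by blast
    then obtain k where "s = tri v k" using TRI_at_vertex[OF s(1)] by blast
    then show "z \<in> support C" using st s(2) by (auto simp: support_def)
  qed
  then have "v \<in> interior (support C)" using B by (meson interiorI)
  moreover have "v \<in> vertices C" using st[of 0] by (auto simp: vertices_def tri_def)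
  ultimately show ?thesis by (simp add: interior_vertices_def)
qed

lemma adj_star: "p \<in> V \<Longrightarrow> adj (tri p k) (tri p (k + 1))"
proof -
  assume p: "p \<in> V"
  have ne: "tri p k \<noteq> tri p (k + 1)"
  proof
    assume "tri p k = tri p (k + 1)"
    moreover have "p + E k \<in> tri p k" by (simp add: tri_def)
    ultimately have "p + E k \<in> tri p (k + 1)" by blast
    then have "E k = E (k + 1) \<or> E k = E (k + 2)" using E_nonzero[of k] by (simp add: tri_def add.commute)
    then show False unfolding E_eq_iff by presburger
  qed
  have "{p, p + E (k + 1)} \<subseteq> tri p k \<inter> tri p (k + 1)" by (auto simp: tri_def)
  then show ?thesis using ne tri_in_TRI[OF p] E_nonzero[of "k + 1"] unfolding adj_def
    by (intro conjI exI[of _ p] exI[of _ "p + E (k + 1)"]) auto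
qed

lemma star_absorbed:
  assumes ab: "\<And>t d. adj t d \<Longrightarrow> t \<in> C \<Longrightarrow> convex hull d \<subseteq> K \<Longrightarrow> d \<in> C"
    and p: "p \<in> V" "cball p mesh \<subseteq> K" and k: "tri p k \<in> C"
  shows "tri p j \<in> C"
proof -
  have K: "convex hull (tri p i) \<subseteq> K" for i
    using hull_subset_cball[OF tri_in_TRI[OF p(1)], of p i] p(2) by (auto simp: tri_def)
  have "tri p (k + int n) \<in> C" for n
  proof (induction n)
    case (Suc n)
    then show ?case using ab[OF adj_star[OF p(1)] Suc.IH K] by (simp add: algebra_simps)
  qed (use k in simp)
  from this[of "nat ((j - k) mod 6)"] have "tri p (k + (j - k) mod 6) \<in> C" by simp
  moreover have "(k + (j - k) mod 6) mod 6 = j mod 6" by (simp add: mod_add_right_eq)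
  ultimately show ?thesis using tri_mod by metis
qed

text \<open>Along \<open>\<Gamma>\<close>, triangles of \<open>C\<close> and triangles outside \<open>C\<close> never meet: triangles with a
  common point have a common vertex, whose star lies in \<open>K\<close> and is absorbed triangle by
  triangle. So the two kinds cover \<open>\<Gamma>\<close> by disjoint closed sets.\<close>
lemma connected_region_absorbed:
  assumes C: "simp_complex C"
    and ab: "\<And>t d. adj t d \<Longrightarrow> t \<in> C \<Longrightarrow> convex hull d \<subseteq> K \<Longrightarrow> d \<in> C"
    and \<Gamma>: "connected \<Gamma>" "bounded \<Gamma>" "\<And>x. x \<in> \<Gamma> \<Longrightarrow> cball x (3 * mesh) \<subseteq> K" "0 \<in> \<Gamma>"
    and z: "0 \<in> interior (support C)"
    and t: "t \<in> TRI" "convex hull t \<inter> \<Gamma> \<noteq> {}"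
  shows "t \<in> C"
proof (rule ccontr)
  assume tC: "t \<notin> C"
  define F where "F = {t \<in> TRI. convex hull t \<inter> \<Gamma> \<noteq> {}}"
  have fF: "finite F" unfolding F_def by (rule finite_TRI_meeting[OF \<Gamma>(2)])
  have cl: "closed (\<Union>t\<in>F \<inter> P. convex hull t)" for P
    using fF TRI_card(2) by (intro closed_UN) (auto simp: F_def finite_imp_compact_convex_hull compact_imp_closed)
  have same: "s' \<in> C" if s: "s \<in> TRI" "s' \<in> TRI" "x \<in> convex hull s" "x \<in> convex hull s'" "x \<in> \<Gamma>" "s \<in> C" for s s' x
  proof -
    obtain p where p: "p \<in> carrier x" using carrier_subset(3)[OF TRI_SX[OF s(1)] s(3)] by blast
    have ps: "p \<in> s" "p \<in> s'" using carrier_subset(1)[OF TRI_SX] s p by blast+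
    obtain k where k: "s = tri p k" "p \<in> V" using TRI_at_vertex[OF s(1) ps(1)] by blast
    obtain j where j: "s' = tri p j" using TRI_at_vertex[OF s(2) ps(2)] by blast
    have "dist x p \<le> 2 * mesh" using hull_subset_cball2[OF s(1,3)] hull_inc[OF ps(1), of convex] by auto
    have "cball p mesh \<subseteq> cball x (3 * mesh)"
    proof
      fix z assume "z \<in> cball p mesh"
      then show "z \<in> cball x (3 * mesh)" using dist_triangle[of x z p] \<open>dist x p \<le> 2 * mesh\<close> by simp
    qed
    then have pK: "cball p mesh \<subseteq> K" using \<Gamma>(3)[OF s(5)] by blast
    have kC: "tri p k \<in> C" using s(6) k(1) by simp
    show ?thesis unfolding j
    proof (rule star_absorbed[OF _ k(2) pK kC])
      show "d \<in> C" if "adj t d" "t \<in> C" "convex hull d \<subseteq> K" for t d by (rule ab[OF that])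
    qed
  qed
  define G1 G2 where "G1 = (\<Union>t\<in>F \<inter> C. convex hull t)" and "G2 = (\<Union>t\<in>F \<inter> - C. convex hull t)"
  have "closed G1" "closed G2" unfolding G1_def G2_def by (rule cl)+
  moreover have "\<Gamma> \<subseteq> G1 \<union> G2"
  proof
    fix x assume x: "x \<in> \<Gamma>"
    obtain s where s: "s \<in> TRI" "x \<in> convex hull s" using plane_covered by blast
    then have "s \<in> F" using x by (auto simp: F_def)
    then show "x \<in> G1 \<union> G2" using s by (auto simp: G1_def G2_def)
  qed
  moreover have "G1 \<inter> G2 \<inter> \<Gamma> = {}"
    using same unfolding G1_def G2_def F_def by blast
  moreover have "G1 \<inter> \<Gamma> \<noteq> {}"
  proof -
    have "tri 0 0 \<in> C" using star_of_interior_vertex[OF C zero_in_V z] .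
    moreover have z0: "0 \<in> convex hull (tri 0 0)" by (rule hull_inc) (simp add: tri_def)
    moreover have "tri 0 0 \<in> F" using z0 \<Gamma>(4) tri_in_TRI[OF zero_in_V] by (auto simp: F_def)
    ultimately show ?thesis using \<Gamma>(4) by (auto simp: G1_def)
  qed
  moreover have "G2 \<inter> \<Gamma> \<noteq> {}" using t tC by (auto simp: G2_def F_def)
  ultimately show False using \<Gamma>(1) unfolding connected_closed by blast
qed

lemma maximal_disc_fills:
  assumes C: "simp_complex C" and hom: "support C homeomorphic (cball 0 1 :: complex set)"
    and K: "compact K" "connected (- K)" "support C \<subseteq> K" and z: "0 \<in> interior (support C)"
    and max: "\<And>d. d \<in> TRI - C \<Longrightarrow> convex hull d \<subseteq> K \<Longrightarrow> \<exists>t\<in>triangles C. card (d \<inter> t) = 2 \<Longrightarrow>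
        \<not> simply_connected (support (add_triangle d C))"
    and \<Gamma>: "connected \<Gamma>" "bounded \<Gamma>" "\<And>x. x \<in> \<Gamma> \<Longrightarrow> cball x (3 * mesh) \<subseteq> K" "0 \<in> \<Gamma>"
    and v: "v \<in> V" "v \<in> \<Gamma>"
  shows "v \<in> interior_vertices C"
proof (rule interior_vertex_of_star[OF v(1)])
  fix k
  have cX: "compact (support C)" using hom homeomorphic_compactness compact_cball by blast
  have "AR (cball 0 1 :: complex set)" by (rule convex_imp_AR) auto
  then have AR: "AR (support C)" using homeomorphic_AR_iff_AR[OF hom] by blast
  have con: "connected (- support C)"
    by (rule connected_complement_homeomorphic_convex_compact[OF hom]) auto
  have con2: "connected (support C)" using hom homeomorphic_connectedness connected_cball by blast
  have max': "\<not> simply_connected (support C \<union> convex hull d)"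
    if d: "adj t d" "t \<in> C" "d \<notin> C" "convex hull d \<subseteq> K" for t d
  proof -
    have T: "t \<in> TRI" "d \<in> TRI" using d(1) by (auto simp: adj_def)
    have "support (add_triangle d C) = support C \<union> convex hull d"
    proof
      show "support (add_triangle d C) \<subseteq> support C \<union> convex hull d"
        unfolding support_def add_triangle_def using hull_mono[of _ d convex] by blast
      have "d \<noteq> {}" using TRI_card(1)[OF T(2)] by auto
      then show "support C \<union> convex hull d \<subseteq> support (add_triangle d C)"
        unfolding support_def add_triangle_def by blast
    qed
    moreover have "t \<in> triangles C" using d(2) TRI_card(1)[OF T(1)] by (simp add: triangles_def)
    moreover have "card (d \<inter> t) = 2" using adj_card[OF d(1)] by (simp add: Int_commute)
    ultimately show ?thesis using max[of d] T(2) d by auto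
  qed
  have ab: "d \<in> C" if "adj t d" "t \<in> C" "convex hull d \<subseteq> K" for t d
    by (rule disc_absorbs_adjacent_triangles[OF C cX AR con con2 _ K _ that])
      (erule (1) disc_is_pure[OF C hom], erule (3) max')
  show "tri v k \<in> C"
  proof (rule connected_region_absorbed[OF C ab \<Gamma> z tri_in_TRI[OF v(1)]])
    have "v \<in> convex hull (tri v k)" by (rule hull_inc) (simp add: tri_def)
    then show "convex hull (tri v k) \<inter> \<Gamma> \<noteq> {}" using v(2) by blast
  qed
qed

end

section \<open>Angles of Euclidean triangles\<close>
text \<open>Twice the signed area of the triangle \<open>p q r\<close>.\<close>
definition orient :: "complex \<Rightarrow> complex \<Rightarrow> complex \<Rightarrow> real" where
  "orient p q r = Im (cnj (q - p) * (r - p))"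

text \<open>The angle at \<open>p\<close>, as the argument of a quotient; products of such quotients are how angles enter
  cross-ratios.\<close>
definition ang :: "complex \<Rightarrow> complex \<Rightarrow> complex \<Rightarrow> real" where
  "ang p q r = Arg ((r - p) / (q - p))"

lemma orient_rotate: "orient q r p = orient p q r"
  by (simp add: orient_def algebra_simps)

lemma orient_distinct:
  assumes "orient p q r > 0" shows "p \<noteq> q" "q \<noteq> r" "r \<noteq> p"
  using assms by (auto simp: orient_def algebra_simps)

lemma ang_bounds:
  assumes "orient p q r > 0"
  shows "0 < ang p q r" "ang p q r < pi"
proof -
  have "Im ((r - p) / (q - p)) = orient p q r / (cmod (q - p))\<^sup>2"
    by (simp add: orient_def Im_divide cmod_power2 field_simps)
  then have "0 < Im ((r - p) / (q - p))"
    using assms orient_distinct[OF assms] by simp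
  then show "0 < ang p q r" "ang p q r < pi" unfolding ang_def using Arg_lt_pi by blast+
qed

lemma sin_ang:
  assumes "orient p q r > 0"
  shows "sin (ang p q r) = orient p q r / (cmod (q - p) * cmod (r - p))"
proof -
  note d = orient_distinct[OF assms]
  define z where "z = (r - p) / (q - p)"
  have z: "z \<noteq> 0" using d by (simp add: z_def)
  have "Im z = cmod z * sin (Arg z)"
    using rcis_cmod_Arg[of z] by (metis Im_rcis)
  moreover have "Im z = orient p q r / (cmod (q - p))\<^sup>2"
    by (simp add: z_def orient_def Im_divide cmod_power2 field_simps)
  ultimately have "cmod z * sin (Arg z) = orient p q r / (cmod (q - p))\<^sup>2" by simp
  moreover have "cmod z = cmod (r - p) / cmod (q - p)" by (simp add: z_def norm_divide)
  ultimately show ?thesis unfolding ang_def z_def[symmetric]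
    using d by (simp add: field_simps power2_eq_square)
qed

text \<open>The bracket is invariant under rotation of the three vertices, so the three logarithmic sines agree with the logarithms of the
  opposite sides up to one common constant.\<close>
lemma law_of_sines:
  assumes "orient p q r > 0"
  shows "ln (sin (ang p q r)) = ln (cmod (r - q)) +
    (ln (orient p q r) - ln (cmod (q - p)) - ln (cmod (r - q)) - ln (cmod (p - r)))"
  unfolding sin_ang[OF assms] using orient_distinct[OF assms] assms
  by (simp add: ln_div ln_mult norm_minus_commute)

lemma ang_sum:
  assumes "orient p q r > 0"
  shows "ang p q r + ang q r p + ang r p q = pi"
proof -
  note d = orient_distinct[OF assms]
  have o: "orient q r p > 0" "orient r p q > 0" using assms orient_rotate by metis+
  define z1 z2 z3 where "z1 = (r - p) / (q - p)" and "z2 = (p - q) / (r - q)" and "z3 = (q - r) / (p - r)"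
  have prod: "z1 * z2 * z3 = -1" unfolding z1_def z2_def z3_def using d
    by (simp add: divide_simps) (simp add: algebra_simps)
  have "z1 * z2 * z3 = rcis (cmod z1) (Arg z1) * rcis (cmod z2) (Arg z2) * rcis (cmod z3) (Arg z3)"
    by (simp only: rcis_cmod_Arg)
  also have "\<dots> = rcis (cmod (z1 * z2 * z3)) (Arg z1 + Arg z2 + Arg z3)"
    by (simp add: rcis_mult norm_mult)
  finally have "cis (Arg z1 + Arg z2 + Arg z3) = -1" unfolding prod by (simp add: rcis_def)
  then have "cos (Arg z1 + Arg z2 + Arg z3) = -1" by (simp add: complex_eq_iff)
  then obtain n :: int where n: "Arg z1 + Arg z2 + Arg z3 = of_int n * (2 * pi) + pi"
    using cos_eq_minus1 by (auto simp: algebra_simps)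
  have b: "0 < Arg z1 + Arg z2 + Arg z3" "Arg z1 + Arg z2 + Arg z3 < 3 * pi"
    using ang_bounds[OF assms] ang_bounds[OF o(1)] ang_bounds[OF o(2)]
    unfolding ang_def z1_def z2_def z3_def by linarith+
  have "n = 0"
  proof (rule ccontr)
    assume "n \<noteq> 0"
    then have "n \<le> -1 \<or> n \<ge> 1" by linarith
    then have "real_of_int n \<le> -1 \<or> real_of_int n \<ge> 1" by linarith
    then have "of_int n * (2 * pi) \<le> -1 * (2 * pi) \<or> of_int n * (2 * pi) \<ge> 1 * (2 * pi)"
      using mult_right_mono[of "real_of_int n" "-1" "2 * pi"] mult_right_mono[of 1 "real_of_int n" "2 * pi"]
      by auto
    then show False using n b pi_gt_zero by linarith
  qed
  then show ?thesis using n by (simp add: ang_def z1_def z2_def z3_def)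
qed

lemma cot_identity:
  fixes A B C :: real
  assumes "A + B + C = pi" "0 < A" "0 < B" "0 < C"
  shows "cot A * cot B + cot B * cot C + cot C * cot A = 1" "cot A + cot B > 0"
proof -
  have s: "sin A > 0" "sin B > 0" "sin C > 0" using assms by (auto intro!: sin_gt_zero)
  have C: "C = pi - (A + B)" using assms by simp
  have sC: "sin C = sin A * cos B + cos A * sin B" unfolding C by (simp add: sin_diff sin_add)
  have cC: "cos C = sin A * sin B - cos A * cos B" unfolding C by (simp add: cos_diff cos_add)
  have "cos A * cos B * sin C + cos B * cos C * sin A + cos C * cos A * sin B = sin A * sin B * sin C"
    unfolding sC cC by (simp add: algebra_simps)
  then show "cot A * cot B + cot B * cot C + cot C * cot A = 1"
    using s unfolding cot_def by (simp add: field_simps)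
  have "cot A + cot B = sin C / (sin A * sin B)" using s unfolding cot_def sC by (simp add: field_simps)
  then show "cot A + cot B > 0" using s by simp
qed

text \<open>This quadratic form is the second derivative of the discrete conformal energy of one triangle. Completing
  the square with the cotangent identity exhibits it as a sum of squares.\<close>
lemma cot_form_nonneg:
  fixes A B C :: real
  assumes "A + B + C = pi" "0 < A" "0 < B" "0 < C" and x: "x + y + z = 0"
  shows "0 \<le> cot A * x\<^sup>2 + cot B * y\<^sup>2 + cot C * z\<^sup>2"
proof -
  define a b c where "a = cot A" and "b = cot B" and "c = cot C"
  have id: "a * b + b * c + c * a = 1" "a + b > 0"
    unfolding a_def b_def c_def using cot_identity[OF assms(1-4)] by auto
  have z: "z = - (x + y)" using x by simp
  have "(a + b) * (a * x\<^sup>2 + b * y\<^sup>2 + c * z\<^sup>2) = (a * x - b * y)\<^sup>2 + (a * b + b * c + c * a) * (x + y)\<^sup>2"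
    unfolding z by (simp add: power2_eq_square algebra_simps)
  then have "0 \<le> (a + b) * (a * x\<^sup>2 + b * y\<^sup>2 + c * z\<^sup>2)" unfolding id(1) by simp
  then show ?thesis using id(2) unfolding a_def b_def c_def by (simp add: zero_le_mult_iff)
qed

lemma DERIV_ln_sin:
  assumes "0 < x" "x < pi"
  shows "((\<lambda>x. ln (sin x)) has_real_derivative cot x) (at x)"
  using sin_gt_zero[OF assms] unfolding cot_def
  by (auto intro!: derivative_eq_intros simp: field_simps)

lemma cot_ge_tan:
  assumes "0 < \<eta>" "0 < x" "x \<le> pi / 2 - \<eta>"
  shows "tan \<eta> \<le> cot x"
proof -
  have "cot x = tan (pi / 2 - x)" by (simp add: tan_cot' cot_def tan_def sin_diff cos_diff)
  moreover have "tan \<eta> \<le> tan (pi / 2 - x)"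
    using assms by (cases "\<eta> = pi / 2 - x") (auto intro!: less_imp_le tan_monotone)
  ultimately show ?thesis by simp
qed

text \<open>Integrate the derivative of \<open>g\<close> along the segment from the angles \<open>a\<close> to the angles \<open>b\<close>. It is nonnegative throughout
  by \<open>cot_form_nonneg\<close>, and on an initial piece of definite length, where all angles are still acute,
  each cotangent has a positive lower bound.
  So the estimate applies to the discrete map, whose angles are not controlled beforehand.\<close>
lemma angle_energy_coercive:
  fixes a1 a2 a3 b1 b2 b3 :: real
  assumes d: "0 < \<delta>" and a: "a1 \<in> {\<delta>..pi/2 - \<delta>}" "a2 \<in> {\<delta>..pi/2 - \<delta>}" "a3 \<in> {\<delta>..pi/2 - \<delta>}"
    and sa: "a1 + a2 + a3 = pi" and b: "b1 > 0" "b2 > 0" "b3 > 0" and sb: "b1 + b2 + b3 = pi"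
  shows "(\<delta> / (2 * pi)) * tan (\<delta> / 2) * ((b1 - a1)\<^sup>2 + (b2 - a2)\<^sup>2 + (b3 - a3)\<^sup>2)
    \<le> (b1 - a1) * (ln (sin b1) - ln (sin a1)) + (b2 - a2) * (ln (sin b2) - ln (sin a2))
      + (b3 - a3) * (ln (sin b3) - ln (sin a3))"
proof -
  define x1 x2 x3 where "x1 = b1 - a1" and "x2 = b2 - a2" and "x3 = b3 - a3"
  define Q where "Q = x1\<^sup>2 + x2\<^sup>2 + x3\<^sup>2"
  define g where "g t = x1 * ln (sin (a1 + t * x1)) + x2 * ln (sin (a2 + t * x2)) + x3 * ln (sin (a3 + t * x3))" for t
  define g' where "g' t = cot (a1 + t * x1) * x1\<^sup>2 + cot (a2 + t * x2) * x2\<^sup>2 + cot (a3 + t * x3) * x3\<^sup>2" for t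
  have conv: "0 < u + t * (v - u)" if "0 < u" "0 < v" "0 \<le> t" "t \<le> 1" for u v t :: real
  proof -
    have "u + t * (v - u) = (1 - t) * u + t * v" by (simp add: algebra_simps)
    moreover have "0 < (1 - t) * u + t * v"
      using that by (cases "t = 0") (auto intro: add_nonneg_pos)
    ultimately show ?thesis by simp
  qed
  have pos: "0 < a1 + t * x1" "0 < a2 + t * x2" "0 < a3 + t * x3" if "0 \<le> t" "t \<le> 1" for t
    unfolding x1_def x2_def x3_def using a b d that by (auto intro!: conv)
  have x0: "x1 + x2 + x3 = 0" using sa sb by (simp add: x1_def x2_def x3_def)
  have sum: "(a1 + t * x1) + (a2 + t * x2) + (a3 + t * x3) = pi" for t
  proof -
    have "(a1 + t * x1) + (a2 + t * x2) + (a3 + t * x3) = (a1 + a2 + a3) + t * (x1 + x2 + x3)"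
      by (simp add: algebra_simps)
    then show ?thesis using sa x0 by simp
  qed
  have lt: "a1 + t * x1 < pi" "a2 + t * x2 < pi" "a3 + t * x3 < pi" if "0 \<le> t" "t \<le> 1" for t
    using pos[OF that] sum[of t] by linarith+
  have DL: "((\<lambda>t. x * ln (sin (c + t * x))) has_real_derivative cot (c + t * x) * x\<^sup>2) (at t)"
    if "0 < c + t * x" "c + t * x < pi" for c x t
  proof -
    have "((\<lambda>t. c + t * x) has_real_derivative x) (at t)" by (auto intro!: derivative_eq_intros)
    from DERIV_cmult[OF DERIV_chain2[where f = "\<lambda>x. ln (sin x)" and g = "\<lambda>t. c + t * x", OF DERIV_ln_sin[OF that] this], of x]
    show ?thesis by (simp add: power2_eq_square mult_ac)
  qed
  have D: "(g has_real_derivative g' t) (at t)" if "0 \<le> t" "t \<le> 1" for t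
    unfolding g_def g'_def using pos[OF that] lt[OF that] by (intro DERIV_add DL)
  \<comment> \<open>angles change by at most pi in total, hence by at most \<delta>/2 up to time t0\<close>
  define t0 where "t0 = \<delta> / (2 * pi)"
  have dpi: "\<delta> \<le> pi / 4" using a(1) by auto
  have t0: "0 < t0" "t0 \<le> 1" using d dpi pi_gt_zero by (simp_all add: t0_def field_simps)
  have 1: "g t0 \<le> g 1"
  proof (rule DERIV_nonneg_imp_nondecreasing[OF t0(2)])
    fix t assume "t0 \<le> t" "t \<le> 1"
    then have t: "0 \<le> t" "t \<le> 1" using t0 by auto
    have "0 \<le> g' t" unfolding g'_def by (rule cot_form_nonneg[OF sum pos[OF t] x0])
    then show "\<exists>y. (g has_real_derivative y) (at t) \<and> 0 \<le> y" using D[OF t] by blast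
  qed
  have 2: "g 0 - tan (\<delta> / 2) * Q * 0 \<le> g t0 - tan (\<delta> / 2) * Q * t0"
  proof (rule DERIV_nonneg_imp_nondecreasing[where f = "\<lambda>t. g t - tan (\<delta> / 2) * Q * t"])
    show "0 \<le> t0" using t0 by simp
    fix t assume "0 \<le> t" "t \<le> t0"
    then have t: "0 \<le> t" "t \<le> 1" using t0 by auto
    have le: "tan (\<delta> / 2) \<le> cot (c + t * x)" if c: "c \<in> {\<delta>..pi/2 - \<delta>}" "\<bar>x\<bar> \<le> pi" for c x
    proof -
      have "\<bar>t * x\<bar> \<le> t0 * pi" unfolding abs_mult using t \<open>t \<le> t0\<close> c by (intro mult_mono) auto
      then have "\<bar>t * x\<bar> \<le> \<delta> / 2" by (simp add: t0_def)
      then show ?thesis using c d by (intro cot_ge_tan) (auto simp: abs_le_iff)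
    qed
    have "\<bar>x1\<bar> \<le> pi" "\<bar>x2\<bar> \<le> pi" "\<bar>x3\<bar> \<le> pi"
      using a b d sa sb unfolding x1_def x2_def x3_def by auto
    then have "tan (\<delta> / 2) * x1\<^sup>2 + tan (\<delta> / 2) * x2\<^sup>2 + tan (\<delta> / 2) * x3\<^sup>2 \<le> g' t"
      unfolding g'_def using le[OF a(1)] le[OF a(2)] le[OF a(3)] by (intro add_mono mult_right_mono) auto
    then have "0 \<le> g' t - tan (\<delta> / 2) * Q" by (simp add: Q_def algebra_simps)
    moreover have "((\<lambda>t. g t - tan (\<delta> / 2) * Q * t) has_real_derivative g' t - tan (\<delta> / 2) * Q) (at t)"
      using D[OF t] by (auto intro!: derivative_eq_intros)
    ultimately show "\<exists>y. ((\<lambda>t. g t - tan (\<delta> / 2) * Q * t) has_real_derivative y) (at t) \<and> 0 \<le> y" by blast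
  qed
  have "g 1 - g 0 = x1 * (ln (sin b1) - ln (sin a1)) + x2 * (ln (sin b2) - ln (sin a2)) + x3 * (ln (sin b3) - ln (sin a3))"
    by (simp add: g_def x1_def x2_def x3_def algebra_simps)
  then show ?thesis using 1 2 unfolding t0_def Q_def x1_def[symmetric] x2_def[symmetric] x3_def[symmetric]
    by (simp add: mult_ac)
qed

lemma sin_ge_sin_delta:
  assumes "0 < \<delta>" "\<delta> \<le> x" "x \<le> pi - \<delta>"
  shows "sin \<delta> \<le> sin x" "0 < sin \<delta>"
proof -
  have dp: "\<delta> \<le> pi / 2" using assms by simp
  show "0 < sin \<delta>" using assms dp by (intro sin_gt_zero) auto
  show "sin \<delta> \<le> sin x"
  proof (cases "x \<le> pi / 2")
    case True then show ?thesis using assms dp by (intro sin_monotone_2pi_le) auto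
  next
    case False
    then have "sin \<delta> \<le> sin (pi - x)" using assms dp by (intro sin_monotone_2pi_le) auto
    then show ?thesis by simp
  qed
qed

lemma cot_lipschitz:
  assumes "0 < \<delta>" "x \<in> {\<delta>..pi - \<delta>}" "y \<in> {\<delta>..pi - \<delta>}"
  shows "\<bar>cot x - cot y\<bar> \<le> 1 / (sin \<delta>)\<^sup>2 * \<bar>x - y\<bar>"
proof -
  have "norm (cot x - cot y) \<le> 1 / (sin \<delta>)\<^sup>2 * norm (x - y)"
  proof (rule field_differentiable_bound[where S = "{\<delta>..pi - \<delta>}"])
    fix z assume z: "z \<in> {\<delta>..pi - \<delta>}"
    have s: "sin \<delta> \<le> sin z" "0 < sin \<delta>" using sin_ge_sin_delta[of \<delta> z] assms z by auto
    show "(cot has_field_derivative - inverse ((sin z)\<^sup>2)) (at z within {\<delta>..pi - \<delta>})"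
      by (rule has_field_derivative_at_within[OF DERIV_cot]) (use s in auto)
    have "(sin \<delta>)\<^sup>2 \<le> (sin z)\<^sup>2" using s by (intro power_mono) auto
    then show "norm (- inverse ((sin z)\<^sup>2)) \<le> 1 / (sin \<delta>)\<^sup>2"
      using s by (simp add: inverse_eq_divide frac_le)
  qed (use assms in auto)
  then show ?thesis by simp
qed

lemma cot_bound:
  assumes "0 < \<delta>" "x \<in> {\<delta>..pi - \<delta>}"
  shows "\<bar>cot x\<bar> \<le> 1 / (sin \<delta>)\<^sup>2"
proof -
  have s: "sin \<delta> \<le> sin x" "0 < sin \<delta>" using sin_ge_sin_delta[of \<delta> x] assms by auto
  have "\<bar>cot x\<bar> = \<bar>cos x\<bar> / sin x" using s by (simp add: cot_def)
  also have "\<dots> \<le> 1 / sin \<delta>" using s by (intro frac_le) auto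
  also have "\<dots> \<le> 1 / (sin \<delta>)\<^sup>2"
    using s sin_le_one[of \<delta>] by (intro frac_le) (auto simp: power2_eq_square mult_left_le_one_le)
  finally show ?thesis .
qed

lemma ln_sin_linearize:
  assumes d: "0 < \<delta>" and x: "a \<in> {\<delta>..pi - \<delta>}" "b \<in> {\<delta>..pi - \<delta>}" "t \<in> {\<delta>..pi - \<delta>}"
  shows "\<bar>ln (sin b) - ln (sin a) - cot t * (b - a)\<bar> \<le> 1 / (sin \<delta>)\<^sup>2 * (\<bar>b - a\<bar> * (\<bar>b - a\<bar> + \<bar>a - t\<bar>))"
proof -
  have D: "((\<lambda>x. ln (sin x) - cot t * x) has_real_derivative cot z - cot t) (at z within closed_segment a b)"
    if "z \<in> closed_segment a b" for z
  proof -
    have "z \<in> {\<delta>..pi - \<delta>}" using that x by (auto simp: closed_segment_eq_real_ivl split: if_splits)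
    then have "0 < z" "z < pi" using d by auto
    then show ?thesis
      by (rule has_field_derivative_at_within[OF DERIV_diff[OF DERIV_ln_sin DERIV_cmult_Id]])
  qed
  have "norm ((ln (sin b) - cot t * b) - (ln (sin a) - cot t * a)) \<le> (1 / (sin \<delta>)\<^sup>2 * (\<bar>b - a\<bar> + \<bar>a - t\<bar>)) * norm (b - a)"
  proof (rule field_differentiable_bound[OF convex_closed_segment D])
    fix z assume z: "z \<in> closed_segment a b"
    then have "z \<in> {\<delta>..pi - \<delta>}" using x by (auto simp: closed_segment_eq_real_ivl split: if_splits)
    then have "\<bar>cot z - cot t\<bar> \<le> 1 / (sin \<delta>)\<^sup>2 * \<bar>z - t\<bar>" using cot_lipschitz[OF d] x by blast
    also have "\<dots> \<le> 1 / (sin \<delta>)\<^sup>2 * (\<bar>b - a\<bar> + \<bar>a - t\<bar>)"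
      using z by (intro mult_left_mono) (auto simp: closed_segment_eq_real_ivl split: if_splits)
    finally show "norm (cot z - cot t) \<le> 1 / (sin \<delta>)\<^sup>2 * (\<bar>b - a\<bar> + \<bar>a - t\<bar>)" by simp
  qed auto
  moreover have "(ln (sin b) - cot t * b) - (ln (sin a) - cot t * a) = ln (sin b) - ln (sin a) - cot t * (b - a)"
    by (simp add: algebra_simps)
  ultimately show ?thesis by (simp only: real_norm_def mult.commute[of "\<bar>b - a\<bar>"] mult.assoc)
qed

lemma ln_sin_lipschitz:
  assumes d: "0 < \<delta>" and x: "a \<in> {\<delta>..pi - \<delta>}" "b \<in> {\<delta>..pi - \<delta>}"
  shows "\<bar>ln (sin b) - ln (sin a)\<bar> \<le> 1 / (sin \<delta>)\<^sup>2 * \<bar>b - a\<bar>"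
proof -
  have "norm (ln (sin b) - ln (sin a)) \<le> 1 / (sin \<delta>)\<^sup>2 * norm (b - a)"
  proof (rule field_differentiable_bound[where S = "{\<delta>..pi - \<delta>}"])
    fix z assume z: "z \<in> {\<delta>..pi - \<delta>}"
    show "((\<lambda>x. ln (sin x)) has_field_derivative cot z) (at z within {\<delta>..pi - \<delta>})"
      by (rule has_field_derivative_at_within[OF DERIV_ln_sin]) (use z d in auto)
    show "norm (cot z) \<le> 1 / (sin \<delta>)\<^sup>2" using cot_bound[OF d z] by simp
  qed (use x in auto)
  then show ?thesis by simp
qed

text \<open>The differential of the angles of a triangle as functions of the logarithmic side lengths, with cotangents taken at the
  fixed angles \<open>t\<close>. The common constant \<open>\<kappa>\<close> drops out, and the cotangent identity turns the coefficient of
  \<open>b1 - a1\<close> into 1.\<close>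
lemma angle_linearize:
  fixes t1 t2 t3 :: real
  assumes d: "0 < \<delta>" and t: "t1 \<in> {\<delta>..pi - \<delta>}" "t2 \<in> {\<delta>..pi - \<delta>}" "t3 \<in> {\<delta>..pi - \<delta>}" "t1 + t2 + t3 = pi"
    and a: "a1 \<in> {\<delta>..pi - \<delta>}" "a2 \<in> {\<delta>..pi - \<delta>}" "a3 \<in> {\<delta>..pi - \<delta>}" "a1 + a2 + a3 = pi"
    and b: "b1 \<in> {\<delta>..pi - \<delta>}" "b2 \<in> {\<delta>..pi - \<delta>}" "b3 \<in> {\<delta>..pi - \<delta>}" "b1 + b2 + b3 = pi"
    and l: "l1 = ln (sin b1) - ln (sin a1) + \<kappa>" "l2 = ln (sin b2) - ln (sin a2) + \<kappa>" "l3 = ln (sin b3) - ln (sin a3) + \<kappa>"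
  shows "\<bar>(b1 - a1) - ((cot t2 + cot t3) * l1 - cot t3 * l2 - cot t2 * l3)\<bar>
    \<le> 4 / (sin \<delta>)^4 * (\<bar>b1 - a1\<bar> * (\<bar>b1 - a1\<bar> + \<bar>a1 - t1\<bar>) + \<bar>b2 - a2\<bar> * (\<bar>b2 - a2\<bar> + \<bar>a2 - t2\<bar>)
         + \<bar>b3 - a3\<bar> * (\<bar>b3 - a3\<bar> + \<bar>a3 - t3\<bar>))"
proof -
  define M where "M = 1 / (sin \<delta>)\<^sup>2"
  have M: "M > 0" using sin_ge_sin_delta[of \<delta> t1] d t by (simp add: M_def)
  define c1 c2 c3 where "c1 = cot t1" and "c2 = cot t2" and "c3 = cot t3"
  have id: "c1 * c2 + c2 * c3 + c3 * c1 = 1"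
    unfolding c1_def c2_def c3_def using t d by (intro cot_identity) auto
  define x1 x2 x3 where "x1 = b1 - a1" and "x2 = b2 - a2" and "x3 = b3 - a3"
  define e1 e2 e3 where "e1 = ln (sin b1) - ln (sin a1) - c1 * x1" and "e2 = ln (sin b2) - ln (sin a2) - c2 * x2"
    and "e3 = ln (sin b3) - ln (sin a3) - c3 * x3"
  define s1 s2 s3 where "s1 = \<bar>x1\<bar> * (\<bar>x1\<bar> + \<bar>a1 - t1\<bar>)" and "s2 = \<bar>x2\<bar> * (\<bar>x2\<bar> + \<bar>a2 - t2\<bar>)"
    and "s3 = \<bar>x3\<bar> * (\<bar>x3\<bar> + \<bar>a3 - t3\<bar>)"
  have e: "\<bar>e1\<bar> \<le> M * s1" "\<bar>e2\<bar> \<le> M * s2" "\<bar>e3\<bar> \<le> M * s3"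
    unfolding e1_def e2_def e3_def s1_def s2_def s3_def x1_def x2_def x3_def c1_def c2_def c3_def M_def
    using ln_sin_linearize[OF d a(1) b(1) t(1)] ln_sin_linearize[OF d a(2) b(2) t(2)] ln_sin_linearize[OF d a(3) b(3) t(3)]
    by auto
  have s: "0 \<le> s1" "0 \<le> s2" "0 \<le> s3" by (auto simp: s1_def s2_def s3_def)
  have c: "\<bar>c2\<bar> \<le> M" "\<bar>c3\<bar> \<le> M" unfolding c2_def c3_def M_def using cot_bound[OF d] t by blast+
  have L: "l1 = c1 * x1 + \<kappa> + e1" "l2 = c2 * x2 + \<kappa> + e2" "l3 = c3 * x3 + \<kappa> + e3"
    using l by (simp_all add: e1_def e2_def e3_def)
  have x3: "x3 = - x1 - x2" using a(4) b(4) by (simp add: x1_def x2_def x3_def)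
  have "(c2 + c3) * l1 - c3 * l2 - c2 * l3 = x1 * (c1 * c2 + c2 * c3 + c3 * c1) + ((c2 + c3) * e1 - c3 * e2 - c2 * e3)"
    unfolding L x3 by (simp add: algebra_simps)
  then have "x1 - ((c2 + c3) * l1 - c3 * l2 - c2 * l3) = - ((c2 + c3) * e1 - c3 * e2 - c2 * e3)" unfolding id by simp
  also have "\<bar>\<dots>\<bar> \<le> \<bar>c2\<bar> * \<bar>e1\<bar> + \<bar>c3\<bar> * \<bar>e1\<bar> + \<bar>c3\<bar> * \<bar>e2\<bar> + \<bar>c2\<bar> * \<bar>e3\<bar>"
    unfolding abs_mult[symmetric] by (simp add: algebra_simps abs_le_iff) linarith
  also have "\<dots> \<le> M * (M * s1) + M * (M * s1) + M * (M * s2) + M * (M * s3)"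
    using c e M by (intro add_mono mult_mono) auto
  also have "\<dots> \<le> 4 * (M * M) * (s1 + s2 + s3)"
  proof -
    have "0 \<le> M * (M * s1)" "0 \<le> M * (M * s2)" "0 \<le> M * (M * s3)" using M s by auto
    then show ?thesis by (simp add: algebra_simps)
  qed
  also have "4 * (M * M) = 4 / (sin \<delta>)^4" by (simp add: M_def power2_eq_square power4_eq_xxxx)
  finally show ?thesis unfolding x1_def x2_def x3_def s1_def s2_def s3_def c1_def c2_def c3_def .
qed

section \<open>Difference quotients of the conformal map\<close>
definition diff_quotient :: "(complex \<Rightarrow> complex) \<Rightarrow> complex \<Rightarrow> complex \<Rightarrow> complex" where
  "diff_quotient f x y = (if x = y then deriv f x else (f y - f x) / (y - x))"

definition log_quotient :: "(complex \<Rightarrow> complex) \<Rightarrow> complex \<Rightarrow> complex \<Rightarrow> complex \<Rightarrow> complex" where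
  "log_quotient f v s t = Ln (diff_quotient f (v + s) (v + t) / deriv f v)"

text \<open>\<open>A2\<close> and \<open>A3\<close> are the Taylor coefficients of \<open>f / f' v\<close> at \<open>v\<close>, and \<open>P2\<close> is the Taylor polynomial of
  degree 2 of \<open>log_quotient f v\<close>.\<close>
definition A2 :: "(complex \<Rightarrow> complex) \<Rightarrow> complex \<Rightarrow> complex" where
  "A2 f v = deriv (deriv f) v / (2 * deriv f v)"

definition A3 :: "(complex \<Rightarrow> complex) \<Rightarrow> complex \<Rightarrow> complex" where
  "A3 f v = deriv (deriv (deriv f)) v / (6 * deriv f v)"

definition P2 :: "(complex \<Rightarrow> complex) \<Rightarrow> complex \<Rightarrow> complex \<Rightarrow> complex \<Rightarrow> complex" where
  "P2 f v s t = A2 f v * (s + t) + (A3 f v * (s\<^sup>2 + s * t + t\<^sup>2) - (A2 f v)\<^sup>2 * (s + t)\<^sup>2 / 2)"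

text \<open>Taylor expansion on the disc of radius 1/2, where the third derivative of the logarithm is at most 16.\<close>
lemma Ln_third_order:
  assumes "norm z \<le> 1/2"
  shows "norm (Ln (1 + z) - (z - z\<^sup>2 / 2)) \<le> 8 * norm z ^ 3"
proof -
  define g where "g i x = (if i = 0 then Ln (1 + x) else if i = 1 then 1 / (1 + x)
     else if i = 2 then - 1 / (1 + x)\<^sup>2 else 2 / (1 + x)^3)" for i :: nat and x :: complex
  have ge: "1/2 \<le> norm (1 + x)" "Re (1 + x) > 0" if "x \<in> cball 0 (1/2)" for x :: complex
  proof -
    have x: "norm x \<le> 1/2" using that by simp
    then show "1/2 \<le> norm (1 + x)" using norm_triangle_ineq2[of 1 "- x"] by simp
    show "Re (1 + x) > 0" using x abs_Re_le_cmod[of x] by simp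
  qed
  have "norm (g 0 z - (\<Sum>i\<le>2. g i 0 * (z - 0) ^ i / fact i)) \<le> 16 * norm (z - 0) ^ Suc 2 / fact 2"
  proof (rule complex_Taylor[where S = "cball 0 (1/2)"])
    fix i :: nat and x :: complex assume x: "x \<in> cball 0 (1/2)" and i: "i \<le> 2"
    have nz: "1 + x \<noteq> 0" "1 + x \<notin> \<real>\<^sub>\<le>\<^sub>0" using ge[OF x] by (auto simp: complex_nonpos_Reals_iff)
    consider "i = 0" | "i = 1" | "i = 2" using i by linarith
    then show "(g i has_field_derivative g (Suc i) x) (at x within cball 0 (1/2))"
    proof cases
      case 1
      have "g 0 = (\<lambda>x. Ln (1 + x))" by (auto simp: g_def)
      moreover have "((\<lambda>x. Ln (1 + x)) has_field_derivative 1 / (1 + x)) (at x within cball 0 (1/2))"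
        using nz by (auto intro!: derivative_eq_intros simp: inverse_eq_divide)
      ultimately show ?thesis using 1 by (simp add: g_def)
    next
      case 2
      have "g 1 = (\<lambda>x. 1 / (1 + x))" by (auto simp: g_def)
      moreover have "((\<lambda>x. 1 / (1 + x)) has_field_derivative - 1 / (1 + x)\<^sup>2) (at x within cball 0 (1/2))"
        using nz by (auto intro!: derivative_eq_intros simp: power2_eq_square)
      ultimately show ?thesis using 2 by (simp add: g_def numeral_2_eq_2)
    next
      case 3
      have "g 2 = (\<lambda>x. - 1 / (1 + x)\<^sup>2)" by (auto simp: g_def)
      moreover have "((\<lambda>x. - 1 / (1 + x)\<^sup>2) has_field_derivative 2 / (1 + x) ^ 3) (at x within cball 0 (1/2))"
      proof -
        have "((\<lambda>u. - 1 / u\<^sup>2) has_field_derivative 2 / (1 + x) ^ 3) (at (1 + x))"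
        proof -
          define u where "u = 1 + x"
          have "u \<noteq> 0" using nz by (simp add: u_def)
          then have "((\<lambda>u. - 1 / u\<^sup>2) has_field_derivative 2 / u ^ 3) (at u)"
            by (auto intro!: derivative_eq_intros simp: field_simps power2_eq_square power3_eq_cube)
          then show ?thesis by (simp only: u_def)
        qed
        moreover have "((\<lambda>x. 1 + x) has_field_derivative 1) (at x within cball 0 (1/2))"
          by (auto intro!: derivative_eq_intros)
        ultimately show ?thesis
          using DERIV_chain2[where f = "\<lambda>u. - 1 / u\<^sup>2" and g = "\<lambda>x. 1 + x"] by fastforce
      qed
      ultimately show ?thesis using 3 by (simp add: g_def)
    qed
  next
    fix x :: complex assume x: "x \<in> cball 0 (1/2)"
    have "(1/2) ^ 3 \<le> norm (1 + x) ^ 3" using ge[OF x] by (intro power_mono) auto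
    then have "2 / norm (1 + x) ^ 3 \<le> 2 / (1/2) ^ 3" by (intro frac_le) auto
    also have "\<dots> = 16" by (simp add: power3_eq_cube)
    finally show "cmod (g (Suc 2) x) \<le> 16" by (simp add: g_def norm_divide norm_power)
  qed (use assms in auto)
  then show ?thesis by (simp add: g_def numeral_2_eq_2 numeral_3_eq_3 algebra_simps)
qed

lemma derivative_taylor:
  assumes D: "open D" and f: "f holomorphic_on D" "\<And>z. z \<in> D \<Longrightarrow> deriv f z \<noteq> 0"
    and K: "compact K" "K \<subseteq> D"
  obtains \<eta> C where "\<eta> > 0" "C > 0" "\<And>v. v \<in> K \<Longrightarrow> cball v \<eta> \<subseteq> D"
    "\<And>v x. v \<in> K \<Longrightarrow> norm x \<le> \<eta> \<Longrightarrow>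
       norm (deriv f (v + x) / deriv f v - (1 + 2 * A2 f v * x + 3 * A3 f v * x\<^sup>2)) \<le> C * norm x ^ 3"
proof -
  obtain \<eta> where \<eta>: "\<eta> > 0" "(\<Union>x\<in>K. cball x \<eta>) \<subseteq> D"
    using compact_subset_open_imp_cball_epsilon_subset[OF K(1) D K(2)] by blast
  define K' where "K' = {x + y | x y. x \<in> K \<and> y \<in> cball 0 \<eta>}"
  have cK': "compact K'" unfolding K'_def by (rule compact_sums[OF K(1) compact_cball])
  have K'D: "K' \<subseteq> D" using \<eta>(2) by (fastforce simp: K'_def dist_norm)
  have hol: "(deriv ^^ n) f holomorphic_on D" for n
    by (induction n) (auto intro: f(1) holomorphic_deriv[OF _ D])
  have "continuous_on K' ((deriv ^^ 4) f)"
    using hol K'D by (meson continuous_on_subset holomorphic_on_imp_continuous_on)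
  then have "bounded ((deriv ^^ 4) f ` K')" using cK' compact_continuous_image compact_imp_bounded by blast
  then obtain M where M: "M > 0" "\<And>x. x \<in> K' \<Longrightarrow> norm ((deriv ^^ 4) f x) \<le> M"
    unfolding bounded_pos by blast
  have "continuous_on K (\<lambda>v. 1 / deriv f v)"
    using K(2) f(2) holomorphic_on_imp_continuous_on[OF hol[of 1]] continuous_on_subset[of D _ K]
    by (intro continuous_on_divide continuous_on_const) auto
  then have "bounded ((\<lambda>v. 1 / deriv f v) ` K)" using K(1) compact_continuous_image compact_imp_bounded by blast
  then obtain m where m: "m > 0" "\<And>v. v \<in> K \<Longrightarrow> norm (1 / deriv f v) \<le> m" unfolding bounded_pos by blast
  show ?thesis
  proof (rule that[of \<eta> "M * m"])
    fix v x :: complex assume v: "v \<in> K" and x: "norm x \<le> \<eta>"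
    have sub: "cball v \<eta> \<subseteq> K'"
    proof
      fix y assume "y \<in> cball v \<eta>"
      then have "y = v + (y - v)" "y - v \<in> cball 0 \<eta>" by (simp_all add: dist_norm norm_minus_commute)
      then show "y \<in> K'" using v unfolding K'_def by blast
    qed
    have "cmod ((deriv ^^ (0 + 1)) f (v + x) - (\<Sum>i\<le>2. (deriv ^^ (i + 1)) f v * (v + x - v) ^ i / fact i))
        \<le> M * cmod (v + x - v) ^ Suc 2 / fact 2"
    proof (rule complex_Taylor[where S = "cball v \<eta>" and f = "\<lambda>i. (deriv ^^ (i + 1)) f"])
      fix i y assume y: "y \<in> cball v \<eta>"
      then have "((deriv ^^ (i + 1)) f has_field_derivative deriv ((deriv ^^ (i + 1)) f) y) (at y)"
        using sub K'D by (intro holomorphic_derivI[OF hol D]) auto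
      then show "((deriv ^^ (i + 1)) f has_field_derivative (deriv ^^ (Suc i + 1)) f y) (at y within cball v \<eta>)"
        by (simp add: has_field_derivative_at_within)
      show "cmod ((deriv ^^ (Suc 2 + 1)) f y) \<le> M" using M(2)[of y] sub y by auto
    qed (use x \<eta> in \<open>auto simp: dist_norm\<close>)
    then have T: "cmod (deriv f (v + x) - (deriv f v + deriv (deriv f) v * x + deriv (deriv (deriv f)) v * x\<^sup>2 / 2)) \<le> M * norm x ^ 3"
      using M(1) by (simp add: numeral_2_eq_2 numeral_3_eq_3 algebra_simps) (smt (verit) mult_nonneg_nonneg norm_ge_zero)
    have nz: "deriv f v \<noteq> 0" using f(2) v K(2) by blast
    have "deriv f (v + x) / deriv f v - (1 + 2 * A2 f v * x + 3 * A3 f v * x\<^sup>2) =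
       (deriv f (v + x) - (deriv f v + deriv (deriv f) v * x + deriv (deriv (deriv f)) v * x\<^sup>2 / 2)) * (1 / deriv f v)"
      using nz by (simp add: A2_def A3_def field_simps)
    also have "norm \<dots> \<le> (M * norm x ^ 3) * m"
      unfolding norm_mult using T m v M by (intro mult_mono) auto
    finally show "norm (deriv f (v + x) / deriv f v - (1 + 2 * A2 f v * x + 3 * A3 f v * x\<^sup>2)) \<le> M * m * norm x ^ 3"
      by (simp add: mult_ac)
  qed (use \<eta> M m in auto)
qed

text \<open>Integrate the expansion of the derivative: the difference quotient of the remainder is bounded by
  the supremum of its derivative.\<close>
lemma quotient_taylor:
  assumes D: "open D" and f: "f holomorphic_on D" "\<And>z. z \<in> D \<Longrightarrow> deriv f z \<noteq> 0"
    and K: "compact K" "K \<subseteq> D"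
  obtains \<eta> C where "\<eta> > 0" "C > 0"
    "\<And>v m s t. v \<in> K \<Longrightarrow> m \<le> \<eta> \<Longrightarrow> norm s \<le> m \<Longrightarrow> norm t \<le> m \<Longrightarrow>
       norm (diff_quotient f (v + s) (v + t) / deriv f v - (1 + A2 f v * (s + t) + A3 f v * (s\<^sup>2 + s * t + t\<^sup>2))) \<le> C * m ^ 3"
proof -
  obtain \<eta> C where \<eta>: "\<eta> > 0" "C > 0" "\<And>v. v \<in> K \<Longrightarrow> cball v \<eta> \<subseteq> D"
    and T: "\<And>v x. v \<in> K \<Longrightarrow> norm x \<le> \<eta> \<Longrightarrow>
       norm (deriv f (v + x) / deriv f v - (1 + 2 * A2 f v * x + 3 * A3 f v * x\<^sup>2)) \<le> C * norm x ^ 3"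
    using derivative_taylor[OF assms] by metis
  show ?thesis
  proof (rule that[of \<eta> C])
    fix v s t :: complex and m :: real assume v: "v \<in> K" and m: "m \<le> \<eta>" and st: "norm s \<le> m" "norm t \<le> m"
    have nz: "deriv f v \<noteq> 0" using f(2) v K(2) by blast
    have le: "C * norm x ^ 3 \<le> C * m ^ 3" if "norm x \<le> m" for x :: complex
      using that \<eta>(2) by (intro mult_left_mono power_mono) auto
    show "norm (diff_quotient f (v + s) (v + t) / deriv f v - (1 + A2 f v * (s + t) + A3 f v * (s\<^sup>2 + s * t + t\<^sup>2))) \<le> C * m ^ 3"
    proof (cases "s = t")
      case True
      then show ?thesis using T[OF v, of s] le[OF st(1)] st m
        by (simp add: diff_quotient_def power2_eq_square algebra_simps)
    next
      case False
      define h where "h x = f (v + x) / deriv f v - (x + A2 f v * x\<^sup>2 + A3 f v * x ^ 3)" for x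
      have "norm (h t - h s) \<le> C * m ^ 3 * norm (t - s)"
      proof (rule field_differentiable_bound[where S = "cball 0 m"])
        fix x assume x: "x \<in> cball (0::complex) m"
        have vx: "v + x \<in> D" using \<eta>(3)[OF v] x m by (auto simp: subset_eq dist_norm)
        have df: "(f has_field_derivative deriv f (v + x)) (at (v + x))"
          using f(1) D vx by (rule holomorphic_derivI)
        have "((\<lambda>x. f (v + x)) has_field_derivative deriv f (v + x) * 1) (at x)"
          by (rule DERIV_chain2[where f = f and g = "\<lambda>x. v + x", OF df]) (auto intro!: derivative_eq_intros)
        then have "(h has_field_derivative deriv f (v + x) / deriv f v - (1 + 2 * A2 f v * x + 3 * A3 f v * x\<^sup>2)) (at x)"
          unfolding h_def using nz by (auto intro!: derivative_eq_intros simp: field_simps)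
        then show "(h has_field_derivative deriv f (v + x) / deriv f v - (1 + 2 * A2 f v * x + 3 * A3 f v * x\<^sup>2)) (at x within cball 0 m)"
          by (rule has_field_derivative_at_within)
        show "norm (deriv f (v + x) / deriv f v - (1 + 2 * A2 f v * x + 3 * A3 f v * x\<^sup>2)) \<le> C * m ^ 3"
          using T[OF v, of x] le[of x] x m by auto
      qed (use st in auto)
      then have "norm ((h t - h s) / (t - s)) \<le> C * m ^ 3"
        using False by (simp add: norm_divide divide_le_eq)
      moreover have "(h t - h s) / (t - s) = diff_quotient f (v + s) (v + t) / deriv f v - (1 + A2 f v * (s + t) + A3 f v * (s\<^sup>2 + s * t + t\<^sup>2))"
      proof -
        have ts: "t - s \<noteq> 0" using False by simp
        have "h t - h s = (f (v + t) - f (v + s)) / deriv f v - (t - s) * (1 + A2 f v * (s + t) + A3 f v * (s\<^sup>2 + s * t + t\<^sup>2))"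
          by (simp add: h_def algebra_simps power2_eq_square power3_eq_cube diff_divide_distrib)
        then show ?thesis using ts False by (simp add: diff_quotient_def field_simps)
      qed
      ultimately show ?thesis by simp
    qed
  qed (use \<eta> in auto)
qed

lemma log_quotient_taylor:
  assumes D: "open D" and f: "f holomorphic_on D" "\<And>z. z \<in> D \<Longrightarrow> deriv f z \<noteq> 0"
    and K: "compact K" "K \<subseteq> D"
  obtains \<eta> C where "\<eta> > 0" "\<eta> \<le> 1" "C > 0"
    "\<And>v m s t. v \<in> K \<Longrightarrow> m \<le> \<eta> \<Longrightarrow> norm s \<le> m \<Longrightarrow> norm t \<le> m \<Longrightarrow> diff_quotient f (v + s) (v + t) = deriv f v * exp (log_quotient f v s t)"
    "\<And>v m s t. v \<in> K \<Longrightarrow> m \<le> \<eta> \<Longrightarrow> norm s \<le> m \<Longrightarrow> norm t \<le> m \<Longrightarrow> norm (log_quotient f v s t) \<le> C * m"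
    "\<And>v m s t. v \<in> K \<Longrightarrow> m \<le> \<eta> \<Longrightarrow> norm s \<le> m \<Longrightarrow> norm t \<le> m \<Longrightarrow> norm (log_quotient f v s t - P2 f v s t) \<le> C * m ^ 3"
proof -
  obtain \<eta> C where \<eta>: "\<eta> > 0" "C > 0"
    and T: "\<And>v m s t. v \<in> K \<Longrightarrow> m \<le> \<eta> \<Longrightarrow> norm s \<le> m \<Longrightarrow> norm t \<le> m \<Longrightarrow>
       norm (diff_quotient f (v + s) (v + t) / deriv f v - (1 + A2 f v * (s + t) + A3 f v * (s\<^sup>2 + s * t + t\<^sup>2))) \<le> C * m ^ 3"
    using quotient_taylor[OF assms] by metis
  have hol: "(deriv ^^ n) f holomorphic_on D" for n
    by (induction n) (auto intro: f(1) holomorphic_deriv[OF _ D])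
  have cont: "continuous_on K ((deriv ^^ n) f)" for n
    using hol K(2) by (meson continuous_on_subset holomorphic_on_imp_continuous_on)
  have "continuous_on K (\<lambda>v. (A2 f v, A3 f v))"
    unfolding A2_def A3_def using cont[of 1] cont[of 2] cont[of 3] f(2) K(2)
    by (intro continuous_on_Pair continuous_on_divide continuous_on_mult continuous_on_const)
      (auto simp: numeral_2_eq_2 numeral_3_eq_3)
  then have "bounded ((\<lambda>v. (A2 f v, A3 f v)) ` K)" using K(1) compact_continuous_image compact_imp_bounded by blast
  then obtain B where B: "B > 0" "\<And>v. v \<in> K \<Longrightarrow> norm (A2 f v, A3 f v) \<le> B" unfolding bounded_pos by blast
  have BA: "norm (A2 f v) \<le> B" "norm (A3 f v) \<le> B" if "v \<in> K" for v
    using B(2)[OF that] norm_fst_le[of "A2 f v" "A3 f v"] norm_snd_le[of "A3 f v" "A2 f v"] by linarith+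
  define C1 where "C1 = 5 * B + C"
  define \<eta>' where "\<eta>' = min \<eta> (min 1 (1 / (2 * C1)))"
  have C1: "C1 > 0" using B \<eta> by (simp add: C1_def)
  have \<eta>': "0 < \<eta>'" "\<eta>' \<le> \<eta>" "\<eta>' \<le> 1" using \<eta> C1 by (simp_all add: \<eta>'_def)
  have "\<eta>' \<le> 1 / (2 * C1)" by (simp add: \<eta>'_def)
  then have \<eta>'4: "C1 * \<eta>' \<le> 1/2" using C1 by (simp add: field_simps)
  \<comment> \<open>b0 bounds the part of y of order two and higher; C2 collects the contributions of the estimates below\<close>
  define b0 where "b0 = 3 * B + C"
  define C2 where "C2 = C + 8 * C1 ^ 3 + b0 * (4 * B + b0) + 2 * C1"
  have C2: "C2 > 0" "2 * C1 \<le> C2" using B \<eta> C1 by (simp_all add: C2_def b0_def add_pos_pos)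
  have main: "diff_quotient f (v + s) (v + t) = deriv f v * exp (log_quotient f v s t) \<and> norm (log_quotient f v s t) \<le> C2 * m \<and>
      norm (log_quotient f v s t - P2 f v s t) \<le> C2 * m ^ 3"
    if v: "v \<in> K" and m: "m \<le> \<eta>'" and st: "norm s \<le> m" "norm t \<le> m" for v s t :: complex and m
  proof -
    have m0: "0 \<le> m" "m \<le> 1" "m \<le> \<eta>" using st m \<eta>' norm_ge_zero[of s] by linarith+
    have m2: "m\<^sup>2 \<le> m" "m ^ 3 \<le> m\<^sup>2"
      using m0 by (auto simp: power2_eq_square power3_eq_cube mult_left_le_one_le mult_left_le)
    have nz: "deriv f v \<noteq> 0" using f(2) v K(2) by blast
    define y where "y = diff_quotient f (v + s) (v + t) / deriv f v - 1"
    define a where "a = A2 f v * (s + t)"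
    define c where "c = A3 f v * (s\<^sup>2 + s * t + t\<^sup>2)"
    define e where "e = y - (a + c)"
    have e: "norm e \<le> C * m ^ 3" using T[OF v m0(3) st] by (simp add: e_def y_def a_def c_def algebra_simps)
    have na: "norm a \<le> 2 * B * m"
    proof -
      have "norm a \<le> B * (m + m)" unfolding a_def norm_mult
        using BA[OF v] st norm_triangle_le[of s t "m + m"] B(1) by (intro mult_mono) auto
      then show ?thesis by simp
    qed
    have nc: "norm c \<le> 3 * B * m\<^sup>2"
    proof -
      have "norm (s\<^sup>2) \<le> m\<^sup>2" "norm (t\<^sup>2) \<le> m\<^sup>2" "norm (s * t) \<le> m\<^sup>2"
        using st m0 unfolding norm_power norm_mult by (auto intro!: power_mono mult_mono simp: power2_eq_square)
      then have "norm (s\<^sup>2 + s * t + t\<^sup>2) \<le> 3 * m\<^sup>2"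
        using norm_triangle_ineq[of "s\<^sup>2 + s * t" "t\<^sup>2"] norm_triangle_ineq[of "s\<^sup>2" "s * t"] by linarith
      then have "norm c \<le> B * (3 * m\<^sup>2)" unfolding c_def norm_mult
        using BA[OF v] B(1) by (intro mult_mono) auto
      then show ?thesis by simp
    qed
    have nb: "norm (c + e) \<le> b0 * m\<^sup>2"
    proof -
      have "norm (c + e) \<le> 3 * B * m\<^sup>2 + C * m ^ 3" using norm_triangle_ineq[of c e] nc e by linarith
      also have "C * m ^ 3 \<le> C * m\<^sup>2" using m2 \<eta> by (intro mult_left_mono) auto
      finally show ?thesis by (simp add: b0_def algebra_simps)
    qed
    have yac: "y = a + (c + e)" by (simp add: e_def)
    have ny: "norm y \<le> C1 * m"
    proof -
      have "norm y \<le> 2 * B * m + b0 * m\<^sup>2" unfolding yac using norm_triangle_ineq[of a "c + e"] na nb by linarith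
      also have "b0 * m\<^sup>2 \<le> b0 * m" using m2 B \<eta> by (intro mult_left_mono) (auto simp: b0_def)
      finally show ?thesis by (simp add: b0_def C1_def algebra_simps)
    qed
    have "C1 * m \<le> C1 * \<eta>'" using m C1 by (intro mult_left_mono) auto
    then have ny2: "norm y \<le> 1/2" using ny \<eta>'4 by linarith
    have y1: "1 + y \<noteq> 0"
    proof
      assume "1 + y = 0"
      then have "y = -1" by (simp add: add_eq_0_iff)
      then show False using ny2 by simp
    qed
    have q: "diff_quotient f (v + s) (v + t) / deriv f v = 1 + y" by (simp add: y_def)
    have l: "log_quotient f v s t = Ln (1 + y)" unfolding log_quotient_def q ..
    have third: "norm (log_quotient f v s t - (y - y\<^sup>2 / 2)) \<le> 8 * norm y ^ 3" unfolding l by (rule Ln_third_order[OF ny2])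
    have ny3: "norm y ^ 3 \<le> C1 ^ 3 * m ^ 3"
      using power_mono[OF ny norm_ge_zero, of 3] by (simp add: power_mult_distrib)
    have 1: "diff_quotient f (v + s) (v + t) = deriv f v * exp (log_quotient f v s t)"
      unfolding l using y1 q nz by (simp add: field_simps)
    have 2: "norm (log_quotient f v s t) \<le> C2 * m"
    proof -
      have "norm (Ln (1 + y) - y) \<le> norm y ^ 2 / (1 - norm y)" by (rule Ln_approx_linear) (use ny2 in simp)
      also have "\<dots> \<le> norm y ^ 2 / (1/2)" using ny2 by (intro frac_le) auto
      also have "\<dots> = (2 * norm y) * norm y" by (simp add: power2_eq_square)
      also have "\<dots> \<le> 1 * norm y" using ny2 by (intro mult_right_mono) auto
      finally have "norm (Ln (1 + y)) \<le> 2 * norm y"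
        using norm_triangle_sub[of "Ln (1 + y)" y] by linarith
      also have "\<dots> \<le> 2 * C1 * m" using ny by simp
      also have "\<dots> \<le> C2 * m" using C2 m0 by (intro mult_right_mono) auto
      finally show ?thesis by (simp add: l)
    qed
    have 3: "norm (log_quotient f v s t - P2 f v s t) \<le> C2 * m ^ 3"
    proof -
      have eq: "log_quotient f v s t - P2 f v s t = (log_quotient f v s t - (y - y\<^sup>2 / 2)) + e - (c + e) * (2 * a + (c + e)) / 2"
      proof -
        have ysq: "(c + e) * (2 * a + (c + e)) = y\<^sup>2 - a\<^sup>2" unfolding yac by (simp add: power2_eq_square algebra_simps)
        have P: "P2 f v s t = a + c - a\<^sup>2 / 2" by (simp add: P2_def a_def c_def power_mult_distrib)
        show ?thesis unfolding ysq P by (simp add: e_def diff_divide_distrib)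
      qed
      have last: "norm ((c + e) * (2 * a + (c + e)) / 2) \<le> b0 * (4 * B + b0) * m ^ 3"
      proof -
        have "norm (2 * a + (c + e)) \<le> 2 * norm a + norm (c + e)"
          using norm_triangle_ineq[of "2 * a" "c + e"] by (simp add: norm_mult)
        also have "\<dots> \<le> 2 * (2 * B * m) + b0 * m"
          using na nb m2 B \<eta> by (intro add_mono mult_left_mono order_trans[OF nb mult_left_mono]) (auto simp: b0_def)
        finally have "norm (2 * a + (c + e)) \<le> (4 * B + b0) * m" by (simp add: algebra_simps)
        then have "norm (c + e) * norm (2 * a + (c + e)) \<le> (b0 * m\<^sup>2) * ((4 * B + b0) * m)"
          using nb B \<eta> m0 by (intro mult_mono) (auto simp: b0_def)
        then have *: "norm ((c + e) * (2 * a + (c + e))) \<le> b0 * (4 * B + b0) * m ^ 3"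
          by (simp add: norm_mult power2_eq_square power3_eq_cube mult_ac)
        have "norm ((c + e) * (2 * a + (c + e)) / 2) \<le> norm ((c + e) * (2 * a + (c + e)))"
          by (simp add: norm_divide)
        then show ?thesis using * by linarith
      qed
      have "norm (log_quotient f v s t - P2 f v s t) \<le> 8 * norm y ^ 3 + C * m ^ 3 + b0 * (4 * B + b0) * m ^ 3"
        unfolding eq using last third e norm_triangle_ineq[of "log_quotient f v s t - (y - y\<^sup>2 / 2)" e]
          norm_triangle_ineq4[of "(log_quotient f v s t - (y - y\<^sup>2 / 2)) + e" "(c + e) * (2 * a + (c + e)) / 2"] by linarith
      also have "\<dots> \<le> 8 * (C1 ^ 3 * m ^ 3) + C * m ^ 3 + b0 * (4 * B + b0) * m ^ 3 + 2 * C1 * m ^ 3"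
      proof -
        have "0 \<le> 2 * C1 * m ^ 3" using C1 m0 by simp
        then show ?thesis using ny3 by linarith
      qed
      also have "\<dots> = C2 * m ^ 3" by (simp add: C2_def algebra_simps)
      finally show ?thesis .
    qed
    show ?thesis using 1 2 3 by blast
  qed
  show ?thesis
    by (rule that[of \<eta>' C2]) (use \<eta>' C2 main in auto)
qed

lemma schwarzian_eq:
  assumes "open D" "f holomorphic_on D" "z \<in> D" "deriv f z \<noteq> 0"
  shows "A3 f z - (A2 f z)\<^sup>2 = schwarzian f z / 6"
proof -
  have h1: "deriv f holomorphic_on D" by (rule holomorphic_deriv[OF assms(2,1)])
  have h2: "deriv (deriv f) holomorphic_on D" by (rule holomorphic_deriv[OF h1 assms(1)])
  have d1: "(deriv f has_field_derivative deriv (deriv f) z) (at z)" by (rule holomorphic_derivI[OF h1 assms(1,3)])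
  have d2: "(deriv (deriv f) has_field_derivative deriv (deriv (deriv f)) z) (at z)" by (rule holomorphic_derivI[OF h2 assms(1,3)])
  have eq: "deriv (\<lambda>w. deriv (deriv f) w / deriv f w) z =
     (deriv (deriv (deriv f)) z * deriv f z - deriv (deriv f) z * deriv (deriv f) z) / (deriv f z * deriv f z)"
    using assms(4) by (intro DERIV_imp_deriv DERIV_divide d1 d2)
  show ?thesis unfolding schwarzian_def eq A2_def A3_def using assms(4)
    by (simp add: field_simps power2_eq_square)
qed

text \<open>The defect of the mean value rule for logarithmic lengths. To second order it sees only the combination of Taylor
  coefficients that is the Schwarzian derivative divided by 6.\<close>
lemma P2_defect:
  "P2 f v s t - (P2 f v s s + P2 f v t t) / 2 = - ((t - s)\<^sup>2 * (A3 f v - (A2 f v)\<^sup>2)) / 2"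
  by (simp add: P2_def power2_eq_square field_simps)

lemma ln_cmod_quotient:
  assumes "diff_quotient f (v + s) (v + t) = deriv f v * exp (log_quotient f v s t)" "deriv f v \<noteq> 0" "s \<noteq> t"
  shows "f (v + t) \<noteq> f (v + s)"
    "ln (cmod (f (v + t) - f (v + s))) = ln (cmod (t - s)) + ln (cmod (deriv f v)) + Re (log_quotient f v s t)"
proof -
  have ts: "t - s \<noteq> 0" using assms(3) by simp
  have "f (v + t) - f (v + s) = (t - s) * (deriv f v * exp (log_quotient f v s t))"
    using assms(1,3) ts by (simp add: diff_quotient_def field_simps)
  then show "f (v + t) \<noteq> f (v + s)"
    "ln (cmod (f (v + t) - f (v + s))) = ln (cmod (t - s)) + ln (cmod (deriv f v)) + Re (log_quotient f v s t)"
    using ts assms(2) by (auto simp: norm_mult ln_mult)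
qed

lemma ang_mult_exp:
  assumes o: "orient x y z > 0" and q: "(z' - x') / (y' - x') = (z - x) / (y - x) * exp l"
    and b: "0 < ang x y z + Im l" "ang x y z + Im l < pi"
  shows "ang x' y' z' = ang x y z + Im l" "orient x' y' z' > 0"
proof -
  note d = orient_distinct[OF o]
  define w where "w = (z - x) / (y - x)"
  have w: "w \<noteq> 0" using d by (simp add: w_def)
  have "w * exp l = rcis (cmod w) (Arg w) * (of_real (exp (Re l)) * cis (Im l))"
    unfolding rcis_cmod_Arg by (subst exp_eq_polar) (rule refl)
  also have "\<dots> = rcis (cmod w * exp (Re l)) (Arg w + Im l)"
    by (simp only: rcis_def of_real_mult cis_mult[symmetric] mult_ac)
  finally have we: "w * exp l = rcis (cmod w * exp (Re l)) (Arg w + Im l)" .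
  have ra: "ang x y z = Arg w" by (simp add: ang_def w_def)
  have "Arg (w * exp l) = Arg w + Im l"
    unfolding we using w b ra
    by (intro Arg_unique[of "cmod w * exp (Re l)"]) (auto simp: rcis_def cis_conv_exp)
  then show a: "ang x' y' z' = ang x y z + Im l" unfolding ang_def q by (simp add: w_def)
  have "0 < Im ((z' - x') / (y' - x'))" using b a Arg_lt_pi unfolding ang_def by metis
  moreover have "Im ((z' - x') / (y' - x')) = orient x' y' z' / (cmod (y' - x'))\<^sup>2"
    by (simp add: orient_def Im_divide cmod_power2 field_simps)
  ultimately show "orient x' y' z' > 0" by (simp add: zero_less_divide_iff)
qed

context triangular_lattice
begin

section \<open>Piecewise linear maps and the energy estimate\<close>
lemma affine_on_tri:
  assumes pl: "pl_extension C g G" and C: "simp_complex C" and t: "tri v k \<in> C"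
  shows "orient (g v) (g (v + E k)) (g (v + E (k + 1))) > 0"
    "0 \<le> a \<Longrightarrow> 0 \<le> b \<Longrightarrow> a + b \<le> 1 \<Longrightarrow>
      G (v + a *\<^sub>R E k + b *\<^sub>R E (k + 1)) = g v + a *\<^sub>R (g (v + E k) - g v) + b *\<^sub>R (g (v + E (k + 1)) - g v)"
proof -
  have tT: "tri v k \<in> triangles C" using t card_tri by (simp add: triangles_def)
  have all: "\<forall>\<Delta>\<in>triangles C. G ` (convex hull \<Delta>) = convex hull (g ` \<Delta>) \<and>
        (\<exists>A b. linear A \<and> 0 < Im (cnj (A 1) * A \<i>) \<and> (\<forall>x \<in> convex hull \<Delta>. G x = A x + b))"
    using pl unfolding pl_extension_def by (elim conjE)
  from bspec[OF all tT]
  have "\<exists>A b. linear A \<and> 0 < Im (cnj (A 1) * A \<i>) \<and> (\<forall>x \<in> convex hull (tri v k). G x = A x + b)"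
    by (rule conjunct2)
  then obtain A c where A: "linear A" "0 < Im (cnj (A 1) * A \<i>)" "\<And>x. x \<in> convex hull (tri v k) \<Longrightarrow> G x = A x + c"
    by blast
  have vert: "p \<in> vertices C" if "p \<in> tri v k" for p using t that by (auto simp: vertices_def)
  have g: "g p = A p + c" if "p \<in> tri v k" for p
    using A(3)[OF hull_inc[OF that]] pl vert[OF that] by (simp add: pl_extension_def)
  have gv: "g v = A v + c" "g (v + E k) = A v + A (E k) + c" "g (v + E (k + 1)) = A v + A (E (k + 1)) + c"
    using g[of v] g[of "v + E k"] g[of "v + E (k + 1)"] linear_add[OF A(1)] by (simp_all add: tri_def)
  have Az: "A z = of_real (Re z) * A 1 + of_real (Im z) * A \<i>" for z
  proof -
    have "z = Re z *\<^sub>R 1 + Im z *\<^sub>R \<i>" by (simp add: complex_eq_iff)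
    then have "A z = A (Re z *\<^sub>R 1 + Im z *\<^sub>R \<i>)" by (rule arg_cong)
    also have "\<dots> = Re z *\<^sub>R A 1 + Im z *\<^sub>R A \<i>" by (simp only: linear_add[OF A(1)] linear_cmul[OF A(1)])
    finally show ?thesis by (simp only: scaleR_conv_of_real)
  qed
  have det: "Im (cnj (A y) * A z) = Im (cnj y * z) * Im (cnj (A 1) * A \<i>)" for y z
    unfolding Az[of y] Az[of z] by (simp add: algebra_simps)
  have "orient (g v) (g (v + E k)) (g (v + E (k + 1))) = Im (cnj (A (E k)) * A (E (k + 1)))"
    unfolding orient_def gv by simp
  also have "\<dots> = area2 * Im (cnj (A 1) * A \<i>)" unfolding det[of "E k"] Im_cnj_E ..
  finally show "orient (g v) (g (v + E k)) (g (v + E (k + 1))) > 0"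
    using area2_pos A(2) by simp
  assume ab: "0 \<le> a" "0 \<le> b" "a + b \<le> 1"
  have "v + a *\<^sub>R E k + b *\<^sub>R E (k + 1) = (1 - a - b) *\<^sub>R v + a *\<^sub>R (v + E k) + b *\<^sub>R (v + E (k + 1))"
    by (simp add: algebra_simps)
  then have "v + a *\<^sub>R E k + b *\<^sub>R E (k + 1) \<in> convex hull {v, v + E k, v + E (k + 1)}"
    unfolding convex_hull_3 mem_Collect_eq using ab
    by (intro exI[of _ "1 - a - b"] exI[of _ a] exI[of _ b]) simp
  then have "G (v + a *\<^sub>R E k + b *\<^sub>R E (k + 1)) = A (v + a *\<^sub>R E k + b *\<^sub>R E (k + 1)) + c"
    using A(3) by (simp add: tri_def)
  then show "G (v + a *\<^sub>R E k + b *\<^sub>R E (k + 1)) = g v + a *\<^sub>R (g (v + E k) - g v) + b *\<^sub>R (g (v + E (k + 1)) - g v)"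
    unfolding gv using A(1) by (simp add: linear_add linear_cmul)
qed

text \<open>Each of the six angles is less than \<open>\<pi>\<close> and their sum is a multiple of \<open>2\<pi>\<close>, so it is \<open>2\<pi>\<close> or \<open>4\<pi>\<close>. In the
  second case the image of the star winds twice around \<open>g v\<close>, and the image of the first edge is covered a second
  time by another sector, which is impossible for a local homeomorphism.\<close>
lemma angle_sum_pl:
  assumes pl: "pl_extension C g G" and C: "simp_complex C" and v: "v \<in> V" "v \<in> interior (support C)"
  shows "(\<Sum>k\<in>{0..5}. ang (g v) (g (v + E k)) (g (v + E (k + 1)))) = 2 * pi"
proof -
  have st: "tri v k \<in> C" for k by (rule star_of_interior_vertex[OF C v])
  define w where "w k = g (v + E k) - g v" for k
  define \<phi> where "\<phi> k = ang (g v) (g (v + E k)) (g (v + E (k + 1)))" for k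
  have w6: "w 6 = w 0" unfolding w_def using E_plus_6[of 0] by simp
  note o = affine_on_tri(1)[OF pl C st]
  have \<phi>: "0 < \<phi> k" "\<phi> k < pi" for k unfolding \<phi>_def using ang_bounds[OF o] by auto
  have w0: "w k \<noteq> 0" for k using orient_distinct(1)[OF o, of k] by (simp add: w_def)
  \<comment> \<open>polar angle of the n-th image edge relative to the first one\<close>
  define P where "P n = (\<Sum>i<n. \<phi> (int i))" for n
  have wP: "\<exists>r>0. w (int n) = of_real r * (w 0 * cis (P n))" for n
  proof (induction n)
    case 0 then show ?case by (intro exI[of _ 1]) (simp add: P_def)
  next
    case (Suc n)
    then obtain r where r: "r > 0" "w (int n) = of_real r * (w 0 * cis (P n))" by blast
    define z where "z = w (int n + 1) / w (int n)"
    have z: "z \<noteq> 0" using w0 by (simp add: z_def)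
    have "\<phi> (int n) = Arg z" by (simp add: \<phi>_def ang_def z_def w_def)
    then have "z = of_real (cmod z) * cis (\<phi> (int n))" using rcis_cmod_Arg[of z] by (simp add: rcis_def)
    then have "w (int (Suc n)) = w (int n) * (of_real (cmod z) * cis (\<phi> (int n)))"
      using w0[of "int n"] by (simp add: z_def field_simps)
    also have "\<dots> = of_real (r * cmod z) * (w 0 * (cis (P n) * cis (\<phi> (int n))))"
      unfolding r(2) by (simp add: mult_ac)
    also have "cis (P n) * cis (\<phi> (int n)) = cis (P (Suc n))" by (simp add: cis_mult P_def)
    finally show ?case using r z by (intro exI[of _ "r * cmod z"]) simp
  qed
  have P6: "P 6 = (\<Sum>k\<in>{0..5}. \<phi> k)"
  proof -
    have "{0..5::int} = {0,1,2,3,4,5}" by auto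
    then show ?thesis by (simp add: P_def eval_nat_numeral lessThan_Suc)
  qed
  obtain r where r: "r > 0" "w 6 = of_real r * (w 0 * cis (P 6))" using wP[of 6] by auto
  have c1: "of_real r * cis (P 6) = 1" using r(2) w6 w0[of 0] by simp
  then have "norm (of_real r * cis (P 6)) = 1" by simp
  then have "r = 1" using r(1) by (simp add: norm_mult)
  then have "cis (P 6) = 1" using c1 by simp
  then have "cos (P 6) = 1" by (simp add: complex_eq_iff)
  then obtain n :: int where n: "P 6 = of_int n * 2 * pi" using cos_one_2pi_int by blast
  have Ps: "P (Suc n) = P n + \<phi> (int n)" for n by (simp add: P_def)
  have Pvals: "P 0 = 0" "P 1 = \<phi> 0" "P 2 = P 1 + \<phi> 1" "P 3 = P 2 + \<phi> 2" "P 4 = P 3 + \<phi> 3" "P 5 = P 4 + \<phi> 4" "P 6 = P 5 + \<phi> 5"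
    using Ps[of 0] Ps[of 1] Ps[of 2] Ps[of 3] Ps[of 4] Ps[of 5] by (simp_all add: P_def eval_nat_numeral)
  have bd: "0 < P 6" "P 6 < 6 * pi" "P 2 < 2 * pi" "P 6 < P 4 + 2 * pi"
    unfolding Pvals using \<phi>[of 0] \<phi>[of 1] \<phi>[of 2] \<phi>[of 3] \<phi>[of 4] \<phi>[of 5] by linarith+
  have "0 < of_int n * (2 * pi)" "of_int n * (2 * pi) < 3 * (2 * pi)" using n bd by (simp_all add: mult_ac)
  then have "0 < real_of_int n" "real_of_int n < 3"
    using pi_gt_zero by (auto simp: zero_less_mult_iff mult_less_cancel_right)
  then have "n = 1 \<or> n = 2" by linarith
  then show ?thesis
  proof
    assume "n = 1" then show ?thesis using n P6 by (simp add: \<phi>_def)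
  next
    assume "n = 2"
    then have "P 6 = 4 * pi" using n by simp
    then have P4: "2 * pi < P 4" using bd by linarith
    \<comment> \<open>the image of the sector j covers the image of the edge in direction 0 a second time\<close>
    have "\<exists>j\<in>{2, 3}. P j \<le> 2 * pi \<and> 2 * pi < P (Suc j)"
    proof (cases "2 * pi < P 3")
      case True then show ?thesis using bd(3) by (intro bexI[of _ 2]) (auto simp: numeral_3_eq_3)
    next
      case False then show ?thesis using P4 by (intro bexI[of _ 3]) (auto simp: eval_nat_numeral)
    qed
    then obtain j :: nat where j: "j \<in> {2, 3}" "P j \<le> 2 * pi" "2 * pi < P (Suc j)" by blast
    define x y where "x = P j" and "y = P (Suc j)"
    have yx: "0 < y - x" "y - x < pi" using Ps[of j] \<phi>[of "int j"] by (simp_all add: x_def y_def)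
    have "sin (y - x) > 0" using yx by (rule sin_gt_zero)
    moreover have sy: "sin y > 0"
    proof -
      have "0 < y - 2 * pi" "y - 2 * pi < pi" using j yx by (auto simp: x_def y_def)
      then have "sin (y - 2 * pi) > 0" by (rule sin_gt_zero)
      then show ?thesis by (simp add: sin_diff)
    qed
    moreover have sx: "- sin x \<ge> 0"
    proof -
      have "0 \<le> 2 * pi - x" "2 * pi - x \<le> pi" using j yx by (auto simp: x_def y_def)
      then have "sin (2 * pi - x) \<ge> 0" by (rule sin_ge_zero)
      then show ?thesis by (simp add: sin_diff)
    qed
    ultimately have S: "sin (y - x) > 0" "sin y > 0" "- sin x \<ge> 0" by auto
    obtain r1 where r1: "r1 > 0" "w (int j) = of_real r1 * (w 0 * cis x)" using wP[of j] by (auto simp: x_def)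
    obtain r2 where r2: "r2 > 0" "w (int (Suc j)) = of_real r2 * (w 0 * cis y)" using wP[of "Suc j"] by (auto simp: y_def)
    \<comment> \<open>solves 1 = s r1 cis x + t r2 cis y: the direction of the first edge lies in the sector\<close>
    define s t where "s = sin y / sin (y - x) / r1" and "t = - sin x / sin (y - x) / r2"
    have st0: "0 < s" "0 \<le> t"
      unfolding s_def t_def using S r1(1) r2(1) by (intro divide_pos_pos divide_nonneg_pos; simp)+
    have "of_real (s * r1) * cis x + of_real (t * r2) * cis y = 1"
    proof -
      have A: "s * r1 = sin y / sin (y - x)" "t * r2 = - sin x / sin (y - x)" using r1 r2 by (auto simp: s_def t_def)
      show ?thesis unfolding A using S(1)
        by (simp add: complex_eq_iff field_simps) (simp add: sin_diff algebra_simps)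
    qed
    moreover have "s *\<^sub>R w (int j) + t *\<^sub>R w (int j + 1) = w 0 * (of_real (s * r1) * cis x + of_real (t * r2) * cis y)"
      using r1(2) r2(2) by (simp add: scaleR_conv_of_real algebra_simps)
    ultimately have w0st: "s *\<^sub>R w (int j) + t *\<^sub>R w (int j + 1) = w 0" by simp
    obtain U h where U: "open U" "v \<in> U" "homeomorphism U (G ` U) G h"
      using pl v(2) unfolding pl_extension_def by blast
    have inj: "p = q" if "p \<in> U" "q \<in> U" "G p = G q" for p q
      using U(3) that unfolding homeomorphism_def by metis
    obtain e where e: "e > 0" "ball v e \<subseteq> U" using U by (meson openE)
    define N where "N = s + t + 1"
    have N: "N \<ge> 1" using st0 by (simp add: N_def)
    \<comment> \<open>small enough for both preimages to lie in the triangles of the star and in U\<close>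
    define l where "l = min (1 / N) (e / (2 * N * mesh))"
    have l: "0 < l" "l * N \<le> 1" "l * N * mesh \<le> e / 2"
    proof -
      show "0 < l" using N e mesh_pos by (simp add: l_def)
      have "l \<le> 1 / N" "l \<le> e / (2 * N * mesh)" by (auto simp: l_def)
      then show "l * N \<le> 1" "l * N * mesh \<le> e / 2" using N mesh_pos by (simp_all add: field_simps)
    qed
    have le: "l \<le> 1" "l * s + l * t \<le> 1" "0 \<le> l * s" "0 \<le> l * t"
      using l st0 by (simp_all add: N_def algebra_simps) (smt (verit) mult_nonneg_nonneg)+
    have "G (v + l *\<^sub>R E 0 + 0 *\<^sub>R E (0 + 1)) = g v + l *\<^sub>R w 0 + 0 *\<^sub>R w (0 + 1)"
      unfolding w_def by (rule affine_on_tri(2)[OF pl C st]) (use l le in auto)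
    moreover have "G (v + (l * s) *\<^sub>R E (int j) + (l * t) *\<^sub>R E (int j + 1)) = g v + (l * s) *\<^sub>R w (int j) + (l * t) *\<^sub>R w (int j + 1)"
      unfolding w_def by (rule affine_on_tri(2)[OF pl C st]) (use le in auto)
    moreover have "(l * s) *\<^sub>R w (int j) + (l * t) *\<^sub>R w (int j + 1) = l *\<^sub>R w 0"
      using w0st by (metis scaleR_add_right scaleR_scaleR)
    ultimately have eq: "G (v + l *\<^sub>R E 0) = G (v + (l * s) *\<^sub>R E (int j) + (l * t) *\<^sub>R E (int j + 1))" by simp
    have U1: "v + l *\<^sub>R E 0 \<in> U"
    proof -
      have "norm (l *\<^sub>R E 0) \<le> l * mesh" using l norm_E_le_mesh[of 0] by simp
      also have "\<dots> \<le> l * N * mesh" using l N mesh_pos by simp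
      also have "\<dots> < e" using l e by simp
      finally show ?thesis using e(2) by (auto simp: dist_norm)
    qed
    have U2: "v + (l * s) *\<^sub>R E (int j) + (l * t) *\<^sub>R E (int j + 1) \<in> U"
    proof -
      define Z where "Z = (l * s) *\<^sub>R E (int j) + (l * t) *\<^sub>R E (int j + 1)"
      have "norm Z \<le> l * s * mesh + l * t * mesh" unfolding Z_def
        by (intro norm_triangle_le add_mono)
          (simp_all only: norm_scaleR abs_of_nonneg[OF le(3)] abs_of_nonneg[OF le(4)]
             mult_left_mono[OF norm_E_le_mesh le(3)] mult_left_mono[OF norm_E_le_mesh le(4)])
      also have "\<dots> \<le> l * N * mesh" using l mesh_pos by (simp add: N_def algebra_simps)
      also have "\<dots> < e" using l e by simp
      finally have "v + Z \<in> ball v e" by (simp add: dist_norm)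
      then show ?thesis using e(2) unfolding Z_def by (auto simp: add.assoc)
    qed
    have "l *\<^sub>R E 0 = l *\<^sub>R (s *\<^sub>R E (int j) + t *\<^sub>R E (int j + 1))"
      using inj[OF U1 U2 eq] by (simp add: algebra_simps)
    then have Eeq: "E 0 = s *\<^sub>R E (int j) + t *\<^sub>R E (int j + 1)" using l(1) by simp
    have "cx (E 0) = s * cx (E (int j)) + t * cx (E (int j + 1))" "cy (E 0) = s * cy (E (int j)) + t * cy (E (int j + 1))"
      unfolding Eeq by simp_all
    then show ?thesis using j(1) st0 by (auto simp: E_explicit)
  qed
qed

text \<open>A corner of the complex is a triangle with a distinguished vertex; the pair \<open>(v, k)\<close> stands for
  the triangle \<open>tri v k\<close> with vertex \<open>v\<close>.\<close>
definition corners :: "complex set set \<Rightarrow> (complex \<times> int) set" where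
  "corners C = (SIGMA v:vertices C. {k \<in> {0..5}. tri v k \<in> C})"

text \<open>The next corner of the same triangle. Summing over a \<open>rot\<close>-orbit is summing over a triangle.\<close>
definition rot :: "complex \<times> int \<Rightarrow> complex \<times> int" where
  "rot c = (fst c + E (snd c), (snd c + 2) mod 6)"

lemma rot_corners: "c \<in> corners C \<Longrightarrow> rot c \<in> corners C"
proof -
  assume c: "c \<in> corners C"
  obtain v k where vk: "c = (v, k)" by (cases c)
  have t: "tri v k \<in> C" using c by (simp add: vk corners_def)
  have "tri (v + E k) ((k + 2) mod 6) = tri (v + E k) (k + 2)" by (rule tri_mod) simp
  then have "tri (v + E k) ((k + 2) mod 6) \<in> C" using t tri_rotate[of v k] by simp
  moreover have "v + E k \<in> tri v k" by (simp add: tri_def)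
  then have "v + E k \<in> vertices C" using t unfolding vertices_def by blast
  moreover have "(k + 2) mod 6 \<le> 5" using pos_mod_bound[of 6 "k + 2"] by linarith
  ultimately show ?thesis by (simp add: rot_def vk corners_def)
qed

lemma rot_rot: "rot (rot (v, k)) = (v + E (k + 1), (k + 4) mod 6)"
proof -
  have "((k + 2) mod 6 + 2) mod 6 = (k + 4) mod 6" by presburger
  then show ?thesis by (simp add: rot_def E_mod_6 E_plus_2)
qed

lemma rot3: "c \<in> corners C \<Longrightarrow> rot (rot (rot c)) = c"
proof -
  assume c: "c \<in> corners C"
  obtain v k where vk: "c = (v, k)" by (cases c)
  have "k mod 6 = k" using c by (simp add: vk corners_def)
  then have "((k + 4) mod 6 + 2) mod 6 = k" by presburger
  moreover have "E (k + 4) = - E (k + 1)" using E_plus_3[of "k + 1"] by (simp add: add.assoc)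
  ultimately show ?thesis unfolding vk rot_rot by (simp add: rot_def E_mod_6)
qed

lemma sum_rot: "finite (corners C) \<Longrightarrow> (\<Sum>c\<in>corners C. H (rot c)) = (\<Sum>c\<in>corners C. H c)"
proof -
  have "bij_betw rot (corners C) (corners C)"
    by (rule bij_betw_byWitness[where f' = "rot \<circ> rot"]) (auto simp: rot3 rot_corners)
  then show ?thesis by (rule sum.reindex_bij_betw)
qed

definition corner_angle :: "(complex \<Rightarrow> complex) \<Rightarrow> complex \<times> int \<Rightarrow> real" where
  "corner_angle g c = ang (g (fst c)) (g (fst c + E (snd c))) (g (fst c + E (snd c + 1)))"

lemma corner_angle_rot:
  "corner_angle g (rot (v, k)) = ang (g (v + E k)) (g (v + E (k + 1))) (g v)"
  "corner_angle g (rot (rot (v, k))) = ang (g (v + E (k + 1))) (g v) (g (v + E k))"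
proof -
  have m: "E ((j mod 6) + 1) = E (j + 1)" for j unfolding E_eq_iff by (simp add: mod_add_left_eq)
  show "corner_angle g (rot (v, k)) = ang (g (v + E k)) (g (v + E (k + 1))) (g v)"
    using E_plus_2[of k] E_plus_3[of k] m[of "k + 2"] E_mod_6[of "k + 2"] by (simp add: corner_angle_def rot_def algebra_simps)
  show "corner_angle g (rot (rot (v, k))) = ang (g (v + E (k + 1))) (g v) (g (v + E k))"
    unfolding rot_rot using E_plus_3[of "k + 1"] E_plus_2[of "k + 3"] E_plus_3[of k] m[of "k + 4"] E_mod_6[of "k + 4"] E_plus_1[of "k + 1"]
    by (simp add: corner_angle_def algebra_simps)
qed

text \<open>The variational argument. Pair the change \<open>\<xi>\<close> of the angles with the change of \<open>ln sin\<close>, once triangle by triangle and once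
  vertex by vertex. In a triangle the common constant of the law of sines is
  annihilated because \<open>\<xi>\<close> sums to zero, and for the same reason the two scale factors at the ends of the
  opposite side may be replaced by minus the one at the vertex. Around an interior vertex \<open>\<xi>\<close> sums to
  zero as well, and at a boundary vertex \<open>u = w\<close>. Only the errors \<open>\<rho>\<close> survive.\<close>
lemma energy_estimate:
  fixes g f :: "complex \<Rightarrow> complex" and u w :: "complex \<Rightarrow> real" and \<rho> :: "complex \<Rightarrow> complex \<Rightarrow> real"
  assumes C: "simp_complex C" "finite C"
    and og: "\<And>v k. tri v k \<in> C \<Longrightarrow> orient (g v) (g (v + E k)) (g (v + E (k + 1))) > 0"
    and of: "\<And>v k. tri v k \<in> C \<Longrightarrow> orient (f v) (f (v + E k)) (f (v + E (k + 1))) > 0"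
    and sg: "\<And>v. v \<in> vertices C \<Longrightarrow> v \<in> interior (support C) \<Longrightarrow> (\<Sum>k\<in>{0..5}. corner_angle g (v, k)) = 2 * pi"
    and sf: "\<And>v. v \<in> vertices C \<Longrightarrow> v \<in> interior (support C) \<Longrightarrow> (\<Sum>k\<in>{0..5}. corner_angle f (v, k)) = 2 * pi"
    and lg: "\<And>p q. {p, q} \<in> edges C \<Longrightarrow> cmod (g p - g q) = cmod (p - q) * exp ((u p + u q) / 2)"
    and lf: "\<And>p q. {p, q} \<in> edges C \<Longrightarrow> cmod (f p - f q) = cmod (p - q) * exp ((w p + w q) / 2 + \<rho> p q)"
    and \<rho>: "\<And>p q. {p, q} \<in> edges C \<Longrightarrow> \<bar>\<rho> p q\<bar> \<le> R"
    and bd: "\<And>v. v \<in> vertices C \<Longrightarrow> v \<notin> interior (support C) \<Longrightarrow> u v = w v"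
    and d: "0 < \<delta>" "\<And>c. c \<in> corners C \<Longrightarrow> corner_angle f c \<in> {\<delta>..pi/2 - \<delta>}"
  shows "(\<Sum>c\<in>corners C. (corner_angle g c - corner_angle f c)\<^sup>2) \<le> (R / ((\<delta> / (2 * pi)) * tan (\<delta> / 2)))\<^sup>2 * card (corners C)"
proof -
  define c0 where "c0 = (\<delta> / (2 * pi)) * tan (\<delta> / 2)"
  have finV: "finite (vertices C)" unfolding vertices_def using C SX_finite by (auto simp: simp_complex_def)
  have finC: "finite (corners C)" unfolding corners_def using finV
    by (intro finite_SigmaI) (auto intro: finite_subset[of _ "{0..5}"])
  define \<xi> where "\<xi> c = corner_angle g c - corner_angle f c" for c
  define x where "x v = u v - w v" for v
  have main: "c0 * ((\<xi> c)\<^sup>2 + (\<xi> (rot c))\<^sup>2 + (\<xi> (rot (rot c)))\<^sup>2)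
      \<le> - (1/2) * (\<xi> c * x (fst c) + \<xi> (rot c) * x (fst (rot c)) + \<xi> (rot (rot c)) * x (fst (rot (rot c))))
        + R * (\<bar>\<xi> c\<bar> + \<bar>\<xi> (rot c)\<bar> + \<bar>\<xi> (rot (rot c))\<bar>)"
    if c: "c \<in> corners C" for c
  proof -
    obtain v k where vk: "c = (v, k)" by (cases c)
    define q r where "q = v + E k" and "r = v + E (k + 1)"
    have t: "tri v k \<in> C" using c by (simp add: vk corners_def)
    have G: "orient (g v) (g q) (g r) > 0" and F: "orient (f v) (f q) (f r) > 0"
      using og[OF t] of[OF t] by (simp_all add: q_def r_def)
    have G': "orient (g q) (g r) (g v) > 0" "orient (g r) (g v) (g q) > 0"
       "orient (f q) (f r) (f v) > 0" "orient (f r) (f v) (f q) > 0"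
      using G F orient_rotate by metis+
    have edge: "{a, b} \<in> edges C" if "a \<noteq> b" "{a, b} \<subseteq> tri v k" for a b
      using C(1) t that unfolding simp_complex_def edges_def by auto
    have dist: "v \<noteq> q" "v \<noteq> r" "q \<noteq> r" using tri_distinct[of v k] by (simp_all add: q_def r_def)
    have e: "{q, r} \<in> edges C" "{r, v} \<in> edges C" "{v, q} \<in> edges C"
      using dist by (auto intro!: edge simp: tri_def q_def r_def)
    have lam: "ln (cmod (g b - g a)) - ln (cmod (f b - f a)) = (x a + x b) / 2 - \<rho> b a"
      if "{a, b} \<in> edges C" "a \<noteq> b" for a b
    proof -
      have "{b, a} \<in> edges C" using that by (simp add: insert_commute)
      then show ?thesis using that by (simp add: lg lf ln_mult x_def field_simps)
    qed
    define b1 b2 b3 a1 a2 a3 where "b1 = corner_angle g c" and "b2 = corner_angle g (rot c)" and "b3 = corner_angle g (rot (rot c))"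
      and "a1 = corner_angle f c" and "a2 = corner_angle f (rot c)" and "a3 = corner_angle f (rot (rot c))"
    have B: "b1 = ang (g v) (g q) (g r)" "b2 = ang (g q) (g r) (g v)" "b3 = ang (g r) (g v) (g q)"
      "a1 = ang (f v) (f q) (f r)" "a2 = ang (f q) (f r) (f v)" "a3 = ang (f r) (f v) (f q)"
      unfolding b1_def b2_def b3_def a1_def a2_def a3_def vk corner_angle_rot by (simp_all add: corner_angle_def q_def r_def)
    define \<kappa> where "\<kappa> = (ln (orient (g v) (g q) (g r)) - ln (cmod (g q - g v)) - ln (cmod (g r - g q)) - ln (cmod (g v - g r)))
       - (ln (orient (f v) (f q) (f r)) - ln (cmod (f q - f v)) - ln (cmod (f r - f q)) - ln (cmod (f v - f r)))"
    have o2: "orient (g q) (g r) (g v) = orient (g v) (g q) (g r)" "orient (g r) (g v) (g q) = orient (g v) (g q) (g r)"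
      "orient (f q) (f r) (f v) = orient (f v) (f q) (f r)" "orient (f r) (f v) (f q) = orient (f v) (f q) (f r)"
      using orient_rotate by metis+
    have L: "ln (sin b1) - ln (sin a1) = (x q + x r) / 2 - \<rho> r q + \<kappa>"
       "ln (sin b2) - ln (sin a2) = (x r + x v) / 2 - \<rho> v r + \<kappa>"
       "ln (sin b3) - ln (sin a3) = (x v + x q) / 2 - \<rho> q v + \<kappa>"
      unfolding B law_of_sines[OF G] law_of_sines[OF F] law_of_sines[OF G'(1)] law_of_sines[OF G'(2)]
        law_of_sines[OF G'(3)] law_of_sines[OF G'(4)] o2
      using lam[OF e(1) dist(3)] lam[OF e(2) dist(2)[symmetric]] lam[OF e(3) dist(1)] by (simp_all add: \<kappa>_def)
    have sums: "b1 + b2 + b3 = pi" "a1 + a2 + a3 = pi" unfolding B using ang_sum[OF G] ang_sum[OF F] by auto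
    have A: "a1 \<in> {\<delta>..pi/2 - \<delta>}" "a2 \<in> {\<delta>..pi/2 - \<delta>}" "a3 \<in> {\<delta>..pi/2 - \<delta>}"
      unfolding a1_def a2_def a3_def using d(2) c rot_corners by blast+
    have bp: "b1 > 0" "b2 > 0" "b3 > 0" unfolding B using ang_bounds(1) G G' by blast+
    have x0: "\<xi> c = b1 - a1" "\<xi> (rot c) = b2 - a2" "\<xi> (rot (rot c)) = b3 - a3"
      by (simp_all add: \<xi>_def b1_def b2_def b3_def a1_def a2_def a3_def)
    have fs: "fst c = v" "fst (rot c) = q" "fst (rot (rot c)) = r" unfolding vk rot_rot by (simp_all add: rot_def q_def r_def)
    define y1 y2 y3 where "y1 = b1 - a1" and "y2 = b2 - a2" and "y3 = b3 - a3"
    have y0: "y3 = - y1 - y2" using sums by (simp add: y1_def y2_def y3_def)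
    have "c0 * (y1\<^sup>2 + y2\<^sup>2 + y3\<^sup>2) \<le> y1 * ((x q + x r) / 2 - \<rho> r q + \<kappa>) + y2 * ((x r + x v) / 2 - \<rho> v r + \<kappa>)
         + y3 * ((x v + x q) / 2 - \<rho> q v + \<kappa>)"
      using angle_energy_coercive[OF d(1) A sums(2) bp sums(1)] unfolding L c0_def y1_def y2_def y3_def .
    also have "\<dots> = - (1/2) * (y1 * x v + y2 * x q + y3 * x r) + (- y1 * \<rho> r q - y2 * \<rho> v r - y3 * \<rho> q v)"
      unfolding y0 by (simp add: field_simps)
    also have "- y1 * \<rho> r q - y2 * \<rho> v r - y3 * \<rho> q v \<le> R * (\<bar>y1\<bar> + \<bar>y2\<bar> + \<bar>y3\<bar>)"
    proof -
      have "- y * s \<le> R * \<bar>y\<bar>" if "\<bar>s\<bar> \<le> R" for y s :: real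
        using mult_right_mono[OF that abs_ge_zero[of y]] abs_ge_minus_self[of "y * s"] by (simp add: abs_mult mult_ac)
      moreover have "\<bar>\<rho> r q\<bar> \<le> R" "\<bar>\<rho> v r\<bar> \<le> R" "\<bar>\<rho> q v\<bar> \<le> R"
        using \<rho> e by (auto simp: insert_commute)
      ultimately have "- y1 * \<rho> r q \<le> R * \<bar>y1\<bar>" "- y2 * \<rho> v r \<le> R * \<bar>y2\<bar>" "- y3 * \<rho> q v \<le> R * \<bar>y3\<bar>" by blast+
      then show ?thesis by (simp add: algebra_simps)
    qed
    finally show ?thesis unfolding x0 fs y1_def y2_def y3_def by simp
  qed
  define S where "S H = (\<Sum>c\<in>corners C. H c)" for H :: "complex \<times> int \<Rightarrow> real"
  \<comment> \<open>summing triangle sums over all corners counts every triangle three times\<close>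
  have S3: "(\<Sum>c\<in>corners C. H c + H (rot c) + H (rot (rot c))) = 3 * S H" for H
    using sum_rot[OF finC, of H] sum_rot[OF finC, of "\<lambda>c. H (rot c)"] by (simp add: sum.distrib S_def)
  have "3 * (c0 * S (\<lambda>c. (\<xi> c)\<^sup>2)) = (\<Sum>c\<in>corners C. c0 * ((\<xi> c)\<^sup>2 + (\<xi> (rot c))\<^sup>2 + (\<xi> (rot (rot c)))\<^sup>2))"
    using S3[of "\<lambda>c. (\<xi> c)\<^sup>2"] by (simp add: sum_distrib_left[symmetric])
  also have "\<dots> \<le> (\<Sum>c\<in>corners C. - (1/2) * (\<xi> c * x (fst c) + \<xi> (rot c) * x (fst (rot c)) + \<xi> (rot (rot c)) * x (fst (rot (rot c))))
        + R * (\<bar>\<xi> c\<bar> + \<bar>\<xi> (rot c)\<bar> + \<bar>\<xi> (rot (rot c))\<bar>))"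
    by (rule sum_mono) (rule main)
  also have "\<dots> = - (1/2) * (3 * S (\<lambda>c. \<xi> c * x (fst c))) + R * (3 * S (\<lambda>c. \<bar>\<xi> c\<bar>))"
    unfolding sum.distrib sum_distrib_left[symmetric]
    using S3[of "\<lambda>c. \<xi> c * x (fst c)"] S3[of "\<lambda>c. \<bar>\<xi> c\<bar>"] by (simp add: sum.distrib)
  also have "S (\<lambda>c. \<xi> c * x (fst c)) = 0"
  proof -
    have "S (\<lambda>c. \<xi> c * x (fst c)) = (\<Sum>v\<in>vertices C. \<Sum>k\<in>{k \<in> {0..5}. tri v k \<in> C}. \<xi> (v, k) * x v)"
    proof -
      have fk: "\<forall>v\<in>vertices C. finite {k \<in> {0..5}. tri v k \<in> C}"
        by (rule ballI, rule finite_subset[of _ "{0..5}"]) auto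
      have "S (\<lambda>c. \<xi> c * x (fst c)) = (\<Sum>(v, k)\<in>(SIGMA v:vertices C. {k \<in> {0..5}. tri v k \<in> C}). \<xi> (v, k) * x v)"
        unfolding S_def corners_def by (rule sum.cong) auto
      then show ?thesis using sum.Sigma[OF finV fk, of "\<lambda>v k. \<xi> (v, k) * x v"] by (rule trans[OF _ sym])
    qed
    also have "\<dots> = (\<Sum>v\<in>vertices C. 0)"
    proof (rule sum.cong[OF refl])
      fix v assume v: "v \<in> vertices C"
      show "(\<Sum>k\<in>{k \<in> {0..5}. tri v k \<in> C}. \<xi> (v, k) * x v) = 0"
      proof (cases "v \<in> interior (support C)")
        case True
        have "v \<in> V" using v C(1) SX_V by (auto simp: vertices_def simp_complex_def)
        then have "{k \<in> {0..5}. tri v k \<in> C} = {0..5}" using star_of_interior_vertex[OF C(1) _ True] by auto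
        moreover have "(\<Sum>k\<in>{0..5}. \<xi> (v, k)) = 0"
          using sg[OF v True] sf[OF v True] by (simp add: \<xi>_def sum_subtractf)
        ultimately show ?thesis by (simp add: sum_distrib_right[symmetric])
      next
        case False then show ?thesis using bd[OF v] by (simp add: x_def)
      qed
    qed
    finally show ?thesis by simp
  qed
  finally have le: "c0 * S (\<lambda>c. (\<xi> c)\<^sup>2) \<le> R * S (\<lambda>c. \<bar>\<xi> c\<bar>)" by simp
  show ?thesis
  proof (cases "corners C = {}")
    case False
    then obtain c where c: "c \<in> corners C" by blast
    have dpi: "\<delta> \<le> pi / 4" using d(2)[OF c] by auto
    have c0: "c0 > 0" unfolding c0_def using d(1) dpi pi_gt_zero by (intro mult_pos_pos tan_gt_zero) auto
    \<comment> \<open>Young's inequality, to absorb the linear term\<close>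
    have "c0 * (R * \<bar>y\<bar>) \<le> c0\<^sup>2 * y\<^sup>2 / 2 + R\<^sup>2 / 2" for y
      using sum_squares_ge_zero[of "c0 * \<bar>y\<bar> - R" 0] by (simp add: power2_eq_square algebra_simps)
    then have "(\<Sum>c\<in>corners C. c0 * (R * \<bar>\<xi> c\<bar>)) \<le> (\<Sum>c\<in>corners C. c0\<^sup>2 * (\<xi> c)\<^sup>2 / 2 + R\<^sup>2 / 2)"
      by (intro sum_mono) auto
    then have "c0 * (R * S (\<lambda>c. \<bar>\<xi> c\<bar>)) \<le> c0\<^sup>2 / 2 * S (\<lambda>c. (\<xi> c)\<^sup>2) + card (corners C) * (R\<^sup>2 / 2)"
      unfolding S_def sum.distrib by (simp add: sum_distrib_left)
    moreover have "c0 * (c0 * S (\<lambda>c. (\<xi> c)\<^sup>2)) \<le> c0 * (R * S (\<lambda>c. \<bar>\<xi> c\<bar>))" using le c0 by (intro mult_left_mono) auto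
    moreover have "c0 * (c0 * S (\<lambda>c. (\<xi> c)\<^sup>2)) = c0\<^sup>2 * S (\<lambda>c. (\<xi> c)\<^sup>2)"
       "c0\<^sup>2 / 2 * S (\<lambda>c. (\<xi> c)\<^sup>2) = (c0\<^sup>2 * S (\<lambda>c. (\<xi> c)\<^sup>2)) / 2"
       "card (corners C) * (R\<^sup>2 / 2) = (R\<^sup>2 * card (corners C)) / 2" by (simp_all add: power2_eq_square)
    ultimately have "c0\<^sup>2 * S (\<lambda>c. (\<xi> c)\<^sup>2) \<le> R\<^sup>2 * card (corners C)" by linarith
    then have "S (\<lambda>c. (\<xi> c)\<^sup>2) \<le> (R / c0)\<^sup>2 * card (corners C)" using c0 by (simp add: field_simps power_divide)
    then show ?thesis by (simp add: S_def \<xi>_def c0_def)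
  qed simp
qed

section \<open>Comparison of the discrete map with the smooth map\<close>
definition lat_angle :: "int \<Rightarrow> real" where "lat_angle k = Arg (E (k + 1) / E k)"

lemma lat_angle_ang: "lat_angle k = ang v (v + E k) (v + E (k + 1))"
  by (simp add: lat_angle_def ang_def)

lemma orient_tri: "orient v (v + E k) (v + E (k + 1)) = area2"
  using Im_cnj_E[of k] by (simp add: orient_def)

lemma lat_angle_plus_3: "lat_angle (k + 3) = lat_angle k"
  using E_plus_3[of k] E_plus_3[of "k + 1"] by (simp add: lat_angle_def algebra_simps)

lemma lat_angle_sum: "lat_angle k + lat_angle (k + 1) + lat_angle (k + 2) = pi"
proof -
  have "ang v (v + E k) (v + E (k + 1)) + ang (v + E k) (v + E (k + 1)) v + ang (v + E (k + 1)) v (v + E k) = pi" for v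
    by (rule ang_sum) (simp add: orient_tri area2_pos)
  moreover have "ang (v + E k) (v + E (k + 1)) v = lat_angle (k + 2)" for v
    using corner_angle_rot(1)[of "\<lambda>z. z" v k] lat_angle_ang[of "k + 2" "v + E k"] E_plus_2[of k] E_plus_3[of k] by (simp add: algebra_simps)
  moreover have "ang (v + E (k + 1)) v (v + E k) = lat_angle (k + 4)" for v
    using lat_angle_ang[of "k + 4" "v + E (k + 1)"] E_plus_3[of "k + 1"] E_plus_2[of "k + 3"] E_plus_3[of k] E_plus_2[of k] by (simp add: algebra_simps)
  ultimately have "lat_angle k + lat_angle (k + 2) + lat_angle (k + 4) = pi" using lat_angle_ang[of k 0] by metis
  then show ?thesis using lat_angle_plus_3[of "k + 1"] by (simp add: algebra_simps)
qed

lemma E_shift: "E (k + 2) = - E (k - 1)" "E (k - 2) = - E (k + 1)" "E (k + 4) = - E (k + 1)" "E (k + 3) = - E k"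
proof -
  have k: "k - 1 + 3 = k + 2" "k - 2 + 3 = k + 1" "k + 1 + 3 = k + 4" by simp_all
  show "E (k + 2) = - E (k - 1)" by (rule E_plus_3[of "k - 1", unfolded k])
  show "E (k - 2) = - E (k + 1)" unfolding E_plus_3[of "k - 2", unfolded k] by (simp only: minus_minus)
  show "E (k + 4) = - E (k + 1)" by (rule E_plus_3[of "k + 1", unfolded k])
  show "E (k + 3) = - E k" by (rule E_plus_3)
qed

text \<open>The two triangles at the edge from \<open>v\<close> to \<open>v + E k\<close>, seen from their other vertices.\<close>
lemma tri_around_edge:
  "tri (v + E (k - 1)) (k + 1) = tri v (k - 1)" "tri (v + E k) (k + 3) = tri v (k - 1)"
  "tri (v + E k) (k + 2) = tri v k" "tri (v + E (k + 1)) (k - 2) = tri v k"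
proof -
  have k: "k - 1 + 2 = k + 1" "k - 1 + 1 = k" "k - 1 + 4 = k + 3" by simp_all
  show "tri (v + E (k - 1)) (k + 1) = tri v (k - 1)" by (rule tri_rotate[of v "k - 1", unfolded k])
  show "tri (v + E k) (k + 3) = tri v (k - 1)" by (rule tri_rotate2[of v "k - 1", unfolded k])
  show "tri (v + E k) (k + 2) = tri v k" by (rule tri_rotate)
  have "tri (v + E (k + 1)) (k - 2) = tri (v + E (k + 1)) (k + 4)" by (rule tri_mod) presburger
  then show "tri (v + E (k + 1)) (k - 2) = tri v k" using tri_rotate2[of v k] by simp
qed

lemma corner_angle_mod: "corner_angle h (v, k mod 6) = corner_angle h (v, k)"
proof -
  have "E ((k mod 6) + 1) = E (k + 1)" unfolding E_eq_iff by (simp add: mod_add_left_eq)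
  then show ?thesis by (simp add: corner_angle_def E_mod_6)
qed

end

text \<open>A discrete conformal map \<open>g\<close> with scale factors \<open>u\<close> next to a map \<open>f\<close> that is nearly conformal in the discrete
  sense, with scale factors \<open>w\<close>. The number \<open>R\<close> bounds the defect of the length rule for \<open>f\<close> and \<open>\<tau>\<close> the
  change of the lattice angles under \<open>f\<close>. On a lattice of mesh \<open>\<epsilon>\<close> they are of order \<open>\<epsilon>\<^sup>2\<close> and \<open>\<epsilon>\<close>.\<close>
locale map_pair = triangular_lattice E for E +
  fixes C :: "complex set set" and g f :: "complex \<Rightarrow> complex" and u w :: "complex \<Rightarrow> real" and R \<tau> \<delta> :: real
  assumes C: "simp_complex C" "finite C"
    and og: "\<And>v k. tri v k \<in> C \<Longrightarrow> orient (g v) (g (v + E k)) (g (v + E (k + 1))) > 0"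
    and of: "\<And>v k. tri v k \<in> C \<Longrightarrow> orient (f v) (f (v + E k)) (f (v + E (k + 1))) > 0"
    and sg: "\<And>v. v \<in> vertices C \<Longrightarrow> v \<in> interior (support C) \<Longrightarrow> (\<Sum>k\<in>{0..5}. corner_angle g (v, k)) = 2 * pi"
    and sf: "\<And>v. v \<in> vertices C \<Longrightarrow> v \<in> interior (support C) \<Longrightarrow> (\<Sum>k\<in>{0..5}. corner_angle f (v, k)) = 2 * pi"
    and lg: "\<And>p q. {p, q} \<in> edges C \<Longrightarrow> cmod (g p - g q) = cmod (p - q) * exp ((u p + u q) / 2)"
    and nf: "\<And>p q. {p, q} \<in> edges C \<Longrightarrow> f p \<noteq> f q"
    and lf: "\<And>p q. {p, q} \<in> edges C \<Longrightarrow> \<bar>ln (cmod (f p - f q)) - ln (cmod (p - q)) - (w p + w q) / 2\<bar> \<le> R"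
    and bd: "\<And>v. v \<in> vertices C \<Longrightarrow> v \<notin> interior (support C) \<Longrightarrow> u v = w v"
    and d: "0 < \<delta>" "\<And>k. lat_angle k \<in> {2 * \<delta>..pi/2 - 2 * \<delta>}"
    and fang: "\<And>v k. tri v k \<in> C \<Longrightarrow> \<bar>corner_angle f (v, k) - lat_angle k\<bar> \<le> \<tau>" and \<tau>: "\<tau> \<le> \<delta>"
begin

definition \<xi> :: "complex \<Rightarrow> int \<Rightarrow> real" where "\<xi> v k = corner_angle g (v, k) - corner_angle f (v, k)"
definition X :: "complex \<Rightarrow> real" where "X v = u v - w v"
definition \<rho> :: "complex \<Rightarrow> complex \<Rightarrow> real" where
  "\<rho> p q = ln (cmod (f p - f q)) - ln (cmod (p - q)) - (w p + w q) / 2"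
definition \<Xi> :: real where "\<Xi> = (\<Sum>c\<in>corners C. (\<xi> (fst c) (snd c))\<^sup>2)"

lemma \<rho>_sym: "\<rho> p q = \<rho> q p" by (simp add: \<rho>_def norm_minus_commute add.commute)

lemma edge_ne: "{p, q} \<in> edges C \<Longrightarrow> p \<noteq> q"
  by (auto simp: edges_def)

lemma fin_corners: "finite (corners C)"
proof -
  have finV: "finite (vertices C)" unfolding vertices_def using C SX_finite by (auto simp: simp_complex_def)
  then show ?thesis unfolding corners_def by (intro finite_SigmaI) (auto intro: finite_subset[of _ "{0..5}"])
qed

lemma \<xi>_mod: "\<xi> v (k mod 6) = \<xi> v k" by (simp add: \<xi>_def corner_angle_mod)

lemma corner_mod: "tri v k \<in> C \<Longrightarrow> (v, k mod 6) \<in> corners C"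
proof -
  assume t: "tri v k \<in> C"
  have "v \<in> tri v k" by (simp add: tri_def)
  then have "v \<in> vertices C" using t unfolding vertices_def by blast
  moreover have "tri v (k mod 6) = tri v k" by (rule tri_mod) simp
  moreover have "k mod 6 \<le> 5" using pos_mod_bound[of 6 k] by linarith
  ultimately show ?thesis using t by (simp add: corners_def)
qed

lemma energy: "\<Xi> \<le> (R / ((\<delta> / (2 * pi)) * tan (\<delta> / 2)))\<^sup>2 * card (corners C)"
proof -
  have "(\<Sum>c\<in>corners C. (corner_angle g c - corner_angle f c)\<^sup>2) \<le> (R / ((\<delta> / (2 * pi)) * tan (\<delta> / 2)))\<^sup>2 * card (corners C)"
  proof (rule energy_estimate[OF C og of sg sf lg _ _ bd d(1), where \<rho> = \<rho>])
    show "cmod (f p - f q) = cmod (p - q) * exp ((w p + w q) / 2 + \<rho> p q)" if "{p, q} \<in> edges C" for p q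
    proof -
      have "(w p + w q) / 2 + \<rho> p q = ln (cmod (f p - f q)) - ln (cmod (p - q))" by (simp add: \<rho>_def)
      then show ?thesis using nf[OF that] edge_ne[OF that] by (simp add: exp_diff)
    qed
    show "\<bar>\<rho> p q\<bar> \<le> R" if "{p, q} \<in> edges C" for p q using lf[OF that] by (simp add: \<rho>_def)
    show "corner_angle f c \<in> {\<delta>..pi / 2 - \<delta>}" if "c \<in> corners C" for c
      using fang[of "fst c" "snd c"] \<tau> d(2)[of "snd c"] that by (auto simp: corners_def abs_le_iff)
  qed
  then show ?thesis by (simp add: \<Xi>_def \<xi>_def)
qed

lemma \<Xi>_nonneg: "0 \<le> \<Xi>" unfolding \<Xi>_def by (intro sum_nonneg) simp

lemma \<xi>_le: "tri v k \<in> C \<Longrightarrow> (\<xi> v k)\<^sup>2 \<le> \<Xi>"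
  using member_le_sum[OF corner_mod, of v k "\<lambda>c. (\<xi> (fst c) (snd c))\<^sup>2"] fin_corners
  by (simp add: \<Xi>_def \<xi>_mod)

lemma sum_\<xi>_sq:
  assumes "\<And>v. v \<in> B \<Longrightarrow> tri (v + o') k \<in> C"
  shows "(\<Sum>v\<in>B. (\<xi> (v + o') k)\<^sup>2) \<le> \<Xi>"
proof -
  have inj: "inj_on (\<lambda>v. (v + o', k mod 6)) B" by (auto simp: inj_on_def)
  have "(\<Sum>v\<in>B. (\<xi> (v + o') k)\<^sup>2) = (\<Sum>c\<in>(\<lambda>v. (v + o', k mod 6)) ` B. (\<xi> (fst c) (snd c))\<^sup>2)"
    by (subst sum.reindex[OF inj]) (simp add: \<xi>_mod)
  also have "\<dots> \<le> \<Xi>" unfolding \<Xi>_def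
    using assms corner_mod by (intro sum_mono2 fin_corners) auto
  finally show ?thesis .
qed

lemma sum_\<xi>_abs:
  assumes "\<And>v. v \<in> B \<Longrightarrow> tri (v + o') k \<in> C"
  shows "(\<Sum>v\<in>B. \<bar>\<xi> (v + o') k\<bar>) \<le> sqrt (card B * \<Xi>)"
proof (cases "finite B")
  case True
  have "(\<Sum>v\<in>B. \<bar>\<xi> (v + o') k\<bar> * 1) \<le> L2_set (\<lambda>v. \<xi> (v + o') k) B * L2_set (\<lambda>_. 1) B"
    using L2_set_mult_ineq[of "\<lambda>v. \<xi> (v + o') k" "\<lambda>_. 1" B] by simp
  also have "\<dots> = sqrt (\<Sum>v\<in>B. (\<xi> (v + o') k)\<^sup>2) * sqrt (card B)" by (simp add: L2_set_def)
  also have "\<dots> \<le> sqrt \<Xi> * sqrt (card B)" using sum_\<xi>_sq[of B o' k, OF assms] by (intro mult_right_mono) auto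
  finally show ?thesis by (simp add: real_sqrt_mult mult.commute)
qed (simp add: \<Xi>_nonneg)

text \<open>One triangle, in two ways: its angles in terms of \<open>X\<close> to first order, and \<open>X\<close> in terms
  of its angles. The second estimate allows first differences of \<open>X\<close> to be controlled by the energy \<open>\<Xi>\<close>.\<close>
lemma triangle_data:
  assumes t: "tri p j \<in> C" and small: "\<Xi> \<le> (\<delta> / 2)\<^sup>2"
  defines "q \<equiv> p + E j" and "r \<equiv> p + E (j + 1)"
  shows "\<bar>\<xi> p j - ((cot (lat_angle (j + 2)) + cot (lat_angle (j + 1))) * ((X q + X r) / 2 - \<rho> q r)
      - cot (lat_angle (j + 1)) * ((X r + X p) / 2 - \<rho> r p) - cot (lat_angle (j + 2)) * ((X p + X q) / 2 - \<rho> p q))\<bar>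
    \<le> 4 / (sin (\<delta> / 2))^4 * (\<bar>\<xi> p j\<bar> * (\<bar>\<xi> p j\<bar> + \<tau>) + \<bar>\<xi> q (j + 2)\<bar> * (\<bar>\<xi> q (j + 2)\<bar> + \<tau>)
         + \<bar>\<xi> r (j + 4)\<bar> * (\<bar>\<xi> r (j + 4)\<bar> + \<tau>))"
    and "\<bar>X q - X p\<bar> \<le> 2 / (sin (\<delta> / 2))\<^sup>2 * (\<bar>\<xi> p j\<bar> + \<bar>\<xi> q (j + 2)\<bar>) + 4 * R"
proof -
  define h where "h = \<delta> / 2"
  have h: "0 < h" using d(1) by (simp add: h_def)
  have G: "orient (g p) (g q) (g r) > 0" and F: "orient (f p) (f q) (f r) > 0"
    using og[OF t] of[OF t] by (simp_all add: q_def r_def)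
  have G': "orient (g q) (g r) (g p) > 0" "orient (g r) (g p) (g q) > 0"
     "orient (f q) (f r) (f p) > 0" "orient (f r) (f p) (f q) > 0"
    using G F orient_rotate by metis+
  have edge: "{a, b} \<in> edges C" if "a \<noteq> b" "{a, b} \<subseteq> tri p j" for a b
    using C(1) t that unfolding simp_complex_def edges_def by auto
  have dist: "p \<noteq> q" "p \<noteq> r" "q \<noteq> r" using tri_distinct[of p j] by (simp_all add: q_def r_def)
  have e: "{q, r} \<in> edges C" "{r, p} \<in> edges C" "{p, q} \<in> edges C"
    using dist by (auto intro!: edge simp: tri_def q_def r_def)
  have lam: "ln (cmod (g b - g a)) - ln (cmod (f b - f a)) = (X a + X b) / 2 - \<rho> a b"
    if "{a, b} \<in> edges C" for a b
  proof -
    have "ln (cmod (g a - g b)) = ln (cmod (a - b)) + (u a + u b) / 2"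
      using that edge_ne[OF that] by (simp add: lg ln_mult)
    then show ?thesis by (simp add: norm_minus_commute \<rho>_def X_def field_simps)
  qed
  have T: "tri q (j + 2) \<in> C" "tri r (j + 4) \<in> C"
    using t tri_rotate[of p j] tri_rotate2[of p j] by (simp_all add: q_def r_def)
  have Ej: "E (j + 2 + 1) = - E j" "E (j + 2) = E (j + 1) - E j" "E (j + 4) = - E (j + 1)" "E (j + 4 + 1) = E j - E (j + 1)"
    using E_plus_3[of j] E_plus_2[of j] E_plus_3[of "j + 1"] E_plus_3[of "j + 2"] by (simp_all add: algebra_simps)
  have ca: "corner_angle m (p, j) = ang (m p) (m q) (m r)" "corner_angle m (q, j + 2) = ang (m q) (m r) (m p)"
     "corner_angle m (r, j + 4) = ang (m r) (m p) (m q)" for m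
    unfolding corner_angle_def fst_conv snd_conv Ej by (simp_all add: q_def r_def)
  define b1 b2 b3 a1 a2 a3 where "b1 = corner_angle g (p, j)" and "b2 = corner_angle g (q, j + 2)" and "b3 = corner_angle g (r, j + 4)"
    and "a1 = corner_angle f (p, j)" and "a2 = corner_angle f (q, j + 2)" and "a3 = corner_angle f (r, j + 4)"
  note defs = b1_def b2_def b3_def a1_def a2_def a3_def
  define \<kappa> where "\<kappa> = (ln (orient (g p) (g q) (g r)) - ln (cmod (g q - g p)) - ln (cmod (g r - g q)) - ln (cmod (g p - g r)))
     - (ln (orient (f p) (f q) (f r)) - ln (cmod (f q - f p)) - ln (cmod (f r - f q)) - ln (cmod (f p - f r)))"
  have o2: "orient (g q) (g r) (g p) = orient (g p) (g q) (g r)" "orient (g r) (g p) (g q) = orient (g p) (g q) (g r)"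
    "orient (f q) (f r) (f p) = orient (f p) (f q) (f r)" "orient (f r) (f p) (f q) = orient (f p) (f q) (f r)"
    using orient_rotate by metis+
  have L: "(X q + X r) / 2 - \<rho> q r = ln (sin b1) - ln (sin a1) + - \<kappa>"
     "(X r + X p) / 2 - \<rho> r p = ln (sin b2) - ln (sin a2) + - \<kappa>"
     "(X p + X q) / 2 - \<rho> p q = ln (sin b3) - ln (sin a3) + - \<kappa>"
    unfolding defs ca law_of_sines[OF G] law_of_sines[OF F] law_of_sines[OF G'(1)] law_of_sines[OF G'(2)]
      law_of_sines[OF G'(3)] law_of_sines[OF G'(4)] o2
    using lam[OF e(1)] lam[OF e(2)] lam[OF e(3)] by (simp_all add: \<kappa>_def)
  have sums: "b1 + b2 + b3 = pi" "a1 + a2 + a3 = pi" unfolding defs ca using ang_sum[OF G] ang_sum[OF F] by auto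
  have ba3: "lat_angle (j + 4) = lat_angle (j + 1)" using lat_angle_plus_3[of "j + 1"] by (simp add: algebra_simps)
  have near: "\<bar>a1 - lat_angle j\<bar> \<le> \<tau>" "\<bar>a2 - lat_angle (j + 2)\<bar> \<le> \<tau>" "\<bar>a3 - lat_angle (j + 1)\<bar> \<le> \<tau>"
    using fang[OF t] fang[OF T(1)] fang[OF T(2)] unfolding ba3 defs by auto
  have x: "\<xi> p j = b1 - a1" "\<xi> q (j + 2) = b2 - a2" "\<xi> r (j + 4) = b3 - a3" by (simp_all add: \<xi>_def defs)
  have sm: "\<bar>b - a\<bar> \<le> h" if "(b - a)\<^sup>2 \<le> \<Xi>" for a b :: real
  proof -
    have "(b - a)\<^sup>2 \<le> h\<^sup>2" using that small by (simp add: h_def)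
    then show ?thesis using h by (simp add: abs_le_square_iff[symmetric])
  qed
  have bs: "\<bar>b1 - a1\<bar> \<le> h" "\<bar>b2 - a2\<bar> \<le> h" "\<bar>b3 - a3\<bar> \<le> h"
    using \<xi>_le[OF t] \<xi>_le[OF T(1)] \<xi>_le[OF T(2)] unfolding x by (auto intro!: sm)
  have t123: "lat_angle j \<in> {h..pi - h}" "lat_angle (j + 2) \<in> {h..pi - h}" "lat_angle (j + 1) \<in> {h..pi - h}" "lat_angle j + lat_angle (j + 2) + lat_angle (j + 1) = pi"
    using d(2)[of j] d(2)[of "j + 2"] d(2)[of "j + 1"] lat_angle_sum[of j] d(1) by (auto simp: h_def)
  have A: "a1 \<in> {h..pi - h}" "a2 \<in> {h..pi - h}" "a3 \<in> {h..pi - h}"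
    using near \<tau> d(2)[of j] d(2)[of "j + 2"] d(2)[of "j + 1"] d(1) by (auto simp: h_def abs_le_iff)
  have box: "b \<in> {h..pi - h}" if "\<bar>b - a\<bar> \<le> h" "\<bar>a - t\<bar> \<le> \<tau>" "t \<in> {2 * \<delta>..pi/2 - 2 * \<delta>}" for a b t
  proof -
    have "b - a \<le> h" "a - b \<le> h" "a - t \<le> \<tau>" "t - a \<le> \<tau>" "2 * \<delta> \<le> t" "t \<le> pi/2 - 2 * \<delta>" "\<delta> = 2 * h"
      using that by (simp_all only: abs_le_iff atLeastAtMost_iff h_def) simp_all
    then have "h \<le> b" "b \<le> pi - h" using \<tau> d(1) pi_gt_zero by linarith+
    then show ?thesis by simp
  qed
  have B: "b1 \<in> {h..pi - h}" "b2 \<in> {h..pi - h}" "b3 \<in> {h..pi - h}"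
    using box[OF bs(1) near(1) d(2)] box[OF bs(2) near(2) d(2)] box[OF bs(3) near(3) d(2)] by auto
  define y1 y2 y3 where "y1 = b1 - a1" and "y2 = b2 - a2" and "y3 = b3 - a3"
  have "\<bar>y1 - ((cot (lat_angle (j + 2)) + cot (lat_angle (j + 1))) * ((X q + X r) / 2 - \<rho> q r)
      - cot (lat_angle (j + 1)) * ((X r + X p) / 2 - \<rho> r p) - cot (lat_angle (j + 2)) * ((X p + X q) / 2 - \<rho> p q))\<bar>
    \<le> 4 / (sin h)^4 * (\<bar>y1\<bar> * (\<bar>y1\<bar> + \<bar>a1 - lat_angle j\<bar>) + \<bar>y2\<bar> * (\<bar>y2\<bar> + \<bar>a2 - lat_angle (j + 2)\<bar>)
         + \<bar>y3\<bar> * (\<bar>y3\<bar> + \<bar>a3 - lat_angle (j + 1)\<bar>))"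
    unfolding y1_def y2_def y3_def
    by (rule angle_linearize[OF h t123 A sums(2) B sums(1) L])
  also have "\<dots> \<le> 4 / (sin h)^4 * (\<bar>y1\<bar> * (\<bar>y1\<bar> + \<tau>) + \<bar>y2\<bar> * (\<bar>y2\<bar> + \<tau>) + \<bar>y3\<bar> * (\<bar>y3\<bar> + \<tau>))"
    using near by (intro mult_left_mono add_mono) auto
  finally show "\<bar>\<xi> p j - ((cot (lat_angle (j + 2)) + cot (lat_angle (j + 1))) * ((X q + X r) / 2 - \<rho> q r)
      - cot (lat_angle (j + 1)) * ((X r + X p) / 2 - \<rho> r p) - cot (lat_angle (j + 2)) * ((X p + X q) / 2 - \<rho> p q))\<bar>
    \<le> 4 / (sin (\<delta> / 2))^4 * (\<bar>\<xi> p j\<bar> * (\<bar>\<xi> p j\<bar> + \<tau>) + \<bar>\<xi> q (j + 2)\<bar> * (\<bar>\<xi> q (j + 2)\<bar> + \<tau>)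
         + \<bar>\<xi> r (j + 4)\<bar> * (\<bar>\<xi> r (j + 4)\<bar> + \<tau>))"
    unfolding x y1_def y2_def y3_def h_def .
  have ls: "\<bar>ln (sin b1) - ln (sin a1)\<bar> \<le> 1 / (sin h)\<^sup>2 * \<bar>y1\<bar>" "\<bar>ln (sin b2) - ln (sin a2)\<bar> \<le> 1 / (sin h)\<^sup>2 * \<bar>y2\<bar>"
    unfolding y1_def y2_def by (rule ln_sin_lipschitz[OF h A(1) B(1)], rule ln_sin_lipschitz[OF h A(2) B(2)])
  have rr: "\<bar>\<rho> q r\<bar> \<le> R" "\<bar>\<rho> r p\<bar> \<le> R" using lf[OF e(1)] lf[OF e(2)] by (auto simp: \<rho>_def)
  have "X q - X p = 2 * ((ln (sin b1) - ln (sin a1)) - (ln (sin b2) - ln (sin a2)) + \<rho> q r - \<rho> r p)"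
    using L(1,2) by (simp add: field_simps)
  also have "\<bar>\<dots>\<bar> \<le> 2 * (1 / (sin h)\<^sup>2 * \<bar>y1\<bar> + 1 / (sin h)\<^sup>2 * \<bar>y2\<bar> + R + R)"
  proof -
    have "\<bar>2 * (A - B + s - t)\<bar> \<le> 2 * (m + n + R + R)"
      if "\<bar>A\<bar> \<le> m" "\<bar>B\<bar> \<le> n" "\<bar>s\<bar> \<le> R" "\<bar>t\<bar> \<le> R" for A B s t m n :: real
      using that by (auto simp: abs_le_iff)
    then show ?thesis using ls rr by blast
  qed
  finally show "\<bar>X q - X p\<bar> \<le> 2 / (sin (\<delta> / 2))\<^sup>2 * (\<bar>\<xi> p j\<bar> + \<bar>\<xi> q (j + 2)\<bar>) + 4 * R"
    unfolding x y1_def y2_def h_def by (simp add: algebra_simps add_divide_distrib)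
qed

text \<open>The two angles that face the edge from \<open>v\<close> to \<open>v + E k\<close>, which together are the argument of the cross-ratio of the two
  triangles at this edge. \<open>\<rho>_comb\<close> is what the length defects of \<open>f\<close> contribute to \<open>dev\<close> by \<open>angle_linearize\<close>, with
  opposite sign, and \<open>err\<close> collects the quadratic errors at the six corners of the two triangles.\<close>
definition dev :: "int \<Rightarrow> complex \<Rightarrow> real" where
  "dev k v = \<xi> (v + E (k - 1)) (k + 1) + \<xi> (v + E (k + 1)) (k - 2)"

definition \<rho>_comb :: "int \<Rightarrow> complex \<Rightarrow> real" where
  "\<rho>_comb k v = 2 * (cot (lat_angle k) + cot (lat_angle (k - 1))) * \<rho> v (v + E k)
     - cot (lat_angle (k - 1)) * (\<rho> v (v + E (k - 1)) + \<rho> (v + E (k + 1)) (v + E k))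
     - cot (lat_angle k) * (\<rho> (v + E (k - 1)) (v + E k) + \<rho> v (v + E (k + 1)))"

definition err :: "int \<Rightarrow> complex \<Rightarrow> real" where
  "err k v = (let s = (\<lambda>p j. \<bar>\<xi> p j\<bar> * (\<bar>\<xi> p j\<bar> + \<tau>)) in
     s (v + E (k - 1)) (k + 1) + s (v + E k) (k + 3) + s v (k - 1) +
     s (v + E (k + 1)) (k - 2) + s v k + s (v + E k) (k + 2))"

text \<open>The two triangles have equal angles at opposite vertices of the parallelogram. Hence the diagonal
  and the sides enter with weights that combine to the mixed second difference of \<open>X\<close> over the
  parallelogram.\<close>
lemma dev_linearize:
  assumes t: "tri v (k - 1) \<in> C" "tri v k \<in> C" and small: "\<Xi> \<le> (\<delta> / 2)\<^sup>2"
  shows "\<bar>dev k v + \<rho>_comb k v - (cot (lat_angle k) + cot (lat_angle (k - 1))) / 2 * (X (v + E k) + X v - X (v + E (k - 1)) - X (v + E (k + 1)))\<bar>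
     \<le> 4 / (sin (\<delta> / 2))^4 * err k v"
proof -
  define a b c where "a = v + E (k - 1)" and "b = v + E k" and "c = v + E (k + 1)"
  have Ek: "E k = E (k - 1) + E (k + 1)" using E_rec[of k] by simp
  note m2 = E_shift[of k]
  have ta: "tri a (k + 1) \<in> C" using t(1) tri_around_edge(1)[of v k] by (simp only: a_def)
  have tc: "tri c (k - 2) \<in> C" using t(2) tri_around_edge(4)[of v k] by (simp only: c_def)
  have kk: "k + 1 + 1 = k + 2" "k - 2 + 1 = k - 1" "k - 2 + 2 = k" "k - 2 + 4 = k + 2" "k + 1 + 2 = k + 3" "k + 1 + 4 = k + 5" by simp_all
  have av: "a + E (k + 1) = b" "a + E (k + 1 + 1) = v" unfolding kk m2 using Ek by (simp_all add: a_def b_def)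
  have cv: "c + E (k - 2) = v" "c + E (k - 2 + 1) = b" unfolding kk m2 using Ek by (simp_all add: c_def b_def)
  have ba': "lat_angle (k + 1 + 2) = lat_angle k" "lat_angle (k + 1 + 1) = lat_angle (k - 1)" "lat_angle (k - 2 + 2) = lat_angle k" "lat_angle (k - 2 + 1) = lat_angle (k - 1)"
    using lat_angle_plus_3[of k] lat_angle_plus_3[of "k - 1"] by (simp_all add: algebra_simps)
  have xm: "\<xi> v (k + 1 + 4) = \<xi> v (k - 1)" 
  proof -
    have "(k + 1 + 4) mod 6 = (k - 1) mod 6" by presburger
    then show ?thesis using \<xi>_mod by metis
  qed
  define s where "s p j = \<bar>\<xi> p j\<bar> * (\<bar>\<xi> p j\<bar> + \<tau>)" for p j
  have 1: "\<bar>\<xi> a (k + 1) - ((cot (lat_angle k) + cot (lat_angle (k - 1))) * ((X b + X v) / 2 - \<rho> b v)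
      - cot (lat_angle (k - 1)) * ((X v + X a) / 2 - \<rho> v a) - cot (lat_angle k) * ((X a + X b) / 2 - \<rho> a b))\<bar>
    \<le> 4 / (sin (\<delta> / 2))^4 * (s a (k + 1) + s b (k + 3) + s v (k - 1))"
    using triangle_data(1)[OF ta small] unfolding av ba' s_def xm unfolding kk .
  have 2: "\<bar>\<xi> c (k - 2) - ((cot (lat_angle k) + cot (lat_angle (k - 1))) * ((X v + X b) / 2 - \<rho> v b)
      - cot (lat_angle (k - 1)) * ((X b + X c) / 2 - \<rho> b c) - cot (lat_angle k) * ((X c + X v) / 2 - \<rho> c v))\<bar>
    \<le> 4 / (sin (\<delta> / 2))^4 * (s c (k - 2) + s v k + s b (k + 2))"
    using triangle_data(1)[OF tc small] unfolding cv ba' s_def unfolding kk .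
  have "dev k v + \<rho>_comb k v - (cot (lat_angle k) + cot (lat_angle (k - 1))) / 2 * (X b + X v - X a - X c)
    = (\<xi> a (k + 1) - ((cot (lat_angle k) + cot (lat_angle (k - 1))) * ((X b + X v) / 2 - \<rho> b v)
      - cot (lat_angle (k - 1)) * ((X v + X a) / 2 - \<rho> v a) - cot (lat_angle k) * ((X a + X b) / 2 - \<rho> a b)))
     + (\<xi> c (k - 2) - ((cot (lat_angle k) + cot (lat_angle (k - 1))) * ((X v + X b) / 2 - \<rho> v b)
      - cot (lat_angle (k - 1)) * ((X b + X c) / 2 - \<rho> b c) - cot (lat_angle k) * ((X c + X v) / 2 - \<rho> c v)))"
    unfolding dev_def \<rho>_comb_def a_def[symmetric] b_def[symmetric] c_def[symmetric] \<rho>_sym[of b v] \<rho>_sym[of b c] \<rho>_sym[of c v]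
    by (simp add: field_simps)
  also have "\<bar>\<dots>\<bar> \<le> 4 / (sin (\<delta> / 2))^4 * (s a (k + 1) + s b (k + 3) + s v (k - 1))
     + 4 / (sin (\<delta> / 2))^4 * (s c (k - 2) + s v k + s b (k + 2))"
    using 1 2 by linarith
  also have "\<dots> = 4 / (sin (\<delta> / 2))^4 * err k v"
    unfolding err_def Let_def s_def a_def b_def c_def by (simp only: distrib_left add_ac)
  finally show ?thesis unfolding a_def b_def c_def .
qed

lemma sum_err:
  assumes t: "\<And>v. v \<in> B \<Longrightarrow> tri v (k - 1) \<in> C" "\<And>v. v \<in> B \<Longrightarrow> tri v k \<in> C" and "0 \<le> \<tau>"
  shows "(\<Sum>v\<in>B. err k v) \<le> 6 * (\<Xi> + \<tau> * sqrt (card B * \<Xi>))"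
proof -
  have one: "(\<Sum>v\<in>B. \<bar>\<xi> (v + o') j\<bar> * (\<bar>\<xi> (v + o') j\<bar> + \<tau>)) \<le> \<Xi> + \<tau> * sqrt (card B * \<Xi>)"
    if "\<And>v. v \<in> B \<Longrightarrow> tri (v + o') j \<in> C" for o' j
  proof -
    have "(\<Sum>v\<in>B. \<bar>\<xi> (v + o') j\<bar> * (\<bar>\<xi> (v + o') j\<bar> + \<tau>)) = (\<Sum>v\<in>B. (\<xi> (v + o') j)\<^sup>2) + \<tau> * (\<Sum>v\<in>B. \<bar>\<xi> (v + o') j\<bar>)"
      by (simp add: sum.distrib sum_distrib_left distrib_left power2_eq_square mult.commute)
    also have "\<dots> \<le> \<Xi> + \<tau> * sqrt (card B * \<Xi>)"
      using sum_\<xi>_sq[of B o' j, OF that] sum_\<xi>_abs[of B o' j, OF that] assms(3) by (intro add_mono mult_left_mono)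
    finally show ?thesis .
  qed
  have T: "tri (v + E (k - 1)) (k + 1) \<in> C" "tri (v + E k) (k + 3) \<in> C" "tri (v + 0) (k - 1) \<in> C"
     "tri (v + E (k + 1)) (k - 2) \<in> C" "tri (v + 0) k \<in> C" "tri (v + E k) (k + 2) \<in> C" if "v \<in> B" for v
    unfolding tri_around_edge add_0_right using t[OF that] by blast+
  define s where "s p j = \<bar>\<xi> p j\<bar> * (\<bar>\<xi> p j\<bar> + \<tau>)" for p j
  have S: "(\<Sum>v\<in>B. s (v + E (k - 1)) (k + 1)) \<le> \<Xi> + \<tau> * sqrt (card B * \<Xi>)"
    "(\<Sum>v\<in>B. s (v + E k) (k + 3)) \<le> \<Xi> + \<tau> * sqrt (card B * \<Xi>)"
    "(\<Sum>v\<in>B. s (v + 0) (k - 1)) \<le> \<Xi> + \<tau> * sqrt (card B * \<Xi>)"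
    "(\<Sum>v\<in>B. s (v + E (k + 1)) (k - 2)) \<le> \<Xi> + \<tau> * sqrt (card B * \<Xi>)"
    "(\<Sum>v\<in>B. s (v + 0) k) \<le> \<Xi> + \<tau> * sqrt (card B * \<Xi>)"
    "(\<Sum>v\<in>B. s (v + E k) (k + 2)) \<le> \<Xi> + \<tau> * sqrt (card B * \<Xi>)"
    unfolding s_def by (rule one, erule T)+
  have "(\<Sum>v\<in>B. err k v) \<le> (\<Xi> + \<tau> * sqrt (card B * \<Xi>)) + (\<Xi> + \<tau> * sqrt (card B * \<Xi>)) + (\<Xi> + \<tau> * sqrt (card B * \<Xi>))
     + (\<Xi> + \<tau> * sqrt (card B * \<Xi>)) + (\<Xi> + \<tau> * sqrt (card B * \<Xi>)) + (\<Xi> + \<tau> * sqrt (card B * \<Xi>))"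
    unfolding err_def Let_def s_def[symmetric] sum.distrib using S unfolding add_0_right by (intro add_mono)
  then show ?thesis by simp
qed

text \<open>The mixed second difference is the difference of the values of \<open>D\<close> at \<open>v + E (k + 1)\<close> and at \<open>v\<close>, so
  summation by parts moves one difference to \<open>\<phi>\<close>, where it costs a factor \<open>mesh\<close>. The other one is
  bounded by \<open>triangle_data\<close> and the Cauchy-Schwarz inequality.\<close>
lemma averaged_second_difference:
  assumes \<phi>: "\<And>x y. \<bar>\<phi> x - \<phi> y\<bar> \<le> l * cmod (x - y)" "\<And>x. x \<notin> cball z r \<Longrightarrow> \<phi> x = 0" and l: "0 \<le> l"
    and star: "\<And>v j. v \<in> V \<inter> cball z (r + mesh) \<Longrightarrow> tri v j \<in> C" and small: "\<Xi> \<le> (\<delta> / 2)\<^sup>2" and R: "0 \<le> R"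
  defines "N \<equiv> real (card (V \<inter> cball z (r + mesh)))"
  shows "\<bar>\<Sum>v\<in>V \<inter> cball z r. \<phi> v * (X (v + E k) + X v - X (v + E (k - 1)) - X (v + E (k + 1)))\<bar>
     \<le> l * mesh * (4 / (sin (\<delta> / 2))\<^sup>2 * sqrt (N * \<Xi>) + 4 * R * N)"
proof -
  define q where "q = E (k + 1)"
  define D where "D v = X (v + E (k - 1)) - X v" for v
  define P where "P = V \<inter> cball z (r + mesh)"
  define B where "B = V \<inter> cball z r"
  have fP: "finite P" unfolding P_def by (rule finite_V_bounded) simp
  have BP: "B \<subseteq> P" unfolding B_def P_def using mesh_pos by auto
  have qV: "v + q \<in> V \<longleftrightarrow> v \<in> V" for v
  proof
    assume "v + q \<in> V"
    then have "v + q + E (k + 4) \<in> V" by (rule V_add_E)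
    then show "v \<in> V" unfolding E_shift(3) q_def by simp
  qed (simp add: q_def V_add_E)
  have nq: "cmod q \<le> mesh" by (simp add: q_def norm_E_le_mesh)
  have Ek: "E k = E (k - 1) + E (k + 1)" using E_rec[of k] by simp
  have "(\<Sum>v\<in>B. \<phi> v * (X (v + E k) + X v - X (v + E (k - 1)) - X (v + E (k + 1)))) = (\<Sum>v\<in>B. \<phi> v * D (v + q)) - (\<Sum>v\<in>B. \<phi> v * D v)"
    unfolding sum_subtractf[symmetric] by (rule sum.cong) (simp_all add: D_def q_def Ek algebra_simps)
  also have "(\<Sum>v\<in>B. \<phi> v * D v) = (\<Sum>v\<in>P. \<phi> v * D v)"
    by (rule sum.mono_neutral_left[OF fP BP]) (auto simp: P_def B_def \<phi>(2))
  also have "(\<Sum>v\<in>B. \<phi> v * D (v + q)) = (\<Sum>v\<in>(\<lambda>v. v + q) ` B. \<phi> (v - q) * D v)"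
    by (subst sum.reindex) (auto simp: inj_on_def)
  also have "\<dots> = (\<Sum>v\<in>P. \<phi> (v - q) * D v)"
  proof (rule sum.mono_neutral_left[OF fP])
    show "(\<lambda>v. v + q) ` B \<subseteq> P"
    proof
      fix x assume "x \<in> (\<lambda>v. v + q) ` B"
      then obtain v where v: "x = v + q" "v \<in> V" "dist z v \<le> r" by (auto simp: B_def)
      have "dist z x \<le> dist z v + dist v x" by (rule dist_triangle)
      also have "dist v x = cmod q" unfolding v(1) by (simp add: dist_norm)
      finally show "x \<in> P" using v nq qV by (simp add: P_def)
    qed
    show "\<forall>i\<in>P - (\<lambda>v. v + q) ` B. \<phi> (i - q) * D i = 0"
    proof
      fix i assume i: "i \<in> P - (\<lambda>v. v + q) ` B"
      have "i - q \<notin> B" using i by (metis Diff_iff diff_add_cancel image_eqI)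
      moreover have "i - q \<in> V" using i qV[of "i - q"] by (simp add: P_def)
      ultimately show "\<phi> (i - q) * D i = 0" using \<phi>(2) by (simp add: B_def)
    qed
  qed
  also have "(\<Sum>v\<in>P. \<phi> (v - q) * D v) - (\<Sum>v\<in>P. \<phi> v * D v) = (\<Sum>v\<in>P. (\<phi> (v - q) - \<phi> v) * D v)"
    by (simp add: sum_subtractf left_diff_distrib)
  also have "\<bar>\<dots>\<bar> \<le> (\<Sum>v\<in>P. l * mesh * (2 / (sin (\<delta> / 2))\<^sup>2 * (\<bar>\<xi> (v + 0) (k - 1)\<bar> + \<bar>\<xi> (v + E (k - 1)) (k + 1)\<bar>) + 4 * R))"
  proof (rule order_trans[OF sum_abs sum_mono])
    fix v assume v: "v \<in> P"
    have t: "tri v (k - 1) \<in> C" using star v by (simp add: P_def)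
    have kk: "k - 1 + 2 = k + 1" by simp
    have "\<bar>D v\<bar> \<le> 2 / (sin (\<delta> / 2))\<^sup>2 * (\<bar>\<xi> v (k - 1)\<bar> + \<bar>\<xi> (v + E (k - 1)) (k + 1)\<bar>) + 4 * R"
      using triangle_data(2)[OF t small] unfolding kk D_def .
    moreover have "\<bar>\<phi> (v - q) - \<phi> v\<bar> \<le> l * mesh"
    proof -
      have "\<bar>\<phi> (v - q) - \<phi> v\<bar> \<le> l * cmod (v - q - v)" by (rule \<phi>(1))
      also have "cmod (v - q - v) = cmod q" by simp
      also have "l * cmod q \<le> l * mesh" using nq l by (rule mult_left_mono)
      finally show ?thesis .
    qed
    ultimately show "\<bar>(\<phi> (v - q) - \<phi> v) * D v\<bar> \<le> l * mesh * (2 / (sin (\<delta> / 2))\<^sup>2 * (\<bar>\<xi> (v + 0) (k - 1)\<bar> + \<bar>\<xi> (v + E (k - 1)) (k + 1)\<bar>) + 4 * R)"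
      unfolding abs_mult by (intro mult_mono) auto
  qed
  also have "\<dots> = l * mesh * (2 / (sin (\<delta> / 2))\<^sup>2 * ((\<Sum>v\<in>P. \<bar>\<xi> (v + 0) (k - 1)\<bar>) + (\<Sum>v\<in>P. \<bar>\<xi> (v + E (k - 1)) (k + 1)\<bar>)) + 4 * R * N)"
    unfolding sum_distrib_left[symmetric] sum.distrib by (simp add: N_def P_def)
  also have "\<dots> \<le> l * mesh * (2 / (sin (\<delta> / 2))\<^sup>2 * (sqrt (N * \<Xi>) + sqrt (N * \<Xi>)) + 4 * R * N)"
  proof -
    have "(\<Sum>v\<in>P. \<bar>\<xi> (v + 0) (k - 1)\<bar>) \<le> sqrt (N * \<Xi>)"
      unfolding N_def P_def[symmetric] by (rule sum_\<xi>_abs) (use star in \<open>simp add: P_def\<close>)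
    moreover have "(\<Sum>v\<in>P. \<bar>\<xi> (v + E (k - 1)) (k + 1)\<bar>) \<le> sqrt (N * \<Xi>)"
      unfolding N_def P_def[symmetric]
    proof (rule sum_\<xi>_abs)
      fix v assume "v \<in> P"
      then show "tri (v + E (k - 1)) (k + 1) \<in> C" using star[of v "k - 1"] unfolding tri_around_edge P_def by blast
    qed
    ultimately have i: "2 / (sin (\<delta> / 2))\<^sup>2 * ((\<Sum>v\<in>P. \<bar>\<xi> (v + 0) (k - 1)\<bar>) + (\<Sum>v\<in>P. \<bar>\<xi> (v + E (k - 1)) (k + 1)\<bar>))
        \<le> 2 / (sin (\<delta> / 2))\<^sup>2 * (sqrt (N * \<Xi>) + sqrt (N * \<Xi>))"
      by (intro mult_left_mono add_mono) auto
    show ?thesis by (rule mult_left_mono[OF add_right_mono[OF i]]) (use l mesh_pos in simp)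
  qed
  finally show ?thesis by (simp add: B_def)
qed

lemma averaged_deviation:
  assumes \<phi>: "\<And>x y. \<bar>\<phi> x - \<phi> y\<bar> \<le> l * cmod (x - y)" "\<And>x. x \<notin> cball z r \<Longrightarrow> \<phi> x = 0" "\<And>x. \<bar>\<phi> x\<bar> \<le> 1" and l: "0 \<le> l"
    and star: "\<And>v j. v \<in> V \<inter> cball z (r + mesh) \<Longrightarrow> tri v j \<in> C" and small: "\<Xi> \<le> (\<delta> / 2)\<^sup>2" and R: "0 \<le> R" "0 \<le> \<tau>"
  defines "N \<equiv> real (card (V \<inter> cball z (r + mesh)))"
  shows "\<bar>\<Sum>v\<in>V \<inter> cball z r. \<phi> v * (dev k v + \<rho>_comb k v)\<bar>
     \<le> 24 / (sin (\<delta> / 2))^4 * (\<Xi> + \<tau> * sqrt (N * \<Xi>))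
       + 1 / (sin (\<delta> / 2))\<^sup>2 * (l * mesh * (4 / (sin (\<delta> / 2))\<^sup>2 * sqrt (N * \<Xi>) + 4 * R * N))"
proof -
  define B where "B = V \<inter> cball z r"
  define Y where "Y v = X (v + E k) + X v - X (v + E (k - 1)) - X (v + E (k + 1))" for v
  define cc where "cc = (cot (lat_angle k) + cot (lat_angle (k - 1))) / 2"
  define M where "M = 4 / (sin (\<delta> / 2))^4"
  have M: "M \<ge> 0" by (simp add: M_def)
  have fP: "finite (V \<inter> cball z (r + mesh))" by (rule finite_V_bounded) simp
  have BP: "B \<subseteq> V \<inter> cball z (r + mesh)" unfolding B_def using mesh_pos by auto
  have st: "tri v j \<in> C" if "v \<in> B" for v j using star BP that by blast
  define S1 S2 where "S1 = (\<Sum>v\<in>B. \<phi> v * (dev k v + \<rho>_comb k v - cc * Y v))" and "S2 = (\<Sum>v\<in>B. \<phi> v * Y v)"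
  have split: "(\<Sum>v\<in>B. \<phi> v * (dev k v + \<rho>_comb k v)) = S1 + cc * S2"
    unfolding S1_def S2_def sum_distrib_left sum.distrib[symmetric] by (rule sum.cong) (simp_all add: algebra_simps)
  have tri_ineq: "\<bar>S1 + cc * S2\<bar> \<le> \<bar>S1\<bar> + \<bar>cc\<bar> * \<bar>S2\<bar>"
    unfolding abs_mult[symmetric] by (rule abs_triangle_ineq)
  have "\<bar>S1\<bar> \<le> (\<Sum>v\<in>B. M * err k v)"
    unfolding S1_def
  proof (rule order_trans[OF sum_abs sum_mono])
    fix v assume v: "v \<in> B"
    have "\<bar>dev k v + \<rho>_comb k v - cc * Y v\<bar> \<le> M * err k v"
      unfolding cc_def Y_def M_def by (rule dev_linearize[OF st[OF v] st[OF v] small])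
    then have "\<bar>\<phi> v\<bar> * \<bar>dev k v + \<rho>_comb k v - cc * Y v\<bar> \<le> 1 * (M * err k v)"
      using \<phi>(3)[of v] by (intro mult_mono) auto
    then show "\<bar>\<phi> v * (dev k v + \<rho>_comb k v - cc * Y v)\<bar> \<le> M * err k v" by (simp add: abs_mult)
  qed
  moreover have "(\<Sum>v\<in>B. M * err k v) \<le> M * (6 * (\<Xi> + \<tau> * sqrt (N * \<Xi>)))"
    unfolding sum_distrib_left[symmetric]
  proof (rule mult_left_mono[OF order_trans[OF sum_err[OF st st R(2)]] M])
    have "real (card B) \<le> N" unfolding N_def using card_mono[OF fP BP] by simp
    then have "sqrt (card B * \<Xi>) \<le> sqrt (N * \<Xi>)" using \<Xi>_nonneg by (intro real_sqrt_le_mono mult_right_mono)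
    then show "6 * (\<Xi> + \<tau> * sqrt (card B * \<Xi>)) \<le> 6 * (\<Xi> + \<tau> * sqrt (N * \<Xi>))"
      using R(2) by (simp add: mult_left_mono)
  qed
  moreover have "\<bar>cc\<bar> * \<bar>S2\<bar> \<le> 1 / (sin (\<delta> / 2))\<^sup>2 * (l * mesh * (4 / (sin (\<delta> / 2))\<^sup>2 * sqrt (N * \<Xi>) + 4 * R * N))"
  proof (rule mult_mono)
    have "\<bar>cot (lat_angle j)\<bar> \<le> 1 / (sin (\<delta> / 2))\<^sup>2" for j
      using d(1) d(2)[of j] by (intro cot_bound) auto
    moreover have "\<bar>(x + y) / 2\<bar> \<le> m" if "\<bar>x\<bar> \<le> m" "\<bar>y\<bar> \<le> m" for x y m :: real
      using that by (auto simp: abs_le_iff)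
    ultimately show "\<bar>cc\<bar> \<le> 1 / (sin (\<delta> / 2))\<^sup>2" unfolding cc_def by blast
    show "\<bar>S2\<bar> \<le> l * mesh * (4 / (sin (\<delta> / 2))\<^sup>2 * sqrt (N * \<Xi>) + 4 * R * N)"
      unfolding S2_def B_def Y_def N_def by (rule averaged_second_difference[OF \<phi>(1,2) l star small R(1)])
  qed auto
  moreover have "M * (6 * (\<Xi> + \<tau> * sqrt (N * \<Xi>))) = 24 / (sin (\<delta> / 2))^4 * (\<Xi> + \<tau> * sqrt (N * \<Xi>))"
    by (simp add: M_def)
  ultimately show ?thesis unfolding B_def[symmetric] split using tri_ineq by linarith
qed

end

context triangular_lattice
begin

section \<open>Counting vertices\<close>
lemma card_V_Int_cball_le:
  assumes "0 \<le> M"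
  shows "real (card (V \<inter> cball 0 M)) \<le> (2 * (M * (norm (E 1) + norm (E 2)) / area2) + 3)\<^sup>2"
proof -
  define x where "x = M * (norm (E 1) + norm (E 2)) / area2"
  define N where "N = \<lceil>x\<rceil>"
  have x: "0 \<le> x" unfolding x_def using assms area2_pos by simp
  then have N: "0 \<le> N" "real_of_int N \<le> x + 1" unfolding N_def by linarith+
  have "card (V \<inter> cball 0 M) \<le> card ((\<lambda>(n, m). of_int n * E 1 + of_int m * E 2) ` ({- N..N} \<times> {- N..N}))"
    using V_Int_cball_subset[of M] unfolding N_def x_def by (intro card_mono) auto
  also have "\<dots> \<le> card ({- N..N} \<times> {- N..N})" by (rule card_image_le) simp
  finally have "real (card (V \<inter> cball 0 M)) \<le> real (card ({- N..N} \<times> {- N..N}))" by (simp only: of_nat_le_iff)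
  also have "\<dots> = (2 * N + 1)\<^sup>2" using N(1) by (simp add: card_cartesian_product power2_eq_square)
  also have "\<dots> \<le> (2 * x + 3)\<^sup>2" using N by (simp add: power_mono)
  finally show ?thesis by (simp add: x_def)
qed

text \<open>A parallelogram of \<open>n\<close> times \<open>n\<close> vertices near \<open>z\<close>, with \<open>n\<close> about \<open>r / (4 mesh)\<close>, fits into the disc.\<close>
lemma card_V_Int_cball_ge:
  assumes r: "16 * mesh \<le> r"
  shows "(r / (8 * mesh))\<^sup>2 \<le> card (V \<inter> cball z (r / 2))"
proof -
  define n where "n = nat (\<lfloor>r / (4 * mesh)\<rfloor> - 1)"
  define p where "p = (\<lambda>(i, j). of_int (\<lfloor>cx z\<rfloor> + int i) * E 1 + of_int (\<lfloor>cy z\<rfloor> + int j) * E 2)"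
  have q: "4 \<le> r / (4 * mesh)" using r mesh_pos by (simp add: field_simps)
  have fl: "real_of_int \<lfloor>r / (4 * mesh)\<rfloor> \<le> r / (4 * mesh)" "r / (4 * mesh) < real_of_int \<lfloor>r / (4 * mesh)\<rfloor> + 1" by linarith+
  have n: "real n = \<lfloor>r / (4 * mesh)\<rfloor> - 1" unfolding n_def using q by (subst of_nat_nat) linarith+
  have lower: "r / (8 * mesh) \<le> real n"
  proof -
    have "r / (8 * mesh) = (r / (4 * mesh)) / 2" by simp
    then show ?thesis using n fl(2) q by linarith
  qed
  have cxp: "cx (p (i, j)) = real_of_int (\<lfloor>cx z\<rfloor> + int i)" "cy (p (i, j)) = real_of_int (\<lfloor>cy z\<rfloor> + int j)" for i j
    by (simp_all only: p_def case_prod_conv cx_linear cy_linear cxy_E mult_zero_right mult_1_right add_0_left add_0_right)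
  have inj: "inj_on p ({..<n} \<times> {..<n})"
  proof (rule inj_onI)
    fix a b assume e: "p a = p b"
    obtain i j i' j' where ab: "a = (i, j)" "b = (i', j')" by (cases a; cases b)
    have "cx (p a) = cx (p b)" "cy (p a) = cy (p b)" using e by simp_all
    then show "a = b" unfolding ab cxp by simp
  qed
  have "p ` ({..<n} \<times> {..<n}) \<subseteq> V \<inter> cball z (r / 2)"
  proof
    fix y assume "y \<in> p ` ({..<n} \<times> {..<n})"
    then obtain i j where ij: "i < n" "j < n" "y = p (i, j)" by auto
    have yV: "y \<in> V" unfolding ij(3) V_iff cxp by (simp only: Ints_of_int)
    define s t where "s = cx (y - z)" and "t = cy (y - z)"
    have st: "s = \<lfloor>cx z\<rfloor> + real i - cx z" "t = \<lfloor>cy z\<rfloor> + real j - cy z"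
      by (simp_all add: s_def t_def ij(3) cxp)
    have ijr: "real i \<le> real n - 1" "real j \<le> real n - 1" using ij by simp_all
    have "\<bar>s\<bar> \<le> real n" "\<bar>t\<bar> \<le> real n" unfolding st abs_le_iff using ijr of_nat_0_le_iff[of i] of_nat_0_le_iff[of j] by linarith+
    moreover have "y - z = of_real s * E 1 + of_real t * E 2" unfolding s_def t_def by (rule cx_cy_decomp)
    ultimately have "norm (y - z) \<le> real n * mesh + real n * mesh"
      using norm_E_le_mesh mesh_pos
      by (simp only:) (intro norm_triangle_le add_mono; simp add: norm_mult mult_mono)
    also have "\<dots> = 2 * mesh * real n" by simp
    also have "\<dots> \<le> 2 * mesh * (r / (4 * mesh))"
    proof (rule mult_left_mono)
      show "real n \<le> r / (4 * mesh)" using n fl(1) by linarith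
    qed (use mesh_pos in simp)
    also have "\<dots> = r / 2" using mesh_pos by simp
    finally show "y \<in> V \<inter> cball z (r / 2)" using yV by (simp add: dist_norm norm_minus_commute)
  qed
  then have "card (p ` ({..<n} \<times> {..<n})) \<le> card (V \<inter> cball z (r / 2))"
    by (intro card_mono finite_V_bounded) simp_all
  then have "n * n \<le> card (V \<inter> cball z (r / 2))" using card_image[OF inj] by (simp add: card_cartesian_product)
  then have "real n * real n \<le> card (V \<inter> cball z (r / 2))" by (metis of_nat_le_iff of_nat_mult)
  moreover have "(r / (8 * mesh))\<^sup>2 \<le> (real n)\<^sup>2" using lower r mesh_pos by (intro power_mono) auto
  ultimately show ?thesis by (simp add: power2_eq_square)
qed

end

section \<open>The conformal map on the lattice\<close>
text \<open>The Taylor estimates of \<open>log_quotient\<close>, uniformly for base points in \<open>K\<close> and offsets of size at most \<open>m\<close>.\<close>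
definition smooth_bounds :: "(complex \<Rightarrow> complex) \<Rightarrow> complex set \<Rightarrow> real \<Rightarrow> real \<Rightarrow> bool" where
  "smooth_bounds f K \<eta> c \<longleftrightarrow> 0 < \<eta> \<and> \<eta> \<le> 1 \<and> 0 < c \<and> (\<forall>v\<in>K. deriv f v \<noteq> 0 \<and> norm (A3 f v - (A2 f v)\<^sup>2) \<le> c \<and>
     (\<forall>m s t. m \<le> \<eta> \<and> norm s \<le> m \<and> norm t \<le> m \<longrightarrow>
        diff_quotient f (v + s) (v + t) = deriv f v * exp (log_quotient f v s t) \<and>
        norm (log_quotient f v s t) \<le> c * m \<and> norm (log_quotient f v s t - P2 f v s t) \<le> c * m ^ 3))"

lemma smooth_bounds_exist:
  assumes D: "open D" and f: "f holomorphic_on D" "\<And>z. z \<in> D \<Longrightarrow> deriv f z \<noteq> 0"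
    and K: "compact K" "K \<subseteq> D"
  obtains \<eta> c where "smooth_bounds f K \<eta> c"
proof -
  have ex: "\<exists>\<eta> C. 0 < \<eta> \<and> \<eta> \<le> 1 \<and> 0 < C \<and> (\<forall>v\<in>K. \<forall>m s t. m \<le> \<eta> \<and> norm s \<le> m \<and> norm t \<le> m \<longrightarrow>
      diff_quotient f (v + s) (v + t) = deriv f v * exp (log_quotient f v s t) \<and> norm (log_quotient f v s t) \<le> C * m \<and>
      norm (log_quotient f v s t - P2 f v s t) \<le> C * m ^ 3)" (is "\<exists>\<eta> C. ?P \<eta> C")
  proof (rule log_quotient_taylor[OF assms])
    fix \<eta> C :: real
    assume h: "0 < \<eta>" "\<eta> \<le> 1" "0 < C"
      and T: "\<And>v m s t. v \<in> K \<Longrightarrow> m \<le> \<eta> \<Longrightarrow> norm s \<le> m \<Longrightarrow> norm t \<le> m \<Longrightarrow> diff_quotient f (v + s) (v + t) = deriv f v * exp (log_quotient f v s t)"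
        "\<And>v m s t. v \<in> K \<Longrightarrow> m \<le> \<eta> \<Longrightarrow> norm s \<le> m \<Longrightarrow> norm t \<le> m \<Longrightarrow> norm (log_quotient f v s t) \<le> C * m"
        "\<And>v m s t. v \<in> K \<Longrightarrow> m \<le> \<eta> \<Longrightarrow> norm s \<le> m \<Longrightarrow> norm t \<le> m \<Longrightarrow> norm (log_quotient f v s t - P2 f v s t) \<le> C * m ^ 3"
    have "?P \<eta> C"
    proof (intro conjI h ballI allI impI)
      fix v s t :: complex and m :: real assume v: "v \<in> K" and a: "m \<le> \<eta> \<and> norm s \<le> m \<and> norm t \<le> m"
      then have a': "m \<le> \<eta>" "norm s \<le> m" "norm t \<le> m" by blast+
      show "diff_quotient f (v + s) (v + t) = deriv f v * exp (log_quotient f v s t)" by (rule T(1)[OF v a'])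
      show "norm (log_quotient f v s t) \<le> C * m" by (rule T(2)[OF v a'])
      show "norm (log_quotient f v s t - P2 f v s t) \<le> C * m ^ 3" by (rule T(3)[OF v a'])
    qed
    then show ?thesis by blast
  qed
  obtain \<eta> C where \<eta>: "\<eta> > 0" "\<eta> \<le> 1" "C > 0"
    and T: "\<And>v m s t. v \<in> K \<Longrightarrow> m \<le> \<eta> \<Longrightarrow> norm s \<le> m \<Longrightarrow> norm t \<le> m \<Longrightarrow> diff_quotient f (v + s) (v + t) = deriv f v * exp (log_quotient f v s t)"
    "\<And>v m s t. v \<in> K \<Longrightarrow> m \<le> \<eta> \<Longrightarrow> norm s \<le> m \<Longrightarrow> norm t \<le> m \<Longrightarrow> norm (log_quotient f v s t) \<le> C * m"
    "\<And>v m s t. v \<in> K \<Longrightarrow> m \<le> \<eta> \<Longrightarrow> norm s \<le> m \<Longrightarrow> norm t \<le> m \<Longrightarrow> norm (log_quotient f v s t - P2 f v s t) \<le> C * m ^ 3"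
    using ex by blast
  have hol: "(deriv ^^ n) f holomorphic_on D" for n
    by (induction n) (auto intro: f(1) holomorphic_deriv[OF _ D])
  have cont: "continuous_on K ((deriv ^^ n) f)" for n
    using hol K(2) by (meson continuous_on_subset holomorphic_on_imp_continuous_on)
  have "continuous_on K (\<lambda>v. A3 f v - (A2 f v)\<^sup>2)"
    unfolding A2_def A3_def using cont[of 1] cont[of 2] cont[of 3] f(2) K(2)
    by (intro continuous_on_diff continuous_on_power continuous_on_divide continuous_on_mult continuous_on_const)
      (auto simp: numeral_2_eq_2 numeral_3_eq_3)
  then have "bounded ((\<lambda>v. A3 f v - (A2 f v)\<^sup>2) ` K)" using K(1) compact_continuous_image compact_imp_bounded by blast
  then obtain B where B: "B > 0" "\<And>v. v \<in> K \<Longrightarrow> norm (A3 f v - (A2 f v)\<^sup>2) \<le> B" unfolding bounded_pos by blast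
  define c where "c = max B C"
  have le: "C * m \<le> c * m" "C * m ^ 3 \<le> c * m ^ 3" if "norm s \<le> m" for m and s :: complex
  proof -
    have "0 \<le> m" using that norm_ge_zero order_trans by blast
    then show "C * m \<le> c * m" "C * m ^ 3 \<le> c * m ^ 3" by (auto intro!: mult_right_mono simp: c_def)
  qed
  show ?thesis
  proof (rule that[of \<eta> c], unfold smooth_bounds_def, intro conjI ballI allI impI)
    show "0 < \<eta>" "\<eta> \<le> 1" "0 < c" using \<eta> B by (auto simp: c_def)
    fix v assume v: "v \<in> K"
    show "deriv f v \<noteq> 0" using f(2) K(2) v by blast
    show "norm (A3 f v - (A2 f v)\<^sup>2) \<le> c" using B(2)[OF v] by (simp add: c_def)
    fix m :: real and s t :: complex
    assume a: "m \<le> \<eta> \<and> norm s \<le> m \<and> norm t \<le> m"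
    show "diff_quotient f (v + s) (v + t) = deriv f v * exp (log_quotient f v s t)" using T(1)[OF v] a by blast
    show "norm (log_quotient f v s t) \<le> c * m" using T(2)[OF v, of m s t] le(1)[of s m] a by linarith
    show "norm (log_quotient f v s t - P2 f v s t) \<le> c * m ^ 3" using T(3)[OF v, of m s t] le(2)[of s m] a by linarith
  qed
qed

lemma smooth_boundsD:
  assumes "smooth_bounds f K \<eta> c" "v \<in> K"
  shows "0 < \<eta>" "\<eta> \<le> 1" "0 < c" "deriv f v \<noteq> 0" "norm (A3 f v - (A2 f v)\<^sup>2) \<le> c"
    "m \<le> \<eta> \<Longrightarrow> norm s \<le> m \<Longrightarrow> norm t \<le> m \<Longrightarrow> diff_quotient f (v + s) (v + t) = deriv f v * exp (log_quotient f v s t)"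
    "m \<le> \<eta> \<Longrightarrow> norm s \<le> m \<Longrightarrow> norm t \<le> m \<Longrightarrow> norm (log_quotient f v s t) \<le> c * m"
    "m \<le> \<eta> \<Longrightarrow> norm s \<le> m \<Longrightarrow> norm t \<le> m \<Longrightarrow> norm (log_quotient f v s t - P2 f v s t) \<le> c * m ^ 3"
  using assms unfolding smooth_bounds_def by blast+

text \<open>Apply \<open>P2_defect\<close> to the real part of \<open>log_quotient\<close>; its values on the diagonal are the logarithms of
  quotients of \<open>f'\<close>.\<close>
lemma log_length_defect:
  assumes sb: "smooth_bounds f K \<eta> c" "v \<in> K" and m: "m \<le> \<eta>" "norm s \<le> m" "norm t \<le> m" and st: "s \<noteq> t"
  defines "D \<equiv> ln (cmod (f (v + s) - f (v + t))) - ln (cmod ((v + s) - (v + t)))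
      - (ln (cmod (deriv f (v + s))) + ln (cmod (deriv f (v + t)))) / 2"
  shows "f (v + s) \<noteq> f (v + t)" "\<bar>D + Re ((t - s)\<^sup>2 * (A3 f v - (A2 f v)\<^sup>2)) / 2\<bar> \<le> 2 * c * m ^ 3"
proof -
  note S = smooth_boundsD[OF sb]
  note q = S(6)[OF m] and ss = S(6)[OF m(1,2,2)] and tt = S(6)[OF m(1,3,3)]
  show "f (v + s) \<noteq> f (v + t)" using ln_cmod_quotient(1)[OF q S(4) st] by simp
  have l: "ln (cmod (f (v + s) - f (v + t))) = ln (cmod (t - s)) + ln (cmod (deriv f v)) + Re (log_quotient f v s t)"
    using ln_cmod_quotient(2)[OF q S(4) st] by (simp add: norm_minus_commute)
  have w: "ln (cmod (deriv f (v + x))) = ln (cmod (deriv f v)) + Re (log_quotient f v x x)" if "norm x \<le> m" for x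
  proof -
    have "deriv f (v + x) = deriv f v * exp (log_quotient f v x x)" using S(6)[OF m(1) that that] by (simp add: diff_quotient_def)
    then show ?thesis using S(4) by (simp add: norm_mult ln_mult)
  qed
  have D: "D = Re (log_quotient f v s t - (log_quotient f v s s + log_quotient f v t t) / 2)"
    unfolding D_def l w[OF m(2)] w[OF m(3)] by (simp add: norm_minus_commute field_simps)
  define x y z where "x = log_quotient f v s t - P2 f v s t" and "y = log_quotient f v s s - P2 f v s s" and "z = log_quotient f v t t - P2 f v t t"
  have n: "norm x \<le> c * m ^ 3" "norm y \<le> c * m ^ 3" "norm z \<le> c * m ^ 3"
    unfolding x_def y_def z_def by (rule S(8)[OF m], rule S(8)[OF m(1,2,2)], rule S(8)[OF m(1,3,3)])
  have "log_quotient f v s t - (log_quotient f v s s + log_quotient f v t t) / 2 = x - (y + z) / 2 + (P2 f v s t - (P2 f v s s + P2 f v t t) / 2)"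
    by (simp add: x_def y_def z_def field_simps)
  also have "\<dots> = x - (y + z) / 2 - ((t - s)\<^sup>2 * (A3 f v - (A2 f v)\<^sup>2)) / 2" unfolding P2_defect by simp
  finally have "D + Re ((t - s)\<^sup>2 * (A3 f v - (A2 f v)\<^sup>2)) / 2 = Re (x - (y + z) / 2)" unfolding D by simp
  also have "\<bar>\<dots>\<bar> \<le> norm (x - (y + z) / 2)" by (rule abs_Re_le_cmod)
  also have "\<dots> \<le> norm x + (norm y + norm z) / 2"
  proof -
    have "norm ((y + z) / 2) = norm (y + z) / 2" by (simp add: norm_divide)
    then have "norm (x - (y + z) / 2) \<le> norm x + norm (y + z) / 2" using norm_triangle_ineq4[of x "(y + z) / 2"] by simp
    also have "\<dots> \<le> norm x + (norm y + norm z) / 2"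
      using norm_triangle_ineq[of y z] by (intro add_left_mono divide_right_mono) auto
    finally show ?thesis .
  qed
  also have "\<dots> \<le> c * m ^ 3 + (c * m ^ 3 + c * m ^ 3) / 2" using n by (intro add_mono divide_right_mono) auto
  also have "\<dots> = 2 * c * m ^ 3" by simp
  finally show "\<bar>D + Re ((t - s)\<^sup>2 * (A3 f v - (A2 f v)\<^sup>2)) / 2\<bar> \<le> 2 * c * m ^ 3" .
qed

lemma quotient_ratio:
  assumes sb: "smooth_bounds f K \<eta> c" "v \<in> K" and m: "m \<le> \<eta>" "norm s \<le> m" "norm t \<le> m" "norm r \<le> m"
    and ne: "s \<noteq> t" "s \<noteq> r"
  shows "(f (v + r) - f (v + s)) / (f (v + t) - f (v + s)) = (r - s) / (t - s) * exp (log_quotient f v s r - log_quotient f v s t)"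
proof -
  note S = smooth_boundsD[OF sb]
  have 1: "f (v + t) - f (v + s) = (t - s) * (deriv f v * exp (log_quotient f v s t))"
    using S(6)[OF m(1,2,3)] ne by (simp add: diff_quotient_def field_simps)
  have 2: "f (v + r) - f (v + s) = (r - s) * (deriv f v * exp (log_quotient f v s r))"
    using S(6)[OF m(1,2,4)] ne by (simp add: diff_quotient_def field_simps)
  have cancel: "(A * (d * x)) / (B * (d * y)) = A / B * (x / y)" if "d \<noteq> 0" for A B d x y :: complex
    using that by simp
  show ?thesis unfolding 1 2 exp_diff by (rule cancel[OF S(4)])
qed

context triangular_lattice
begin

lemma lat_angle_mod: "lat_angle (k mod 6) = lat_angle k"
proof -
  have "E (k mod 6 + 1) = E (k + 1)" unfolding E_eq_iff by (simp add: mod_add_left_eq)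
  then show ?thesis by (simp add: lat_angle_def E_mod_6)
qed

text \<open>The quotient that defines the angle is multiplied by the exponential of a small number, whose imaginary part is
  added to the angle.\<close>
lemma smooth_corner_angle:
  assumes sb: "smooth_bounds f K \<eta> c" "v \<in> K" and m: "m \<le> \<eta>" "norm s \<le> m" "norm t \<le> m" "norm r \<le> m"
    and st: "t = s + E k" "r = s + E (k + 1)" and d: "0 < \<delta>" "lat_angle k \<in> {2 * \<delta>..pi/2 - 2 * \<delta>}" and small: "2 * c * m \<le> \<delta>"
  shows "ang (f (v + s)) (f (v + t)) (f (v + r)) = lat_angle k + Im (log_quotient f v s r - log_quotient f v s t)"
    "orient (f (v + s)) (f (v + t)) (f (v + r)) > 0" "\<bar>Im (log_quotient f v s r - log_quotient f v s t)\<bar> \<le> 2 * c * m"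
proof -
  note S = smooth_boundsD[OF sb]
  define l where "l = log_quotient f v s r - log_quotient f v s t"
  have "norm l \<le> c * m + c * m" unfolding l_def
    using S(7)[OF m(1,2,4)] S(7)[OF m(1,2,3)] norm_triangle_ineq4[of "log_quotient f v s r" "log_quotient f v s t"] by linarith
  then have Il: "\<bar>Im l\<bar> \<le> 2 * c * m" using abs_Im_le_cmod[of l] by simp
  then show "\<bar>Im (log_quotient f v s r - log_quotient f v s t)\<bar> \<le> 2 * c * m" by (simp add: l_def)
  have ne: "s \<noteq> t" "s \<noteq> r" using st E_nonzero by auto
  have p: "v + t = (v + s) + E k" "v + r = (v + s) + E (k + 1)" using st by auto
  have o: "orient (v + s) (v + t) (v + r) > 0" unfolding p using orient_tri area2_pos by simp
  have a: "ang (v + s) (v + t) (v + r) = lat_angle k" unfolding p by (rule lat_angle_ang[symmetric])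
  have q: "(f (v + r) - f (v + s)) / (f (v + t) - f (v + s)) = ((v + r) - (v + s)) / ((v + t) - (v + s)) * exp l"
    using quotient_ratio[OF sb m ne] by (simp add: l_def)
  have "0 < lat_angle k + Im l" "lat_angle k + Im l < pi" using d Il small by (auto simp: abs_le_iff)
  from ang_mult_exp[OF o q, unfolded a, OF this]
  show "ang (f (v + s)) (f (v + t)) (f (v + r)) = lat_angle k + Im (log_quotient f v s r - log_quotient f v s t)"
    "orient (f (v + s)) (f (v + t)) (f (v + r)) > 0" by (auto simp: l_def)
qed

lemma vertices_in_support: "vertices C \<subseteq> support C"
proof
  fix p assume "p \<in> vertices C"
  then obtain s where "s \<in> C" "p \<in> s" by (auto simp: vertices_def)
  then show "p \<in> support C" unfolding support_def by (blast intro: hull_inc)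
qed

text \<open>The angle sum of the smooth map is \<open>2\<pi>\<close> because the increments of \<open>log_quotient\<close> telescope around the vertex.\<close>
lemma map_pair_of_approximation:
  assumes C: "simp_complex C" and sub: "support C \<subseteq> K" and cK: "compact K"
    and sb: "smooth_bounds f K \<eta> c" and m: "mesh \<le> \<eta>" "2 * c * mesh \<le> \<delta>"
    and d: "0 < \<delta>" "\<And>k. lat_angle k \<in> {2 * \<delta>..pi/2 - 2 * \<delta>}"
    and pl: "pl_extension C g G" and sc: "scale_factors C g u"
    and bd: "\<And>v. v \<in> boundary_vertices C \<Longrightarrow> u v = ln (cmod (deriv f v))"
  shows "map_pair E C g f u (\<lambda>v. ln (cmod (deriv f v))) (3 * c * mesh\<^sup>2) (2 * c * mesh) \<delta>"
proof unfold_locales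
  have vK: "vertices C \<subseteq> K" using sub vertices_in_support by blast
  have vV: "vertices C \<subseteq> V" using C SX_V by (auto simp: vertices_def simp_complex_def)
  have cV: "v \<in> vertices C" if "tri v k \<in> C" for v k
  proof -
    have "v \<in> tri v k" by (simp add: tri_def)
    then show ?thesis using that unfolding vertices_def by blast
  qed
  show "simp_complex C" by fact
  show "finite C"
  proof (rule finite_subset)
    show "C \<subseteq> Pow (V \<inter> K)" using vV vK by (auto simp: vertices_def)
    show "finite (Pow (V \<inter> K))" using finite_V_bounded[OF compact_imp_bounded[OF cK]] by (simp only: finite_Pow_iff)
  qed
  show "orient (g v) (g (v + E k)) (g (v + E (k + 1))) > 0" if "tri v k \<in> C" for v k
    by (rule affine_on_tri(1)[OF pl C that])
  note E0 = norm_E_le_mesh mesh_pos[THEN less_imp_le]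
  have corner: "ang (f v) (f (v + E k)) (f (v + E (k + 1))) = lat_angle k + Im (log_quotient f v 0 (E (k + 1)) - log_quotient f v 0 (E k))"
    "orient (f v) (f (v + E k)) (f (v + E (k + 1))) > 0" "\<bar>Im (log_quotient f v 0 (E (k + 1)) - log_quotient f v 0 (E k))\<bar> \<le> 2 * c * mesh"
    if "v \<in> K" for v k
    using smooth_corner_angle[OF sb that m(1) _ _ _ _ _ d(1) d(2) m(2), of 0 "E k" "E (k + 1)" k] E0 by auto
  show "orient (f v) (f (v + E k)) (f (v + E (k + 1))) > 0" if "tri v k \<in> C" for v k
    using corner(2) cV[OF that] vK by blast
  show "\<bar>corner_angle f (v, k) - lat_angle k\<bar> \<le> 2 * c * mesh" if "tri v k \<in> C" for v k
    using corner(1,3)[of v k] cV[OF that] vK by (auto simp: corner_angle_def)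
  show "2 * c * mesh \<le> \<delta>" "0 < \<delta>" "lat_angle k \<in> {2 * \<delta>..pi/2 - 2 * \<delta>}" for k using m d by auto
  show "(\<Sum>k\<in>{0..5}. corner_angle g (v, k)) = 2 * pi" if "v \<in> vertices C" "v \<in> interior (support C)" for v
    using angle_sum_pl[OF pl C _ that(2)] that(1) vV by (auto simp: corner_angle_def)
  show "(\<Sum>k\<in>{0..5}. corner_angle f (v, k)) = 2 * pi" if "v \<in> vertices C" "v \<in> interior (support C)" for v
  proof -
    have vk: "v \<in> K" using that vK by blast
    have "{0..5::int} = {0,1,2,3,4,5}" by auto
    moreover have "E 6 = E 0" using E_plus_6[of 0] by simp
    moreover have "lat_angle 0 + lat_angle 1 + lat_angle 2 = pi" "lat_angle 3 + lat_angle 4 + lat_angle 5 = pi" using lat_angle_sum[of 0] lat_angle_sum[of 3] by simp_all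
    ultimately show ?thesis using corner(1)[OF vk] by (simp add: corner_angle_def)
  qed
  show "cmod (g p - g q) = cmod (p - q) * exp ((u p + u q) / 2)" if "{p, q} \<in> edges C" for p q
    using sc that unfolding scale_factors_def by blast
  show "u v = ln (cmod (deriv f v))" if "v \<in> vertices C" "v \<notin> interior (support C)" for v
    using bd that by (simp add: boundary_vertices_def)
  have edge: "p \<in> K \<and> p \<noteq> q \<and> norm (q - p) \<le> mesh" if e: "{p, q} \<in> edges C" for p q
  proof -
    have ne: "p \<noteq> q" using e by (auto simp: edges_def)
    have eC: "{p, q} \<in> C" using e by (simp add: edges_def)
    then have "p \<in> vertices C" by (auto simp: vertices_def)
    moreover obtain t where t: "t \<in> TRI" "{p, q} \<subseteq> t" using eC C unfolding simp_complex_def simplices_def by blast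
    then have "q \<in> cball p mesh" using hull_subset_cball[OF t(1), of p] hull_inc[of q t convex] by auto
    ultimately show ?thesis using ne vK by (auto simp: dist_norm norm_minus_commute)
  qed
  have defect: "f p \<noteq> f q \<and> \<bar>ln (cmod (f p - f q)) - ln (cmod (p - q)) - (ln (cmod (deriv f p)) + ln (cmod (deriv f q))) / 2
      + Re ((q - p)\<^sup>2 * (A3 f p - (A2 f p)\<^sup>2)) / 2\<bar> \<le> 2 * c * mesh ^ 3"
    if e: "{p, q} \<in> edges C" for p q
  proof -
    have pq: "p \<in> K" "0 \<noteq> q - p" "norm (q - p) \<le> mesh" "norm (0 :: complex) \<le> mesh" using edge[OF e] E0(2) by auto
    from log_length_defect[OF sb pq(1) m(1) pq(4,3,2)] show ?thesis
      unfolding add_0_right add_diff_cancel_left' diff_add_cancel diff_0_right by (simp only: add_diff_eq add_diff_cancel_left' simp_thms)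
  qed
  show "f p \<noteq> f q" if "{p, q} \<in> edges C" for p q using defect[OF that] by blast
  show "\<bar>ln (cmod (f p - f q)) - ln (cmod (p - q)) - (ln (cmod (deriv f p)) + ln (cmod (deriv f q))) / 2\<bar> \<le> 3 * c * mesh\<^sup>2"
    if e: "{p, q} \<in> edges C" for p q
  proof -
    note S = smooth_boundsD[OF sb, of p]
    have pK: "p \<in> K" using edge[OF e] by blast
    have "norm ((q - p)\<^sup>2 * (A3 f p - (A2 f p)\<^sup>2)) \<le> mesh\<^sup>2 * c"
      unfolding norm_mult norm_power using edge[OF e] S(5)[OF pK] E0(2) by (intro mult_mono power_mono) auto
    moreover have "\<bar>Re ((q - p)\<^sup>2 * (A3 f p - (A2 f p)\<^sup>2))\<bar> \<le> norm ((q - p)\<^sup>2 * (A3 f p - (A2 f p)\<^sup>2))" by (rule abs_Re_le_cmod)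
    ultimately have 1: "\<bar>Re ((q - p)\<^sup>2 * (A3 f p - (A2 f p)\<^sup>2)) / 2\<bar> \<le> c * mesh\<^sup>2"
      using abs_ge_zero[of "Re ((q - p)\<^sup>2 * (A3 f p - (A2 f p)\<^sup>2))"] by (simp only: abs_divide mult.commute)
    have "mesh ^ 3 \<le> mesh\<^sup>2" using m(1) S(2)[OF pK] E0(2) by (simp add: power3_eq_cube power2_eq_square mult_left_le)
    then have 2: "2 * c * mesh ^ 3 \<le> 2 * (c * mesh\<^sup>2)" using S(3)[OF pK] by simp
    have "\<bar>x\<bar> \<le> b1 + b2" if "\<bar>x + y\<bar> \<le> b1" "\<bar>y\<bar> \<le> b2" for x y b1 b2 :: real using that by linarith
    from this[OF defect[OF e, THEN conjunct2] 1] show ?thesis using 2 by linarith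
  qed
qed

end

lemma lat_vec_mod: "lat_vec \<alpha> \<beta> \<gamma> (k mod 6) = lat_vec \<alpha> \<beta> \<gamma> k"
proof -
  have "(k mod 6) mod 3 = k mod 3" by (simp add: mod_mod_cancel)
  then show ?thesis by (simp only: lat_vec_def lat_dir_def lat_len_def mod_mod_trivial)
qed

lemma lat_vec_values:
  assumes "\<alpha> + \<beta> + \<gamma> = pi"
  shows "lat_vec \<alpha> \<beta> \<gamma> 0 = - of_real (sin \<beta>) * cis (\<alpha> + \<beta>)" "lat_vec \<alpha> \<beta> \<gamma> 1 = of_real (sin \<alpha>)"
    "lat_vec \<alpha> \<beta> \<gamma> 2 = of_real (sin \<gamma>) * cis \<beta>" "lat_vec \<alpha> \<beta> \<gamma> 3 = of_real (sin \<beta>) * cis (\<alpha> + \<beta>)"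
    "lat_vec \<alpha> \<beta> \<gamma> 4 = - of_real (sin \<alpha>)" "lat_vec \<alpha> \<beta> \<gamma> 5 = - of_real (sin \<gamma>) * cis \<beta>"
    "of_real (sin \<gamma>) * cis \<beta> = of_real (sin \<alpha>) + of_real (sin \<beta>) * cis (\<alpha> + \<beta>)"
proof -
  have "\<gamma> = pi - (\<alpha> + \<beta>)" using assms by simp
  then have s: "sin \<gamma> = sin \<alpha> * cos \<beta> + cos \<alpha> * sin \<beta>" by (simp add: sin_diff sin_add)
  have re: "(sin \<alpha> * cos \<beta> + cos \<alpha> * sin \<beta>) * cos \<beta> = sin \<alpha> + sin \<beta> * (cos \<alpha> * cos \<beta> - sin \<alpha> * sin \<beta>)"
    using sin_cos_squared_add[of \<beta>] by algebra
  show "of_real (sin \<gamma>) * cis \<beta> = of_real (sin \<alpha>) + of_real (sin \<beta>) * cis (\<alpha> + \<beta>)"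
    unfolding s using re by (simp add: complex_eq_iff cos_add sin_add)
qed (simp_all add: lat_vec_def lat_dir_def lat_len_def)

lemma triangular_lattice_lat_vec:
  assumes "0 < \<alpha>" "0 < \<beta>" "0 < \<gamma>" "\<alpha> + \<beta> + \<gamma> = pi" "0 < \<epsilon>"
  shows "triangular_lattice (\<lambda>k. of_real \<epsilon> * lat_vec \<alpha> \<beta> \<gamma> k)"
proof
  note v = lat_vec_values[OF assms(4)]
  fix k :: int
  define L where "L = lat_vec \<alpha> \<beta> \<gamma>"
  have m: "L k = L (k mod 6)" "L (k - 1) = L ((k mod 6 - 1) mod 6)" "L (k + 1) = L ((k mod 6 + 1) mod 6)"
    unfolding L_def by (metis lat_vec_mod mod_diff_left_eq mod_add_left_eq)+
  have "k mod 6 \<in> {0,1,2,3,4,5}" by simp presburger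
  then have "L (k - 1) + L (k + 1) = L k" unfolding m using v by (auto simp: L_def)
  then show "of_real \<epsilon> * lat_vec \<alpha> \<beta> \<gamma> (k - 1) + of_real \<epsilon> * lat_vec \<alpha> \<beta> \<gamma> (k + 1) = of_real \<epsilon> * lat_vec \<alpha> \<beta> \<gamma> k"
    unfolding L_def by (metis distrib_left)
next
  note v = lat_vec_values[OF assms(4)]
  have "\<alpha> + \<beta> < pi" using assms by simp
  then have "sin \<alpha> > 0" "sin \<beta> > 0" "sin (\<alpha> + \<beta>) > 0" using assms by (auto intro!: sin_gt_zero)
  then show "0 < Im (cnj (of_real \<epsilon> * lat_vec \<alpha> \<beta> \<gamma> 0) * (of_real \<epsilon> * lat_vec \<alpha> \<beta> \<gamma> 1))"
    unfolding v using assms(5) by simp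
qed

lemma lat_angles:
  assumes a: "0 < \<alpha>" "0 < \<beta>" "0 < \<gamma>" "\<alpha> + \<beta> + \<gamma> = pi" and \<epsilon>: "0 < \<epsilon>"
  shows "triangular_lattice.lat_angle (\<lambda>k. of_real \<epsilon> * lat_vec \<alpha> \<beta> \<gamma> k) k \<in> {\<alpha>, \<beta>, \<gamma>}"
proof -
  interpret triangular_lattice "\<lambda>k. of_real \<epsilon> * lat_vec \<alpha> \<beta> \<gamma> k"
    by (rule triangular_lattice_lat_vec[OF assms])
  note v = lat_vec_values[OF a(4)]
  have s: "sin \<alpha> > 0" "sin \<beta> > 0" "sin \<gamma> > 0" using a by (auto intro!: sin_gt_zero)
  have b: "lat_angle j = Arg (lat_vec \<alpha> \<beta> \<gamma> (j + 1) / lat_vec \<alpha> \<beta> \<gamma> j)" for j unfolding lat_angle_def using \<epsilon> by simp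
  have Arg: "Arg z = t" if "z = of_real r * cis t" "0 < r" "0 < t" "t < pi" for z r t
    using that by (intro Arg_unique[of r]) (auto simp: cis_conv_exp)
  have 1: "lat_angle 1 = \<beta>" unfolding b using v s a by (intro Arg[of _ "sin \<gamma> / sin \<alpha>"]) auto
  have 2: "lat_angle 2 = \<alpha>" unfolding b using v(3,4) s a
    by (intro Arg[of _ "sin \<beta> / sin \<gamma>"]) (auto simp: field_simps cis_mult[symmetric])
  have 3: "lat_angle 3 = \<gamma>" using lat_angle_sum[of 1] 1 2 a(4) by simp
  have p: "lat_angle (j + 3 * int n) = lat_angle j" for j n
  proof (induction n)
    case (Suc n) then show ?case using lat_angle_plus_3[of "j + 3 * int n"] by (simp add: algebra_simps)
  qed simp
  have "lat_angle k = lat_angle (k mod 6)" by (rule lat_angle_mod[symmetric])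
  moreover have "k mod 6 \<in> {0,1,2,3,4,5}" by simp presburger
  moreover have "lat_angle 0 = \<gamma>" "lat_angle 4 = \<beta>" "lat_angle 5 = \<alpha>" using lat_angle_plus_3[of 0] lat_angle_plus_3[of 1] lat_angle_plus_3[of 2] 1 2 3 by simp_all
  ultimately show ?thesis using 1 2 3 by auto
qed

context triangular_lattice
begin

lemma cot_lat_angle: "cot (lat_angle k) = Re (cnj (E k) * E (k + 1)) / area2"
proof -
  define z where "z = E (k + 1) / E k"
  have z: "z \<noteq> 0" using E_nonzero by (simp add: z_def)
  have nE: "(cmod (E k))\<^sup>2 \<noteq> 0" using E_nonzero by simp
  have zz: "z = (cnj (E k) * E (k + 1)) / (cmod (E k))\<^sup>2"
  proof -
    have "complex_of_real ((cmod (E k))\<^sup>2) = E k * cnj (E k)" by (rule complex_norm_square)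
    then show ?thesis using E_nonzero[of k] by (simp only:) (simp add: z_def)
  qed
  have "Re z = Re (cnj (E k) * E (k + 1)) / (cmod (E k))\<^sup>2" "Im z = area2 / (cmod (E k))\<^sup>2"
    unfolding zz Re_divide_of_real Im_divide_of_real Im_cnj_E by simp_all
  moreover have "Re z = cmod z * cos (Arg z)" "Im z = cmod z * sin (Arg z)"
    using rcis_cmod_Arg[of z] by (metis Re_rcis, metis Im_rcis)
  ultimately have c: "cmod z * cos (Arg z) = Re (cnj (E k) * E (k + 1)) / (cmod (E k))\<^sup>2"
     "cmod z * sin (Arg z) = area2 / (cmod (E k))\<^sup>2" by simp_all
  have "cot (lat_angle k) = (cmod z * cos (Arg z)) / (cmod z * sin (Arg z))" using z by (simp add: lat_angle_def z_def cot_def)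
  also have "\<dots> = Re (cnj (E k) * E (k + 1)) / area2" unfolding c using nE by simp
  finally show ?thesis .
qed

end

section \<open>The second order term of the cross-ratio\<close>
text \<open>The first summand comes from the angles of \<open>f\<close> and the second one from the length defects of
  \<open>f\<close>, whose cotangent weights are \<open>Re (cnj b * q)\<close> and \<open>Re (cnj p * b)\<close> over the common denominator
  \<open>Im (cnj p * q)\<close>. The sum factorises.\<close>
lemma schwarzian_quadratic_identity:
  fixes p q S :: complex
  defines "b \<equiv> p + q"
  shows "Im (cnj p * q) * Im ((q\<^sup>2 - p\<^sup>2) * S)
    + Re (S * (of_real (Re (cnj b * q) + Re (cnj p * b)) * b\<^sup>2 - of_real (Re (cnj p * b)) * p\<^sup>2 - of_real (Re (cnj b * q)) * q\<^sup>2))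
    = 3 * Re (S * p * q * of_real ((cmod b)\<^sup>2))"
  unfolding b_def cmod_power2 by (simp add: power2_eq_square) (simp add: algebra_simps)

lemma P2_cross_ratio:
  assumes "b = p + q"
  shows "P2 f v p 0 - P2 f v p b + P2 f v q b - P2 f v q 0 = (q\<^sup>2 - p\<^sup>2) * (A3 f v - (A2 f v)\<^sup>2)"
  unfolding P2_def assms by (simp add: power2_eq_square field_simps)

lemma cmod_cis_taylor: "cmod (cis x - 1 - \<i> * of_real x) \<le> x\<^sup>2"
proof -
  have "cmod (exp (\<i> * of_real x) - (\<Sum>k\<le>1. (\<i> * of_real x) ^ k / fact k)) \<le> exp \<bar>Re (\<i> * of_real x)\<bar> * cmod (\<i> * of_real x) ^ Suc 1 / fact 1"
    by (rule Taylor_exp)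
  then show ?thesis by (simp add: cis_conv_exp norm_mult power2_eq_square diff_diff_eq)
qed

context map_pair
begin

text \<open>The part of the change of the two facing angles that is due to \<open>f\<close>; the part due to the difference of
  \<open>g\<close> and \<open>f\<close> is \<open>dev\<close>.\<close>
definition smooth_dev :: "int \<Rightarrow> complex \<Rightarrow> real" where
  "smooth_dev k v = (corner_angle f (v + E (k - 1), k + 1) - lat_angle (k + 1)) + (corner_angle f (v + E (k + 1), k - 2) - lat_angle (k - 2))"

text \<open>The expected argument of the cross-ratio quotient; it has the size of \<open>mesh\<^sup>2\<close>.\<close>
definition \<Theta> :: "int \<Rightarrow> complex \<Rightarrow> real" where
  "\<Theta> k v = 3 * Re ((A3 f v - (A2 f v)\<^sup>2) * E (k - 1) * E (k + 1) * of_real ((cmod (E k))\<^sup>2)) / area2"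

text \<open>Both \<open>smooth_dev\<close> and \<open>\<rho>_comb\<close> are of second order, with main terms that are quadratic in the edge vectors and linear in
  the Schwarzian derivative; \<open>schwarzian_quadratic_identity\<close> adds them up. The deviation \<open>dev + smooth_dev\<close>
  equals \<open>(dev + \<rho>_comb) + (smooth_dev - \<rho>_comb)\<close>, and the first bracket averages out.\<close>
lemma second_order_target:
  assumes w: "w = (\<lambda>v. ln (cmod (deriv f v)))" and sb: "smooth_bounds f K \<eta> c" "v \<in> K"
    and m: "mesh \<le> \<eta>" "2 * c * mesh \<le> \<delta>"
  shows "\<bar>smooth_dev k v - \<rho>_comb k v - \<Theta> k v\<bar> \<le> (4 + 16 / (sin (\<delta> / 2))\<^sup>2) * c * mesh ^ 3"
    "\<bar>smooth_dev k v\<bar> \<le> 6 * c * mesh\<^sup>2"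
proof -
  note S = smooth_boundsD[OF sb]
  define p q b where "p = E (k - 1)" and "q = E (k + 1)" and "b = E k"
  have b: "b = p + q" using E_rec[of k] by (simp add: p_def q_def b_def)
  have n: "norm p \<le> mesh" "norm q \<le> mesh" "norm b \<le> mesh" "norm (0::complex) \<le> mesh"
    using norm_E_le_mesh mesh_pos by (simp_all add: p_def q_def b_def)
  define S6 where "S6 = A3 f v - (A2 f v)\<^sup>2"
  have kk: "k + 1 + 1 = k + 2" "k - 2 + 1 = k - 1" by simp_all
  have c1: "corner_angle f (v + p, k + 1) = lat_angle (k + 1) + Im (log_quotient f v p 0 - log_quotient f v p b)"
  proof -
    have "b = p + E (k + 1)" "0 = p + E (k + 1 + 1)" unfolding kk E_shift using b by (simp_all add: p_def q_def)
    from smooth_corner_angle(1)[OF sb m(1) n(1,3,4) this d(1) d(2) m(2)]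
    have an: "ang (f (v + p)) (f (v + b)) (f (v + 0)) = lat_angle (k + 1) + Im (log_quotient f v p 0 - log_quotient f v p b)" .
    have e: "v + p + E (k + 1) = v + b" "v + p + E (k + 1 + 1) = v + 0"
      unfolding kk E_shift using b by (simp_all add: p_def q_def)
    show ?thesis unfolding corner_angle_def fst_conv snd_conv e by (rule an)
  qed
  have c2: "corner_angle f (v + q, k - 2) = lat_angle (k - 2) + Im (log_quotient f v q b - log_quotient f v q 0)"
  proof -
    have "0 = q + E (k - 2)" "b = q + E (k - 2 + 1)" unfolding kk E_shift using b by (simp_all add: p_def q_def)
    from smooth_corner_angle(1)[OF sb m(1) n(2,4,3) this d(1) d(2) m(2)]
    have an: "ang (f (v + q)) (f (v + 0)) (f (v + b)) = lat_angle (k - 2) + Im (log_quotient f v q b - log_quotient f v q 0)" .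
    have e: "v + q + E (k - 2) = v + 0" "v + q + E (k - 2 + 1) = v + b"
      unfolding kk E_shift using b by (simp_all add: p_def q_def)
    show ?thesis unfolding corner_angle_def fst_conv snd_conv e by (rule an)
  qed
  define x1 x2 x3 x4 where "x1 = log_quotient f v p 0 - P2 f v p 0" and "x2 = log_quotient f v p b - P2 f v p b"
    and "x3 = log_quotient f v q b - P2 f v q b" and "x4 = log_quotient f v q 0 - P2 f v q 0"
  have x: "norm x1 \<le> c * mesh ^ 3" "norm x2 \<le> c * mesh ^ 3" "norm x3 \<le> c * mesh ^ 3" "norm x4 \<le> c * mesh ^ 3"
    unfolding x1_def x2_def x3_def x4_def by (rule S(8)[OF m(1)], rule n, rule n)+
  have df: "smooth_dev k v = Im ((q\<^sup>2 - p\<^sup>2) * S6) + Im (x1 - x2 + x3 - x4)"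
  proof -
    have "smooth_dev k v = Im (log_quotient f v p 0 - log_quotient f v p b + log_quotient f v q b - log_quotient f v q 0)"
      unfolding smooth_dev_def p_def[symmetric] q_def[symmetric] c1 c2 by simp
    also have "log_quotient f v p 0 - log_quotient f v p b + log_quotient f v q b - log_quotient f v q 0
        = (P2 f v p 0 - P2 f v p b + P2 f v q b - P2 f v q 0) + (x1 - x2 + x3 - x4)"
      by (simp add: x1_def x2_def x3_def x4_def)
    finally show ?thesis unfolding P2_cross_ratio[OF b] S6_def by simp
  qed
  have xs: "\<bar>Im (x1 - x2 + x3 - x4)\<bar> \<le> 4 * (c * mesh ^ 3)"
  proof -
    have "norm (x1 - x2 + x3 - x4) \<le> norm x1 + norm x2 + norm x3 + norm x4"
      using norm_triangle_ineq4[of "x1 - x2 + x3" x4] norm_triangle_ineq[of "x1 - x2" x3] norm_triangle_ineq4[of x1 x2] by linarith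
    then show ?thesis using abs_Im_le_cmod[of "x1 - x2 + x3 - x4"] x by linarith
  qed
  show "\<bar>smooth_dev k v\<bar> \<le> 6 * c * mesh\<^sup>2"
  proof -
    have "norm ((q\<^sup>2 - p\<^sup>2) * S6) \<le> (mesh\<^sup>2 + mesh\<^sup>2) * c"
      unfolding norm_mult using S(5) n by (intro mult_mono order_trans[OF norm_triangle_ineq4] add_mono) (auto simp: S6_def norm_power intro!: power_mono)
    then have "\<bar>Im ((q\<^sup>2 - p\<^sup>2) * S6)\<bar> \<le> 2 * (c * mesh\<^sup>2)" using abs_Im_le_cmod[of "(q\<^sup>2 - p\<^sup>2) * S6"] by (simp add: mult.commute)
    moreover have "c * mesh ^ 3 \<le> c * mesh\<^sup>2"
      using m(1) S(2,3) mesh_pos by (simp add: power3_eq_cube power2_eq_square mult_left_le)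
    ultimately show ?thesis unfolding df using xs by linarith
  qed
  have rho: "\<bar>\<rho> (v + s) (v + t) + Re ((t - s)\<^sup>2 * S6) / 2\<bar> \<le> 2 * (c * mesh ^ 3)"
    if "norm s \<le> mesh" "norm t \<le> mesh" "s \<noteq> t" for s t
  proof -
    have weq: "w x = ln (cmod (deriv f x))" for x using w by simp
    show ?thesis using log_length_defect(2)[OF sb m(1) that] unfolding \<rho>_def weq S6_def by (simp only: mult.assoc)
  qed
  have ne: "0 \<noteq> b" "0 \<noteq> p" "q \<noteq> b" "p \<noteq> b" "0 \<noteq> q" using E_nonzero[of k] E_nonzero[of "k - 1"] E_nonzero[of "k + 1"]
    by (auto simp: b_def p_def q_def) (use b in \<open>auto simp: b_def p_def q_def\<close>)
  define r1 r2 r3 r4 r5 where "r1 = \<rho> v (v + b) + Re (b\<^sup>2 * S6) / 2" and "r2 = \<rho> v (v + p) + Re (p\<^sup>2 * S6) / 2"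
    and "r3 = \<rho> (v + q) (v + b) + Re (p\<^sup>2 * S6) / 2" and "r4 = \<rho> (v + p) (v + b) + Re (q\<^sup>2 * S6) / 2"
    and "r5 = \<rho> v (v + q) + Re (q\<^sup>2 * S6) / 2"
  have r: "\<bar>r1\<bar> \<le> 2 * (c * mesh ^ 3)" "\<bar>r2\<bar> \<le> 2 * (c * mesh ^ 3)" "\<bar>r3\<bar> \<le> 2 * (c * mesh ^ 3)"
     "\<bar>r4\<bar> \<le> 2 * (c * mesh ^ 3)" "\<bar>r5\<bar> \<le> 2 * (c * mesh ^ 3)"
  proof -
    have "b - q = p" "b - p = q" using b by simp_all
    then show "\<bar>r1\<bar> \<le> 2 * (c * mesh ^ 3)" "\<bar>r2\<bar> \<le> 2 * (c * mesh ^ 3)" "\<bar>r3\<bar> \<le> 2 * (c * mesh ^ 3)"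
     "\<bar>r4\<bar> \<le> 2 * (c * mesh ^ 3)" "\<bar>r5\<bar> \<le> 2 * (c * mesh ^ 3)"
      using rho[OF n(4,3) ne(1)] rho[OF n(4,1) ne(2)] rho[OF n(2,3) ne(3)] rho[OF n(1,3) ne(4)] rho[OF n(4,2) ne(5)]
      unfolding r1_def r2_def r3_def r4_def r5_def by (simp_all only: add_0_right diff_0_right)
  qed
  define C1 C2 where "C1 = cot (lat_angle k)" and "C2 = cot (lat_angle (k - 1))"
  define M where "M = 1 / (sin (\<delta> / 2))\<^sup>2"
  have CM: "\<bar>C1\<bar> \<le> M" "\<bar>C2\<bar> \<le> M" unfolding C1_def C2_def M_def
    using d(1) d(2)[of k] d(2)[of "k - 1"] by (auto intro!: cot_bound)
  have rc: "\<rho>_comb k v = - Re (S6 * (of_real (C1 + C2) * b\<^sup>2 - of_real C2 * p\<^sup>2 - of_real C1 * q\<^sup>2))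
       + (2 * (C1 + C2) * r1 - C2 * (r2 + r3) - C1 * (r4 + r5))"
  proof -
    have "Re (S6 * (of_real (C1 + C2) * b\<^sup>2 - of_real C2 * p\<^sup>2 - of_real C1 * q\<^sup>2))
       = (C1 + C2) * Re (b\<^sup>2 * S6) - C2 * Re (p\<^sup>2 * S6) - C1 * Re (q\<^sup>2 * S6)"
      by (simp add: algebra_simps)
    moreover define Xb Xp Xq where "Xb = Re (b\<^sup>2 * S6)" and "Xp = Re (p\<^sup>2 * S6)" and "Xq = Re (q\<^sup>2 * S6)"
    moreover have "\<rho>_comb k v = 2 * (C1 + C2) * (r1 - Xb / 2) - C2 * ((r2 - Xp / 2) + (r3 - Xp / 2))
        - C1 * ((r4 - Xq / 2) + (r5 - Xq / 2))"
      unfolding \<rho>_comb_def r1_def r2_def r3_def r4_def r5_def Xb_def Xp_def Xq_def C1_def C2_def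
        p_def[symmetric] q_def[symmetric] b_def[symmetric] by (simp only: add_diff_cancel_right')
    ultimately show ?thesis by (simp only:) (simp add: field_simps)
  qed
  have rs: "\<bar>2 * (C1 + C2) * r1 - C2 * (r2 + r3) - C1 * (r4 + r5)\<bar> \<le> 16 * M * (c * mesh ^ 3)"
  proof -
    define y where "y = 2 * (c * mesh ^ 3)"
    have pr: "\<bar>C * r\<bar> \<le> M * y" if "\<bar>C\<bar> \<le> M" "\<bar>r\<bar> \<le> y" for C r
      unfolding abs_mult using that by (intro mult_mono) auto
    have "\<bar>2 * (C1 + C2) * r1 - C2 * (r2 + r3) - C1 * (r4 + r5)\<bar>
        = \<bar>2 * (C1 * r1) + 2 * (C2 * r1) - C2 * r2 - C2 * r3 - C1 * r4 - C1 * r5\<bar>" by (simp add: algebra_simps)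
    also have "\<dots> \<le> 8 * (M * y)"
      using pr[OF CM(1), of r1] pr[OF CM(2), of r1] pr[OF CM(2), of r2] pr[OF CM(2), of r3] pr[OF CM(1), of r4] pr[OF CM(1), of r5] r
      unfolding y_def[symmetric] abs_le_iff by linarith
    finally show ?thesis by (simp add: y_def)
  qed
  have th: "Im ((q\<^sup>2 - p\<^sup>2) * S6) + Re (S6 * (of_real (C1 + C2) * b\<^sup>2 - of_real C2 * p\<^sup>2 - of_real C1 * q\<^sup>2)) = \<Theta> k v"
  proof -
    have A: "Im (cnj p * q) = area2"
    proof -
      have "Im (cnj p * b) = area2" using Im_cnj_E[of "k - 1"] by (simp add: p_def b_def)
      moreover have "cnj p * b = cnj p * p + cnj p * q" unfolding b by (simp add: distrib_left)
      moreover have "Im (cnj p * p) = 0" by simp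
      ultimately show ?thesis by simp
    qed
    have C: "C1 = Re (cnj b * q) / area2" "C2 = Re (cnj p * b) / area2"
      unfolding C1_def C2_def cot_lat_angle by (simp_all add: b_def p_def q_def)
    define U where "U = of_real (Re (cnj b * q) + Re (cnj p * b)) * b\<^sup>2 - of_real (Re (cnj p * b)) * p\<^sup>2 - of_real (Re (cnj b * q)) * q\<^sup>2"
    have idn: "area2 * Im ((q\<^sup>2 - p\<^sup>2) * S6) + Re (S6 * U) = 3 * Re (S6 * p * q * of_real ((cmod b)\<^sup>2))"
      using schwarzian_quadratic_identity[of p q S6] unfolding b[symmetric] A U_def .
    have "of_real (C1 + C2) * b\<^sup>2 - of_real C2 * p\<^sup>2 - of_real C1 * q\<^sup>2 = U / of_real area2"
      unfolding C U_def by (simp add: add_divide_distrib diff_divide_distrib distrib_right)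
    then have "Re (S6 * (of_real (C1 + C2) * b\<^sup>2 - of_real C2 * p\<^sup>2 - of_real C1 * q\<^sup>2)) = Re (S6 * U) / area2"
      by (simp only: times_divide_eq_right Re_divide_of_real)
    then have "Im ((q\<^sup>2 - p\<^sup>2) * S6) + Re (S6 * (of_real (C1 + C2) * b\<^sup>2 - of_real C2 * p\<^sup>2 - of_real C1 * q\<^sup>2))
       = (area2 * Im ((q\<^sup>2 - p\<^sup>2) * S6) + Re (S6 * U)) / area2"
      using area2_pos by (simp add: add_divide_distrib)
    then have "Im ((q\<^sup>2 - p\<^sup>2) * S6) + Re (S6 * (of_real (C1 + C2) * b\<^sup>2 - of_real C2 * p\<^sup>2 - of_real C1 * q\<^sup>2))
       = 3 * Re (S6 * p * q * of_real ((cmod b)\<^sup>2)) / area2" unfolding idn .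
    then show ?thesis unfolding \<Theta>_def S6_def[symmetric] p_def[symmetric] q_def[symmetric] b_def[symmetric] .
  qed
  have "smooth_dev k v - \<rho>_comb k v - \<Theta> k v = Im (x1 - x2 + x3 - x4) - (2 * (C1 + C2) * r1 - C2 * (r2 + r3) - C1 * (r4 + r5))"
    unfolding df rc th[symmetric] by simp
  also have "\<bar>\<dots>\<bar> \<le> 4 * (c * mesh ^ 3) + 16 * M * (c * mesh ^ 3)" using xs rs by linarith
  finally show "\<bar>smooth_dev k v - \<rho>_comb k v - \<Theta> k v\<bar> \<le> (4 + 16 / (sin (\<delta> / 2))\<^sup>2) * c * mesh ^ 3"
    by (simp add: M_def algebra_simps)
qed

text \<open>The scale factors cancel in the modulus of the cross-ratio, which leaves its argument, the sum of
  the two facing angles.\<close>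
lemma cross_ratio_deviation:
  assumes t: "tri v (k - 1) \<in> C" "tri v k \<in> C"
  shows "cross_ratio (g v) (g (v + E (k - 1))) (g (v + E k)) (g (v + E (k + 1)))
      / cross_ratio v (v + E (k - 1)) (v + E k) (v + E (k + 1)) = cis (dev k v + smooth_dev k v)"
proof -
  define a b c where "a = v + E (k - 1)" and "b = v + E k" and "c = v + E (k + 1)"
  have Ek: "E k = E (k - 1) + E (k + 1)" using E_rec[of k] by simp
  have kk: "k + 1 + 1 = k + 2" "k - 2 + 1 = k - 1" by simp_all
  have av: "a + E (k + 1) = b" "a + E (k + 1 + 1) = v" unfolding kk E_shift using Ek by (simp_all add: a_def b_def)
  have cv: "c + E (k - 2) = v" "c + E (k - 2 + 1) = b" unfolding kk E_shift using Ek by (simp_all add: c_def b_def)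
  have dist: "v \<noteq> a" "v \<noteq> b" "v \<noteq> c" "a \<noteq> b" "b \<noteq> c"
    using tri_distinct[of v "k - 1"] tri_distinct[of v k] by (simp_all add: a_def b_def c_def)
  have edge: "{x, y} \<in> edges C" if "x \<noteq> y" "{x, y} \<subseteq> tri v j" "tri v j \<in> C" for x y j
    using C(1) that unfolding simp_complex_def edges_def by auto
  have e: "{v, a} \<in> edges C" "{b, c} \<in> edges C" "{a, b} \<in> edges C" "{c, v} \<in> edges C"
    using edge[OF dist(1) _ t(1)] edge[OF dist(5) _ t(2)] edge[OF dist(4) _ t(1)] edge[OF dist(3)[symmetric] _ t(2)]
    by (auto simp: tri_def a_def b_def c_def)
  have polar: "cross_ratio (h v) (h a) (h b) (h c)
      = of_real (cmod (cross_ratio (h v) (h a) (h b) (h c))) * cis (ang (h a) (h b) (h v) + ang (h c) (h v) (h b))"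
    for h :: "complex \<Rightarrow> complex"
  proof -
    define x y where "x = (h v - h a) / (h b - h a)" and "y = (h b - h c) / (h v - h c)"
    have "(h a - h b) * (h c - h v) = (h b - h a) * (h v - h c)" by (simp add: algebra_simps)
    then have xy: "cross_ratio (h v) (h a) (h b) (h c) = x * y" by (simp add: cross_ratio_def x_def y_def)
    have "x * y = rcis (cmod x) (Arg x) * rcis (cmod y) (Arg y)" by (simp only: rcis_cmod_Arg)
    also have "\<dots> = rcis (cmod x * cmod y) (Arg x + Arg y)" by (rule rcis_mult)
    also have "\<dots> = of_real (cmod (x * y)) * cis (Arg x + Arg y)" by (simp only: rcis_def norm_mult)
    finally show ?thesis unfolding xy ang_def x_def[symmetric] y_def[symmetric] .
  qed
  have norms: "cmod (cross_ratio (g v) (g a) (g b) (g c)) = cmod (cross_ratio v a b c)"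
  proof -
    have "exp ((u v + u a) / 2) * exp ((u b + u c) / 2) = exp ((u a + u b) / 2) * exp ((u c + u v) / 2)"
      by (simp add: mult_exp_exp field_simps)
    then show ?thesis unfolding cross_ratio_def norm_divide norm_mult lg[OF e(1)] lg[OF e(2)] lg[OF e(3)] lg[OF e(4)]
      by (simp add: mult_ac)
  qed
  have nz: "cmod (cross_ratio v a b c) \<noteq> 0" using dist by (simp add: cross_ratio_def)
  have angs: "ang a b v = lat_angle (k + 1)" "ang c v b = lat_angle (k - 2)"
    using lat_angle_ang[of "k + 1" a] lat_angle_ang[of "k - 2" c] unfolding av cv by simp_all
  have cg: "ang (h a) (h b) (h v) = corner_angle h (a, k + 1)" "ang (h c) (h v) (h b) = corner_angle h (c, k - 2)" for h
    unfolding corner_angle_def fst_conv snd_conv av cv by simp_all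
  have tot: "dev k v + smooth_dev k v = (corner_angle g (a, k + 1) + corner_angle g (c, k - 2)) - (lat_angle (k + 1) + lat_angle (k - 2))"
    by (simp add: dev_def smooth_dev_def \<xi>_def a_def c_def)
  define R' where "R' = cmod (cross_ratio v a b c)"
  have "cross_ratio (g v) (g a) (g b) (g c) = of_real R' * cis (corner_angle g (a, k + 1) + corner_angle g (c, k - 2))"
    using polar[of g] unfolding norms cg R'_def .
  moreover have "cross_ratio v a b c = of_real R' * cis (lat_angle (k + 1) + lat_angle (k - 2))"
    using polar[of "\<lambda>x. x"] unfolding angs R'_def .
  moreover have "R' \<noteq> 0" using nz by (simp add: R'_def)
  ultimately have "cross_ratio (g v) (g a) (g b) (g c) / cross_ratio v a b c
     = cis (corner_angle g (a, k + 1) + corner_angle g (c, k - 2)) / cis (lat_angle (k + 1) + lat_angle (k - 2))" by simp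
  then show ?thesis unfolding tot cis_divide a_def b_def c_def .
qed

text \<open>The sum splits into \<open>averaged_deviation\<close>, the pointwise third order error of \<open>second_order_target\<close>, and the
  error of replacing \<open>cis x - 1\<close> by \<open>\<i> x\<close>, which is quadratic in angles and so bounded by the energy.\<close>
lemma averaged_cross_ratio:
  assumes w: "w = (\<lambda>v. ln (cmod (deriv f v)))" and sb: "smooth_bounds f K \<eta> c"
    and m: "mesh \<le> \<eta>" "2 * c * mesh \<le> \<delta>"
    and \<phi>: "\<And>x y. \<bar>\<phi> x - \<phi> y\<bar> \<le> l * cmod (x - y)" "\<And>x. x \<notin> cball z r \<Longrightarrow> \<phi> x = 0" "\<And>x. \<bar>\<phi> x\<bar> \<le> 1" and l: "0 \<le> l"
    and star: "\<And>v j. v \<in> V \<inter> cball z (r + mesh) \<Longrightarrow> tri v j \<in> C" and small: "\<Xi> \<le> (\<delta> / 2)\<^sup>2" and R: "0 \<le> R" "0 \<le> \<tau>"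
    and K: "cball z r \<subseteq> K"
  defines "N \<equiv> real (card (V \<inter> cball z (r + mesh)))"
  shows "cmod (\<Sum>v\<in>V \<inter> cball z r. of_real (\<phi> v) * (cis (dev k v + smooth_dev k v) - 1 - \<i> * of_real (\<Theta> k v)))
     \<le> 24 / (sin (\<delta> / 2))^4 * (\<Xi> + \<tau> * sqrt (N * \<Xi>))
       + 1 / (sin (\<delta> / 2))\<^sup>2 * (l * mesh * (4 / (sin (\<delta> / 2))\<^sup>2 * sqrt (N * \<Xi>) + 4 * R * N))
       + N * ((4 + 16 / (sin (\<delta> / 2))\<^sup>2) * c * mesh ^ 3) + (6 * \<Xi> + N * (3 * (6 * c * mesh\<^sup>2)\<^sup>2))"
proof -
  define B where "B = V \<inter> cball z r"
  have fP: "finite (V \<inter> cball z (r + mesh))" by (rule finite_V_bounded) simp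
  have BP: "B \<subseteq> V \<inter> cball z (r + mesh)" unfolding B_def using mesh_pos by auto
  have fB: "finite B" using fP BP finite_subset by blast
  have cB: "real (card B) \<le> N" unfolding N_def using card_mono[OF fP BP] by simp
  have st: "tri v j \<in> C" if "v \<in> B" for v j using star BP that by blast
  have vK: "v \<in> K" if "v \<in> B" for v using that K by (auto simp: B_def)
  define x where "x v = dev k v + smooth_dev k v" for v
  define e3 where "e3 = (4 + 16 / (sin (\<delta> / 2))\<^sup>2) * c * mesh ^ 3"
  define e2 where "e2 = 6 * c * mesh\<^sup>2"
  define b1 where "b1 = 24 / (sin (\<delta> / 2))^4 * (\<Xi> + \<tau> * sqrt (N * \<Xi>))
       + 1 / (sin (\<delta> / 2))\<^sup>2 * (l * mesh * (4 / (sin (\<delta> / 2))\<^sup>2 * sqrt (N * \<Xi>) + 4 * R * N))"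
  define S1 where "S1 = (\<Sum>v\<in>B. \<phi> v * (dev k v + \<rho>_comb k v))"
  define S2 where "S2 = (\<Sum>v\<in>B. \<phi> v * (smooth_dev k v - \<rho>_comb k v - \<Theta> k v))"
  define S3 where "S3 = (\<Sum>v\<in>B. of_real (\<phi> v) * (cis (x v) - 1 - \<i> * of_real (x v)))"
  have eq: "(\<Sum>v\<in>B. of_real (\<phi> v) * (cis (dev k v + smooth_dev k v) - 1 - \<i> * of_real (\<Theta> k v))) = \<i> * of_real S1 + \<i> * of_real S2 + S3"
    unfolding S1_def S2_def S3_def of_real_sum sum_distrib_left sum.distrib[symmetric]
    by (rule sum.cong) (simp_all add: x_def algebra_simps)
  have 1: "\<bar>S1\<bar> \<le> b1" unfolding S1_def B_def b1_def N_def
    by (rule averaged_deviation[OF \<phi> l star small R])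
  have e30: "0 \<le> e3" if "v \<in> B" for v
    using second_order_target(1)[OF w sb vK[OF that] m, of k] unfolding e3_def by linarith
  have 2: "\<bar>S2\<bar> \<le> N * e3"
  proof -
    have "\<bar>S2\<bar> \<le> (\<Sum>v\<in>B. e3)" unfolding S2_def
    proof (rule order_trans[OF sum_abs sum_mono])
      fix v assume v: "v \<in> B"
      have "\<bar>\<phi> v\<bar> * \<bar>smooth_dev k v - \<rho>_comb k v - \<Theta> k v\<bar> \<le> 1 * e3"
        using second_order_target(1)[OF w sb vK[OF v] m, of k] \<phi>(3)[of v] unfolding e3_def by (intro mult_mono) auto
      then show "\<bar>\<phi> v * (smooth_dev k v - \<rho>_comb k v - \<Theta> k v)\<bar> \<le> e3" by (simp add: abs_mult)
    qed
    also have "\<dots> \<le> N * e3"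
    proof (cases "B = {}")
      case True
      then show ?thesis using smooth_bounds_def[of f K \<eta> c] sb mesh_pos by (simp add: e3_def N_def)
    next
      case False
      then show ?thesis using cB e30 by (auto intro!: mult_right_mono)
    qed
    finally show ?thesis .
  qed
  have 3: "cmod S3 \<le> 6 * \<Xi> + N * (3 * e2\<^sup>2)"
  proof -
    have "cmod S3 \<le> (\<Sum>v\<in>B. 3 * (\<xi> (v + E (k - 1)) (k + 1))\<^sup>2 + 3 * (\<xi> (v + E (k + 1)) (k - 2))\<^sup>2 + 3 * e2\<^sup>2)"
      unfolding S3_def
    proof (rule sum_norm_le)
      fix v assume v: "v \<in> B"
      have "cmod (of_real (\<phi> v) * (cis (x v) - 1 - \<i> * of_real (x v))) \<le> 1 * (x v)\<^sup>2"
        unfolding norm_mult norm_of_real using \<phi>(3)[of v] cmod_cis_taylor[of "x v"] by (intro mult_mono) auto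
      also have "(x v)\<^sup>2 \<le> 3 * (\<xi> (v + E (k - 1)) (k + 1))\<^sup>2 + 3 * (\<xi> (v + E (k + 1)) (k - 2))\<^sup>2 + 3 * (smooth_dev k v)\<^sup>2"
      proof -
        have "(s + t + r)\<^sup>2 \<le> 3 * s\<^sup>2 + 3 * t\<^sup>2 + 3 * r\<^sup>2" for s t r :: real
        proof -
          have "3 * s\<^sup>2 + 3 * t\<^sup>2 + 3 * r\<^sup>2 - (s + t + r)\<^sup>2 = (s - t)\<^sup>2 + (t - r)\<^sup>2 + (s - r)\<^sup>2"
            by (simp add: power2_eq_square algebra_simps)
          then show ?thesis by (smt (verit) zero_le_power2)
        qed
        then show ?thesis unfolding x_def dev_def by blast
      qed
      also have "(smooth_dev k v)\<^sup>2 \<le> e2\<^sup>2"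
        using power_mono[OF second_order_target(2)[OF w sb vK[OF v] m, of k] abs_ge_zero, of 2] unfolding e2_def by simp
      finally show "cmod (of_real (\<phi> v) * (cis (x v) - 1 - \<i> * of_real (x v)))
          \<le> 3 * (\<xi> (v + E (k - 1)) (k + 1))\<^sup>2 + 3 * (\<xi> (v + E (k + 1)) (k - 2))\<^sup>2 + 3 * e2\<^sup>2" by simp
    qed
    also have "\<dots> = 3 * (\<Sum>v\<in>B. (\<xi> (v + E (k - 1)) (k + 1))\<^sup>2) + 3 * (\<Sum>v\<in>B. (\<xi> (v + E (k + 1)) (k - 2))\<^sup>2) + card B * (3 * e2\<^sup>2)"
      by (simp add: sum.distrib sum_distrib_left)
    also have "\<dots> \<le> 3 * \<Xi> + 3 * \<Xi> + N * (3 * e2\<^sup>2)"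
    proof (intro add_mono mult_left_mono mult_right_mono sum_\<xi>_sq)
      show "tri (v + E (k - 1)) (k + 1) \<in> C" if "v \<in> B" for v using st[OF that] by (simp only: tri_around_edge)
      show "tri (v + E (k + 1)) (k - 2) \<in> C" if "v \<in> B" for v using st[OF that] by (simp only: tri_around_edge)
    qed (use cB in auto)
    finally show ?thesis by simp
  qed
  have "cmod (\<i> * of_real S1 + \<i> * of_real S2 + S3) \<le> \<bar>S1\<bar> + \<bar>S2\<bar> + cmod S3"
    using norm_triangle_ineq[of "\<i> * of_real S1 + \<i> * of_real S2" S3] norm_triangle_ineq[of "\<i> * of_real S1" "\<i> * of_real S2"]
    by (simp add: norm_mult)
  then show ?thesis unfolding B_def[symmetric] eq using 1 2 3 unfolding b1_def e2_def e3_def by linarith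
qed

end

section \<open>Averages of discrete Schwarzians\<close>
lemma lattice_translation:
  assumes a: "0 < \<alpha>" "0 < \<beta>" "0 < \<gamma>" "\<alpha> + \<beta> + \<gamma> = pi" and \<epsilon>: "0 < \<epsilon>"
  defines "E \<equiv> \<lambda>k. of_real \<epsilon> * lat_vec \<alpha> \<beta> \<gamma> k"
  shows "lat_vertices \<alpha> \<beta> \<gamma> \<epsilon> = triangular_lattice.V E"
    "lat_shift \<alpha> \<beta> \<gamma> \<epsilon> k v = v + E k"
    "lat_triangles \<alpha> \<beta> \<gamma> \<epsilon> = triangular_lattice.TRI E"
    "tri_lattice \<alpha> \<beta> \<gamma> \<epsilon> \<subseteq> triangular_lattice.simplices E"
proof -
  interpret triangular_lattice E unfolding E_def by (rule triangular_lattice_lat_vec[OF a \<epsilon>])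
  show sh: "lat_shift \<alpha> \<beta> \<gamma> \<epsilon> k v = v + E k" for k v by (simp add: lat_shift_def E_def)
  have "of_real \<epsilon> * (of_int n * lat_vec \<alpha> \<beta> \<gamma> 1 + of_int m * lat_vec \<alpha> \<beta> \<gamma> 2) = of_int n * E 1 + of_int m * E 2" for n m
    by (simp add: E_def algebra_simps)
  then show V: "lat_vertices \<alpha> \<beta> \<gamma> \<epsilon> = V" unfolding lat_vertices_def V_def by simp
  show T: "lat_triangles \<alpha> \<beta> \<gamma> \<epsilon> = TRI" unfolding lat_triangles_def TRI_def tri_def sh V by auto
  have "{v} \<in> simplices" "{v, v + E k} \<in> simplices" if "v \<in> V" for v k
  proof -
    have "{v} \<subseteq> tri v k" "{v, v + E k} \<subseteq> tri v k" by (simp_all add: tri_def)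
    then show "{v} \<in> simplices" "{v, v + E k} \<in> simplices"
      using tri_in_TRI[OF that, of k] unfolding simplices_def by blast+
  qed
  then show "tri_lattice \<alpha> \<beta> \<gamma> \<epsilon> \<subseteq> simplices"
    unfolding tri_lattice_def T lat_edges_def sh V using TRI_SX by auto
qed

lemma lattice_filling:
  assumes a: "0 < \<alpha>" "0 < \<beta>" "0 < \<gamma>" "\<alpha> + \<beta> + \<gamma> = pi" and \<epsilon>: "0 < \<epsilon>"
    and md: "maximal_disc_subcomplex \<alpha> \<beta> \<gamma> \<epsilon> K C"
    and K: "compact K" "connected (- K)"
  defines "E \<equiv> \<lambda>k. of_real \<epsilon> * lat_vec \<alpha> \<beta> \<gamma> k"
  shows "triangular_lattice.simp_complex E C" "support C \<subseteq> K"
    "connected \<Gamma> \<Longrightarrow> bounded \<Gamma> \<Longrightarrow> (\<And>x. x \<in> \<Gamma> \<Longrightarrow> cball x (3 * triangular_lattice.mesh E) \<subseteq> K) \<Longrightarrow> 0 \<in> \<Gamma> \<Longrightarrow>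
      lat_vertices \<alpha> \<beta> \<gamma> \<epsilon> \<inter> \<Gamma> \<subseteq> interior_vertices C"
proof -
  interpret triangular_lattice E unfolding E_def by (rule triangular_lattice_lat_vec[OF a \<epsilon>])
  note T = lattice_translation[OF a \<epsilon>, folded E_def]
  have sub: "subcomplex C (tri_lattice \<alpha> \<beta> \<gamma> \<epsilon>)" and sK: "support C \<subseteq> K"
    and hom: "support C homeomorphic (cball 0 1 :: complex set)" and z: "0 \<in> interior_vertices C"
    and max: "\<forall>\<Delta> \<in> lat_triangles \<alpha> \<beta> \<gamma> \<epsilon> - C.
        convex hull \<Delta> \<subseteq> K \<and> (\<exists>\<Delta>' \<in> triangles C. card (\<Delta> \<inter> \<Delta>') = 2) \<longrightarrow>
        \<not> simply_connected (support (add_triangle \<Delta> C))"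
    using md unfolding maximal_disc_subcomplex_def by blast+
  show C: "simp_complex C" using sub T(4) unfolding subcomplex_def simp_complex_def by blast
  show "support C \<subseteq> K" by fact
  assume \<Gamma>: "connected \<Gamma>" "bounded \<Gamma>" "\<And>x. x \<in> \<Gamma> \<Longrightarrow> cball x (3 * mesh) \<subseteq> K" "0 \<in> \<Gamma>"
  show "lat_vertices \<alpha> \<beta> \<gamma> \<epsilon> \<inter> \<Gamma> \<subseteq> interior_vertices C"
  proof
    fix v assume v: "v \<in> lat_vertices \<alpha> \<beta> \<gamma> \<epsilon> \<inter> \<Gamma>"
    show "v \<in> interior_vertices C"
    proof (rule maximal_disc_fills[OF C hom K sK _ _ \<Gamma>])
      show "0 \<in> interior (support C)" using z by (simp add: interior_vertices_def)
      show "\<not> simply_connected (support (add_triangle d C))"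
        if "d \<in> TRI - C" "convex hull d \<subseteq> K" "\<exists>t\<in>triangles C. card (d \<inter> t) = 2" for d
        using max that unfolding T(3) by blast
      show "v \<in> V" "v \<in> \<Gamma>" using v unfolding T(1) by auto
    qed
  qed
qed

text \<open>\<open>\<Theta>\<close> for the lattice with \<open>\<epsilon> = 1\<close>; in general \<open>\<Theta>\<close> scales with \<open>\<epsilon>\<^sup>2\<close>.\<close>
definition schwarzian_limit :: "real \<Rightarrow> real \<Rightarrow> real \<Rightarrow> (complex \<Rightarrow> complex) \<Rightarrow> int \<Rightarrow> complex \<Rightarrow> real" where
  "schwarzian_limit \<alpha> \<beta> \<gamma> f k v = 3 * Re ((A3 f v - (A2 f v)\<^sup>2) * lat_vec \<alpha> \<beta> \<gamma> (k - 1) * lat_vec \<alpha> \<beta> \<gamma> (k + 1)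
      * of_real ((cmod (lat_vec \<alpha> \<beta> \<gamma> k))\<^sup>2)) / Im (cnj (lat_vec \<alpha> \<beta> \<gamma> 1) * lat_vec \<alpha> \<beta> \<gamma> 2)"

text \<open>All error terms of \<open>averaged_cross_ratio\<close> are \<open>O(\<epsilon>)\<close>: the number of vertices is \<open>O(\<epsilon>\<^sup>-\<^sup>2)\<close>, and with \<open>R = O(\<epsilon>\<^sup>2)\<close> the
  energy estimate gives \<open>\<Xi> = O(\<epsilon>\<^sup>4 \<epsilon>\<^sup>-\<^sup>2) = O(\<epsilon>\<^sup>2)\<close>.\<close>
lemma averaged_discrete_schwarzian:
  assumes a: "0 < \<alpha>" "0 < \<beta>" "0 < \<gamma>" "\<alpha> + \<beta> + \<gamma> = pi"
    and d: "0 < \<delta>" "{\<alpha>, \<beta>, \<gamma>} \<subseteq> {2 * \<delta>..pi/2 - 2 * \<delta>}"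
    and K: "compact K" "connected (- K)" "K \<subseteq> cball 0 M" and sb: "smooth_bounds f K \<eta> c"
    and \<phi>: "\<And>x y. \<bar>\<phi> x - \<phi> y\<bar> \<le> l * cmod (x - y)" "\<And>x. x \<notin> cball z r \<Longrightarrow> \<phi> x = 0" "\<And>x. \<bar>\<phi> x\<bar> \<le> 1" and l: "0 \<le> l"
    and r: "0 < r" "cball z (2 * r) \<subseteq> K"
  shows "\<exists>\<epsilon>1>0. \<exists>B. \<forall>\<epsilon> C g v0. 0 < \<epsilon> \<and> \<epsilon> < \<epsilon>1 \<and> maximal_disc_subcomplex \<alpha> \<beta> \<gamma> \<epsilon> K C \<and>
      discrete_approximation f C v0 g \<and> lat_vertices \<alpha> \<beta> \<gamma> \<epsilon> \<inter> cball z (2 * r) \<subseteq> interior_vertices C \<longrightarrow>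
      cmod (\<Sum>v\<in>lat_vertices \<alpha> \<beta> \<gamma> \<epsilon> \<inter> cball z r. of_real (\<phi> v * \<epsilon>\<^sup>2) *
         (discrete_schwarzian \<alpha> \<beta> \<gamma> \<epsilon> g k v - \<i> * of_real (schwarzian_limit \<alpha> \<beta> \<gamma> f k v))) \<le> B * \<epsilon>"
proof -
  define m0 where "m0 = (\<Sum>j\<in>{0..5}. norm (lat_vec \<alpha> \<beta> \<gamma> j))"
  define ar where "ar = Im (cnj (lat_vec \<alpha> \<beta> \<gamma> 1) * lat_vec \<alpha> \<beta> \<gamma> 2)"
  define le where "le = norm (lat_vec \<alpha> \<beta> \<gamma> 1) + norm (lat_vec \<alpha> \<beta> \<gamma> 2)"
  have m0: "m0 > 0" and ar: "ar > 0"
  proof -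
    interpret triangular_lattice "\<lambda>k. of_real 1 * lat_vec \<alpha> \<beta> \<gamma> k" by (rule triangular_lattice_lat_vec[OF a]) simp
    show "m0 > 0" using mesh_pos unfolding mesh_def m0_def by simp
    show "ar > 0" using area2_pos unfolding area2_def ar_def by simp
  qed
  have zK: "z \<in> K" using r by auto
  then have "z \<in> cball 0 M" using K(3) by blast
  then have M: "0 \<le> M" using norm_ge_zero[of z] by (simp del: norm_ge_zero)
  note S = smooth_boundsD[OF sb zK]
  have le: "0 \<le> le" by (simp add: le_def)
  \<comment> \<open>CN bounds the number of vertices times \<epsilon>^2, \<kappa> is the coercivity constant of the energy, CX bounds \<Xi> / \<epsilon>^2, and q bounds the Cauchy-Schwarz factor sqrt (N \<Xi>)\<close>
  define CN where "CN = (2 * (M * le / ar) + 3)\<^sup>2"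
  define \<kappa> where "\<kappa> = (\<delta> / (2 * pi)) * tan (\<delta> / 2)"
  define CX where "CX = (3 * c * m0\<^sup>2 / \<kappa>)\<^sup>2 * (6 * CN)"
  define q where "q = sqrt (CN * CX)"
  define s2 where "s2 = 1 / (sin (\<delta> / 2))\<^sup>2"
  define s4 where "s4 = 1 / (sin (\<delta> / 2)) ^ 4"
  define B where "B = 24 * s4 * (CX + 2 * c * m0 * q) + s2 * (l * m0 * (4 * s2 * q + 12 * c * m0\<^sup>2 * CN))
     + CN * ((4 + 16 * s2) * c * m0 ^ 3) + (6 * CX + CN * (3 * (6 * c * m0\<^sup>2)\<^sup>2))"
  have pos: "0 \<le> CN" "0 \<le> CX" "0 \<le> q" "0 \<le> s2" "0 \<le> s4"
    by (simp_all add: CN_def CX_def q_def s2_def s4_def)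
  \<comment> \<open>in this order: \<epsilon>^2 \<le> \<epsilon>, mesh within the Taylor radius, small angle changes of f, mesh \<le> r, and \<Xi> \<le> (\<delta>/2)^2\<close>
  define \<epsilon>1 where "\<epsilon>1 = Min {1, \<eta> / m0, \<delta> / (2 * c * m0), r / m0, sqrt ((\<delta> / 2)\<^sup>2 / (CX + 1))}"
  have e1: "0 < \<epsilon>1" unfolding \<epsilon>1_def using S(1,3) m0 d(1) r(1) pos(2) by simp
  show ?thesis
  proof (rule exI[of _ \<epsilon>1], rule conjI[OF e1], rule exI[of _ B], intro allI impI)
    fix \<epsilon> C g v0
    assume h: "0 < \<epsilon> \<and> \<epsilon> < \<epsilon>1 \<and> maximal_disc_subcomplex \<alpha> \<beta> \<gamma> \<epsilon> K C \<and>
      discrete_approximation f C v0 g \<and> lat_vertices \<alpha> \<beta> \<gamma> \<epsilon> \<inter> cball z (2 * r) \<subseteq> interior_vertices C"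
    then have \<epsilon>: "0 < \<epsilon>" and md: "maximal_disc_subcomplex \<alpha> \<beta> \<gamma> \<epsilon> K C" and da: "discrete_approximation f C v0 g"
      and fill: "lat_vertices \<alpha> \<beta> \<gamma> \<epsilon> \<inter> cball z (2 * r) \<subseteq> interior_vertices C" and "\<epsilon> < \<epsilon>1" by blast+
    from \<open>\<epsilon> < \<epsilon>1\<close> have eb: "\<epsilon> < 1" "\<epsilon> < \<eta> / m0" "\<epsilon> < \<delta> / (2 * c * m0)" "\<epsilon> < r / m0" "\<epsilon> < sqrt ((\<delta> / 2)\<^sup>2 / (CX + 1))"
      unfolding \<epsilon>1_def by simp_all
    have e2: "\<epsilon> * m0 \<le> \<eta>" "2 * c * (\<epsilon> * m0) \<le> \<delta>" "\<epsilon> * m0 \<le> r" "CX * \<epsilon>\<^sup>2 \<le> (\<delta> / 2)\<^sup>2"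
    proof -
      show "\<epsilon> * m0 \<le> \<eta>" "2 * c * (\<epsilon> * m0) \<le> \<delta>" "\<epsilon> * m0 \<le> r" using eb m0 S(3) by (simp_all add: field_simps)
      have "\<epsilon>\<^sup>2 \<le> (sqrt ((\<delta> / 2)\<^sup>2 / (CX + 1)))\<^sup>2" using eb(5) \<epsilon> by (intro power_mono) auto
      also have "\<dots> = (\<delta> / 2)\<^sup>2 / (CX + 1)" using pos(2) by simp
      finally have "\<epsilon>\<^sup>2 * (CX + 1) \<le> (\<delta> / 2)\<^sup>2" using pos(2) by (simp add: le_divide_eq)
      moreover have "CX * \<epsilon>\<^sup>2 \<le> \<epsilon>\<^sup>2 * (CX + 1)" by (simp add: algebra_simps)
      ultimately show "CX * \<epsilon>\<^sup>2 \<le> (\<delta> / 2)\<^sup>2" by linarith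
    qed
    define E where "E = (\<lambda>k. of_real \<epsilon> * lat_vec \<alpha> \<beta> \<gamma> k)"
    interpret triangular_lattice E unfolding E_def by (rule triangular_lattice_lat_vec[OF a \<epsilon>])
    note T = lattice_translation[OF a \<epsilon>, folded E_def]
    note F = lattice_filling(1,2)[OF a \<epsilon> md K(1,2), folded E_def]
    have nE: "norm (E j) = \<epsilon> * norm (lat_vec \<alpha> \<beta> \<gamma> j)" for j using \<epsilon> by (simp add: E_def norm_mult)
    have mesh: "mesh = \<epsilon> * m0" unfolding mesh_def m0_def nE by (simp add: sum_distrib_left)
    have E12: "E 1 = of_real \<epsilon> * lat_vec \<alpha> \<beta> \<gamma> 1" "E 2 = of_real \<epsilon> * lat_vec \<alpha> \<beta> \<gamma> 2" by (simp_all add: E_def)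
    have area: "area2 = \<epsilon>\<^sup>2 * ar" unfolding area2_def ar_def E12 by (simp add: power2_eq_square algebra_simps)
    have sh: "lat_shift \<alpha> \<beta> \<gamma> \<epsilon> k v = v + E k" for k v by (simp add: T(2) E_def)
    have lat_angle: "lat_angle j \<in> {2 * \<delta>..pi/2 - 2 * \<delta>}" for j
      using lat_angles[OF a \<epsilon>, of j] d(2) unfolding E_def by blast
    obtain G where pl: "pl_extension C g G" using da unfolding discrete_approximation_def discrete_conformal_def by blast
    obtain u where u: "scale_factors C g u" "\<And>v. v \<in> boundary_vertices C \<Longrightarrow> u v = ln (cmod (deriv f v))"
      using da unfolding discrete_approximation_def by blast
    define w where "w = (\<lambda>v. ln (cmod (deriv f v)))"
    define R \<tau> where "R = 3 * c * mesh\<^sup>2" and "\<tau> = 2 * c * mesh"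
    interpret map_pair E C g f u w R \<tau> \<delta>
      unfolding R_def \<tau>_def w_def
      by (rule map_pair_of_approximation[OF F(1,2) K(1) sb _ _ d(1) lat_angle pl u(1)]) (use e2 mesh u(2) in auto)
    have R: "0 \<le> R" "0 \<le> \<tau>" using S(3) mesh_pos by (simp_all add: R_def \<tau>_def)
    define N where "N = real (card (V \<inter> cball z (r + mesh)))"
    have cardK: "real (card (V \<inter> cball 0 M)) \<le> CN / \<epsilon>\<^sup>2"
    proof -
      have "norm (E 1) + norm (E 2) = \<epsilon> * le" unfolding E_def le_def using \<epsilon> by (simp add: norm_mult distrib_left)
      then have "M * (norm (E 1) + norm (E 2)) / area2 = (M * le / ar) / \<epsilon>"
        unfolding area using \<epsilon> ar by (simp add: power2_eq_square field_simps)
      then have "real (card (V \<inter> cball 0 M)) \<le> (2 * ((M * le / ar) / \<epsilon>) + 3)\<^sup>2" using card_V_Int_cball_le[OF M] by simp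
      also have "\<dots> \<le> ((2 * (M * le / ar) + 3) / \<epsilon>)\<^sup>2"
      proof (rule power_mono)
        have "3 \<le> 3 / \<epsilon>" using \<epsilon> eb(1) by (simp add: field_simps)
        then show "2 * ((M * le / ar) / \<epsilon>) + 3 \<le> (2 * (M * le / ar) + 3) / \<epsilon>" by (simp add: add_divide_distrib)
        show "0 \<le> 2 * ((M * le / ar) / \<epsilon>) + 3" using M le ar \<epsilon> by simp
      qed
      finally show ?thesis by (simp add: CN_def power_divide)
    qed
    have NK: "N \<le> CN / \<epsilon>\<^sup>2"
    proof -
      have "cball z (r + mesh) \<subseteq> cball z (2 * r)" using e2(3) mesh by auto
      then have "V \<inter> cball z (r + mesh) \<subseteq> V \<inter> cball 0 M" using r(2) K(3) by blast
      then have "card (V \<inter> cball z (r + mesh)) \<le> card (V \<inter> cball 0 M)"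
        by (intro card_mono finite_V_bounded) auto
      then show ?thesis using cardK unfolding N_def by linarith
    qed
    have corners: "real (card (corners C)) \<le> 6 * (CN / \<epsilon>\<^sup>2)"
    proof -
      have "vertices C \<subseteq> V \<inter> cball 0 M"
        using F(1) SX_V vertices_in_support[of C] F(2) K(3) by (fastforce simp: simp_complex_def vertices_def)
      then have "corners C \<subseteq> (V \<inter> cball 0 M) \<times> {0..5}" unfolding corners_def by auto
      then have "card (corners C) \<le> card ((V \<inter> cball 0 M) \<times> {0..5::int})"
        by (intro card_mono finite_cartesian_product finite_V_bounded) auto
      then have "real (card (corners C)) \<le> 6 * real (card (V \<inter> cball 0 M))" by (simp add: card_cartesian_product)
      then show ?thesis using cardK by linarith
    qed
    have Xi: "\<Xi> \<le> CX * \<epsilon>\<^sup>2"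
    proof -
      have "\<Xi> \<le> (R / \<kappa>)\<^sup>2 * card (corners C)" using energy unfolding \<kappa>_def .
      also have "\<dots> \<le> (R / \<kappa>)\<^sup>2 * (6 * (CN / \<epsilon>\<^sup>2))" using corners by (intro mult_left_mono) auto
      also have "\<dots> = CX * \<epsilon>\<^sup>2" unfolding R_def mesh CX_def using \<epsilon> by (simp add: power2_eq_square field_simps)
      finally show ?thesis .
    qed
    then have small: "\<Xi> \<le> (\<delta> / 2)\<^sup>2" using e2(4) by linarith
    have sq: "sqrt (N * \<Xi>) \<le> q"
    proof -
      have "N * \<Xi> \<le> (CN / \<epsilon>\<^sup>2) * (CX * \<epsilon>\<^sup>2)" using NK Xi \<Xi>_nonneg pos(1) by (intro mult_mono) auto
      also have "\<dots> = CN * CX" using \<epsilon> by simp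
      finally show ?thesis unfolding q_def by (rule real_sqrt_le_mono)
    qed
    have NR: "N * R \<le> CN * (3 * c * m0\<^sup>2)"
    proof -
      have "N * R \<le> (CN / \<epsilon>\<^sup>2) * R" using NK R(1) by (rule mult_right_mono)
      also have "\<dots> = CN * (3 * c * m0\<^sup>2)" unfolding R_def mesh using \<epsilon> by (simp add: power2_eq_square field_simps)
      finally show ?thesis .
    qed
    have star: "tri v j \<in> C" if "v \<in> V \<inter> cball z (r + mesh)" for v j
    proof -
      have "v \<in> V \<inter> cball z (2 * r)" using that e2(3) mesh by auto
      then have "v \<in> interior_vertices C" using fill unfolding T(1) by blast
      then show ?thesis using star_of_interior_vertex[OF F(1)] that by (auto simp: interior_vertices_def)
    qed
    have zr: "cball z r \<subseteq> K" using r subset_cball[of r "2 * r" z] by auto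
    have bound: "cmod (\<Sum>v\<in>V \<inter> cball z r. of_real (\<phi> v) * (cis (dev k v + smooth_dev k v) - 1 - \<i> * of_real (\<Theta> k v))) \<le> B * \<epsilon>"
    proof -
      have ee: "\<epsilon>\<^sup>2 \<le> \<epsilon>" using eb(1) \<epsilon> by (simp add: power2_eq_square mult_left_le)
      have 1: "24 / (sin (\<delta> / 2))^4 * (\<Xi> + \<tau> * sqrt (N * \<Xi>)) \<le> (24 * s4 * (CX + 2 * c * m0 * q)) * \<epsilon>"
      proof -
        have "\<Xi> \<le> CX * \<epsilon>" using Xi mult_left_mono[OF ee pos(2)] by linarith
        moreover have "\<tau> * sqrt (N * \<Xi>) \<le> \<tau> * q" using sq R(2) by (rule mult_left_mono)
        moreover have "\<tau> * q = (2 * c * m0 * q) * \<epsilon>" by (simp add: \<tau>_def mesh)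
        ultimately have "\<Xi> + \<tau> * sqrt (N * \<Xi>) \<le> (CX + 2 * c * m0 * q) * \<epsilon>" by (simp add: distrib_right)
        then have "24 * s4 * (\<Xi> + \<tau> * sqrt (N * \<Xi>)) \<le> 24 * s4 * ((CX + 2 * c * m0 * q) * \<epsilon>)" using pos(5) by (intro mult_left_mono) auto
        then have "24 * s4 * (\<Xi> + \<tau> * sqrt (N * \<Xi>)) \<le> (24 * s4 * (CX + 2 * c * m0 * q)) * \<epsilon>" by (simp only: mult.assoc)
        moreover have "24 / (sin (\<delta> / 2))^4 = 24 * s4" by (simp add: s4_def)
        ultimately show ?thesis by (simp only:)
      qed
      have 2: "1 / (sin (\<delta> / 2))\<^sup>2 * (l * mesh * (4 / (sin (\<delta> / 2))\<^sup>2 * sqrt (N * \<Xi>) + 4 * R * N))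
          \<le> (s2 * (l * m0 * (4 * s2 * q + 12 * c * m0\<^sup>2 * CN))) * \<epsilon>"
      proof -
        have "4 * s2 * sqrt (N * \<Xi>) \<le> 4 * s2 * q" using sq pos(4) by (intro mult_left_mono) auto
        moreover have "4 * R * N \<le> 12 * c * m0\<^sup>2 * CN" using NR by (simp add: mult_ac)
        ultimately have "4 * s2 * sqrt (N * \<Xi>) + 4 * R * N \<le> 4 * s2 * q + 12 * c * m0\<^sup>2 * CN" by linarith
        then have "s2 * (l * mesh * (4 * s2 * sqrt (N * \<Xi>) + 4 * R * N)) \<le> s2 * (l * mesh * (4 * s2 * q + 12 * c * m0\<^sup>2 * CN))"
          using pos(4) l mesh_pos by (intro mult_left_mono) auto
        then show ?thesis by (simp add: s2_def mesh mult_ac)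
      qed
      have 3: "N * ((4 + 16 / (sin (\<delta> / 2))\<^sup>2) * c * mesh ^ 3) \<le> (CN * ((4 + 16 * s2) * c * m0 ^ 3)) * \<epsilon>"
      proof -
        have "N * ((4 + 16 * s2) * c * mesh ^ 3) \<le> (CN / \<epsilon>\<^sup>2) * ((4 + 16 * s2) * c * mesh ^ 3)"
          using NK pos(4) S(3) mesh_pos by (intro mult_right_mono) auto
        also have "\<dots> = (CN * ((4 + 16 * s2) * c * m0 ^ 3)) * \<epsilon>"
          unfolding mesh using \<epsilon> by (simp add: power2_eq_square power3_eq_cube)
        finally show ?thesis by (simp add: s2_def)
      qed
      have 4: "6 * \<Xi> + N * (3 * (6 * c * mesh\<^sup>2)\<^sup>2) \<le> (6 * CX + CN * (3 * (6 * c * m0\<^sup>2)\<^sup>2)) * \<epsilon>"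
      proof -
        have "N * (3 * (6 * c * mesh\<^sup>2)\<^sup>2) \<le> (CN / \<epsilon>\<^sup>2) * (3 * (6 * c * mesh\<^sup>2)\<^sup>2)"
          using NK by (intro mult_right_mono) auto
        also have "\<dots> = (CN * (3 * (6 * c * m0\<^sup>2)\<^sup>2)) * \<epsilon>\<^sup>2"
          unfolding mesh using \<epsilon> by (simp add: power2_eq_square)
        finally have "6 * \<Xi> + N * (3 * (6 * c * mesh\<^sup>2)\<^sup>2) \<le> (6 * CX + CN * (3 * (6 * c * m0\<^sup>2)\<^sup>2)) * \<epsilon>\<^sup>2"
          using Xi by (simp add: distrib_right)
        also have "\<dots> \<le> (6 * CX + CN * (3 * (6 * c * m0\<^sup>2)\<^sup>2)) * \<epsilon>"
          using ee pos by (intro mult_left_mono) auto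
        finally show ?thesis .
      qed
      have "mesh \<le> \<eta>" "2 * c * mesh \<le> \<delta>" using e2 mesh by auto
      note main = averaged_cross_ratio[OF w_def sb this \<phi> l star small R zr, of k, folded N_def]
      have "B * \<epsilon> = (24 * s4 * (CX + 2 * c * m0 * q)) * \<epsilon> + (s2 * (l * m0 * (4 * s2 * q + 12 * c * m0\<^sup>2 * CN))) * \<epsilon>
          + (CN * ((4 + 16 * s2) * c * m0 ^ 3)) * \<epsilon> + (6 * CX + CN * (3 * (6 * c * m0\<^sup>2)\<^sup>2)) * \<epsilon>"
        unfolding B_def by (simp only: distrib_right)
      then show ?thesis using main 1 2 3 4 by linarith
    qed
    have summand: "of_real (\<phi> v * \<epsilon>\<^sup>2) * (discrete_schwarzian \<alpha> \<beta> \<gamma> \<epsilon> g k v - \<i> * of_real (schwarzian_limit \<alpha> \<beta> \<gamma> f k v))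
       = of_real (\<phi> v) * (cis (dev k v + smooth_dev k v) - 1 - \<i> * of_real (\<Theta> k v))" if v: "v \<in> V \<inter> cball z r" for v
    proof -
      have "v \<in> V \<inter> cball z (r + mesh)" using v mesh_pos by auto
      then have t: "tri v (k - 1) \<in> C" "tri v k \<in> C" by (rule star)+
      have e0: "of_real (\<epsilon>\<^sup>2) \<noteq> (0 :: complex)" using \<epsilon> by simp
      have ds: "of_real (\<epsilon>\<^sup>2) * discrete_schwarzian \<alpha> \<beta> \<gamma> \<epsilon> g k v = cis (dev k v + smooth_dev k v) - 1"
        unfolding discrete_schwarzian_def Let_def sh cross_ratio_deviation[OF t] using e0 by simp
      have th: "\<epsilon>\<^sup>2 * schwarzian_limit \<alpha> \<beta> \<gamma> f k v = \<Theta> k v"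
      proof -
        define S6 where "S6 = A3 f v - (A2 f v)\<^sup>2"
        define P where "P = S6 * lat_vec \<alpha> \<beta> \<gamma> (k - 1) * lat_vec \<alpha> \<beta> \<gamma> (k + 1) * of_real ((cmod (lat_vec \<alpha> \<beta> \<gamma> k))\<^sup>2)"
        have "S6 * E (k - 1) * E (k + 1) * of_real ((cmod (E k))\<^sup>2) = of_real (\<epsilon> ^ 4) * P"
          unfolding E_def P_def norm_mult using \<epsilon> by (simp add: power2_eq_square power4_eq_xxxx mult_ac)
        then have "Re (S6 * E (k - 1) * E (k + 1) * of_real ((cmod (E k))\<^sup>2)) = \<epsilon> ^ 4 * Re P"
          by (simp del: of_real_power)
        then have "\<Theta> k v = 3 * (\<epsilon> ^ 4 * Re P) / (\<epsilon>\<^sup>2 * ar)"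
          unfolding \<Theta>_def S6_def[symmetric] area by simp
        also have "\<dots> = \<epsilon>\<^sup>2 * (3 * Re P / ar)" using \<epsilon> ar by (simp add: power2_eq_square power4_eq_xxxx)
        finally show ?thesis unfolding schwarzian_limit_def P_def S6_def ar_def by simp
      qed
      have "of_real (\<phi> v * \<epsilon>\<^sup>2) * (discrete_schwarzian \<alpha> \<beta> \<gamma> \<epsilon> g k v - \<i> * of_real (schwarzian_limit \<alpha> \<beta> \<gamma> f k v))
         = of_real (\<phi> v) * (of_real (\<epsilon>\<^sup>2) * discrete_schwarzian \<alpha> \<beta> \<gamma> \<epsilon> g k v - \<i> * of_real (\<epsilon>\<^sup>2 * schwarzian_limit \<alpha> \<beta> \<gamma> f k v))"
        by (simp add: algebra_simps)
      then show ?thesis unfolding ds th .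
    qed
    have "(\<Sum>v\<in>V \<inter> cball z r. of_real (\<phi> v * \<epsilon>\<^sup>2) *
         (discrete_schwarzian \<alpha> \<beta> \<gamma> \<epsilon> g k v - \<i> * of_real (schwarzian_limit \<alpha> \<beta> \<gamma> f k v)))
       = (\<Sum>v\<in>V \<inter> cball z r. of_real (\<phi> v) * (cis (dev k v + smooth_dev k v) - 1 - \<i> * of_real (\<Theta> k v)))"
      by (rule sum.cong[OF refl summand])
    then show "cmod (\<Sum>v\<in>lat_vertices \<alpha> \<beta> \<gamma> \<epsilon> \<inter> cball z r. of_real (\<phi> v * \<epsilon>\<^sup>2) *
         (discrete_schwarzian \<alpha> \<beta> \<gamma> \<epsilon> g k v - \<i> * of_real (schwarzian_limit \<alpha> \<beta> \<gamma> f k v))) \<le> B * \<epsilon>"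
      unfolding T(1) using bound by simp
  qed
qed

section \<open>The limits determine the Schwarzian derivative\<close>
text \<open>The three numbers are \<open>- X\<close>, \<open>X + Y\<close> and \<open>- Y\<close> up to the factor \<open>2 A\<close>, where \<open>X\<close> and \<open>Y\<close> are the real inner
  products of one complex number \<open>P\<close> with \<open>a\<close> and \<open>b\<close>. The identity \<open>key\<close> recovers \<open>P\<close> from them by means of the dual basis.\<close>
lemma schwarzian_reconstruction:
  fixes a b S :: complex
  assumes A: "Im (cnj a * b) \<noteq> 0"
  defines "A \<equiv> Im (cnj a * b)"
  defines "\<theta>1 \<equiv> Re (S * (- b) * (a + b) * of_real ((cmod a)\<^sup>2)) / (2 * A)"
    and "\<theta>2 \<equiv> Re (S * a * b * of_real ((cmod (a + b))\<^sup>2)) / (2 * A)"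
    and "\<theta>3 \<equiv> Re (S * (a + b) * (- a) * of_real ((cmod b)\<^sup>2)) / (2 * A)"
  shows "3 * a * (a + b) * b * S = 2 * ((a + b + b) * (\<i> * of_real \<theta>1) + (a - b) * (\<i> * of_real \<theta>2) + (- a - (a + b)) * (\<i> * of_real \<theta>3))"
proof -
  define P where "P = S * a * b * (a + b)"
  define X Y where "X = Re (P * cnj a)" and "Y = Re (P * cnj b)"
  have t: "\<theta>1 = - X / (2 * A)" "\<theta>2 = (X + Y) / (2 * A)" "\<theta>3 = - Y / (2 * A)"
  proof -
    have "S * (- b) * (a + b) * of_real ((cmod a)\<^sup>2) = - (P * cnj a)" "S * (a + b) * (- a) * of_real ((cmod b)\<^sup>2) = - (P * cnj b)"
      "S * a * b * of_real ((cmod (a + b))\<^sup>2) = P * cnj a + P * cnj b"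
      unfolding complex_norm_square P_def by (simp_all add: algebra_simps)
    then show "\<theta>1 = - X / (2 * A)" "\<theta>2 = (X + Y) / (2 * A)" "\<theta>3 = - Y / (2 * A)"
      unfolding \<theta>1_def \<theta>2_def \<theta>3_def X_def Y_def by simp_all
  qed
  have key: "\<i> * (a * of_real Y - b * of_real X) = of_real A * P"
    unfolding A_def X_def Y_def by (simp add: complex_eq_iff) (simp add: algebra_simps)
  have An: "A \<noteq> 0" using A by (simp add: A_def)
  have gen: "2 * ((a + b + b) * (\<i> * of_real (- x / (2 * t))) + (a - b) * (\<i> * of_real ((x + y) / (2 * t))) + (- a - (a + b)) * (\<i> * of_real (- y / (2 * t))))
    = 3 * (\<i> * (a * of_real y - b * of_real x)) / of_real t" if "t \<noteq> 0" for t x y :: real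
    using that by (simp add: field_simps)
  have "2 * ((a + b + b) * (\<i> * of_real \<theta>1) + (a - b) * (\<i> * of_real \<theta>2) + (- a - (a + b)) * (\<i> * of_real \<theta>3))
    = 3 * (\<i> * (a * of_real Y - b * of_real X)) / of_real A"
    unfolding t by (rule gen[OF An])
  also have "\<dots> = 3 * P" unfolding key using An by simp
  finally show ?thesis by (simp add: P_def mult_ac)
qed

text \<open>Along the sequence, \<open>S z\<close> is close to \<open>s\<^sub>k(v)\<close>, and \<open>\<theta>\<^sub>k(z)\<close> to \<open>\<theta>\<^sub>k(v)\<close>, for all \<open>v\<close> in a small disc around \<open>z\<close>. On
  that disc the weighted means of \<open>s\<^sub>k\<close> and \<open>\<i> \<theta>\<^sub>k\<close> are close by \<open>averaged_discrete_schwarzian\<close>, since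
  the total weight \<open>P\<close> stays away from zero.\<close>
lemma limit_of_discrete_schwarzian:
  fixes T :: "real \<Rightarrow> complex set set"
  assumes a: "0 < \<alpha>" "\<alpha> < pi / 2" "0 < \<beta>" "\<beta> < pi / 2" "0 < \<gamma>" "\<gamma> < pi / 2" "\<alpha> + \<beta> + \<gamma> = pi"
    and D: "open D" "f holomorphic_on D" "\<And>z. z \<in> D \<Longrightarrow> deriv f z \<noteq> 0"
    and K: "compact K" "K \<subseteq> D" "connected (interior K)" "0 \<in> interior K" "connected (- K)"
    and T: "\<forall>\<^sub>F \<epsilon> in at_right 0. maximal_disc_subcomplex \<alpha> \<beta> \<gamma> \<epsilon> K (T \<epsilon>)"
    and F: "\<forall>\<^sub>F \<epsilon> in at_right 0. discrete_approximation f (T \<epsilon>) (v0 \<epsilon>) (F \<epsilon>)"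
    and e: "\<And>n. 0 < e n" "e \<longlonglongrightarrow> 0"
    and lim: "locally_uniform_limit_along e (\<lambda>\<epsilon>. interior_vertices (T \<epsilon>))
             (\<lambda>\<epsilon>. discrete_schwarzian \<alpha> \<beta> \<gamma> \<epsilon> (F \<epsilon>) k) (interior K) S"
    and z: "z \<in> interior K"
  shows "S z = \<i> * of_real (schwarzian_limit \<alpha> \<beta> \<gamma> f k z)"
proof -
  define h where "h = schwarzian_limit \<alpha> \<beta> \<gamma> f k"
  define \<delta> where "\<delta> = Min {\<alpha>, \<beta>, \<gamma>, pi/2 - \<alpha>, pi/2 - \<beta>, pi/2 - \<gamma>} / 2"
  have d: "0 < \<delta>" "{\<alpha>, \<beta>, \<gamma>} \<subseteq> {2 * \<delta>..pi/2 - 2 * \<delta>}"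
  proof -
    define m where "m = Min {\<alpha>, \<beta>, \<gamma>, pi/2 - \<alpha>, pi/2 - \<beta>, pi/2 - \<gamma>}"
    have m: "m > 0" "m \<le> \<alpha>" "m \<le> \<beta>" "m \<le> \<gamma>" "m \<le> pi/2 - \<alpha>" "m \<le> pi/2 - \<beta>" "m \<le> pi/2 - \<gamma>"
      unfolding m_def using a by simp_all
    have "2 * \<delta> = m" by (simp add: \<delta>_def m_def)
    then show "0 < \<delta>" "{\<alpha>, \<beta>, \<gamma>} \<subseteq> {2 * \<delta>..pi/2 - 2 * \<delta>}" using m by auto
  qed
  obtain \<eta> c where sb: "smooth_bounds f K \<eta> c" using smooth_bounds_exist[OF D K(1,2)] by blast
  obtain M where "\<And>x. x \<in> K \<Longrightarrow> norm x \<le> M" using compact_imp_bounded[OF K(1)] unfolding bounded_iff by blast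
  then have M: "K \<subseteq> cball 0 M" by auto
  have oI: "open (interior K)" by simp
  have hol: "(deriv ^^ n) f holomorphic_on D" for n
    by (induction n) (auto intro: D(2) holomorphic_deriv[OF _ D(1)])
  have cont: "continuous_on (interior K) ((deriv ^^ n) f)" for n
    using hol K(2) interior_subset by (meson continuous_on_subset holomorphic_on_imp_continuous_on)
  have nz: "deriv f v \<noteq> 0" if "v \<in> interior K" for v using D(3) K(2) interior_subset that by blast
  have "continuous_on (interior K) (\<lambda>v. A3 f v - (A2 f v)\<^sup>2)"
    unfolding A2_def A3_def using cont[of 1] cont[of 2] cont[of 3] nz
    by (intro continuous_on_diff continuous_on_power continuous_on_divide continuous_on_mult continuous_on_const)
      (auto simp: numeral_2_eq_2 numeral_3_eq_3)
  then have conth: "continuous_on (interior K) h"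
    unfolding h_def schwarzian_limit_def divide_inverse
    by (intro continuous_on_mult continuous_on_const continuous_on_Re)
  have main: "cmod (S z - \<i> * of_real (h z)) \<le> 3 * \<sigma>" if \<sigma>: "\<sigma> > 0" for \<sigma>
  proof -
    obtain \<delta>1 \<delta>2 where \<delta>1: "\<delta>1 > 0" "\<delta>2 > 0"
      and lim': "\<And>n v. e n < \<delta>1 \<Longrightarrow> v \<in> interior_vertices (T (e n)) \<Longrightarrow> cmod (v - z) < \<delta>2 \<Longrightarrow>
        cmod (S z - discrete_schwarzian \<alpha> \<beta> \<gamma> (e n) (F (e n)) k v) < \<sigma>"
      using lim \<sigma> z unfolding locally_uniform_limit_along_def by meson
    obtain \<delta>3 where \<delta>3: "\<delta>3 > 0" "\<And>v. v \<in> interior K \<Longrightarrow> dist v z < \<delta>3 \<Longrightarrow> dist (h v) (h z) < \<sigma>"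
      using conth z \<sigma> unfolding continuous_on_iff by metis
    obtain \<delta>4 where \<delta>4: "\<delta>4 > 0" "ball z \<delta>4 \<subseteq> interior K" using oI z by (meson openE)
    define r where "r = Min {\<delta>2, \<delta>3, \<delta>4} / 3"
    have r: "0 < r" "r < \<delta>2" "r < \<delta>3" "2 * r < \<delta>4"
    proof -
      define m where "m = Min {\<delta>2, \<delta>3, \<delta>4}"
      have "m > 0" "m \<le> \<delta>2" "m \<le> \<delta>3" "m \<le> \<delta>4" unfolding m_def using \<delta>1 \<delta>3 \<delta>4 by simp_all
      moreover have "r = m / 3" by (simp add: r_def m_def)
      ultimately show "0 < r" "r < \<delta>2" "r < \<delta>3" "2 * r < \<delta>4" by linarith+
    qed
    have zI: "cball z (2 * r) \<subseteq> interior K" using r(4) \<delta>4(2) by (auto simp: subset_eq)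
    obtain \<gamma>' where \<gamma>': "path \<gamma>'" "path_image \<gamma>' \<subseteq> interior K" "pathstart \<gamma>' = 0" "pathfinish \<gamma>' = z"
      using K(3,4) z oI by (metis connected_open_path_connected path_connected_def)
    \<comment> \<open>the disc has to be reached from 0, where the complex is known to be present\<close>
    define \<Gamma> where "\<Gamma> = path_image \<gamma>' \<union> cball z (2 * r)"
    have \<Gamma>: "compact \<Gamma>" "connected \<Gamma>" "0 \<in> \<Gamma>" "\<Gamma> \<subseteq> interior K"
    proof -
      show "compact \<Gamma>" unfolding \<Gamma>_def using \<gamma>'(1) by (intro compact_Un compact_path_image compact_cball)
      have "z \<in> path_image \<gamma>' \<inter> cball z (2 * r)" using \<gamma>'(4) r(1) pathfinish_in_path_image[of \<gamma>'] by auto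
      then show "connected \<Gamma>" unfolding \<Gamma>_def
        using connected_path_image[OF \<gamma>'(1)] connected_cball by (intro connected_Un) auto
      show "0 \<in> \<Gamma>" unfolding \<Gamma>_def using \<gamma>'(3) pathstart_in_path_image[of \<gamma>'] by auto
      show "\<Gamma> \<subseteq> interior K" unfolding \<Gamma>_def using \<gamma>'(2) zI by blast
    qed
    obtain d0 where d0: "d0 > 0" "(\<Union>x\<in>\<Gamma>. cball x d0) \<subseteq> interior K"
      using compact_subset_open_imp_cball_epsilon_subset[OF \<Gamma>(1) oI \<Gamma>(4)] by blast
    define \<phi> where "\<phi> x = max 0 (1 - cmod (x - z) / r)" for x
    have \<phi>0: "0 \<le> \<phi> x" for x by (simp add: \<phi>_def)
    have \<phi>1: "\<bar>\<phi> x - \<phi> y\<bar> \<le> 1 / r * cmod (x - y)" for x y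
    proof -
      have "\<bar>\<phi> x - \<phi> y\<bar> \<le> \<bar>cmod (x - z) / r - cmod (y - z) / r\<bar>" unfolding \<phi>_def by (auto simp: max_def abs_if)
      also have "\<dots> = \<bar>cmod (x - z) - cmod (y - z)\<bar> / r" using r(1) by (simp add: diff_divide_distrib[symmetric])
      also have "\<dots> \<le> cmod (x - y) / r" using r(1) norm_triangle_ineq3[of "x - z" "y - z"] by (simp add: divide_right_mono)
      finally show ?thesis by simp
    qed
    have \<phi>2: "\<phi> x = 0" if "x \<notin> cball z r" for x
      using that r(1) by (auto simp: \<phi>_def dist_norm norm_minus_commute field_simps max_def)
    have \<phi>3: "\<bar>\<phi> x\<bar> \<le> 1" for x using r(1) by (simp add: \<phi>_def)
    have \<phi>4: "1/2 \<le> \<phi> x" if "x \<in> cball z (r / 2)" for x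
      using that r(1) by (auto simp: \<phi>_def dist_norm norm_minus_commute field_simps max_def)
    have zK: "cball z (2 * r) \<subseteq> K" using zI interior_subset by blast
    obtain \<epsilon>1 B where \<epsilon>1: "\<epsilon>1 > 0" and est: "\<And>\<epsilon> C g v0. 0 < \<epsilon> \<Longrightarrow> \<epsilon> < \<epsilon>1 \<Longrightarrow> maximal_disc_subcomplex \<alpha> \<beta> \<gamma> \<epsilon> K C \<Longrightarrow>
      discrete_approximation f C v0 g \<Longrightarrow> lat_vertices \<alpha> \<beta> \<gamma> \<epsilon> \<inter> cball z (2 * r) \<subseteq> interior_vertices C \<Longrightarrow>
      cmod (\<Sum>v\<in>lat_vertices \<alpha> \<beta> \<gamma> \<epsilon> \<inter> cball z r. of_real (\<phi> v * \<epsilon>\<^sup>2) *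
         (discrete_schwarzian \<alpha> \<beta> \<gamma> \<epsilon> g k v - \<i> * of_real (h v))) \<le> B * \<epsilon>"
    proof -
      have r1: "0 \<le> 1 / r" using r(1) by simp
      from averaged_discrete_schwarzian[OF a(1,3,5,7) d K(1,5) M sb \<phi>1 \<phi>2 \<phi>3 r1 r(1) zK, of k]
      show ?thesis using that unfolding h_def by meson
    qed
    define m0 where "m0 = (\<Sum>j\<in>{0..5}. norm (lat_vec \<alpha> \<beta> \<gamma> j))"
    have m0: "m0 > 0"
    proof -
      interpret triangular_lattice "\<lambda>k. of_real 1 * lat_vec \<alpha> \<beta> \<gamma> k" by (rule triangular_lattice_lat_vec[OF a(1,3,5,7)]) simp
      show "m0 > 0" using mesh_pos unfolding mesh_def m0_def by simp
    qed
    \<comment> \<open>lower bound of the total weight, from the vertices within r/2 of z, where the tent is at least 1/2\<close>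
    define P0 where "P0 = (r / (8 * m0))\<^sup>2 / 2"
    have P0: "P0 > 0" using r(1) m0 by (simp add: P0_def)
    define \<epsilon>2 where "\<epsilon>2 = Min {\<epsilon>1, \<delta>1, d0 / (3 * m0), r / (16 * m0), \<sigma> * P0 / (\<bar>B\<bar> + 1)}"
    have e2: "\<epsilon>2 > 0" unfolding \<epsilon>2_def using \<epsilon>1 \<delta>1 d0 m0 r \<sigma> P0 by (simp add: add_pos_nonneg)
    have "\<forall>\<^sub>F \<epsilon> in at_right 0. \<epsilon> < \<epsilon>2" using e2 by (simp add: eventually_at_right_field) blast
    then have ev: "\<forall>\<^sub>F \<epsilon> in at_right 0. \<epsilon> < \<epsilon>2 \<and> maximal_disc_subcomplex \<alpha> \<beta> \<gamma> \<epsilon> K (T \<epsilon>) \<and> discrete_approximation f (T \<epsilon>) (v0 \<epsilon>) (F \<epsilon>)"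
      using T F by eventually_elim blast
    have "filterlim e (at_right 0) sequentially"
      using e by (intro tendsto_imp_filterlim_at_right always_eventually allI)
    then have "\<forall>\<^sub>F n in sequentially. e n < \<epsilon>2 \<and> maximal_disc_subcomplex \<alpha> \<beta> \<gamma> (e n) K (T (e n)) \<and> discrete_approximation f (T (e n)) (v0 (e n)) (F (e n))"
      using ev by (rule eventually_compose_filterlim[rotated])
    then obtain n where n: "e n < \<epsilon>2" "maximal_disc_subcomplex \<alpha> \<beta> \<gamma> (e n) K (T (e n))" "discrete_approximation f (T (e n)) (v0 (e n)) (F (e n))"
      using eventually_happens'[OF sequentially_bot] by blast
    define \<epsilon> where "\<epsilon> = e n"
    have \<epsilon>: "0 < \<epsilon>" using e(1) by (simp add: \<epsilon>_def)
    have sm: "\<epsilon> < \<epsilon>1" "\<epsilon> < \<delta>1" "\<epsilon> < d0 / (3 * m0)" "\<epsilon> < r / (16 * m0)" "\<epsilon> < \<sigma> * P0 / (\<bar>B\<bar> + 1)"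
      using n(1) unfolding \<epsilon>2_def \<epsilon>_def by simp_all
    define E where "E = (\<lambda>k. of_real \<epsilon> * lat_vec \<alpha> \<beta> \<gamma> k)"
    interpret triangular_lattice E unfolding E_def by (rule triangular_lattice_lat_vec[OF a(1,3,5,7) \<epsilon>])
    have nE: "norm (E j) = \<epsilon> * norm (lat_vec \<alpha> \<beta> \<gamma> j)" for j using \<epsilon> by (simp add: E_def norm_mult)
    have mesh: "mesh = \<epsilon> * m0" unfolding mesh_def m0_def nE by (simp add: sum_distrib_left)
    note V = lattice_translation(1)[OF a(1,3,5,7) \<epsilon>, folded E_def]
    have "V \<inter> \<Gamma> \<subseteq> interior_vertices (T \<epsilon>)"
    proof -
      have "cball x (3 * mesh) \<subseteq> K" if "x \<in> \<Gamma>" for x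
      proof -
        have "3 * mesh \<le> d0" using sm(3) m0 by (simp add: mesh field_simps)
        then have "cball x (3 * mesh) \<subseteq> cball x d0" by auto
        then show ?thesis using d0(2) that interior_subset[of K] by blast
      qed
      from lattice_filling(3)[OF a(1,3,5,7) \<epsilon> n(2)[folded \<epsilon>_def] K(1,5), folded E_def, OF \<Gamma>(2) compact_imp_bounded[OF \<Gamma>(1)] this \<Gamma>(3)]
      show ?thesis unfolding V .
    qed
    then have fill: "V \<inter> cball z (2 * r) \<subseteq> interior_vertices (T \<epsilon>)" by (auto simp: \<Gamma>_def)
    define Q where "Q = V \<inter> cball z r"
    have fQ: "finite Q" unfolding Q_def by (rule finite_V_bounded) simp
    define s where "s v = discrete_schwarzian \<alpha> \<beta> \<gamma> \<epsilon> (F \<epsilon>) k v" for v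
    have A1: "cmod (\<Sum>v\<in>Q. of_real (\<phi> v * \<epsilon>\<^sup>2) * (s v - \<i> * of_real (h v))) \<le> B * \<epsilon>"
      using est[OF \<epsilon> sm(1) n(2)[folded \<epsilon>_def] n(3)[folded \<epsilon>_def]] fill unfolding V Q_def s_def by blast
    define P where "P = (\<Sum>v\<in>Q. \<phi> v * \<epsilon>\<^sup>2)"
    have near: "cmod (S z - s v) \<le> \<sigma>" "cmod (of_real (h v) - of_real (h z) :: complex) \<le> \<sigma>" if "v \<in> Q" for v
    proof -
      have vr: "cmod (v - z) \<le> r" "v \<in> V \<inter> cball z (2 * r)" using that r(1) by (auto simp: Q_def dist_norm norm_minus_commute)
      have "v \<in> interior_vertices (T (e n))" using vr(2) fill unfolding \<epsilon>_def by blast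
      then show "cmod (S z - s v) \<le> \<sigma>" using lim'[of n v] sm(2) vr(1) r(2) unfolding s_def \<epsilon>_def by force
      have "v \<in> interior K" using vr(2) zI by blast
      then have "\<bar>h v - h z\<bar> \<le> \<sigma>" using \<delta>3(2)[of v] vr(1) r(3) by (simp add: dist_norm)
      then show "cmod (of_real (h v) - of_real (h z) :: complex) \<le> \<sigma>" by (simp only: of_real_diff[symmetric] norm_of_real)
    qed
    have w0: "0 \<le> \<phi> v * \<epsilon>\<^sup>2" for v using \<phi>0 by simp
    have A2: "cmod (\<Sum>v\<in>Q. of_real (\<phi> v * \<epsilon>\<^sup>2) * (S z - s v)) \<le> \<sigma> * P"
      unfolding P_def sum_distrib_left
    proof (rule sum_norm_le)
      fix v assume "v \<in> Q"
      then show "cmod (of_real (\<phi> v * \<epsilon>\<^sup>2) * (S z - s v)) \<le> \<sigma> * (\<phi> v * \<epsilon>\<^sup>2)"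
        using mult_left_mono[OF near(1) w0] w0[of v] by (simp only: norm_mult norm_of_real abs_of_nonneg mult.commute)
    qed
    have A3: "cmod (\<Sum>v\<in>Q. of_real (\<phi> v * \<epsilon>\<^sup>2) * (\<i> * (of_real (h v) - of_real (h z)))) \<le> \<sigma> * P"
      unfolding P_def sum_distrib_left
    proof (rule sum_norm_le)
      fix v assume "v \<in> Q"
      then have "\<phi> v * \<epsilon>\<^sup>2 * cmod (of_real (h v) - of_real (h z) :: complex) \<le> \<phi> v * \<epsilon>\<^sup>2 * \<sigma>"
        using near(2) w0 by (intro mult_left_mono)
      then show "cmod (of_real (\<phi> v * \<epsilon>\<^sup>2) * (\<i> * (of_real (h v) - of_real (h z)))) \<le> \<sigma> * (\<phi> v * \<epsilon>\<^sup>2)"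
        using w0[of v] by (simp only: norm_mult norm_of_real abs_of_nonneg norm_ii mult_1_left mult.commute)
    qed
    have eq: "of_real P * (S z - \<i> * of_real (h z)) = (\<Sum>v\<in>Q. of_real (\<phi> v * \<epsilon>\<^sup>2) * (S z - s v))
       + (\<Sum>v\<in>Q. of_real (\<phi> v * \<epsilon>\<^sup>2) * (s v - \<i> * of_real (h v)))
       + (\<Sum>v\<in>Q. of_real (\<phi> v * \<epsilon>\<^sup>2) * (\<i> * (of_real (h v) - of_real (h z))))"
      unfolding P_def of_real_sum sum_distrib_right sum.distrib[symmetric]
      by (rule sum.cong) (simp_all add: algebra_simps)
    have Pl: "P0 \<le> P"
    proof -
      have fH: "finite (V \<inter> cball z (r / 2))" by (rule finite_V_bounded) simp
      have "16 * mesh \<le> r" using sm(4) m0 by (simp add: mesh field_simps)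
      from card_V_Int_cball_ge[OF this, of z]
      have "(r / (8 * (\<epsilon> * m0)))\<^sup>2 \<le> card (V \<inter> cball z (r / 2))" unfolding mesh .
      then have "\<epsilon>\<^sup>2 / 2 * (r / (8 * (\<epsilon> * m0)))\<^sup>2 \<le> \<epsilon>\<^sup>2 / 2 * card (V \<inter> cball z (r / 2))" by (intro mult_left_mono) auto
      moreover have "\<epsilon>\<^sup>2 / 2 * (r / (8 * (\<epsilon> * m0)))\<^sup>2 = P0" unfolding P0_def using \<epsilon> m0 by (simp add: power2_eq_square field_simps)
      moreover have "\<epsilon>\<^sup>2 / 2 * card (V \<inter> cball z (r / 2)) = (\<Sum>v\<in>V \<inter> cball z (r / 2). 1/2 * \<epsilon>\<^sup>2)" by simp
      moreover have "\<dots> \<le> (\<Sum>v\<in>V \<inter> cball z (r / 2). \<phi> v * \<epsilon>\<^sup>2)"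
        using \<phi>4 by (intro sum_mono mult_right_mono) auto
      moreover have "\<dots> \<le> P" unfolding P_def Q_def
        using fQ w0 r(1) unfolding Q_def by (intro sum_mono2) auto
      ultimately show ?thesis by linarith
    qed
    have "P * cmod (S z - \<i> * of_real (h z)) = cmod (of_real P * (S z - \<i> * of_real (h z)))"
      using Pl P0 by (simp add: norm_mult)
    also have "\<dots> \<le> \<sigma> * P + B * \<epsilon> + \<sigma> * P"
      unfolding eq using A1 A2 A3 by (intro norm_triangle_le add_mono)
    also have "B * \<epsilon> \<le> \<sigma> * P"
    proof -
      have "B * \<epsilon> \<le> (\<bar>B\<bar> + 1) * \<epsilon>" using \<epsilon> by (intro mult_right_mono) auto
      also have "\<dots> \<le> \<sigma> * P0" using sm(5) by (simp add: field_simps)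
      also have "\<dots> \<le> \<sigma> * P" using Pl \<sigma> by (intro mult_left_mono) auto
      finally show ?thesis .
    qed
    finally have "P * cmod (S z - \<i> * of_real (h z)) \<le> P * (3 * \<sigma>)" by (simp add: algebra_simps)
    then show ?thesis using Pl P0 by (simp add: mult_le_cancel_left)
  qed
  have "cmod (S z - \<i> * of_real (h z)) \<le> 0"
  proof (rule field_le_epsilon)
    fix t :: real assume "0 < t"
    then show "cmod (S z - \<i> * of_real (h z)) \<le> 0 + t" using main[of "t / 3"] by simp
  qed
  then show ?thesis by (simp add: h_def)
qed

theorem theorem5p1:
  fixes \<alpha> \<beta> \<gamma> :: real
    and f :: "complex \<Rightarrow> complex" and D K :: "complex set"
    and T :: "real \<Rightarrow> complex set set"
    and v0 :: "real \<Rightarrow> complex"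
    and F :: "real \<Rightarrow> complex \<Rightarrow> complex"
    and e :: "nat \<Rightarrow> real"
    and S :: "int \<Rightarrow> complex \<Rightarrow> complex"
  assumes "0 < \<alpha>" "\<alpha> < pi / 2" "0 < \<beta>" "\<beta> < pi / 2" "0 < \<gamma>" "\<gamma> < pi / 2"
    and "\<alpha> + \<beta> + \<gamma> = pi"
    and "open D" "connected D" "f holomorphic_on D" "\<And>z. z \<in> D \<Longrightarrow> deriv f z \<noteq> 0"
    and "compact K" "K \<subseteq> D" "K = closure (interior K)"
    and "simply_connected (interior K)" "0 \<in> interior K"
    and "positive_reach (frontier K)"
    and "\<forall>\<^sub>F \<epsilon> in at_right 0. maximal_disc_subcomplex \<alpha> \<beta> \<gamma> \<epsilon> K (T \<epsilon>)"
    and "\<forall>\<^sub>F \<epsilon> in at_right 0. {0, v0 \<epsilon>} \<in> edges (T \<epsilon>)"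
    and "\<forall>\<^sub>F \<epsilon> in at_right 0. discrete_approximation f (T \<epsilon>) (v0 \<epsilon>) (F \<epsilon>)"
    and "\<And>n. 0 < e n" "e \<longlonglongrightarrow> 0"
    and "\<And>k. k \<in> {1, 2, 3} \<Longrightarrow>
           locally_uniform_limit_along e (\<lambda>\<epsilon>. interior_vertices (T \<epsilon>))
             (\<lambda>\<epsilon>. discrete_schwarzian \<alpha> \<beta> \<gamma> \<epsilon> (F \<epsilon>) k) (interior K) (S k)"
  shows "let \<omega> = lat_dir \<alpha> \<beta>; L = (\<lambda>k. complex_of_real (lat_len \<alpha> \<beta> \<gamma> k)) in
    \<forall>z \<in> interior K.
    schwarzian f z =
      2 * ((L 2 * \<omega> 2 + L 3 * \<omega> 3) * S 1 z
           + (L 1 * \<omega> 1 - L 3 * \<omega> 3) * S 2 z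
           + (- L 1 * \<omega> 1 - L 2 * \<omega> 2) * S 3 z)
        / (3 * L 1 * L 2 * L 3 * \<omega> 1 * \<omega> 2 * \<omega> 3)"
  unfolding Let_def
proof
  fix z assume z: "z \<in> interior K"
  have cK: "connected (- K)" by (rule connected_complement_of_positive_reach[OF assms(12,14,15,17)])
  have lims: "S k z = \<i> * of_real (schwarzian_limit \<alpha> \<beta> \<gamma> f k z)" if "k \<in> {1, 2, 3}" for k
    by (rule limit_of_discrete_schwarzian[OF assms(1-8,10,11,12,13) simply_connected_imp_connected[OF assms(15)]
          assms(16) cK assms(18,20,21,22) assms(23)[OF that] z])
  define l where "l = lat_vec \<alpha> \<beta> \<gamma>"
  define a b where "a = l 1" and "b = l 3"
  interpret triangular_lattice "\<lambda>k. of_real 1 * lat_vec \<alpha> \<beta> \<gamma> k"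
    by (rule triangular_lattice_lat_vec[OF assms(1,3,5,7)]) simp
  have l: "l 0 = - b" "l 2 = a + b" "l 4 = - a"
    using E_explicit E_rec[of 2] unfolding a_def b_def l_def by simp_all
  have ar: "Im (cnj (l 1) * l 2) = Im (cnj a * b)" unfolding l a_def[symmetric] by (simp add: algebra_simps)
  have arn: "Im (cnj a * b) \<noteq> 0" using area2_pos unfolding area2_def ar[symmetric] l_def by simp
  define Sf where "Sf = schwarzian f z"
  have zD: "z \<in> D" using z assms(13) interior_subset by blast
  have six: "A3 f z - (A2 f z)\<^sup>2 = Sf / 6"
    unfolding Sf_def by (rule schwarzian_eq[OF assms(8,10) zD assms(11)[OF zD]])
  have third: "3 * Re (Sf / 6 * x * y * of_real t) / A = Re (Sf * x * y * of_real t) / (2 * A)" for x y t A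
  proof -
    have "Sf / 6 * x * y * of_real t = of_real (1/6) * (Sf * x * y * of_real t)" by simp
    then have "Re (Sf / 6 * x * y * of_real t) = Re (Sf * x * y * of_real t) / 6" by (simp add: Re_divide_numeral)
    then show ?thesis by simp
  qed
  have th: "schwarzian_limit \<alpha> \<beta> \<gamma> f 1 z = Re (Sf * (- b) * (a + b) * of_real ((cmod a)\<^sup>2)) / (2 * Im (cnj a * b))"
    "schwarzian_limit \<alpha> \<beta> \<gamma> f 2 z = Re (Sf * a * b * of_real ((cmod (a + b))\<^sup>2)) / (2 * Im (cnj a * b))"
    "schwarzian_limit \<alpha> \<beta> \<gamma> f 3 z = Re (Sf * (a + b) * (- a) * of_real ((cmod b)\<^sup>2)) / (2 * Im (cnj a * b))"
    unfolding schwarzian_limit_def six l_def[symmetric] ar third by (simp_all add: l flip: a_def b_def)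
  have rec: "3 * a * (a + b) * b * Sf = 2 * ((a + b + b) * S 1 z + (a - b) * S 2 z + (- a - (a + b)) * S 3 z)"
    using schwarzian_reconstruction[OF arn, of Sf] lims[of 1] lims[of 2] lims[of 3] unfolding th by simp
  have nz: "3 * a * (a + b) * b \<noteq> 0"
    using E_nonzero[of 1] E_nonzero[of 2] E_nonzero[of 3] l unfolding a_def b_def l_def by simp
  have vec: "complex_of_real (lat_len \<alpha> \<beta> \<gamma> k) * lat_dir \<alpha> \<beta> k = l k" for k by (simp add: l_def lat_vec_def)
  have den: "3 * complex_of_real (lat_len \<alpha> \<beta> \<gamma> 1) * complex_of_real (lat_len \<alpha> \<beta> \<gamma> 2) * complex_of_real (lat_len \<alpha> \<beta> \<gamma> 3)
      * lat_dir \<alpha> \<beta> 1 * lat_dir \<alpha> \<beta> 2 * lat_dir \<alpha> \<beta> 3 = 3 * a * (a + b) * b"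
  proof -
    have "3 * a * (a + b) * b = 3 * l 1 * l 2 * l 3" by (simp only: l(2) a_def b_def)
    then show ?thesis unfolding vec[symmetric] by (simp only: mult_ac)
  qed
  have neg: "- complex_of_real (lat_len \<alpha> \<beta> \<gamma> 1) * lat_dir \<alpha> \<beta> 1 = - a" using vec[of 1] by (simp add: a_def)
  show "schwarzian f z =
      2 * ((complex_of_real (lat_len \<alpha> \<beta> \<gamma> 2) * lat_dir \<alpha> \<beta> 2 + complex_of_real (lat_len \<alpha> \<beta> \<gamma> 3) * lat_dir \<alpha> \<beta> 3) * S 1 z
           + (complex_of_real (lat_len \<alpha> \<beta> \<gamma> 1) * lat_dir \<alpha> \<beta> 1 - complex_of_real (lat_len \<alpha> \<beta> \<gamma> 3) * lat_dir \<alpha> \<beta> 3) * S 2 z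
           + (- complex_of_real (lat_len \<alpha> \<beta> \<gamma> 1) * lat_dir \<alpha> \<beta> 1 - complex_of_real (lat_len \<alpha> \<beta> \<gamma> 2) * lat_dir \<alpha> \<beta> 2) * S 3 z)
        / (3 * complex_of_real (lat_len \<alpha> \<beta> \<gamma> 1) * complex_of_real (lat_len \<alpha> \<beta> \<gamma> 2) * complex_of_real (lat_len \<alpha> \<beta> \<gamma> 3)
            * lat_dir \<alpha> \<beta> 1 * lat_dir \<alpha> \<beta> 2 * lat_dir \<alpha> \<beta> 3)"
    unfolding den neg vec l a_def[symmetric] b_def[symmetric] using rec nz by (simp add: Sf_def eq_divide_eq mult.commute)
qed

end
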